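(* For any non-zero $\mu\in\mathcal{M}_F(E)$, $$\lim_{t\to\infty}t\,\mathbb{P}_{\mu}\left(\|X_t\|\neq 0\right)=\nu^{-1}\langle\phi_0,\mu\rangle,\qquad\text{where } \nu:=\tfrac12\langle A(\phi_0)^2,\psi_0\rangle_m .$$ Furthermore, for every constant $M>0$, the convergence is uniform in $\mu$ with $\mu(E)\le M$.
   Context: Spaces. $E$ is a locally compact separable metric space, $m$ is a $\sigma$-finite Borel measure on $E$ with full support, $\langle f,g\rangle_m=\int_E fg\,dm$ and $\|\cdot\|_2$ is the norm of $L^2(E,m)$. $\partial\notin E$ is a cemetery point, separate from $E$, $E_\partial=E\cup\{\partial\}$, and every function $f$ on $E$ is extended by $f(\partial)=0$. $\mathcal{B}(E)$, $\mathcal{B}^+(E)$, $\mathcal{B}_b(E)$, $\mathcal{B}_b^+(E)$ are the Borel, non-negative Borel, bounded Borel, bounded non-negative Borel functions on $E$. $\mathcal{M}_F(E)$ is the space of finite measures on $E$ with the weak topology; $\langle f,\mu\rangle=\int f\,d\mu$, $\|\mu\|=\langle 1,\mu\rangle$. Superprocess. $\xi=\{\xi_t,\Pi_x\}$ is a Hunt process on $E$ (sent to $\partial$ at its lifetime) with semigroup $P_t$; $\beta\in\mathcal{B}_b^+(E)$; $\varphi(x,z)=-a(x)z+b(x)z^2+\int_{(0,\infty)}(e^{-zy}-1+zy)\,n(x,dy)$ for $x\in E$, $z\ge0$, with $a\in\mathcal{B}_b(E)$, $b\in\mathcal{B}_b^+(E)$ and $n$ a kernel from $E$ to $(0,\infty)$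 with $\sup_{x\in E}\int_{(0,\infty)}y^2\,n(x,dy)<\infty$. The case $\beta(\cdot)(b(\cdot)+n(\cdot,(0,\infty)))=0$ $m$-a.e. is excluded. $\Psi(x,z)=\beta(x)\varphi(x,z)$ for $x\in E$, and $\Psi(\partial,z)=0$. $X=\{X_t,t\ge0;\mathbb{P}_\mu\}$ is the $\mathcal{M}_F(E)$-valued Hunt process, with $X_0=\mu$ under $\mathbb{P}_\mu$, such that for $f\in\mathcal{B}_b^+(E)$, $-\log\mathbb{P}_\mu(e^{-\langle f,X_t\rangle})=\langle u_f(t,\cdot),\mu\rangle$, where $u_f$ is the unique locally bounded (i.e. bounded on $[0,t]\times E_\partial$ for every $t>0$) non-negative solution of $u_f(t,x)+\Pi_x\int_0^t\Psi(\xi_s,u_f(t-s,\xi_s))\,ds=\Pi_xf(\xi_t)$, $x\in E_\partial$. ($\mathbb{P}_\mu$ also denotes expectation.) Set $\alpha(x)=\beta(x)a(x)$, $A(x)=\beta(x)\big(2b(x)+\int_0^\infty y^2\,n(x,dy)\big)$, let $K>0$ be a constant with $\sup_{x\in E}(|\alpha(x)|+A(x))\le K$, and $T_tf(x)=\Pi_x\big[e^{\int_0^t\alpha(\xi_s)ds}f(\xi_t)\big]$. Standing assumptions. For each $t>0$ there is a continuous strictly positive function $p(t,\cdot,\cdot)$ on $E\times E$ with $P_tf(x)=\int_Ep(t,x,y)f(y)\,m(dy)$ for all non-negative $f$, and: (1) for any $t>0$, $\int_Ep(t,x,y)\,m(dx)\le1$; and, with $a_t(x):=\int_Ep(t,x,y)^2m(dy)$,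 $\hat a_t(x):=\int_Ep(t,y,x)^2m(dy)$, one has $\int_Ea_t(x)\,m(dx)<\infty$, and $a_t,\hat a_t$ are continuous on $E$. (2) Let $\widehat P_tf(x)=\int_Ep(t,y,x)f(y)m(dy)$, let $\widetilde L,\widehat{\widetilde L}$ be the $L^2(E,m)$-generators of $\{P_t\},\{\widehat P_t\}$, $\widetilde\lambda_0=\sup\Re(\sigma(\widetilde L))=\sup\Re(\sigma(\widehat{\widetilde L}))$ (a simple eigenvalue of both), and $\widetilde\phi_0,\widetilde\psi_0$ the corresponding continuous strictly positive eigenfunctions of $\widetilde L,\widehat{\widetilde L}$ with $\|\widetilde\phi_0\|_2=1$, $\langle\widetilde\phi_0,\widetilde\psi_0\rangle_m=1$. Then $\widetilde\phi_0$ is bounded, and for every $t>0$ there is $c_t>0$ with $p(t,x,y)\le c_t\widetilde\phi_0(x)\widetilde\psi_0(y)$ for all $x,y\in E$. (3) Under these assumptions $T_tf(x)=\int_Eq(t,x,y)f(y)m(dy)$ with $q(t,\cdot,\cdot)$ continuous and strictly positive; let $\widehat T_tf(x)=\int_Eq(t,y,x)f(y)m(dy)$, let $L,\widehat L$ be the $L^2(E,m)$-generators of $\{T_t\},\{\widehat T_t\}$, $\lambda_0=\sup\Re(\sigma(L))=\sup\Re(\sigma(\widehat L))$ (a simple eigenvalue of both), and $\phi_0,\psi_0$ the corresponding continuous strictly positive eigenfunctions of $L,\widehat L$ with $\|\phi_0\|_2=1$, $\langle\phi_0,\psi_0\rangle_m=1$. It is assumed that $\lambda_0=0$ (criticality).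 (4) With $q_t(x):=\mathbb{P}_{\delta_x}(\|X_t\|=0)$: $q_t(x)\in(0,1)$ for all $t>0$, $x\in E$, and there is $t_0>0$ with $\inf_{x\in E}q_{t_0}(x)>0$. Under these assumptions $\phi_0$ is bounded and $0<\nu<\infty$. *)

theory Defs
  imports "HOL-Probability.Probability"
begin

section \<open>State spaces\<close>

definition borel_of :: "'s topology \<Rightarrow> 's measure" where
  "borel_of T = sigma (topspace T) {U. openin T U}"

text \<open>
  \<open>E\<^sub>\<partial>\<close> is the type \<open>'a option\<close>, with \<open>None\<close> for the cemetery \<open>\<partial>\<close>.  As usual for Hunt
  processes on a locally compact separable metric space, paths are right continuous with left
  limits in the one-point compactification, in which \<open>\<partial>\<close> is isolated if \<open>E\<close> is compact.
  A Hunt process for the (finer) topology in which \<open>\<partial>\<close> is always isolated is also one for this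
  topology, and both topologies have the same Borel sets, so this reading covers both conventions.
\<close>

definition cemetery_top :: "('a::topological_space) option topology" where
  "cemetery_top = Alexandroff_compactification euclidean"

definition ext0 :: "('a \<Rightarrow> 'c::zero) \<Rightarrow> 'a option \<Rightarrow> 'c" where
  "ext0 f = case_option 0 f"

definition bounded_borel :: "('a::topological_space \<Rightarrow> real) set" where
  "bounded_borel = {f \<in> borel_measurable borel. bounded (range f)}"

definition bounded_borel_nonneg :: "('a::topological_space \<Rightarrow> real) set" where
  "bounded_borel_nonneg = {f \<in> bounded_borel. \<forall>x. 0 \<le> f x}"

definition finite_measures :: "('a::topological_space) measure set" where
  "finite_measures = {\<mu>. finite_measure \<mu> \<and> sets \<mu> = sets borel}"

definition weak_top :: "('a::topological_space) measure topology" where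
  "weak_top = subtopology
     (topology_generated_by
        {{\<mu>. (\<integral>x. f x \<partial>\<mu>) \<in> U} | (f :: 'a \<Rightarrow> real) U.
           continuous_on UNIV f \<and> bounded (range f) \<and> open U})
     finite_measures"

definition is_kernel :: "'a measure \<Rightarrow> 'b measure \<Rightarrow> ('a \<Rightarrow> 'b measure) \<Rightarrow> bool" where
  "is_kernel M N k \<longleftrightarrow>
     (\<forall>x\<in>space M. sets (k x) = sets N) \<and>
     (\<forall>B\<in>sets N. (\<lambda>x. emeasure (k x) B) \<in> borel_measurable M)"

section \<open>Hunt processes\<close>

definition cadlag_path :: "'s topology \<Rightarrow> (real \<Rightarrow> 's) \<Rightarrow> bool" where
  "cadlag_path T w \<longleftrightarrow>
     (\<forall>t\<ge>0. limitin T w (w t) (at_right t)) \<and>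
     (\<forall>t>0. \<exists>l. limitin T w l (at_left t))"

text \<open>
  Times are real numbers \<open>\<ge> 0\<close>; filtrations are indexed by, and stopping times take values in,
  \<open>[0,\<infinity>]\<close>, i.e. the type \<open>ennreal\<close>.
\<close>

definition strong_markov ::
  "'s topology \<Rightarrow> 'w measure \<Rightarrow> (ennreal \<Rightarrow> 'w measure) \<Rightarrow> (real \<Rightarrow> 'w \<Rightarrow> 's) \<Rightarrow> ('s \<Rightarrow> 'w measure) \<Rightarrow> bool"
where
  "strong_markov T \<Omega> F X P \<longleftrightarrow>
     (\<forall>\<tau> x s B \<Lambda>. stopping_time F \<tau> \<longrightarrow> x \<in> topspace T \<longrightarrow> 0 \<le> s \<longrightarrow> B \<in> sets (borel_of T) \<longrightarrow>
        \<Lambda> \<in> sets (filtration.pre_sigma (space \<Omega>) F \<tau>) \<longrightarrow>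
        emeasure (P x) {\<omega> \<in> \<Lambda>. \<tau> \<omega> < \<infinity> \<and> X (enn2real (\<tau> \<omega>) + s) \<omega> \<in> B} =
        (\<integral>\<^sup>+\<omega>\<in>{\<omega> \<in> \<Lambda>. \<tau> \<omega> < \<infinity>}.
           emeasure (P (X (enn2real (\<tau> \<omega>)) \<omega>)) {\<omega>' \<in> space \<Omega>. X s \<omega>' \<in> B} \<partial>P x))"

definition quasi_left_continuous ::
  "'s topology \<Rightarrow> (ennreal \<Rightarrow> 'w measure) \<Rightarrow> (real \<Rightarrow> 'w \<Rightarrow> 's) \<Rightarrow> ('s \<Rightarrow> 'w measure) \<Rightarrow> bool"
where
  "quasi_left_continuous T F X P \<longleftrightarrow>
     (\<forall>\<tau> \<sigma> x. (\<forall>n. stopping_time F (\<tau> n)) \<longrightarrow> (\<forall>\<omega>. incseq (\<lambda>n. \<tau> n \<omega>)) \<longrightarrow>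
        (\<forall>\<omega>. \<sigma> \<omega> = (SUP n::nat. \<tau> n \<omega>)) \<longrightarrow> x \<in> topspace T \<longrightarrow>
        (AE \<omega> in P x. \<sigma> \<omega> < \<infinity> \<longrightarrow>
           limitin T (\<lambda>n. X (enn2real (\<tau> n \<omega>)) \<omega>) (X (enn2real (\<sigma> \<omega>)) \<omega>) sequentially))"

text \<open>
  \<open>X\<close> is the process and \<open>P x\<close> its law when started from \<open>x\<close>.
  The state space \<open>T\<close> is meant to contain the cemetery, if there is one.  Since \<open>P\<close> is a kernel on
  all of \<open>\<Omega>\<close>, the properties under \<open>P x\<close> carry over to arbitrary initial laws.
\<close>

definition hunt_process ::
  "'s topology \<Rightarrow> 'w measure \<Rightarrow> (real \<Rightarrow> 'w \<Rightarrow> 's) \<Rightarrow> ('s \<Rightarrow> 'w measure) \<Rightarrow> bool"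
where
  "hunt_process T \<Omega> X P \<longleftrightarrow>
     P \<in> borel_of T \<rightarrow>\<^sub>M prob_algebra \<Omega> \<and>
     (\<forall>x\<in>topspace T. AE \<omega> in P x. X 0 \<omega> = x) \<and>
     (\<forall>\<omega>\<in>space \<Omega>. cadlag_path T (\<lambda>t. X t \<omega>)) \<and>
     (\<exists>F. filtration (space \<Omega>) F \<and>
          (\<forall>t. subalgebra \<Omega> (F t)) \<and>
          (\<forall>t<\<infinity>. sets (F t) = (\<Inter>u\<in>{t<..}. sets (F u))) \<and>
          (\<forall>t\<ge>0. X t \<in> F (ennreal t) \<rightarrow>\<^sub>M borel_of T) \<and>
          strong_markov T \<Omega> F X P \<and>
          quasi_left_continuous T F X P)"

definition hunt_process_on_E ::
  "'w measure \<Rightarrow> (real \<Rightarrow> 'w \<Rightarrow> ('a::topological_space) option) \<Rightarrow> ('a option \<Rightarrow> 'w measure) \<Rightarrow> bool"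
where
  "hunt_process_on_E \<Omega> \<xi> Px \<longleftrightarrow>
     hunt_process cemetery_top \<Omega> \<xi> Px \<and>
     (\<forall>\<omega>\<in>space \<Omega>. \<forall>s t. 0 \<le> s \<longrightarrow> s \<le> t \<longrightarrow> \<xi> s \<omega> = None \<longrightarrow> \<xi> t \<omega> = None)"

definition semigroup_P ::
  "(real \<Rightarrow> 'w \<Rightarrow> 'a option) \<Rightarrow> ('a option \<Rightarrow> 'w measure) \<Rightarrow> real \<Rightarrow> ('a \<Rightarrow> ennreal) \<Rightarrow> 'a \<Rightarrow> ennreal"
where
  "semigroup_P \<xi> Px t f x = (\<integral>\<^sup>+\<omega>. ext0 f (\<xi> t \<omega>) \<partial>Px (Some x))"

definition feynman_kac ::
  "(real \<Rightarrow> 'w \<Rightarrow> 'a option) \<Rightarrow> ('a option \<Rightarrow> 'w measure) \<Rightarrow> ('a \<Rightarrow> real) \<Rightarrow>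
   real \<Rightarrow> ('a \<Rightarrow> ennreal) \<Rightarrow> 'a \<Rightarrow> ennreal"
where
  "feynman_kac \<xi> Px \<alpha> t f x =
     (\<integral>\<^sup>+\<omega>. ennreal (exp (LINT s:{0..t}|lborel. ext0 \<alpha> (\<xi> s \<omega>))) * ext0 f (\<xi> t \<omega>) \<partial>Px (Some x))"

section \<open>Superprocesses\<close>

definition branching_mechanism ::
  "('a \<Rightarrow> real) \<Rightarrow> ('a \<Rightarrow> real) \<Rightarrow> ('a \<Rightarrow> real measure) \<Rightarrow> 'a \<Rightarrow> real \<Rightarrow> real"
where
  "branching_mechanism a b n x z =
     - a x * z + b x * z\<^sup>2 + (\<integral>y. exp (- z * y) - 1 + z * y \<partial>n x)"

definition Psi ::
  "('a \<Rightarrow> real) \<Rightarrow> ('a \<Rightarrow> real) \<Rightarrow> ('a \<Rightarrow> real) \<Rightarrow> ('a \<Rightarrow> real measure) \<Rightarrow> 'a option \<Rightarrow> real \<Rightarrow> real"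
where
  "Psi \<beta> a b n x z = ext0 (\<lambda>x. \<beta> x * branching_mechanism a b n x z) x"

definition variance_A ::
  "('a \<Rightarrow> real) \<Rightarrow> ('a \<Rightarrow> real) \<Rightarrow> ('a \<Rightarrow> real measure) \<Rightarrow> 'a \<Rightarrow> real"
where
  "variance_A \<beta> b n x = \<beta> x * (2 * b x + (\<integral>y. y\<^sup>2 \<partial>n x))"

definition mild_solution ::
  "(real \<Rightarrow> 'w \<Rightarrow> ('a::topological_space) option) \<Rightarrow> ('a option \<Rightarrow> 'w measure) \<Rightarrow>
   ('a option \<Rightarrow> real \<Rightarrow> real) \<Rightarrow> ('a \<Rightarrow> real) \<Rightarrow> (real \<Rightarrow> 'a option \<Rightarrow> real) \<Rightarrow> bool"
where
  "mild_solution \<xi> Px \<Psi> f u \<longleftrightarrow>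
     (\<lambda>(t, x). u t x) \<in> borel_measurable (restrict_space borel {0..} \<Otimes>\<^sub>M borel_of cemetery_top) \<and>
     (\<forall>t\<ge>0. \<forall>x. 0 \<le> u t x) \<and>
     (\<forall>t>0. \<exists>C. \<forall>s\<in>{0..t}. \<forall>x. u s x \<le> C) \<and>
     (\<forall>t\<ge>0. \<forall>x. u t x + (\<integral>\<omega>. (LINT s:{0..t}|lborel. \<Psi> (\<xi> s \<omega>) (u (t - s) (\<xi> s \<omega>))) \<partial>Px x) =
                 (\<integral>\<omega>. ext0 f (\<xi> t \<omega>) \<partial>Px x))"

definition superprocess ::
  "(real \<Rightarrow> 'w \<Rightarrow> ('a::topological_space) option) \<Rightarrow> ('a option \<Rightarrow> 'w measure) \<Rightarrow>
   ('a option \<Rightarrow> real \<Rightarrow> real) \<Rightarrow>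
   'v measure \<Rightarrow> (real \<Rightarrow> 'v \<Rightarrow> 'a measure) \<Rightarrow> ('a measure \<Rightarrow> 'v measure) \<Rightarrow> bool"
where
  "superprocess \<xi> Px \<Psi> \<Omega> X PX \<longleftrightarrow>
     hunt_process weak_top \<Omega> X PX \<and>
     (\<forall>f\<in>bounded_borel_nonneg.
        \<exists>u. mild_solution \<xi> Px \<Psi> f u \<and>
            (\<forall>v. mild_solution \<xi> Px \<Psi> f v \<longrightarrow> (\<forall>t\<ge>0. \<forall>x. v t x = u t x)) \<and>
            (\<forall>\<mu>\<in>finite_measures. \<forall>t\<ge>0.
               - ln (\<integral>\<omega>. exp (- (\<integral>x. f x \<partial>X t \<omega>)) \<partial>PX \<mu>) = (\<integral>x. u t (Some x) \<partial>\<mu>)))"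

section \<open>Semigroups on complex \<open>L\<^sup>2\<close>, their generators and spectra\<close>

text \<open>
  \<open>L\<^sup>2(m)\<close> consists of complex functions, and equality in \<open>L\<^sup>2(m)\<close> is equality \<open>m\<close>-almost everywhere.
  An unbounded operator is given by its graph, a relation closed under almost everywhere equality.
\<close>

definition L2 :: "'a measure \<Rightarrow> ('a \<Rightarrow> complex) set" where
  "L2 m = {f \<in> borel_measurable m. integrable m (\<lambda>x. (cmod (f x))\<^sup>2)}"

definition L2_norm :: "'a measure \<Rightarrow> ('a \<Rightarrow> complex) \<Rightarrow> real" where
  "L2_norm m f = sqrt (\<integral>x. (cmod (f x))\<^sup>2 \<partial>m)"

definition kernel_op :: "'a measure \<Rightarrow> ('a \<Rightarrow> 'a \<Rightarrow> real) \<Rightarrow> ('a \<Rightarrow> complex) \<Rightarrow> 'a \<Rightarrow> complex" where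
  "kernel_op m k f x = (\<integral>y. complex_of_real (k x y) * f y \<partial>m)"

text \<open>The limit is taken of the integral in \<open>[0,\<infinity>]\<close>, which is finite whenever the quotient is in \<open>L\<^sup>2(m)\<close>.\<close>

definition L2_generator ::
  "'a measure \<Rightarrow> (real \<Rightarrow> 'a \<Rightarrow> 'a \<Rightarrow> real) \<Rightarrow> (('a \<Rightarrow> complex) \<times> ('a \<Rightarrow> complex)) set"
where
  "L2_generator m k = {(f, g). f \<in> L2 m \<and> g \<in> L2 m \<and>
     ((\<lambda>t. \<integral>\<^sup>+x. ennreal ((cmod ((kernel_op m (k t) f x - f x) / complex_of_real t - g x))\<^sup>2) \<partial>m)
        \<longlongrightarrow> 0) (at_right 0)}"

definition resolvent_set ::
  "'a measure \<Rightarrow> (('a \<Rightarrow> complex) \<times> ('a \<Rightarrow> complex)) set \<Rightarrow> complex set"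
where
  "resolvent_set m G = {z.
     (\<forall>h\<in>L2 m. \<exists>(f, g)\<in>G. AE x in m. z * f x - g x = h x) \<and>
     (\<exists>C. \<forall>(f, g)\<in>G. L2_norm m f \<le> C * L2_norm m (\<lambda>x. z * f x - g x))}"

definition spectrum_of ::
  "'a measure \<Rightarrow> (('a \<Rightarrow> complex) \<times> ('a \<Rightarrow> complex)) set \<Rightarrow> complex set"
where
  "spectrum_of m G = - resolvent_set m G"

definition spectral_bound ::
  "'a measure \<Rightarrow> (('a \<Rightarrow> complex) \<times> ('a \<Rightarrow> complex)) set \<Rightarrow> ereal"
where
  "spectral_bound m G = (SUP z\<in>spectrum_of m G. ereal (Re z))"

definition eigenfunction ::
  "'a measure \<Rightarrow> (('a \<Rightarrow> complex) \<times> ('a \<Rightarrow> complex)) set \<Rightarrow> complex \<Rightarrow> ('a \<Rightarrow> complex) \<Rightarrow> bool"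
where
  "eigenfunction m G z f \<longleftrightarrow> (f, \<lambda>x. z * f x) \<in> G \<and> \<not> (AE x in m. f x = 0)"

text \<open>
  Algebraic multiplicity one: \<open>ker (z - G)\<close> is one-dimensional and \<open>ker (z - G)\<^sup>2 = ker (z - G)\<close>.
\<close>

definition simple_eigenvalue ::
  "'a measure \<Rightarrow> (('a \<Rightarrow> complex) \<times> ('a \<Rightarrow> complex)) set \<Rightarrow> complex \<Rightarrow> bool"
where
  "simple_eigenvalue m G z \<longleftrightarrow>
     (\<exists>f. eigenfunction m G z f \<and>
          (\<forall>h. eigenfunction m G z h \<longrightarrow> (\<exists>c. AE x in m. h x = c * f x))) \<and>
     \<not> (\<exists>(h, g)\<in>G. eigenfunction m G z (\<lambda>x. z * h x - g x))"

definition transpose_kernel :: "(real \<Rightarrow> 'a \<Rightarrow> 'a \<Rightarrow> real) \<Rightarrow> real \<Rightarrow> 'a \<Rightarrow> 'a \<Rightarrow> real" where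
  "transpose_kernel k t x y = k t y x"

definition principal_eigen ::
  "('a::topological_space) measure \<Rightarrow> (real \<Rightarrow> 'a \<Rightarrow> 'a \<Rightarrow> real) \<Rightarrow> real \<Rightarrow> ('a \<Rightarrow> real) \<Rightarrow> ('a \<Rightarrow> real) \<Rightarrow> bool"
where
  "principal_eigen m k lam \<phi> \<psi> \<longleftrightarrow>
     (let G = L2_generator m k; H = L2_generator m (transpose_kernel k);
          z = complex_of_real lam
      in spectral_bound m G = ereal lam \<and> spectral_bound m H = ereal lam \<and>
         simple_eigenvalue m G z \<and> simple_eigenvalue m H z \<and>
         eigenfunction m G z (\<lambda>x. complex_of_real (\<phi> x)) \<and>
         eigenfunction m H z (\<lambda>x. complex_of_real (\<psi> x))) \<and>
     continuous_on UNIV \<phi> \<and> continuous_on UNIV \<psi> \<and> (\<forall>x. 0 < \<phi> x) \<and> (\<forall>x. 0 < \<psi> x) \<and>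
     L2_norm m (\<lambda>x. complex_of_real (\<phi> x)) = 1 \<and>
     (\<integral>x. \<phi> x * \<psi> x \<partial>m) = 1"

definition continuous_positive_kernel :: "(real \<Rightarrow> 'a::topological_space \<Rightarrow> 'a \<Rightarrow> real) \<Rightarrow> bool" where
  "continuous_positive_kernel k \<longleftrightarrow>
     (\<forall>t>0. continuous_on UNIV (\<lambda>(x, y). k t x y) \<and> (\<forall>x y. 0 < k t x y))"

definition is_density ::
  "('a::topological_space) measure \<Rightarrow> (real \<Rightarrow> ('a \<Rightarrow> ennreal) \<Rightarrow> 'a \<Rightarrow> ennreal) \<Rightarrow>
   (real \<Rightarrow> 'a \<Rightarrow> 'a \<Rightarrow> real) \<Rightarrow> bool"
where
  "is_density m S k \<longleftrightarrow>
     (\<forall>t>0. \<forall>f\<in>borel_measurable borel. \<forall>x. S t f x = (\<integral>\<^sup>+y. ennreal (k t x y) * f y \<partial>m))"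

text \<open>This is \<open>a\<^sub>t(x)\<close>; its dual version is obtained from the transposed kernel.\<close>

definition row_sq :: "'a measure \<Rightarrow> (real \<Rightarrow> 'a \<Rightarrow> 'a \<Rightarrow> real) \<Rightarrow> real \<Rightarrow> 'a \<Rightarrow> ennreal" where
  "row_sq m k t x = (\<integral>\<^sup>+y. ennreal ((k t x y)\<^sup>2) \<partial>m)"

definition continuous_finite :: "('a::topological_space \<Rightarrow> ennreal) \<Rightarrow> bool" where
  "continuous_finite f \<longleftrightarrow> (\<forall>x. f x < \<infinity>) \<and> continuous_on UNIV f"

definition extinct :: "'v measure \<Rightarrow> (real \<Rightarrow> 'v \<Rightarrow> ('a::topological_space) measure) \<Rightarrow> real \<Rightarrow> 'v set" where
  "extinct \<Omega> X t = {\<omega> \<in> space \<Omega>. measure (X t \<omega>) UNIV = 0}"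

definition survives :: "'v measure \<Rightarrow> (real \<Rightarrow> 'v \<Rightarrow> ('a::topological_space) measure) \<Rightarrow> real \<Rightarrow> 'v set" where
  "survives \<Omega> X t = {\<omega> \<in> space \<Omega>. measure (X t \<omega>) UNIV \<noteq> 0}"

end

theory Submission
  imports Defs "HOL-Real_Asymp.Real_Asymp"
begin

text \<open>
  The Laplace functional linearises the extinction problem. The indicator of \<open>\<parallel>X\<^sub>t\<parallel> = 0\<close> is the limit of
  \<open>exp (- \<langle>k, X\<^sub>t\<rangle>)\<close> as \<open>k\<close> grows. At the time \<open>\<tau>\<close> at which extinction has uniformly positive probability,
  the negative logarithms of the extinction probabilities from the points of \<open>E\<close> form a bounded function \<open>f\<close>; restarting at \<open>\<tau>\<close> shows
  that the probability of survival up to \<open>\<tau> + s\<close> from \<open>\<mu>\<close> is \<open>1 - exp (- \<langle>u\<^sub>s, \<mu>\<rangle>)\<close>, where \<open>u\<close> is the mild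
  solution with initial value \<open>f\<close> (\<open>superprocess_extinction\<close>). It therefore suffices to prove that
  \<open>t * u\<^sub>t / \<phi>\<close> converges uniformly to \<open>1 / \<nu>\<close> (\<open>kolmogorov_uniform\<close>); the second order error in \<open>1 - exp (- z)\<close>
  disappears after multiplication with \<open>t\<close>, uniformly for bounded total mass (\<open>survival_from_log\<close>).

  Moving the linear part of the branching mechanism into the semigroup turns the mild equation into
  \<open>u\<^bsub>r+t\<^esub> = T\<^sub>t u\<^sub>r - \<integral>\<^sub>0\<^sup>t T\<^sub>s (R u\<^bsub>r+t-s\<^esub>) ds\<close>, with the Feynman-Kac semigroup \<open>T\<close> and \<open>R\<close> the part of
  second order (\<open>mild_change_of_semigroup\<close>, \<open>mild_flow\<close>). Criticality means \<open>T\<^sub>t \<phi> = \<phi>\<close> and that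
  \<open>\<psi> dm\<close> is invariant under \<open>T\<close>. Hence \<open>c t = \<langle>u\<^sub>t, \<psi>\<rangle>\<close> satisfies \<open>c' = - \<langle>R u, \<psi>\<rangle>\<close>. If \<open>u\<^sub>t\<close> is
  asymptotically \<open>c t * \<phi>\<close>, the right-hand side is asymptotically \<open>- \<nu> (c t)\<^sup>2\<close>, because
  \<open>R (z) = A z\<^sup>2 / 2 + o(z\<^sup>2)\<close>. Then \<open>1 / c\<close> grows with slope \<open>\<nu>\<close>, which is Kolmogorov's argument
  (\<open>second_order_loss\<close>, \<open>inverse_c_increments\<close>).

  That \<open>u\<^sub>t\<close> aligns with \<open>\<phi>\<close> rests on intrinsic ultracontractivity: for each \<open>h > 0\<close>, \<open>T\<^sub>h g\<close> lies between
  multiples of \<open>\<phi> * \<langle>g, \<psi>\<rangle>\<close> for all nonnegative \<open>g\<close> (\<open>intrinsic_bounds\<close>). The lower bound is a Doeblin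
  minorisation, so that \<open>T\<^bsub>nh\<^esub> g / \<phi>\<close> converges to \<open>\<langle>g, \<psi>\<rangle>\<close> geometrically and uniformly if \<open>g / \<phi>\<close> is bounded
  (\<open>doeblin\<close>), while the
  nonlinear term is negligible on bounded time intervals once \<open>c\<close> is small (\<open>asymptotic_profile\<close>).
  The upper bound is the ultracontractivity hypothesis. The lower bound for \<open>p\<close> comes from three steps: enter a
  compact set, move inside it, leave it (\<open>p_lower\<close>); it passes to \<open>q\<close> since the two kernels are
  comparable at each time. The eigenfunctions enter as elements of the \<open>L\<^sup>2\<close> generators, so that the equation
  \<open>T\<^sub>t \<phi> = e\<^bsup>\<lambda> t\<^esup> \<phi>\<close> has to be derived from the generator; the proof is an Euler scheme
  (\<open>eigenfunction_pairing\<close>).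
\<close>

section \<open>The state space with cemetery point\<close>

lemma space_borel_of: "space (borel_of T) = topspace T"
  unfolding borel_of_def by (rule space_measure_of) (auto dest: openin_subset)

lemma sets_borel_of: "sets (borel_of T) = sigma_sets (topspace T) {U. openin T U}"
  unfolding borel_of_def by (rule sets_measure_of) (auto dest: openin_subset)

lemma openin_borel_of: "openin T U \<Longrightarrow> U \<in> sets (borel_of T)"
  unfolding sets_borel_of by auto

lemma measurable_borel_ofI:
  assumes "\<And>x. x \<in> space M \<Longrightarrow> f x \<in> topspace T"
    and "\<And>U. openin T U \<Longrightarrow> f -` U \<inter> space M \<in> sets M"
  shows "f \<in> M \<rightarrow>\<^sub>M borel_of T"
  using assms unfolding borel_of_def
  by (intro measurable_measure_of) (auto dest: openin_subset)

lemma topspace_cemetery [simp]: "topspace cemetery_top = UNIV"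
  unfolding cemetery_top_def by (auto simp: UNIV_option_conv)

lemma space_cemetery [simp]: "space (borel_of cemetery_top) = UNIV"
  by (simp add: space_borel_of)

text \<open>
  The open sets of the compactification that contain the added point are complements of sets \<open>Some ` C\<close>, so that
  the images of open sets of the original space already generate the Borel sets.
\<close>

lemma measurable_cemeteryI:
  fixes f :: "'w \<Rightarrow> ('a::topological_space) option"
  assumes f: "\<And>U. open U \<Longrightarrow> f -` (Some ` U) \<inter> space M \<in> sets M"
  shows "f \<in> M \<rightarrow>\<^sub>M borel_of cemetery_top"
proof (rule measurable_borel_ofI)
  fix V :: "'a option set" assume "openin cemetery_top V"
  then consider U where "open U" "V = Some ` U"
    | C where "closed C" "V = insert None (Some ` (- C))"
    unfolding cemetery_top_def openin_Alexandroff_compactification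
    by (auto simp: Compl_eq_Diff_UNIV)
  then show "f -` V \<inter> space M \<in> sets M"
  proof cases
    case 1 then show ?thesis using f by simp
  next
    case 2
    have "V = - (Some ` UNIV - Some ` (- C))"
      using 2 by (auto simp: UNIV_option_conv)
    then have "f -` V \<inter> space M = space M - ((f -` (Some ` UNIV) \<inter> space M) - (f -` (Some ` (- C)) \<inter> space M))"
      by auto
    then show ?thesis using f[of UNIV] f[of "- C"] \<open>closed C\<close> by (metis open_Compl open_UNIV sets.Diff sets.top)
  qed
qed simp

lemma Some_image_borel:
  fixes A :: "'a::topological_space set"
  assumes "A \<in> sets borel" shows "Some ` A \<in> sets (borel_of cemetery_top)"
proof -
  have U: "Some ` U \<in> sets (borel_of cemetery_top)" if "open U" for U :: "'a set"
    using that by (intro openin_borel_of) (simp add: cemetery_top_def)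
  have "A \<in> sigma_sets UNIV {S. open S}" using assms by (simp add: borel_def)
  then show ?thesis
  proof induction
    case (Compl a)
    have "Some ` (UNIV - a) = Some ` UNIV - Some ` a" by auto
    then show ?case using Compl U[of UNIV] by (metis open_UNIV sets.Diff)
  next
    case (Union a)
    then show ?case by (auto simp: image_UN)
  qed (use U in auto)
qed

lemma ext0_measurable [measurable (raw)]:
  fixes f :: "'a::topological_space \<Rightarrow> 'c::{topological_space,zero}"
  assumes f: "f \<in> borel_measurable borel"
  shows "ext0 f \<in> borel_measurable (borel_of cemetery_top)"
proof (rule borel_measurableI)
  fix S :: "'c set" assume "open S"
  have A: "f -` S \<in> sets borel" using measurable_sets[OF f, of S] \<open>open S\<close> by simp
  have N: "{None :: 'a option} \<in> sets (borel_of cemetery_top)"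
  proof -
    have "{None :: 'a option} = space (borel_of cemetery_top) - Some ` UNIV" by (auto simp: UNIV_option_conv)
    then show ?thesis using Some_image_borel[of "UNIV :: 'a set"] by (metis sets.compl_sets sets.top space_borel)
  qed
  have "ext0 f -` S \<inter> space (borel_of cemetery_top) = Some ` (f -` S) \<union> (if 0 \<in> S then {None} else {})"
    (is "?L = ?R")
  proof (rule set_eqI)
    fix z show "z \<in> ?L \<longleftrightarrow> z \<in> ?R" by (cases z) (auto simp: ext0_def)
  qed
  then show "ext0 f -` S \<inter> space (borel_of cemetery_top) \<in> sets (borel_of cemetery_top)"
    using sets.Un[OF Some_image_borel[OF A] N] Some_image_borel[OF A] by simp
qed

lemma Some_measurable [measurable]:
  "Some \<in> borel \<rightarrow>\<^sub>M borel_of cemetery_top"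
  by (rule measurable_cemeteryI) (auto simp: inj_vimage_image_eq)

text \<open>
  These functions separate balls from the rest of the space and vanish at the cemetery point. For a relatively
  compact ball they are continuous on the compactification, in contrast to the indicator of the ball.
\<close>

definition bump :: "'a::metric_space \<Rightarrow> real \<Rightarrow> 'a option \<Rightarrow> real" where
  "bump x r = ext0 (\<lambda>y. max 0 (r - dist x y))"

lemma continuous_map_bump:
  assumes c: "compact (cball x r)"
  shows "continuous_map cemetery_top euclideanreal (bump x r)"
proof -
  have "openin cemetery_top (bump x r -` U)" if U: "open U" for U
  proof -
    let ?g = "\<lambda>y. max 0 (r - dist x y)"
    have o: "open (?g -` U)" by (intro open_vimage U continuous_intros)
    show ?thesis
    proof (cases "0 \<in> U")
      case False
      then have "bump x r -` U = Some ` (?g -` U)"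
        by (auto simp: bump_def ext0_def image_iff split: option.splits)
      then show ?thesis using o by (simp add: cemetery_top_def)
    next
      case True
      let ?C = "- (?g -` U)"
      have "?C \<subseteq> cball x r" using True by (auto simp: max_def split: if_splits)
      moreover have "closed ?C" using o by auto
      ultimately have "compact ?C"
        using c by (metis compact_Int_closed inf.absorb_iff2 inf_commute)
      moreover have "bump x r -` U = insert None (Some ` (- ?C))"
      proof (rule set_eqI)
        fix z show "z \<in> bump x r -` U \<longleftrightarrow> z \<in> insert None (Some ` (- ?C))"
          using True by (cases z) (auto simp: bump_def ext0_def)
      qed
      ultimately show ?thesis using \<open>closed ?C\<close>
        unfolding cemetery_top_def openin_Alexandroff_compactification
        by (auto simp: Compl_eq_Diff_UNIV)
    qed
  qed
  then show ?thesis unfolding continuous_map_def by (simp add: vimage_def)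
qed

lemma compact_ball_exists:
  fixes x :: "'a::metric_space"
  assumes E: "locally_compact_space (euclidean :: 'a topology)" and U: "open U" "x \<in> U"
  shows "\<exists>r>0. ball x r \<subseteq> U \<and> compact (cball x r)"
proof -
  obtain V K where VK: "open V" "compact K" "x \<in> V" "V \<subseteq> K"
    using E unfolding locally_compact_space_def by simp meson
  have "open (U \<inter> V)" "x \<in> U \<inter> V" using U VK by auto
  then obtain r where r: "r > 0" "cball x r \<subseteq> U \<inter> V"
    by (meson open_contains_cball)
  have "compact (K \<inter> cball x r)" using VK(2) by (rule compact_Int_closed) simp
  moreover have "K \<inter> cball x r = cball x r" using r(2) VK(4) by auto
  ultimately have "compact (cball x r)" by simp
  then show ?thesis using r ball_subset_cball[of x r] by (intro exI[of _ r]) auto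
qed

text \<open>
  The topology of the compactification is not presented by a metric, so that measurability of a limit is reduced to
  that of real limits: an open set is a countable union of relatively compact balls, and such a ball is the set where a
  continuous bump function is positive.
\<close>

lemma measurable_cemetery_limit:
  fixes Z :: "'w \<Rightarrow> ('a::{metric_space,second_countable_topology}) option"
  assumes E: "locally_compact_space (euclidean :: 'a topology)"
    and meas: "\<And>n. Zn n \<in> M \<rightarrow>\<^sub>M borel_of cemetery_top"
    and lim: "\<And>\<omega>. \<omega> \<in> space M \<Longrightarrow> limitin cemetery_top (\<lambda>n. Zn n \<omega>) (Z \<omega>) sequentially"
  shows "Z \<in> M \<rightarrow>\<^sub>M borel_of cemetery_top"
proof (rule measurable_cemeteryI)
  fix U :: "'a set" assume U: "open U"
  have ball: "Z -` (Some ` ball x r) \<inter> space M \<in> sets M" if c: "compact (cball x r)" for x r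
  proof -
    have L: "(\<lambda>n. bump x r (Zn n \<omega>)) \<longlonglongrightarrow> bump x r (Z \<omega>)" if "\<omega> \<in> space M" for \<omega>
      using continuous_map_limit[OF continuous_map_bump[OF c] lim[OF that]] by (simp add: o_def)
    have B: "bump x r \<in> borel_measurable (borel_of cemetery_top)"
      unfolding bump_def by (rule ext0_measurable) measurable
    have "(\<lambda>\<omega>. bump x r (Z \<omega>)) \<in> borel_measurable M"
      by (rule borel_measurable_LIMSEQ_real[OF L measurable_compose[OF meas B]])
    then have "{\<omega> \<in> space M. bump x r (Z \<omega>) > 0} \<in> sets M" by measurable
    moreover have "{\<omega> \<in> space M. bump x r (Z \<omega>) > 0} = Z -` (Some ` ball x r) \<inter> space M"
      by (auto simp: bump_def ext0_def image_iff split: option.splits)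
    ultimately show ?thesis by simp
  qed
  define \<F> where "\<F> = {ball x r | x r. compact (cball x r) \<and> ball x r \<subseteq> U}"
  have "\<And>S. S \<in> \<F> \<Longrightarrow> open S" by (auto simp: \<F>_def)
  then obtain \<F>' where F': "\<F>' \<subseteq> \<F>" "countable \<F>'" "\<Union>\<F>' = \<Union>\<F>"
    using Lindelof[of \<F>] by blast
  have "\<Union>\<F> = U"
  proof
    show "U \<subseteq> \<Union>\<F>"
    proof
      fix x assume "x \<in> U"
      then obtain r where "r > 0" "ball x r \<subseteq> U" "compact (cball x r)"
        using compact_ball_exists[OF E U] by blast
      then show "x \<in> \<Union>\<F>" unfolding \<F>_def by (auto intro!: exI[of _ "ball x r"])
    qed
  qed (auto simp: \<F>_def)
  then have "Z -` (Some ` \<Union>\<F>) \<inter> space M = Z -` (Some ` U) \<inter> space M" by simp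
  moreover have "Z -` (Some ` \<Union>\<F>) \<inter> space M = (\<Union>S\<in>\<F>'. Z -` (Some ` S) \<inter> space M)"
    unfolding F'(3)[symmetric] image_Union by blast
  moreover have "\<dots> \<in> sets M"
    using F' ball by (intro sets.countable_UN') (auto simp: \<F>_def)
  ultimately show "Z -` (Some ` U) \<inter> space M \<in> sets M" by simp
qed

lemma limitin_at_right_sequence:
  fixes w :: "real \<Rightarrow> 's"
  assumes lim: "limitin T w (w s) (at_right s)" and t: "\<And>n. s \<le> \<tau> n" "\<tau> \<longlonglongrightarrow> s"
  shows "limitin T (\<lambda>n. w (\<tau> n)) (w s) sequentially"
  unfolding limitin_def
proof (intro conjI allI impI)
  show "w s \<in> topspace T" using lim by (simp add: limitin_def)
  fix U assume U: "openin T U \<and> w s \<in> U"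
  then have "eventually (\<lambda>r. w r \<in> U) (at_right s)" using lim by (simp add: limitin_def)
  then obtain b where b: "b > s" "\<And>r. s < r \<Longrightarrow> r < b \<Longrightarrow> w r \<in> U"
    by (auto simp: eventually_at_right_field)
  have "eventually (\<lambda>n. \<tau> n < b) sequentially" using t(2) b(1) by (rule order_tendstoD)
  then show "eventually (\<lambda>n. w (\<tau> n) \<in> U) sequentially"
    by eventually_elim (metis U b(2) t(1) less_eq_real_def)
qed

text \<open>
  A right-continuous path is the limit of step paths evaluated at the next grid point to the right. Truncating the grid
  at \<open>t\<close> keeps the approximations measurable for the information up to time \<open>t\<close>.
\<close>

lemma progressive_measurable:
  fixes X :: "real \<Rightarrow> 'w \<Rightarrow> ('a::{metric_space,second_countable_topology}) option"
  assumes E: "locally_compact_space (euclidean :: 'a topology)"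
    and t: "0 \<le> t"
    and meas: "\<And>s. 0 \<le> s \<Longrightarrow> s \<le> t \<Longrightarrow> X s \<in> F \<rightarrow>\<^sub>M borel_of cemetery_top"
    and cadlag: "\<And>\<omega>. \<omega> \<in> space F \<Longrightarrow> cadlag_path cemetery_top (\<lambda>t. X t \<omega>)"
  shows "(\<lambda>(s, \<omega>). X (max 0 (min s t)) \<omega>) \<in> borel \<Otimes>\<^sub>M F \<rightarrow>\<^sub>M borel_of cemetery_top"
proof -
  define \<tau> where "\<tau> n k = min t ((real_of_int k + 1) / real (Suc n))" for n k
  define \<kappa> where "\<kappa> n s = max 0 \<lfloor>max 0 (min s t) * real (Suc n)\<rfloor>" for n and s :: real
  define g where "g n s = \<tau> n (\<kappa> n s)" for n s
  have [measurable]: "\<kappa> n \<in> borel \<rightarrow>\<^sub>M count_space UNIV" for n unfolding \<kappa>_def by measurable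
  have [measurable]: "X (max 0 (\<tau> n k)) \<in> F \<rightarrow>\<^sub>M borel_of cemetery_top" for n k
    using t by (intro meas) (auto simp: \<tau>_def)
  have \<kappa>0: "\<kappa> n s \<ge> 0" for n s by (simp add: \<kappa>_def)
  have g0: "max 0 (g n s) = g n s" for n s using \<kappa>0[of n s] t by (auto simp: g_def \<tau>_def)
  have \<kappa>e: "\<kappa> n s = \<lfloor>max 0 (min s t) * real (Suc n)\<rfloor>" for n s
    by (simp add: \<kappa>_def max_def)
  have gs: "max 0 (min s t) \<le> g n s" for n s
  proof -
    have "max 0 (min s t) * real (Suc n) \<le> real_of_int (\<kappa> n s) + 1" unfolding \<kappa>e by linarith
    then have "max 0 (min s t) \<le> (real_of_int (\<kappa> n s) + 1) / real (Suc n)"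
      by (subst pos_le_divide_eq) simp_all
    then show ?thesis using t by (auto simp: g_def \<tau>_def)
  qed
  have gs2: "g n s \<le> max 0 (min s t) + 1 / real (Suc n)" for n s
  proof -
    have "real_of_int (\<kappa> n s) \<le> max 0 (min s t) * real (Suc n)" unfolding \<kappa>e by linarith
    then have "(real_of_int (\<kappa> n s) + 1) / real (Suc n) \<le> max 0 (min s t) + 1 / real (Suc n)"
      by (simp add: pos_divide_le_eq distrib_right)
    then show ?thesis by (auto simp: g_def \<tau>_def)
  qed
  have lim: "(\<lambda>n. g n s) \<longlonglongrightarrow> max 0 (min s t)" for s
  proof (rule tendsto_sandwich[OF always_eventually always_eventually])
    show "\<forall>n. max 0 (min s t) \<le> g n s" "\<forall>n. g n s \<le> max 0 (min s t) + 1 / real (Suc n)"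
      using gs gs2 by blast+
    show "(\<lambda>n. max 0 (min s t) + 1 / real (Suc n)) \<longlonglongrightarrow> max 0 (min s t)"
      using LIMSEQ_inverse_real_of_nat_add[of "max 0 (min s t)"] by (simp add: divide_inverse)
    show "(\<lambda>n. max 0 (min s t)) \<longlonglongrightarrow> max 0 (min s t)" by simp
  qed
  show ?thesis
  proof (rule measurable_cemetery_limit[OF E, where Zn="\<lambda>n (s, \<omega>). X (g n s) \<omega>"])
    fix n
    have "(\<lambda>z. X (max 0 (\<tau> n (\<kappa> n (fst z)))) (snd z)) \<in> borel \<Otimes>\<^sub>M F \<rightarrow>\<^sub>M borel_of cemetery_top"
      by (rule measurable_compose_countable[where f="\<lambda>k z. X (max 0 (\<tau> n k)) (snd z)" and g="\<lambda>z. \<kappa> n (fst z)"])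
        (rule measurable_compose[OF measurable_snd], fact, rule measurable_compose[OF measurable_fst], fact)
    then show "(\<lambda>(s, \<omega>). X (g n s) \<omega>) \<in> borel \<Otimes>\<^sub>M F \<rightarrow>\<^sub>M borel_of cemetery_top"
      unfolding g_def[symmetric] g0 by (simp add: split_beta)
  next
    fix z assume "z \<in> space ((borel :: real measure) \<Otimes>\<^sub>M F)"
    then have "limitin cemetery_top (\<lambda>r. X r (snd z)) (X (max 0 (min (fst z) t)) (snd z)) (at_right (max 0 (min (fst z) t)))"
      using cadlag[of "snd z"] by (auto simp: cadlag_path_def space_pair_measure)
    from limitin_at_right_sequence[OF this gs lim]
    show "limitin cemetery_top (\<lambda>n. case z of (s, \<omega>) \<Rightarrow> X (g n s) \<omega>) (case z of (s, \<omega>) \<Rightarrow> X (max 0 (min s t)) \<omega>) sequentially"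
      by (simp add: split_beta)
  qed
qed

section \<open>Integrals of bounded functions over time intervals\<close>

lemma set_integrable_bounded_interval:
  fixes f :: "real \<Rightarrow> real"
  assumes [measurable]: "f \<in> borel_measurable borel" and C: "\<And>u. u \<in> {s..t} \<Longrightarrow> \<bar>f u\<bar> \<le> C"
  shows "set_integrable lborel {s..t} f"
  unfolding set_integrable_def
proof (rule Bochner_Integration.integrable_bound)
  show "integrable lborel (\<lambda>u. indicat_real {s..t} u *\<^sub>R C)" by (cases "s \<le> t") auto
  have "norm (indicat_real {s..t} u *\<^sub>R f u) \<le> norm (indicat_real {s..t} u *\<^sub>R C)" for u
    using C[of u] by (auto simp: indicator_def)
  then show "AE u in lborel. norm (indicat_real {s..t} u *\<^sub>R f u) \<le> norm (indicat_real {s..t} u *\<^sub>R C)"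
    by simp
qed measurable

lemma abs_interval_integral_le:
  fixes f :: "real \<Rightarrow> real"
  assumes st: "s \<le> t" and C: "\<And>u. u \<in> {s..t} \<Longrightarrow> \<bar>f u\<bar> \<le> C" and "0 \<le> C"
  shows "\<bar>LINT u:{s..t}|lborel. f u\<bar> \<le> C * (t - s)"
proof (cases "set_integrable lborel {s..t} f")
  case True
  have "\<bar>LINT u:{s..t}|lborel. f u\<bar> \<le> (LINT u:{s..t}|lborel. \<bar>f u\<bar>)"
    using set_integral_norm_bound[OF True] by simp
  also have "\<dots> \<le> (LINT u:{s..t}|lborel. C)"
    by (rule set_integral_mono[OF set_integrable_abs[OF True] set_integrable_bounded_interval[where C="\<bar>C\<bar>"]])
      (use C in auto)
  also have "\<dots> = C * (t - s)" using st by (simp add: set_lebesgue_integral_def)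
  finally show ?thesis .
next
  case False
  then show ?thesis using st \<open>0 \<le> C\<close>
    by (simp add: set_integrable_def set_lebesgue_integral_def not_integrable_integral_eq)
qed

lemma interval_integral_combine:
  fixes f :: "real \<Rightarrow> real"
  assumes "set_integrable lborel {s..t} f" "s \<le> r" "r \<le> t"
  shows "(LINT u:{s..r}|lborel. f u) + (LINT u:{r..t}|lborel. f u) = (LINT u:{s..t}|lborel. f u)"
proof -
  have 1: "set_integrable lborel {s..r} f" "set_integrable lborel {r..t} f"
    using assms by (auto intro: set_integrable_subset)
  show ?thesis
    using assms 1 Henstock_Kurzweil_Integration.integral_combine[of s r t f]
    by (simp add: set_borel_integral_eq_integral)
qed

lemma interval_integral_shift:
  fixes g :: "real \<Rightarrow> real"
  shows "(LINT r:{t..t+s}|lborel. g r) = (LINT r:{0..s}|lborel. g (t + r))"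
proof -
  have "(LINT r:{t..t+s}|lborel. g r) = (\<integral>x. indicator {t..t+s} (t + 1 * x) *\<^sub>R g (t + 1 * x) \<partial>lborel)"
    unfolding set_lebesgue_integral_def by (subst lborel_integral_real_affine[where c=1 and t=t]) simp_all
  also have "\<dots> = (LINT r:{0..s}|lborel. g (t + r))"
    unfolding set_lebesgue_integral_def by (intro Bochner_Integration.integral_cong) (auto simp: indicator_def)
  finally show ?thesis .
qed

lemma interval_integral_measurable [measurable (raw)]:
  fixes h :: "'p \<Rightarrow> real \<Rightarrow> real"
  assumes h: "(\<lambda>(p, r). h p r) \<in> borel_measurable (M \<Otimes>\<^sub>M borel)"
    and [measurable]: "\<sigma> \<in> borel_measurable M" "\<tau> \<in> borel_measurable M"
  shows "(\<lambda>p. LINT r:{\<sigma> p..\<tau> p}|lborel. h p r) \<in> borel_measurable M"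
proof -
  have [measurable]: "(\<lambda>(p, r). h p r) \<in> borel_measurable (M \<Otimes>\<^sub>M lborel)" using h by simp
  have "(\<lambda>p. \<integral>r. (if \<sigma> p \<le> r \<and> r \<le> \<tau> p then h p r else 0) \<partial>lborel) \<in> borel_measurable M" by measurable
  moreover have "(\<lambda>p. LINT r:{\<sigma> p..\<tau> p}|lborel. h p r) = (\<lambda>p. \<integral>r. (if \<sigma> p \<le> r \<and> r \<le> \<tau> p then h p r else 0) \<partial>lborel)"
    unfolding set_lebesgue_integral_def
    by (intro ext Bochner_Integration.integral_cong refl) (auto simp: indicator_def)
  ultimately show ?thesis by simp
qed

lemma abs_interval_integral_le':
  fixes f b :: "real \<Rightarrow> real"
  assumes b: "set_integrable lborel {s..t} b" and fb: "\<And>u. u \<in> {s..t} \<Longrightarrow> \<bar>f u\<bar> \<le> b u"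
  shows "\<bar>LINT u:{s..t}|lborel. f u\<bar> \<le> (LINT u:{s..t}|lborel. b u)"
proof (cases "set_integrable lborel {s..t} f")
  case True
  have "\<bar>LINT u:{s..t}|lborel. f u\<bar> \<le> (LINT u:{s..t}|lborel. \<bar>f u\<bar>)"
    using set_integral_norm_bound[OF True] by simp
  also have "\<dots> \<le> (LINT u:{s..t}|lborel. b u)"
    by (rule set_integral_mono[OF set_integrable_abs[OF True] b fb])
  finally show ?thesis .
next
  case False
  then have "(LINT u:{s..t}|lborel. f u) = 0"
    by (simp add: set_integrable_def set_lebesgue_integral_def not_integrable_integral_eq)
  moreover have "0 \<le> (LINT u:{s..t}|lborel. b u)"
    unfolding set_lebesgue_integral_def using order_trans[OF abs_ge_zero fb]
    by (intro Bochner_Integration.integral_nonneg) (auto simp: indicator_def)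
  ultimately show ?thesis by simp
qed

text \<open>
  Bounds and a finite measure replace the integrability hypotheses, which is how exchanges with time integrals occur below.
\<close>

lemma fubini_time:
  fixes g :: "real \<Rightarrow> 'w \<Rightarrow> real"
  assumes M: "finite_measure M"
    and g[measurable]: "(\<lambda>(r, \<omega>). g r \<omega>) \<in> borel_measurable (borel \<Otimes>\<^sub>M M)"
    and C: "\<And>r \<omega>. r \<in> {a..b} \<Longrightarrow> \<omega> \<in> space M \<Longrightarrow> \<bar>g r \<omega>\<bar> \<le> C"
  shows "(\<integral>\<omega>. (LINT r:{a..b}|lborel. g r \<omega>) \<partial>M) = (LINT r:{a..b}|lborel. (\<integral>\<omega>. g r \<omega> \<partial>M))"
proof -
  interpret MM: finite_measure M by fact
  interpret pair_sigma_finite lborel M by unfold_locales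
  have [measurable]: "(\<lambda>(r, \<omega>). g r \<omega>) \<in> borel_measurable (lborel \<Otimes>\<^sub>M M)" using g by simp
  have "integrable (lborel \<Otimes>\<^sub>M M) (\<lambda>(r, \<omega>). indicator {a..b} r *\<^sub>R g r \<omega>)"
  proof (rule Bochner_Integration.integrable_bound)
    have "emeasure (lborel \<Otimes>\<^sub>M M) ({a..b} \<times> space M) < \<infinity>"
      by (subst MM.emeasure_pair_measure_Times)
         (auto simp: ennreal_mult_less_top MM.emeasure_eq_measure emeasure_lborel_Icc_eq)
    then show "integrable (lborel \<Otimes>\<^sub>M M) (\<lambda>z. indicat_real ({a..b} \<times> space M) z *\<^sub>R C)"
      by (auto intro!: integrable_scaleR_left integrable_real_indicator)
    have "norm ((\<lambda>(r, \<omega>). indicat_real {a..b} r *\<^sub>R g r \<omega>) z) \<le> norm (indicat_real ({a..b} \<times> space M) z *\<^sub>R C)"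
      if "z \<in> space (lborel \<Otimes>\<^sub>M M)" for z
      using C[of "fst z" "snd z"] that by (auto simp: indicator_def space_pair_measure)
    then show "AE z in (lborel \<Otimes>\<^sub>M M). norm ((\<lambda>(r, \<omega>). indicat_real {a..b} r *\<^sub>R g r \<omega>) z) \<le> norm (indicat_real ({a..b} \<times> space M) z *\<^sub>R C)"
      by (intro AE_I2) auto
  qed measurable
  from Fubini_integral[OF this] show ?thesis
    unfolding set_lebesgue_integral_def by simp
qed

text \<open>
  Both sides integrate over the triangle of pairs of nonnegative times with sum at most the horizon.
\<close>

lemma triangle_fubini:
  fixes h :: "real \<Rightarrow> real \<Rightarrow> real"
  assumes h[measurable]: "(\<lambda>(r, v). h r v) \<in> borel_measurable (borel \<Otimes>\<^sub>M borel)"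
    and C: "\<And>r v. 0 \<le> r \<Longrightarrow> 0 \<le> v \<Longrightarrow> r + v \<le> T \<Longrightarrow> \<bar>h r v\<bar> \<le> C"
  shows "(LINT s:{0..T}|lborel. (LINT r:{0..s}|lborel. h r (s - r))) = (LINT r:{0..T}|lborel. (LINT v:{0..T-r}|lborel. h r v))"
proof -
  let ?k = "\<lambda>s r. (if 0 \<le> r \<and> r \<le> s \<and> s \<le> T then h r (s - r) else 0)"
  have [measurable]: "(\<lambda>(s, r). ?k s r) \<in> borel_measurable (lborel \<Otimes>\<^sub>M lborel)" by measurable
  have int: "integrable (lborel \<Otimes>\<^sub>M lborel) (\<lambda>(s, r). ?k s r)"
  proof (rule Bochner_Integration.integrable_bound)
    have "emeasure (lborel \<Otimes>\<^sub>M lborel) ({0..T} \<times> {0..T}) < \<infinity>"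
      by (subst lborel.emeasure_pair_measure_Times) (auto simp: ennreal_mult_less_top emeasure_lborel_Icc_eq)
    then show "integrable (lborel \<Otimes>\<^sub>M lborel) (\<lambda>z. indicat_real ({0..T} \<times> {0..T}) z *\<^sub>R C)"
      by (auto intro!: integrable_scaleR_left integrable_real_indicator)
    have "norm ((\<lambda>(s, r). ?k s r) z) \<le> norm (indicat_real ({0..T} \<times> {0..T}) z *\<^sub>R C)" for z :: "real \<times> real"
      using C[of "snd z" "fst z - snd z"] by (cases z) (auto simp: indicator_def)
    then show "AE z in (lborel \<Otimes>\<^sub>M lborel). norm ((\<lambda>(s, r). ?k s r) z) \<le> norm (indicat_real ({0..T} \<times> {0..T}) z *\<^sub>R C)"
      by (intro AE_I2) auto
  qed measurable
  have "(LINT s:{0..T}|lborel. (LINT r:{0..s}|lborel. h r (s - r))) = (\<integral>s. (\<integral>r. ?k s r \<partial>lborel) \<partial>lborel)"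
    unfolding set_lebesgue_integral_def
    by (intro Bochner_Integration.integral_cong refl, subst integral_scaleR_right[symmetric],
        intro Bochner_Integration.integral_cong refl) (auto simp: indicator_def)
  also have "\<dots> = (\<integral>r. (\<integral>s. ?k s r \<partial>lborel) \<partial>lborel)"
    using lborel_pair.Fubini_integral[OF int] by simp
  also have "\<dots> = (\<integral>r. (\<integral>v. ?k (r + v) r \<partial>lborel) \<partial>lborel)"
  proof (rule Bochner_Integration.integral_cong[OF refl])
    fix r show "(\<integral>s. ?k s r \<partial>lborel) = (\<integral>v. ?k (r + v) r \<partial>lborel)"
      using lborel_integral_real_affine[of 1 "\<lambda>s. ?k s r" r, unfolded mult_1_left] by simp
  qed
  also have "\<dots> = (LINT r:{0..T}|lborel. (LINT v:{0..T-r}|lborel. h r v))"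
    unfolding set_lebesgue_integral_def
    by (intro Bochner_Integration.integral_cong refl, subst integral_scaleR_right[symmetric],
        intro Bochner_Integration.integral_cong refl) (auto simp: indicator_def)
  finally show ?thesis .
qed

section \<open>The exponential of an integral\<close>

text \<open>
  A function with increments of second order has derivative zero. This replaces the fundamental theorem of calculus
  for integrands that are only measurable.
\<close>

lemma const_of_quadratic_modulus:
  fixes f :: "real \<Rightarrow> real"
  assumes q: "\<And>s t. 0 \<le> s \<Longrightarrow> s \<le> t \<Longrightarrow> t \<le> T \<Longrightarrow> \<bar>f t - f s\<bar> \<le> C * (t - s)\<^sup>2" and T: "0 \<le> T"
  shows "f T = f 0"
proof -
  have "(f has_field_derivative 0) (at x within {0..T})" if x: "x \<in> {0..T}" for x
    unfolding has_field_derivative_iff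
  proof (rule Lim_null_comparison)
    show "\<forall>\<^sub>F y in at x within {0..T}. norm ((f y - f x) / (y - x)) \<le> C * \<bar>y - x\<bar>"
      unfolding eventually_at_filter
    proof (intro always_eventually allI impI)
      fix y assume y: "y \<noteq> x" "y \<in> {0..T}"
      have "\<bar>f y - f x\<bar> \<le> C * (y - x)\<^sup>2"
        using q[of x y] q[of y x] x y by (cases "x \<le> y") (auto simp: abs_minus_commute power2_commute)
      then show "norm ((f y - f x) / (y - x)) \<le> C * \<bar>y - x\<bar>"
        using y by (simp add: abs_divide divide_le_eq power2_eq_square abs_mult[symmetric] mult.assoc)
    qed
    have "((\<lambda>y. C * \<bar>y - x\<bar>) \<longlongrightarrow> C * \<bar>x - x\<bar>) (at x within {0..T})" by (intro tendsto_intros)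
    then show "((\<lambda>y. C * \<bar>y - x\<bar>) \<longlongrightarrow> 0) (at x within {0..T})" by simp
  qed
  then obtain c where "\<And>x. x \<in> {0..T} \<Longrightarrow> f x = c"
    using has_field_derivative_zero_constant[of "{0..T}" f] by auto
  then show ?thesis using T by (metis atLeastAtMost_iff order_refl)
qed

lemma abs_exp_diff_le:
  fixes x y M :: real
  assumes "x \<le> M" "y \<le> M" shows "\<bar>exp x - exp y\<bar> \<le> exp M * \<bar>x - y\<bar>"
proof -
  have a: "exp u - exp v \<le> exp M * (u - v)" if "v \<le> u" "u \<le> M" for u v :: real
  proof -
    have "exp u * (1 + (v - u)) \<le> exp u * exp (v - u)" by (intro mult_left_mono exp_ge_add_one_self) simp
    then have "exp u - exp v \<le> exp u * (u - v)" by (simp add: exp_diff algebra_simps)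
    also have "\<dots> \<le> exp M * (u - v)" using that by (intro mult_right_mono) auto
    finally show ?thesis .
  qed
  show ?thesis using a[of x y] a[of y x] assms by (cases "x \<le> y") auto
qed

lemma abs_exp_taylor_le:
  fixes x y M :: real
  assumes "x \<le> M" "y \<le> M" shows "\<bar>exp x - exp y - exp y * (x - y)\<bar> \<le> exp M * (x - y)\<^sup>2"
proof -
  have 1: "exp v + exp v * (u - v) \<le> exp u" for u v :: real
  proof -
    have "exp v * (1 + (u - v)) \<le> exp v * exp (u - v)" by (intro mult_left_mono exp_ge_add_one_self) simp
    then show ?thesis by (simp add: exp_diff algebra_simps)
  qed
  have "exp x - exp y - exp y * (x - y) \<le> (exp x - exp y) * (x - y)" using 1[of x y] by (simp add: algebra_simps)
  also have "\<dots> \<le> \<bar>exp x - exp y\<bar> * \<bar>x - y\<bar>" by (simp add: abs_mult[symmetric])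
  also have "\<dots> \<le> (exp M * \<bar>x - y\<bar>) * \<bar>x - y\<bar>" by (intro mult_right_mono abs_exp_diff_le assms) simp
  also have "\<dots> = exp M * (x - y)\<^sup>2" by (simp add: power2_eq_square abs_mult[symmetric] mult.assoc)
  finally show ?thesis using 1[of y x] by simp
qed

text \<open>
  This is the integrated form of \<open>(exp A)' = exp A * a\<close>. As \<open>a\<close> is only bounded and measurable, \<open>A\<close> need not
  be differentiable everywhere; instead the difference of the two sides has increments of second order in time.
\<close>

lemma exp_integral:
  fixes a :: "real \<Rightarrow> real"
  assumes [measurable]: "a \<in> borel_measurable borel" and K: "\<And>u. \<bar>a u\<bar> \<le> K" and T: "0 \<le> T"
  defines "A \<equiv> \<lambda>t. LINT u:{0..t}|lborel. a u"
  shows "exp (A T) = 1 + (LINT r:{0..T}|lborel. exp (A r) * a r)"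
proof -
  have K0: "0 \<le> K" using K[of 0] by linarith
  have [measurable]: "A \<in> borel_measurable borel"
  proof -
    have "(\<lambda>t. \<integral>u. (if 0 \<le> u \<and> u \<le> t then a u else 0) \<partial>lborel) \<in> borel_measurable borel" by measurable
    moreover have "A = (\<lambda>t. \<integral>u. (if 0 \<le> u \<and> u \<le> t then a u else 0) \<partial>lborel)"
      unfolding A_def set_lebesgue_integral_def
      by (intro ext Bochner_Integration.integral_cong refl) (auto simp: indicator_def)
    ultimately show ?thesis by simp
  qed
  have ia: "set_integrable lborel {s..t} a" for s t using K by (intro set_integrable_bounded_interval) auto
  have dA: "A t - A s = (LINT u:{s..t}|lborel. a u)" if "0 \<le> s" "s \<le> t" for s t
    unfolding A_def using interval_integral_combine[OF ia that] by simp
  have dAb: "\<bar>A t - A s\<bar> \<le> K * (t - s)" if "0 \<le> s" "s \<le> t" for s t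
    unfolding dA[OF that] using K K0 that by (intro abs_interval_integral_le) auto
  have I0: "(LINT u:{0..0}|lborel. g u) = 0" for g :: "real \<Rightarrow> real"
    using abs_interval_integral_le[of 0 0 g "\<bar>g 0\<bar>"] by simp
  have A0: "A 0 = 0" using I0 by (simp add: A_def)
  have Ab: "\<bar>A t\<bar> \<le> K * T" if "0 \<le> t" "t \<le> T" for t
    using dAb[of 0 t] that K0 A0 mult_left_mono[of t T K] by simp
  let ?B = "\<lambda>r. exp (A r) * a r"
  have Bb: "\<bar>?B r\<bar> \<le> exp (K * T) * K" if "r \<in> {s..t}" "0 \<le> s" "t \<le> T" for r s t
    unfolding abs_mult using Ab[of r] K[of r] that by (intro mult_mono) auto
  have iB: "set_integrable lborel {s..t} ?B" if "0 \<le> s" "t \<le> T" for s t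
    using Bb[OF _ that] by (intro set_integrable_bounded_interval) auto
  define R where "R t = exp (A t) - (LINT r:{0..t}|lborel. ?B r)" for t
  have "R T = R 0"
  proof (rule const_of_quadratic_modulus[where C="exp (K * T) * K\<^sup>2 + exp (K * T) * K\<^sup>2", OF _ T])
    fix s t assume st: "0 \<le> s" "s \<le> t" "t \<le> T"
    have "R t - R s = (exp (A t) - exp (A s)) - (LINT r:{s..t}|lborel. ?B r)"
      using interval_integral_combine[OF iB[of 0 t] st(1,2)] st by (simp add: R_def)
    also have "(LINT r:{s..t}|lborel. ?B r) = (LINT r:{s..t}|lborel. (exp (A r) - exp (A s)) * a r) + exp (A s) * (A t - A s)"
    proof -
      have "set_integrable lborel {s..t} (\<lambda>r. exp (A s) * a r)" using ia by (rule set_integrable_mult_right)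
      then have "(LINT r:{s..t}|lborel. ?B r - exp (A s) * a r) = (LINT r:{s..t}|lborel. ?B r) - (LINT r:{s..t}|lborel. exp (A s) * a r)"
        using iB[of s t] st by (intro set_integral_diff) auto
      then show ?thesis unfolding dA[OF st(1,2)] by (simp add: left_diff_distrib)
    qed
    finally have e: "R t - R s = (exp (A t) - exp (A s) - exp (A s) * (A t - A s)) - (LINT r:{s..t}|lborel. (exp (A r) - exp (A s)) * a r)"
      by simp
    have "\<bar>exp (A t) - exp (A s) - exp (A s) * (A t - A s)\<bar> \<le> exp (K * T) * (A t - A s)\<^sup>2"
      using Ab[of t] Ab[of s] st by (intro abs_exp_taylor_le) auto
    also have "\<dots> \<le> exp (K * T) * (K * (t - s))\<^sup>2"
      using dAb[OF st(1,2)] by (intro mult_left_mono) (auto simp: abs_le_square_iff[symmetric])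
    finally have 1: "\<bar>exp (A t) - exp (A s) - exp (A s) * (A t - A s)\<bar> \<le> exp (K * T) * K\<^sup>2 * (t - s)\<^sup>2"
      by (simp add: power_mult_distrib mult.assoc)
    have "\<bar>LINT r:{s..t}|lborel. (exp (A r) - exp (A s)) * a r\<bar> \<le> (exp (K * T) * (K * (t - s)) * K) * (t - s)"
    proof (rule abs_interval_integral_le[OF st(2)])
      fix r assume r: "r \<in> {s..t}"
      have "\<bar>exp (A r) - exp (A s)\<bar> \<le> exp (K * T) * \<bar>A r - A s\<bar>"
        using Ab[of r] Ab[of s] st r by (intro abs_exp_diff_le) auto
      also have "\<dots> \<le> exp (K * T) * (K * (t - s))"
        using dAb[of s r] st r K0 mult_left_mono[of "r - s" "t - s" K] by (intro mult_left_mono) auto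
      finally show "\<bar>(exp (A r) - exp (A s)) * a r\<bar> \<le> exp (K * T) * (K * (t - s)) * K"
        unfolding abs_mult using K[of r] K0 st by (intro mult_mono) auto
    qed (use K0 st in auto)
    then have 2: "\<bar>LINT r:{s..t}|lborel. (exp (A r) - exp (A s)) * a r\<bar> \<le> exp (K * T) * K\<^sup>2 * (t - s)\<^sup>2"
      by (simp add: power2_eq_square mult_ac)
    show "\<bar>R t - R s\<bar> \<le> (exp (K * T) * K\<^sup>2 + exp (K * T) * K\<^sup>2) * (t - s)\<^sup>2"
      unfolding e distrib_right using 1 2 by linarith
  qed
  then show ?thesis using I0 by (simp add: R_def A0)
qed

section \<open>Feynman-Kac semigroups of a Markov process\<close>

text \<open>
  The consequences of the Hunt property used below: joint and progressive measurability of the paths and the Markov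
  property at constant times. Times are cut off at \<open>0\<close> because the paths are indexed by all reals.
\<close>

locale markov_family =
  fixes N :: "'s measure" and \<Omega> :: "'w measure" and F :: "real \<Rightarrow> 'w measure"
    and X :: "real \<Rightarrow> 'w \<Rightarrow> 's" and P :: "'s \<Rightarrow> 'w measure"
  assumes space_N [simp]: "space N = UNIV"
    and kernel [measurable]: "P \<in> N \<rightarrow>\<^sub>M prob_algebra \<Omega>"
    and start: "AE \<omega> in P x. X 0 \<omega> = x"
    and joint [measurable]: "(\<lambda>(s, \<omega>). X (max 0 s) \<omega>) \<in> borel \<Otimes>\<^sub>M \<Omega> \<rightarrow>\<^sub>M N"
    and sub: "0 \<le> t \<Longrightarrow> subalgebra \<Omega> (F t)"
    and prog: "0 \<le> t \<Longrightarrow> (\<lambda>(s, \<omega>). X (max 0 (min s t)) \<omega>) \<in> borel \<Otimes>\<^sub>M F t \<rightarrow>\<^sub>M N"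
    and markov_sets: "0 \<le> r \<Longrightarrow> 0 \<le> s \<Longrightarrow> B \<in> sets N \<Longrightarrow> \<Lambda> \<in> sets (F r) \<Longrightarrow>
       emeasure (P x) {\<omega> \<in> \<Lambda>. X (r + s) \<omega> \<in> B} =
       (\<integral>\<^sup>+\<omega>. indicator \<Lambda> \<omega> * emeasure (P (X r \<omega>)) {\<omega>' \<in> space \<Omega>. X s \<omega>' \<in> B} \<partial>P x)"
begin

lemma kernel_subprob [measurable]: "P \<in> N \<rightarrow>\<^sub>M subprob_algebra \<Omega>"
  using kernel by (rule measurable_prob_algebraD)

lemma prob_P: "prob_space (P x)" and sets_P [measurable_cong]: "sets (P x) = sets \<Omega>"
  using measurable_space[OF kernel, of x] by (auto simp: space_prob_algebra)

lemma space_P [simp]: "space (P x) = space \<Omega>" by (rule sets_eq_imp_space_eq) (rule sets_P)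

lemma measure_P_space [simp]: "measure (P x) (space \<Omega>) = 1"
  using prob_space.prob_space[OF prob_P, of x] by simp

lemma X_measurable [measurable]: "X (max 0 t) \<in> \<Omega> \<rightarrow>\<^sub>M N"
proof -
  have "(\<lambda>\<omega>. case (t, \<omega>) of (s, \<omega>) \<Rightarrow> X (max 0 s) \<omega>) \<in> \<Omega> \<rightarrow>\<^sub>M N" by measurable
  then show ?thesis by simp
qed

lemma X_measurable': "0 \<le> t \<Longrightarrow> X t \<in> \<Omega> \<rightarrow>\<^sub>M N" using X_measurable[of t] by simp

lemma X_measurable_F: assumes "0 \<le> t" shows "X t \<in> F t \<rightarrow>\<^sub>M N"
proof -
  note prog[OF assms, measurable]
  have "(\<lambda>\<omega>. case (t, \<omega>) of (s, \<omega>) \<Rightarrow> X (max 0 (min s t)) \<omega>) \<in> F t \<rightarrow>\<^sub>M N" by measurable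
  then show ?thesis using assms by simp
qed

text \<open>
  The indicators of events are the defining case; monotone class arguments extend it first in \<open>f\<close> and then in \<open>Y\<close>.
\<close>

lemma nn_markov:
  assumes rs: "0 \<le> r" "0 \<le> s" and Y: "Y \<in> borel_measurable (F r)"
    and f: "f \<in> borel_measurable N"
  shows "(\<integral>\<^sup>+\<omega>. Y \<omega> * f (X (r + s) \<omega>) \<partial>P x) = (\<integral>\<^sup>+\<omega>. Y \<omega> * (\<integral>\<^sup>+\<omega>'. f (X s \<omega>') \<partial>P (X r \<omega>)) \<partial>P x)"
proof -
  have FO: "g \<in> \<Omega> \<rightarrow>\<^sub>M M" if "g \<in> F r \<rightarrow>\<^sub>M M" for g and M :: "'c measure"
    using measurable_from_subalg[OF sub[OF rs(1)] that] .
  have FO': "\<Lambda> \<in> sets \<Omega>" if "\<Lambda> \<in> sets (F r)" for \<Lambda> using sub[OF rs(1)] that by (auto simp: subalgebra_def)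
  have [measurable]: "X (r + s) \<in> \<Omega> \<rightarrow>\<^sub>M N" "X s \<in> \<Omega> \<rightarrow>\<^sub>M N" "X r \<in> \<Omega> \<rightarrow>\<^sub>M N"
    using rs by (auto intro!: X_measurable')
  have Q[measurable]: "(\<lambda>y. \<integral>\<^sup>+\<omega>'. g (X s \<omega>') \<partial>P y) \<in> borel_measurable N" if [measurable]: "g \<in> borel_measurable N" for g :: "'s \<Rightarrow> ennreal"
    by (rule nn_integral_measurable_subprob_algebra2[where N=\<Omega>]) measurable
  have 1: "(\<integral>\<^sup>+\<omega>. indicator \<Lambda> \<omega> * f (X (r + s) \<omega>) \<partial>P x) = (\<integral>\<^sup>+\<omega>. indicator \<Lambda> \<omega> * (\<integral>\<^sup>+\<omega>'. f (X s \<omega>') \<partial>P (X r \<omega>)) \<partial>P x)"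
    if L: "\<Lambda> \<in> sets (F r)" for \<Lambda>
    using f
  proof (induction rule: borel_measurable_induct)
    case (cong f g)
    have "f = g" using cong(3) by (intro ext) auto
    then show ?case using cong(4) by simp
  next
    case (set B)
    note [measurable] = set FO'[OF L]
    have "(\<integral>\<^sup>+\<omega>. indicator \<Lambda> \<omega> * indicator B (X (r + s) \<omega>) \<partial>P x) = (\<integral>\<^sup>+\<omega>. indicator {\<omega> \<in> \<Lambda>. X (r + s) \<omega> \<in> B} \<omega> \<partial>P x)"
      by (intro nn_integral_cong) (auto simp: indicator_def)
    also have "\<dots> = emeasure (P x) {\<omega> \<in> \<Lambda>. X (r + s) \<omega> \<in> B}"
    proof (rule nn_integral_indicator)
      have "{\<omega> \<in> \<Lambda>. X (r + s) \<omega> \<in> B} = \<Lambda> \<inter> {\<omega> \<in> space \<Omega>. X (r + s) \<omega> \<in> B}"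
        using sets.sets_into_space[OF FO'[OF L]] by auto
      then show "{\<omega> \<in> \<Lambda>. X (r + s) \<omega> \<in> B} \<in> sets (P x)" by simp
    qed
    also have "\<dots> = (\<integral>\<^sup>+\<omega>. indicator \<Lambda> \<omega> * emeasure (P (X r \<omega>)) {\<omega>' \<in> space \<Omega>. X s \<omega>' \<in> B} \<partial>P x)"
      by (rule markov_sets[OF rs set L])
    also have "\<dots> = (\<integral>\<^sup>+\<omega>. indicator \<Lambda> \<omega> * (\<integral>\<^sup>+\<omega>'. indicator B (X s \<omega>') \<partial>P (X r \<omega>)) \<partial>P x)"
    proof -
      have "emeasure (P y) {\<omega>' \<in> space \<Omega>. X s \<omega>' \<in> B} = (\<integral>\<^sup>+\<omega>'. indicator {\<omega>' \<in> space \<Omega>. X s \<omega>' \<in> B} \<omega>' \<partial>P y)" for y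
        by (rule nn_integral_indicator[symmetric]) measurable
      also have "\<And>y. (\<integral>\<^sup>+\<omega>'. indicator {\<omega>' \<in> space \<Omega>. X s \<omega>' \<in> B} \<omega>' \<partial>P y) = (\<integral>\<^sup>+\<omega>'. indicator B (X s \<omega>') \<partial>P y)"
        by (intro nn_integral_cong) (auto simp: indicator_def)
      finally show ?thesis by simp
    qed
    finally show ?case .
  next
    case (mult u c)
    note [measurable] = mult(2) FO'[OF L]
    have "(\<integral>\<^sup>+\<omega>. indicator \<Lambda> \<omega> * (c * u (X (r + s) \<omega>)) \<partial>P x) = c * (\<integral>\<^sup>+\<omega>. indicator \<Lambda> \<omega> * u (X (r + s) \<omega>) \<partial>P x)"
      by (subst nn_integral_cmult[symmetric]) (auto simp: mult_ac)
    also have "\<dots> = (\<integral>\<^sup>+\<omega>. c * (indicator \<Lambda> \<omega> * (\<integral>\<^sup>+\<omega>'. u (X s \<omega>') \<partial>P (X r \<omega>))) \<partial>P x)"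
      unfolding mult(4) by (subst nn_integral_cmult) auto
    also have "\<dots> = (\<integral>\<^sup>+\<omega>. indicator \<Lambda> \<omega> * (\<integral>\<^sup>+\<omega>'. c * u (X s \<omega>') \<partial>P (X r \<omega>)) \<partial>P x)"
      by (intro nn_integral_cong, subst nn_integral_cmult) (auto simp: mult_ac)
    finally show ?case .
  next
    case (add u v)
    have [measurable]: "u \<in> borel_measurable N" "v \<in> borel_measurable N" by fact+
    note [measurable] = FO'[OF L]
    have "(\<integral>\<^sup>+\<omega>. indicator \<Lambda> \<omega> * (v (X (r + s) \<omega>) + u (X (r + s) \<omega>)) \<partial>P x)
       = (\<integral>\<^sup>+\<omega>. indicator \<Lambda> \<omega> * v (X (r + s) \<omega>) \<partial>P x) + (\<integral>\<^sup>+\<omega>. indicator \<Lambda> \<omega> * u (X (r + s) \<omega>) \<partial>P x)"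
      by (subst nn_integral_add[symmetric]) (auto simp: distrib_left)
    also have "\<dots> = (\<integral>\<^sup>+\<omega>. indicator \<Lambda> \<omega> * (\<integral>\<^sup>+\<omega>'. v (X s \<omega>') \<partial>P (X r \<omega>)) + indicator \<Lambda> \<omega> * (\<integral>\<^sup>+\<omega>'. u (X s \<omega>') \<partial>P (X r \<omega>)) \<partial>P x)"
      unfolding add.IH by (subst nn_integral_add) auto
    also have "\<dots> = (\<integral>\<^sup>+\<omega>. indicator \<Lambda> \<omega> * (\<integral>\<^sup>+\<omega>'. v (X s \<omega>') + u (X s \<omega>') \<partial>P (X r \<omega>)) \<partial>P x)"
      by (intro nn_integral_cong, subst nn_integral_add) (auto simp: distrib_left)
    finally show ?case .
  next
    case (seq U)
    note [measurable] = seq(1) FO'[OF L]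
    have m: "incseq (\<lambda>i \<omega>. indicator \<Lambda> \<omega> * U i (X (r + s) \<omega>))" "incseq (\<lambda>i \<omega>. U i (X s \<omega>))"
      "incseq (\<lambda>i \<omega>. indicator \<Lambda> \<omega> * (\<integral>\<^sup>+\<omega>'. U i (X s \<omega>') \<partial>P (X r \<omega>)))"
      using seq(3) by (auto simp: incseq_def le_fun_def intro!: mult_left_mono nn_integral_mono)
    have "(\<integral>\<^sup>+\<omega>. indicator \<Lambda> \<omega> * (SUP i. U i) (X (r + s) \<omega>) \<partial>P x) = (\<integral>\<^sup>+\<omega>. (SUP i. indicator \<Lambda> \<omega> * U i (X (r + s) \<omega>)) \<partial>P x)"
      by (simp add: SUP_mult_left_ennreal image_comp)
    also have "\<dots> = (SUP i. \<integral>\<^sup>+\<omega>. indicator \<Lambda> \<omega> * U i (X (r + s) \<omega>) \<partial>P x)"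
      by (rule nn_integral_monotone_convergence_SUP[OF m(1)]) measurable
    also have "\<dots> = (SUP i. \<integral>\<^sup>+\<omega>. indicator \<Lambda> \<omega> * (\<integral>\<^sup>+\<omega>'. U i (X s \<omega>') \<partial>P (X r \<omega>)) \<partial>P x)"
      using seq.IH by simp
    also have "\<dots> = (\<integral>\<^sup>+\<omega>. (SUP i. indicator \<Lambda> \<omega> * (\<integral>\<^sup>+\<omega>'. U i (X s \<omega>') \<partial>P (X r \<omega>))) \<partial>P x)"
      by (rule nn_integral_monotone_convergence_SUP[OF m(3), symmetric]) measurable
    also have "\<dots> = (\<integral>\<^sup>+\<omega>. indicator \<Lambda> \<omega> * (\<integral>\<^sup>+\<omega>'. (SUP i. U i (X s \<omega>')) \<partial>P (X r \<omega>)) \<partial>P x)"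
      by (subst nn_integral_monotone_convergence_SUP[OF m(2)]) (auto simp: SUP_mult_left_ennreal)
    finally show ?case by (simp add: image_comp)
  qed
  note [measurable] = f
  show ?thesis using Y
  proof (induction rule: borel_measurable_induct)
    case (cong g h)
    have "g \<omega> = h \<omega>" if "\<omega> \<in> space \<Omega>" for \<omega>
      using cong(3) that sub[OF rs(1)] by (auto simp: subalgebra_def)
    then have "(\<integral>\<^sup>+\<omega>. g \<omega> * k \<omega> \<partial>P x) = (\<integral>\<^sup>+\<omega>. h \<omega> * k \<omega> \<partial>P x)" for k
      by (intro nn_integral_cong) simp
    then show ?case using cong(4) by simp
  next
    case (set B) then show ?case by (rule 1)
  next
    case (mult u c)
    note [measurable] = FO[OF mult(2)]
    show ?case using mult(4) by (simp add: nn_integral_cmult mult.assoc)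
  next
    case (add u v)
    have [measurable]: "u \<in> borel_measurable \<Omega>" "v \<in> borel_measurable \<Omega>"
      by (intro FO, fact)+
    show ?case using add.IH by (simp add: nn_integral_add distrib_right)
  next
    case (seq U)
    note [measurable] = FO[OF seq(1)]
    have m: "incseq (\<lambda>i \<omega>. U i \<omega> * f (X (r + s) \<omega>))" "incseq (\<lambda>i \<omega>. U i \<omega> * (\<integral>\<^sup>+\<omega>'. f (X s \<omega>') \<partial>P (X r \<omega>)))"
      using seq(3) by (auto simp: incseq_def le_fun_def intro!: mult_right_mono)
    have "(\<integral>\<^sup>+\<omega>. (SUP i. U i) \<omega> * f (X (r + s) \<omega>) \<partial>P x) = (SUP i. \<integral>\<^sup>+\<omega>. U i \<omega> * f (X (r + s) \<omega>) \<partial>P x)"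
      by (subst nn_integral_monotone_convergence_SUP[OF m(1), symmetric]) (auto simp: SUP_mult_right_ennreal image_comp)
    also have "\<dots> = (SUP i. \<integral>\<^sup>+\<omega>. U i \<omega> * (\<integral>\<^sup>+\<omega>'. f (X s \<omega>') \<partial>P (X r \<omega>)) \<partial>P x)" using seq.IH by simp
    also have "\<dots> = (\<integral>\<^sup>+\<omega>. (SUP i. U i) \<omega> * (\<integral>\<^sup>+\<omega>'. f (X s \<omega>') \<partial>P (X r \<omega>)) \<partial>P x)"
      by (subst nn_integral_monotone_convergence_SUP[OF m(2), symmetric]) (auto simp: SUP_mult_right_ennreal image_comp)
    finally show ?case .
  qed
qed

lemma integrable_P:
  fixes g :: "'w \<Rightarrow> real"
  assumes "g \<in> borel_measurable \<Omega>" "\<And>\<omega>. \<omega> \<in> space \<Omega> \<Longrightarrow> \<bar>g \<omega>\<bar> \<le> C"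
  shows "integrable (P x) g"
proof -
  interpret prob_space "P x" by (rule prob_P)
  have "g \<in> borel_measurable (P x)" using assms(1) by simp
  then show ?thesis using assms by (intro integrable_const_bound[where B=C]) (auto intro!: AE_I2)
qed

lemma expectation_measurable [measurable (raw)]:
  fixes f :: "'c \<Rightarrow> 'w \<Rightarrow> real"
  assumes "(\<lambda>(p, \<omega>). f p \<omega>) \<in> borel_measurable (M \<Otimes>\<^sub>M \<Omega>)" and "\<zeta> \<in> M \<rightarrow>\<^sub>M N"
  shows "(\<lambda>p. \<integral>\<omega>. f p \<omega> \<partial>P (\<zeta> p)) \<in> borel_measurable M"
proof -
  note [measurable] = assms
  have "(\<lambda>p. integral\<^sup>L (distr (P (\<zeta> p)) (M \<Otimes>\<^sub>M \<Omega>) (Pair p)) (\<lambda>(p, \<omega>). f p \<omega>)) \<in> borel_measurable M"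
  proof (rule measurable_compose[OF measurable_distr2 integral_measurable_subprob_algebra])
    show "(\<lambda>(p, y). (p, y)) \<in> M \<Otimes>\<^sub>M \<Omega> \<rightarrow>\<^sub>M M \<Otimes>\<^sub>M \<Omega>" by simp
    show "(\<lambda>p. P (\<zeta> p)) \<in> M \<rightarrow>\<^sub>M subprob_algebra \<Omega>" by measurable
  qed measurable
  then show ?thesis
    by (rule measurable_cong[THEN iffD1, rotated]) (simp add: integral_distr)
qed

lemma markov:
  fixes Y :: "'w \<Rightarrow> real" and f :: "'s \<Rightarrow> real"
  assumes rs: "0 \<le> r" "0 \<le> s" and Y: "Y \<in> borel_measurable (F r)" "\<And>\<omega>. \<omega> \<in> space \<Omega> \<Longrightarrow> \<bar>Y \<omega>\<bar> \<le> C"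
    and f: "f \<in> borel_measurable N" "\<And>y. \<bar>f y\<bar> \<le> D"
  shows "(\<integral>\<omega>. Y \<omega> * f (X (r + s) \<omega>) \<partial>P x) = (\<integral>\<omega>. Y \<omega> * (\<integral>\<omega>'. f (X s \<omega>') \<partial>P (X r \<omega>)) \<partial>P x)"
proof -
  have [measurable]: "X (r + s) \<in> \<Omega> \<rightarrow>\<^sub>M N" "X s \<in> \<Omega> \<rightarrow>\<^sub>M N" "X r \<in> \<Omega> \<rightarrow>\<^sub>M N"
    using rs by (auto intro!: X_measurable')
  note [measurable] = f(1)
  have Ym[measurable]: "Y \<in> borel_measurable \<Omega>" using measurable_from_subalg[OF sub[OF rs(1)] Y(1)] .
  define Q where "Q g y = (\<integral>\<omega>'. g (X s \<omega>') \<partial>P y)" for g :: "'s \<Rightarrow> real" and y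
  have Qm[measurable]: "Q g \<in> borel_measurable N" if [measurable]: "g \<in> borel_measurable N" for g
    unfolding Q_def by measurable
  have Qb: "\<bar>Q g y\<bar> \<le> D" if [measurable]: "g \<in> borel_measurable N" and gb: "\<And>y. \<bar>g y\<bar> \<le> D" for g D y
  proof -
    interpret prob_space "P y" by (rule prob_P)
    have "\<bar>Q g y\<bar> \<le> (\<integral>\<omega>'. \<bar>g (X s \<omega>')\<bar> \<partial>P y)" unfolding Q_def by (rule integral_abs_bound)
    also have "\<dots> \<le> (\<integral>\<omega>'. D \<partial>P y)"
      using gb order_trans[OF abs_ge_zero gb] by (intro integral_mono integrable_P[where C=D]) auto
    finally show ?thesis by (simp add: prob_space)
  qed
  have pos: "(\<integral>\<omega>. Y' \<omega> * f' (X (r + s) \<omega>) \<partial>P x) = (\<integral>\<omega>. Y' \<omega> * Q f' (X r \<omega>) \<partial>P x)"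
    if Y'F: "Y' \<in> borel_measurable (F r)" and Y': "\<And>\<omega>. \<omega> \<in> space \<Omega> \<Longrightarrow> 0 \<le> Y' \<omega>"
     and f'[measurable]: "f' \<in> borel_measurable N" and f'0: "\<And>y. 0 \<le> f' y" "\<And>y. f' y \<le> D'" for Y' f' D'
  proof -
    note [measurable] = measurable_from_subalg[OF sub[OF rs(1)] Y'F]
    have Q0: "0 \<le> Q f' y" for y unfolding Q_def using f'0 by simp
    have Qn: "ennreal (Q f' y) = (\<integral>\<^sup>+\<omega>'. ennreal (f' (X s \<omega>')) \<partial>P y)" for y
      unfolding Q_def using f'0 by (intro nn_integral_eq_integral[symmetric] integrable_P[where C=D']) auto
    have YF: "(\<lambda>\<omega>. ennreal (Y' \<omega>)) \<in> borel_measurable (F r)" using Y'F by simp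
    have "(\<integral>\<omega>. Y' \<omega> * f' (X (r + s) \<omega>) \<partial>P x) = enn2real (\<integral>\<^sup>+\<omega>. ennreal (Y' \<omega>) * ennreal (f' (X (r + s) \<omega>)) \<partial>P x)"
      using Y' f'0 by (subst integral_eq_nn_integral) (auto simp: ennreal_mult intro!: AE_I2 arg_cong[where f=enn2real] nn_integral_cong)
    also have "\<dots> = enn2real (\<integral>\<^sup>+\<omega>. ennreal (Y' \<omega>) * ennreal (Q f' (X r \<omega>)) \<partial>P x)"
      unfolding Qn using nn_markov[OF rs YF, where f="\<lambda>y. ennreal (f' y)"] by simp
    also have "\<dots> = (\<integral>\<omega>. Y' \<omega> * Q f' (X r \<omega>) \<partial>P x)"
      using Y' Q0 by (subst integral_eq_nn_integral) (auto simp: ennreal_mult intro!: AE_I2 arg_cong[where f=enn2real] nn_integral_cong)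
    finally show ?thesis .
  qed
  define f1 where "f1 y = f y + \<bar>D\<bar>" for y
  define Y1 where "Y1 \<omega> = Y \<omega> + \<bar>C\<bar>" for \<omega>
  have [measurable]: "f1 \<in> borel_measurable N" "Y1 \<in> borel_measurable \<Omega>" "(\<lambda>y. \<bar>D\<bar>) \<in> borel_measurable N"
    unfolding f1_def Y1_def by measurable
  have Y1F: "Y1 \<in> borel_measurable (F r)" unfolding Y1_def using Y(1) by simp
  have f1b: "0 \<le> f1 y" "f1 y \<le> 2 * \<bar>D\<bar>" "\<bar>f1 y\<bar> \<le> 2 * \<bar>D\<bar>" for y using f(2)[of y] unfolding f1_def by auto
  have Y1b: "0 \<le> Y1 \<omega>" "\<bar>Y1 \<omega>\<bar> \<le> 2 * \<bar>C\<bar>" if "\<omega> \<in> space \<Omega>" for \<omega> using Y(2)[OF that] unfolding Y1_def by auto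
  have Qf: "Q f y = Q f1 y - \<bar>D\<bar>" for y
  proof -
    interpret prob_space "P y" by (rule prob_P)
    have "Q f1 y = Q f y + (\<integral>\<omega>. \<bar>D\<bar> \<partial>P y)" unfolding f1_def Q_def
      using f(2) by (intro Bochner_Integration.integral_add integrable_P[where C="\<bar>D\<bar>"])
        (auto intro: order_trans[OF _ abs_ge_self])
    then show ?thesis by (simp add: prob_space)
  qed
  have prodb: "\<bar>g \<omega> * h \<omega>\<bar> \<le> a * b" if "\<bar>g \<omega>\<bar> \<le> a" "\<bar>h \<omega>\<bar> \<le> b" for g h :: "'w \<Rightarrow> real" and \<omega> a b
    unfolding abs_mult using that by (intro mult_mono) auto
  have Qb1: "\<bar>Q f1 y\<bar> \<le> 2 * \<bar>D\<bar>" for y using f1b by (intro Qb) auto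
  have i1: "integrable (P x) (\<lambda>\<omega>. Y1 \<omega> * f1 (X (r + s) \<omega>))"
    by (intro integrable_P[where C="(2 * \<bar>C\<bar>) * (2 * \<bar>D\<bar>)"] prodb f1b Y1b) auto
  have i2: "integrable (P x) (\<lambda>\<omega>. Y1 \<omega> * Q f1 (X r \<omega>))"
    by (intro integrable_P[where C="(2 * \<bar>C\<bar>) * (2 * \<bar>D\<bar>)"] prodb Qb1 Y1b) auto
  have i3: "integrable (P x) (\<lambda>\<omega>. f1 (X (r + s) \<omega>))" using f1b by (intro integrable_P[where C="2 * \<bar>D\<bar>"]) auto
  have i4: "integrable (P x) (\<lambda>\<omega>. Q f1 (X r \<omega>))" using Qb1 by (intro integrable_P[where C="2 * \<bar>D\<bar>"]) auto
  have i5: "integrable (P x) Y" using Y(2) by (intro integrable_P[where C="C"]) auto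
  have p1: "(\<integral>\<omega>. Y1 \<omega> * f1 (X (r + s) \<omega>) \<partial>P x) = (\<integral>\<omega>. Y1 \<omega> * Q f1 (X r \<omega>) \<partial>P x)"
    using f1b Y1b by (intro pos Y1F) auto
  have p2: "(\<integral>\<omega>. f1 (X (r + s) \<omega>) \<partial>P x) = (\<integral>\<omega>. Q f1 (X r \<omega>) \<partial>P x)"
    using pos[of "\<lambda>_. 1" f1 "2 * \<bar>D\<bar>"] f1b by auto
  have "(\<integral>\<omega>. Y \<omega> * f (X (r + s) \<omega>) \<partial>P x) = (\<integral>\<omega>. Y1 \<omega> * f1 (X (r + s) \<omega>) - \<bar>C\<bar> * f1 (X (r + s) \<omega>) - \<bar>D\<bar> * Y \<omega> \<partial>P x)"
    unfolding f1_def Y1_def by (simp add: algebra_simps)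
  also have "\<dots> = (\<integral>\<omega>. Y1 \<omega> * Q f1 (X r \<omega>) \<partial>P x) - \<bar>C\<bar> * (\<integral>\<omega>. Q f1 (X r \<omega>) \<partial>P x) - \<bar>D\<bar> * (\<integral>\<omega>. Y \<omega> \<partial>P x)"
    using i1 i3 i5 p1 p2 by simp
  also have "\<dots> = (\<integral>\<omega>. Y1 \<omega> * Q f1 (X r \<omega>) - \<bar>C\<bar> * Q f1 (X r \<omega>) - \<bar>D\<bar> * Y \<omega> \<partial>P x)"
    using i2 i4 i5 by simp
  also have "\<dots> = (\<integral>\<omega>. Y \<omega> * Q f (X r \<omega>) \<partial>P x)"
    unfolding Qf Y1_def by (simp add: algebra_simps)
  finally show ?thesis unfolding Q_def .
qed

definition mult_fun :: "('s \<Rightarrow> real) \<Rightarrow> real \<Rightarrow> 'w \<Rightarrow> real" where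
  "mult_fun \<alpha> t \<omega> = exp (LINT u:{0..t}|lborel. \<alpha> (X (max 0 u) \<omega>))"

text \<open>
  The Feynman-Kac semigroup with potential \<open>\<alpha>\<close>; the potential \<open>0\<close> gives the transition semigroup.
\<close>

definition FK :: "('s \<Rightarrow> real) \<Rightarrow> real \<Rightarrow> ('s \<Rightarrow> real) \<Rightarrow> 's \<Rightarrow> real" where
  "FK \<alpha> t f x = (\<integral>\<omega>. mult_fun \<alpha> t \<omega> * f (X (max 0 t) \<omega>) \<partial>P x)"

abbreviation trans :: "real \<Rightarrow> ('s \<Rightarrow> real) \<Rightarrow> 's \<Rightarrow> real" where "trans \<equiv> FK (\<lambda>_. 0)"

lemma mult_fun_joint [measurable]:
  assumes [measurable]: "\<alpha> \<in> borel_measurable N"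
  shows "(\<lambda>(t, \<omega>). mult_fun \<alpha> t \<omega>) \<in> borel_measurable (borel \<Otimes>\<^sub>M \<Omega>)"
proof -
  have "(\<lambda>z. exp (\<integral>u. (if 0 \<le> u \<and> u \<le> fst z then \<alpha> (X (max 0 u) (snd z)) else 0) \<partial>lborel)) \<in> borel_measurable (borel \<Otimes>\<^sub>M \<Omega>)"
  proof -
    have 1: "(\<lambda>w. case (snd w, snd (fst w)) of (s, \<omega>) \<Rightarrow> X (max 0 s) \<omega>) \<in> (borel \<Otimes>\<^sub>M \<Omega>) \<Otimes>\<^sub>M lborel \<rightarrow>\<^sub>M N"
      by measurable
    note [measurable] = measurable_compose[OF 1[unfolded prod.case] assms]
    show ?thesis by measurable
  qed
  moreover have "(\<lambda>z. exp (\<integral>u. (if 0 \<le> u \<and> u \<le> fst z then \<alpha> (X (max 0 u) (snd z)) else 0) \<partial>lborel)) = (\<lambda>(t, \<omega>). mult_fun \<alpha> t \<omega>)"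
    unfolding mult_fun_def set_lebesgue_integral_def
    by (auto intro!: ext Bochner_Integration.integral_cong simp: indicator_def)
  ultimately show ?thesis by simp
qed

lemma mult_fun_measurable [measurable]:
  assumes [measurable]: "\<alpha> \<in> borel_measurable N" shows "mult_fun \<alpha> t \<in> borel_measurable \<Omega>"
proof -
  have "(\<lambda>\<omega>. case (t, \<omega>) of (t, \<omega>) \<Rightarrow> mult_fun \<alpha> t \<omega>) \<in> borel_measurable \<Omega>" by measurable
  then show ?thesis by simp
qed

lemma mult_fun_adapted:
  assumes [measurable]: "\<alpha> \<in> borel_measurable N" and t: "0 \<le> t"
  shows "mult_fun \<alpha> t \<in> borel_measurable (F t)"
proof -
  note [measurable] = prog[OF t]
  have "(\<lambda>\<omega>. exp (\<integral>u. (if 0 \<le> u \<and> u \<le> t then \<alpha> (X (max 0 (min u t)) \<omega>) else 0) \<partial>lborel)) \<in> borel_measurable (F t)"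
  proof -
    have 1: "(\<lambda>w. case (snd w, fst w) of (s, \<omega>) \<Rightarrow> X (max 0 (min s t)) \<omega>) \<in> F t \<Otimes>\<^sub>M lborel \<rightarrow>\<^sub>M N"
      by measurable
    note [measurable] = measurable_compose[OF 1[unfolded prod.case] assms(1)]
    show ?thesis by measurable
  qed
  moreover have "(\<lambda>\<omega>. exp (\<integral>u. (if 0 \<le> u \<and> u \<le> t then \<alpha> (X (max 0 (min u t)) \<omega>) else 0) \<partial>lborel)) = mult_fun \<alpha> t"
    unfolding mult_fun_def set_lebesgue_integral_def
    by (auto intro!: ext Bochner_Integration.integral_cong simp: indicator_def)
  ultimately show ?thesis by simp
qed

lemma mult_fun_pos: "0 < mult_fun \<alpha> t \<omega>" by (simp add: mult_fun_def)

lemma mult_fun_zero [simp]: "mult_fun \<alpha> 0 \<omega> = 1"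
  using abs_interval_integral_le[of 0 0 "\<lambda>u. \<alpha> (X (max 0 u) \<omega>)" "\<bar>\<alpha> (X 0 \<omega>)\<bar>"]
  by (simp add: mult_fun_def)

lemma mult_fun_trivial [simp]: "mult_fun (\<lambda>_. 0) t \<omega> = 1"
  by (simp add: mult_fun_def set_lebesgue_integral_def)

lemma mult_fun_le:
  assumes "\<And>y. \<bar>\<alpha> y\<bar> \<le> K" "0 \<le> t" shows "mult_fun \<alpha> t \<omega> \<le> exp (K * t)" "exp (- K * t) \<le> mult_fun \<alpha> t \<omega>"
proof -
  have "0 \<le> K" using order_trans[OF abs_ge_zero assms(1)] .
  then have "\<bar>LINT u:{0..t}|lborel. \<alpha> (X (max 0 u) \<omega>)\<bar> \<le> K * (t - 0)"
    using assms by (intro abs_interval_integral_le) auto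
  then show "mult_fun \<alpha> t \<omega> \<le> exp (K * t)" "exp (- K * t) \<le> mult_fun \<alpha> t \<omega>" unfolding mult_fun_def by auto
qed

lemma FK_measurable [measurable (raw)]:
  assumes [measurable]: "\<alpha> \<in> borel_measurable N" "\<tau> \<in> borel_measurable M" "\<zeta> \<in> M \<rightarrow>\<^sub>M N"
    "(\<lambda>(p, y). H p y) \<in> borel_measurable (M \<Otimes>\<^sub>M N)"
  shows "(\<lambda>p. FK \<alpha> (\<tau> p) (\<lambda>y. H p y) (\<zeta> p)) \<in> borel_measurable M"
proof -
  have 1: "(\<lambda>z. case (\<tau> (fst z), snd z) of (t, \<omega>) \<Rightarrow> mult_fun \<alpha> t \<omega>) \<in> borel_measurable (M \<Otimes>\<^sub>M \<Omega>)"
    by measurable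
  have 2: "(\<lambda>z. case (\<tau> (fst z), snd z) of (t, \<omega>) \<Rightarrow> X (max 0 t) \<omega>) \<in> M \<Otimes>\<^sub>M \<Omega> \<rightarrow>\<^sub>M N"
    by measurable
  note [measurable] = 1[unfolded prod.case] 2[unfolded prod.case]
  have 3: "(\<lambda>z. case (fst z, X (max 0 (\<tau> (fst z))) (snd z)) of (p, y) \<Rightarrow> H p y) \<in> borel_measurable (M \<Otimes>\<^sub>M \<Omega>)"
    by measurable
  note [measurable] = 3[unfolded prod.case]
  show ?thesis unfolding FK_def by measurable
qed

lemma FK_fun_measurable [measurable]:
  assumes [measurable]: "\<alpha> \<in> borel_measurable N" "f \<in> borel_measurable N"
  shows "FK \<alpha> t f \<in> borel_measurable N"
proof -
  have "(\<lambda>p. FK \<alpha> t (\<lambda>y. f y) p) \<in> borel_measurable N" by measurable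
  then show ?thesis by simp
qed

lemma FK_integrand_bound:
  assumes "\<And>y. \<bar>\<alpha> y\<bar> \<le> K" "\<And>y. \<bar>f y\<bar> \<le> C" "0 \<le> t"
  shows "\<bar>mult_fun \<alpha> t \<omega> * f y\<bar> \<le> exp (K * t) * C"
  unfolding abs_mult using mult_fun_le(1)[OF assms(1,3)] assms(2) mult_fun_pos[of \<alpha> t \<omega>]
  by (intro mult_mono) auto

lemma FK_integrable:
  assumes [measurable]: "\<alpha> \<in> borel_measurable N" "f \<in> borel_measurable N"
    and "\<And>y. \<bar>\<alpha> y\<bar> \<le> K" "\<And>y. \<bar>f y\<bar> \<le> C" "0 \<le> t"
  shows "integrable (P x) (\<lambda>\<omega>. mult_fun \<alpha> t \<omega> * f (X (max 0 t) \<omega>))"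
  using FK_integrand_bound[OF assms(3-5)] by (intro integrable_P[where C="exp (K * t) * C"]) auto

lemma FK_bound:
  assumes [measurable]: "\<alpha> \<in> borel_measurable N" "f \<in> borel_measurable N"
    and b: "\<And>y. \<bar>\<alpha> y\<bar> \<le> K" "\<And>y. \<bar>f y\<bar> \<le> C" "0 \<le> t"
  shows "\<bar>FK \<alpha> t f x\<bar> \<le> exp (K * t) * C"
proof -
  have "\<bar>FK \<alpha> t f x\<bar> \<le> (\<integral>\<omega>. \<bar>mult_fun \<alpha> t \<omega> * f (X (max 0 t) \<omega>)\<bar> \<partial>P x)" unfolding FK_def by (rule integral_abs_bound)
  also have "\<dots> \<le> (\<integral>\<omega>. exp (K * t) * C \<partial>P x)"
  proof (rule integral_mono)
    show "integrable (P x) (\<lambda>\<omega>. exp (K * t) * C)" by (rule integrable_P) auto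
  qed (use FK_integrable[OF assms] FK_integrand_bound[OF b] in auto)
  finally show ?thesis by simp
qed

lemma FK_linear:
  assumes [measurable]: "\<alpha> \<in> borel_measurable N" "f \<in> borel_measurable N" "g \<in> borel_measurable N"
    and b: "\<And>y. \<bar>\<alpha> y\<bar> \<le> K" "\<And>y. \<bar>f y\<bar> \<le> C" "\<And>y. \<bar>g y\<bar> \<le> D" "0 \<le> t"
  shows "FK \<alpha> t (\<lambda>y. f y + g y) x = FK \<alpha> t f x + FK \<alpha> t g x"
    and "FK \<alpha> t (\<lambda>y. f y - g y) x = FK \<alpha> t f x - FK \<alpha> t g x"
  using FK_integrable[OF assms(1,2) b(1,2,4)] FK_integrable[OF assms(1,3) b(1,3,4)]
  by (auto simp: FK_def distrib_left right_diff_distrib)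

lemma FK_zero:
  assumes [measurable]: "f \<in> borel_measurable N" shows "FK \<alpha> 0 f x = f x"
proof -
  have [measurable]: "X 0 \<in> \<Omega> \<rightarrow>\<^sub>M N" by (rule X_measurable') simp
  have "FK \<alpha> 0 f x = (\<integral>\<omega>. f x \<partial>P x)" unfolding FK_def
    by (rule integral_cong_AE) (use start[of x] in \<open>auto elim: eventually_mono\<close>)
  then show ?thesis by simp
qed

lemma FK_time_integral:
  fixes g :: "real \<Rightarrow> 's \<Rightarrow> real"
  assumes [measurable]: "\<alpha> \<in> borel_measurable N" "(\<lambda>(r, y). g r y) \<in> borel_measurable (borel \<Otimes>\<^sub>M N)"
    and b: "\<And>y. \<bar>\<alpha> y\<bar> \<le> K" "\<And>r y. r \<in> {a..b} \<Longrightarrow> \<bar>g r y\<bar> \<le> C" "0 \<le> t"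
  shows "FK \<alpha> t (\<lambda>y. LINT r:{a..b}|lborel. g r y) x = (LINT r:{a..b}|lborel. FK \<alpha> t (g r) x)"
proof -
  have "FK \<alpha> t (\<lambda>y. LINT r:{a..b}|lborel. g r y) x = (\<integral>\<omega>. (LINT r:{a..b}|lborel. mult_fun \<alpha> t \<omega> * g r (X (max 0 t) \<omega>)) \<partial>P x)"
    unfolding FK_def by simp
  also have "\<dots> = (LINT r:{a..b}|lborel. (\<integral>\<omega>. mult_fun \<alpha> t \<omega> * g r (X (max 0 t) \<omega>) \<partial>P x))"
  proof (rule fubini_time[where g="\<lambda>r \<omega>. mult_fun \<alpha> t \<omega> * g r (X (max 0 t) \<omega>)" and C="exp (K * t) * C"])
    show "finite_measure (P x)" using prob_P prob_space.axioms(1) by blast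
    have 3: "(\<lambda>z. case (fst z, X (max 0 t) (snd z)) of (p, y) \<Rightarrow> g p y) \<in> borel_measurable (borel \<Otimes>\<^sub>M P x)"
      by measurable
    note [measurable] = 3[unfolded prod.case]
    show "(\<lambda>(r, \<omega>). mult_fun \<alpha> t \<omega> * g r (X (max 0 t) \<omega>)) \<in> borel_measurable (borel \<Otimes>\<^sub>M P x)"
      by measurable
    show "\<bar>mult_fun \<alpha> t \<omega> * g r (X (max 0 t) \<omega>)\<bar> \<le> exp (K * t) * C" if "r \<in> {a..b}" for r \<omega>
      using FK_integrand_bound[OF b(1) b(2)[OF that] b(3)] .
  qed
  finally show ?thesis unfolding FK_def .
qed

text \<open>
  The exponential functional solves a linear integral equation along every path.
\<close>

lemma mult_fun_increment:
  assumes [measurable]: "\<alpha> \<in> borel_measurable N" and K: "\<And>y. \<bar>\<alpha> y\<bar> \<le> K" and t: "0 \<le> t" "0 \<le> s" and \<omega>: "\<omega> \<in> space \<Omega>"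
  shows "mult_fun \<alpha> (t + s) \<omega> = mult_fun \<alpha> t \<omega> + (LINT r:{0..s}|lborel. mult_fun \<alpha> (t + r) \<omega> * \<alpha> (X (t + r) \<omega>))"
proof -
  let ?a = "\<lambda>u. \<alpha> (X (max 0 u) \<omega>)"
  have 1: "(\<lambda>u. case (u, \<omega>) of (u, \<omega>) \<Rightarrow> X (max 0 u) \<omega>) \<in> borel \<rightarrow>\<^sub>M N"
    using \<omega> by (intro measurable_compose[OF _ joint]) simp
  have [measurable]: "?a \<in> borel_measurable borel" using measurable_compose[OF 1 assms(1)] by simp
  have 2: "(\<lambda>u. case (u, \<omega>) of (u, \<omega>) \<Rightarrow> mult_fun \<alpha> u \<omega>) \<in> borel_measurable borel"
    using \<omega> by (intro measurable_compose[OF _ mult_fun_joint]) simp_all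
  note [measurable] = 2[unfolded prod.case]
  have e: "mult_fun \<alpha> T \<omega> = 1 + (LINT r:{0..T}|lborel. mult_fun \<alpha> r \<omega> * ?a r)" if "0 \<le> T" for T
    unfolding mult_fun_def using K that by (intro exp_integral) auto
  have K0: "0 \<le> K" using order_trans[OF abs_ge_zero K] .
  have "set_integrable lborel {0..t+s} (\<lambda>r. mult_fun \<alpha> r \<omega> * ?a r)"
  proof (rule set_integrable_bounded_interval[where C="exp (K * (t + s)) * K"])
    fix u assume u: "u \<in> {0..t+s}"
    have "exp (K * u) * K \<le> exp (K * (t + s)) * K" using u K0 by (intro mult_right_mono) (auto intro: mult_left_mono)
    then show "\<bar>mult_fun \<alpha> u \<omega> * ?a u\<bar> \<le> exp (K * (t + s)) * K"
      using FK_integrand_bound[where \<alpha>=\<alpha> and f=\<alpha> and t=u and \<omega>=\<omega> and y="X (max 0 u) \<omega>", OF K K] u by simp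
  qed measurable
  from interval_integral_combine[OF this, of t]
  have "mult_fun \<alpha> (t + s) \<omega> = mult_fun \<alpha> t \<omega> + (LINT r:{t..t+s}|lborel. mult_fun \<alpha> r \<omega> * ?a r)"
    using e[of t] e[of "t + s"] t by simp
  also have "(LINT r:{t..t+s}|lborel. mult_fun \<alpha> r \<omega> * ?a r) = (LINT r:{0..s}|lborel. mult_fun \<alpha> (t + r) \<omega> * ?a (t + r))"
    by (rule interval_integral_shift)
  also have "\<dots> = (LINT r:{0..s}|lborel. mult_fun \<alpha> (t + r) \<omega> * \<alpha> (X (t + r) \<omega>))"
    using t by (intro set_lebesgue_integral_cong) auto
  finally show ?thesis .
qed

text \<open>
  Expand the multiplicative functional between \<open>t\<close> and \<open>t + s\<close> by its integral equation, and apply the Markov property at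
  \<open>t\<close> to the leading term and at \<open>t + r\<close> under the integral. The case \<open>t = 0\<close> is the usual perturbation formula.
\<close>

lemma FK_duhamel:
  assumes [measurable]: "\<alpha> \<in> borel_measurable N" "f \<in> borel_measurable N"
    and K: "\<And>y. \<bar>\<alpha> y\<bar> \<le> K" and C: "\<And>y. \<bar>f y\<bar> \<le> C" and t: "0 \<le> t" "0 \<le> s"
  shows "FK \<alpha> (t + s) f x = FK \<alpha> t (trans s f) x + (LINT r:{0..s}|lborel. FK \<alpha> (t + r) (\<lambda>y. \<alpha> y * trans (s - r) f y) x)"
proof -
  have [measurable]: "X (t + s) \<in> \<Omega> \<rightarrow>\<^sub>M N" using t by (intro X_measurable') auto
  have K0: "0 \<le> K" using order_trans[OF abs_ge_zero K] .
  have C0: "0 \<le> C" using order_trans[OF abs_ge_zero C] .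
  have sum: "(\<lambda>z. case (t + fst z, snd z) of (u, \<omega>) \<Rightarrow> mult_fun \<alpha> u \<omega>) \<in> borel_measurable (borel \<Otimes>\<^sub>M \<Omega>)"
     "(\<lambda>z. case (t + fst z, snd z) of (u, \<omega>) \<Rightarrow> X (max 0 u) \<omega>) \<in> borel \<Otimes>\<^sub>M \<Omega> \<rightarrow>\<^sub>M N"
    by measurable
  let ?h = "\<lambda>r \<omega>. mult_fun \<alpha> (t + r) \<omega> * \<alpha> (X (max 0 (t + r)) \<omega>) * f (X (t + s) \<omega>)"
  note [measurable] = sum[unfolded prod.case]
  have hm: "(\<lambda>(r, \<omega>). ?h r \<omega>) \<in> borel_measurable (borel \<Otimes>\<^sub>M \<Omega>)" by measurable
  have hb: "\<bar>?h r \<omega>\<bar> \<le> exp (K * (t + s)) * K * C" if r: "r \<in> {0..s}" for r \<omega>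
  proof -
    have "exp (K * (t + r)) * K \<le> exp (K * (t + s)) * K" using r K0 t by (intro mult_right_mono) (auto intro: mult_left_mono)
    then have "\<bar>mult_fun \<alpha> (t + r) \<omega> * \<alpha> (X (max 0 (t + r)) \<omega>)\<bar> \<le> exp (K * (t + s)) * K"
      using FK_integrand_bound[where \<alpha>=\<alpha> and f=\<alpha> and t="t + r" and \<omega>=\<omega> and y="X (max 0 (t + r)) \<omega>", OF K K] r t by simp
    then show ?thesis unfolding abs_mult[of _ "f _"] using C C0 K0 by (intro mult_mono) auto
  qed
  have fin: "finite_measure (P x)" using prob_P prob_space.axioms(1) by blast
  have eq: "mult_fun \<alpha> (t + s) \<omega> * f (X (t + s) \<omega>) = mult_fun \<alpha> t \<omega> * f (X (t + s) \<omega>) + (LINT r:{0..s}|lborel. ?h r \<omega>)"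
    if "\<omega> \<in> space \<Omega>" for \<omega>
  proof -
    have "(LINT r:{0..s}|lborel. mult_fun \<alpha> (t + r) \<omega> * \<alpha> (X (max 0 (t + r)) \<omega>)) = (LINT r:{0..s}|lborel. mult_fun \<alpha> (t + r) \<omega> * \<alpha> (X (t + r) \<omega>))"
      using t by (intro set_lebesgue_integral_cong) auto
    then show ?thesis
      unfolding set_integral_mult_left mult_fun_increment[OF assms(1) K t that] by (simp add: distrib_right)
  qed
  have hm': "(\<lambda>(r, \<omega>). ?h r \<omega>) \<in> borel_measurable (borel \<Otimes>\<^sub>M P x)" using hm by simp
  have i1: "integrable (P x) (\<lambda>\<omega>. mult_fun \<alpha> t \<omega> * f (X (t + s) \<omega>))"
    using FK_integrand_bound[OF K C t(1)] by (intro integrable_P) auto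
  have i2: "integrable (P x) (\<lambda>\<omega>. LINT r:{0..s}|lborel. ?h r \<omega>)"
  proof (rule integrable_P)
    have "(\<lambda>\<omega>. \<integral>r. (case (\<omega>, r) of (\<omega>, r) \<Rightarrow> (if 0 \<le> r \<and> r \<le> s then ?h r \<omega> else 0)) \<partial>lborel) \<in> borel_measurable \<Omega>"
    proof -
      have "(\<lambda>z. case (snd z, fst z) of (r, \<omega>) \<Rightarrow> ?h r \<omega>) \<in> borel_measurable (\<Omega> \<Otimes>\<^sub>M lborel)"
        by (rule measurable_compose[OF _ hm]) measurable
      note [measurable] = this[unfolded prod.case]
      show ?thesis by measurable
    qed
    also have "(\<lambda>\<omega>. \<integral>r. (case (\<omega>, r) of (\<omega>, r) \<Rightarrow> (if 0 \<le> r \<and> r \<le> s then ?h r \<omega> else 0)) \<partial>lborel) = (\<lambda>\<omega>. LINT r:{0..s}|lborel. ?h r \<omega>)"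
      unfolding set_lebesgue_integral_def by (auto intro!: ext Bochner_Integration.integral_cong simp: indicator_def)
    finally show "(\<lambda>\<omega>. LINT r:{0..s}|lborel. ?h r \<omega>) \<in> borel_measurable \<Omega>" .
    show "\<bar>LINT r:{0..s}|lborel. ?h r \<omega>\<bar> \<le> exp (K * (t + s)) * K * C * (s - 0)" for \<omega>
      using hb K0 C0 t by (intro abs_interval_integral_le) auto
  qed
  have "FK \<alpha> (t + s) f x = (\<integral>\<omega>. mult_fun \<alpha> t \<omega> * f (X (t + s) \<omega>) + (LINT r:{0..s}|lborel. ?h r \<omega>) \<partial>P x)"
    unfolding FK_def using t by (intro Bochner_Integration.integral_cong) (auto simp: eq)
  also have "\<dots> = (\<integral>\<omega>. mult_fun \<alpha> t \<omega> * f (X (t + s) \<omega>) \<partial>P x) + (\<integral>\<omega>. (LINT r:{0..s}|lborel. ?h r \<omega>) \<partial>P x)"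
    using i1 i2 by simp
  also have "(\<integral>\<omega>. mult_fun \<alpha> t \<omega> * f (X (t + s) \<omega>) \<partial>P x) = FK \<alpha> t (trans s f) x"
    using markov[OF t mult_fun_adapted[OF assms(1) t(1)], of "exp (K * t)" f C x] mult_fun_le(1)[OF K t(1)] mult_fun_pos[of \<alpha> t] C t
    by (simp add: FK_def less_imp_le)
  also have "(\<integral>\<omega>. (LINT r:{0..s}|lborel. ?h r \<omega>) \<partial>P x) = (LINT r:{0..s}|lborel. (\<integral>\<omega>. ?h r \<omega> \<partial>P x))"
    by (rule fubini_time[OF fin hm' hb])
  also have "\<dots> = (LINT r:{0..s}|lborel. FK \<alpha> (t + r) (\<lambda>y. \<alpha> y * trans (s - r) f y) x)"
  proof (rule set_lebesgue_integral_cong)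
    show "\<forall>r. r \<in> {0..s} \<longrightarrow> (\<integral>\<omega>. ?h r \<omega> \<partial>P x) = FK \<alpha> (t + r) (\<lambda>y. \<alpha> y * trans (s - r) f y) x"
    proof (intro allI impI)
      fix r assume r: "r \<in> {0..s}"
      have tr: "0 \<le> t + r" "0 \<le> s - r" "t + r + (s - r) = t + s" using r t by auto
      have ad: "(\<lambda>\<omega>. mult_fun \<alpha> (t + r) \<omega> * \<alpha> (X (t + r) \<omega>)) \<in> borel_measurable (F (t + r))"
        using mult_fun_adapted[OF assms(1) tr(1)] measurable_compose[OF X_measurable_F[OF tr(1)] assms(1)]
        by (rule borel_measurable_times)
      show "(\<integral>\<omega>. ?h r \<omega> \<partial>P x) = FK \<alpha> (t + r) (\<lambda>y. \<alpha> y * trans (s - r) f y) x"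
        using markov[OF tr(1,2) ad, of "exp (K * (t + r)) * K" f C x] FK_integrand_bound[where \<alpha>=\<alpha> and f=\<alpha>, OF K K tr(1)] C tr t r
        by (simp add: FK_def mult.assoc)
    qed
  qed simp
  finally show ?thesis .
qed

lemma trans_bound:
  assumes "f \<in> borel_measurable N" "\<And>y. \<bar>f y\<bar> \<le> C" "0 \<le> t"
  shows "\<bar>trans t f x\<bar> \<le> C"
  using FK_bound[of "\<lambda>_. 0" f 0 C t x] assms by simp

text \<open>
  Without shift operators on the path space the multiplicative functional cannot be split at time \<open>t\<close> directly. Instead, both sides
  satisfy the same linear Volterra equation in \<open>s\<close> by Duhamel's formula, and the defect \<open>D\<close> of the semigroup property, which
  satisfies its homogeneous version, is bounded by a constant times \<open>(K s)\<^sup>n / n!\<close> for every \<open>n\<close>.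
\<close>

lemma FK_semigroup:
  assumes \<alpha>[measurable]: "\<alpha> \<in> borel_measurable N" and f: "f \<in> borel_measurable N"
    and K: "\<And>y. \<bar>\<alpha> y\<bar> \<le> K" and C: "\<And>y. \<bar>f y\<bar> \<le> C" and t: "0 \<le> t" "0 \<le> s"
  shows "FK \<alpha> (t + s) f x = FK \<alpha> t (FK \<alpha> s f) x"
proof -
  have K0: "0 \<le> K" using order_trans[OF abs_ge_zero K] .
  define D where "D s f = FK \<alpha> (t + s) f x - FK \<alpha> t (FK \<alpha> s f) x" for s f
  define M where "M = 2 * exp (K * (t + s))"
  \<comment> \<open>The homogeneous Volterra equation for the defect.\<close>
  have rec: "D s f = (LINT r:{0..s}|lborel. D r (\<lambda>y. \<alpha> y * trans (s - r) f y))"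
    if f[measurable]: "f \<in> borel_measurable N" and C: "\<And>y. \<bar>f y\<bar> \<le> C" and s: "0 \<le> s" for f C s
  proof -
    have C0: "0 \<le> C" using order_trans[OF abs_ge_zero C] .
    let ?g = "\<lambda>r y. \<alpha> y * trans (s - r) f y"
    have gm[measurable]: "(\<lambda>(r, y). ?g r y) \<in> borel_measurable (borel \<Otimes>\<^sub>M N)" by measurable
    have [measurable]: "?g r \<in> borel_measurable N" for r by measurable
    have gb: "\<bar>?g r y\<bar> \<le> K * C" if "r \<in> {0..s}" for r y
      unfolding abs_mult using K trans_bound[OF f C, of "s - r" y] that K0 by (intro mult_mono) auto
    have Fb: "\<bar>FK \<alpha> r (?g r) y\<bar> \<le> exp (K * s) * (K * C)" if r: "r \<in> {0..s}" for r y
    proof -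
      have "\<bar>FK \<alpha> r (?g r) y\<bar> \<le> exp (K * r) * (K * C)" using r by (intro FK_bound K gb) auto
      also have "\<dots> \<le> exp (K * s) * (K * C)" using r K0 C0 by (intro mult_right_mono) (auto intro: mult_left_mono)
      finally show ?thesis .
    qed
    have [measurable]: "(\<lambda>(r, y). FK \<alpha> r (?g r) y) \<in> borel_measurable (borel \<Otimes>\<^sub>M N)" by measurable
    have [measurable]: "(\<lambda>y. LINT r:{0..s}|lborel. FK \<alpha> r (?g r) y) \<in> borel_measurable N" by measurable
    have 1: "FK \<alpha> s f y = trans s f y + (LINT r:{0..s}|lborel. FK \<alpha> r (?g r) y)" for y
      using FK_duhamel[OF \<alpha> f K C order_refl s, of y] by (simp add: FK_zero)
    have "FK \<alpha> t (FK \<alpha> s f) x = FK \<alpha> t (\<lambda>y. trans s f y + (LINT r:{0..s}|lborel. FK \<alpha> r (?g r) y)) x"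
      by (simp add: 1[abs_def])
    also have "\<dots> = FK \<alpha> t (trans s f) x + FK \<alpha> t (\<lambda>y. LINT r:{0..s}|lborel. FK \<alpha> r (?g r) y) x"
    proof (rule FK_linear(1)[OF _ _ _ K _ _ t(1)])
      show "\<bar>LINT r:{0..s}|lborel. FK \<alpha> r (?g r) y\<bar> \<le> exp (K * s) * (K * C) * (s - 0)" for y
        using s C0 K0 Fb by (intro abs_interval_integral_le) auto
    qed (use trans_bound[OF f C s] in auto)
    also have "FK \<alpha> t (\<lambda>y. LINT r:{0..s}|lborel. FK \<alpha> r (?g r) y) x = (LINT r:{0..s}|lborel. FK \<alpha> t (FK \<alpha> r (?g r)) x)"
      by (rule FK_time_integral[OF _ _ K Fb t(1)]) auto
    finally have 2: "FK \<alpha> t (FK \<alpha> s f) x = FK \<alpha> t (trans s f) x + (LINT r:{0..s}|lborel. FK \<alpha> t (FK \<alpha> r (?g r)) x)" .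
    have i1: "set_integrable lborel {0..s} (\<lambda>r. FK \<alpha> (t + r) (?g r) x)"
    proof (rule set_integrable_bounded_interval)
      show "(\<lambda>r. FK \<alpha> (t + r) (?g r) x) \<in> borel_measurable borel" by measurable
      fix r assume r: "r \<in> {0..s}"
      have "\<bar>FK \<alpha> (t + r) (?g r) x\<bar> \<le> exp (K * (t + r)) * (K * C)" using r t by (intro FK_bound K gb) auto
      also have "\<dots> \<le> exp (K * (t + s)) * (K * C)" using r K0 C0 by (intro mult_right_mono) (auto intro: mult_left_mono)
      finally show "\<bar>FK \<alpha> (t + r) (?g r) x\<bar> \<le> exp (K * (t + s)) * (K * C)" .
    qed
    have i2: "set_integrable lborel {0..s} (\<lambda>r. FK \<alpha> t (FK \<alpha> r (?g r)) x)"
    proof (rule set_integrable_bounded_interval)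
      show "(\<lambda>r. FK \<alpha> t (FK \<alpha> r (?g r)) x) \<in> borel_measurable borel" by measurable
      show "\<bar>FK \<alpha> t (FK \<alpha> r (?g r)) x\<bar> \<le> exp (K * t) * (exp (K * s) * (K * C))" if "r \<in> {0..s}" for r
        using t by (intro FK_bound K Fb that) auto
    qed
    show ?thesis
      unfolding D_def 2 FK_duhamel[OF \<alpha> f K C t(1) s, of x] using set_integral_diff(2)[OF i1 i2] by simp
  qed
  have bd: "\<bar>D s' f\<bar> \<le> M * C * (K * s') ^ n / fact n"
    if "f \<in> borel_measurable N" "\<And>y. \<bar>f y\<bar> \<le> C" "0 \<le> s'" "s' \<le> s" for f C s' n
    using that
  proof (induction n arbitrary: f C s')
    case 0
    note [measurable] = 0(1)
    have C0: "0 \<le> C" using order_trans[OF abs_ge_zero 0(2)] .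
    have a: "\<bar>FK \<alpha> (t + s') f x\<bar> \<le> exp (K * (t + s')) * C" using 0 t by (intro FK_bound K) auto
    have b: "\<bar>FK \<alpha> t (FK \<alpha> s' f) x\<bar> \<le> exp (K * t) * (exp (K * s') * C)" using 0 t by (intro FK_bound K) auto
    have e: "exp (K * t) * (exp (K * s') * C) = exp (K * (t + s')) * C" by (simp add: exp_add distrib_left)
    have "exp (K * (t + s')) * C \<le> exp (K * (t + s)) * C" using 0 K0 C0 by (intro mult_right_mono) (auto intro: mult_left_mono)
    then show ?case using a b unfolding e D_def M_def by simp
  next
    case (Suc n)
    note [measurable] = Suc.prems(1)
    have C0: "0 \<le> C" using order_trans[OF abs_ge_zero Suc.prems(2)] .
    have "\<bar>D s' f\<bar> = \<bar>LINT r:{0..s'}|lborel. D r (\<lambda>y. \<alpha> y * trans (s' - r) f y)\<bar>"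
      by (subst rec[OF Suc.prems(1-3)]) simp
    also have "\<dots> \<le> (LINT r:{0..s'}|lborel. (M * (K * C) * K ^ n / fact n) * r ^ n)"
    proof (rule abs_interval_integral_le')
      show "set_integrable lborel {0..s'} (\<lambda>r. (M * (K * C) * K ^ n / fact n) * r ^ n)"
        unfolding set_integrable_def
        by (rule borel_integrable_compact[of "{0..s'}", unfolded if_distrib if_distribR, simplified]) (auto intro!: continuous_intros)
      fix r assume r: "r \<in> {0..s'}"
      have "\<bar>D r (\<lambda>y. \<alpha> y * trans (s' - r) f y)\<bar> \<le> M * (K * C) * (K * r) ^ n / fact n"
      proof (rule Suc.IH)
        show "\<bar>\<alpha> y * trans (s' - r) f y\<bar> \<le> K * C" for y
          unfolding abs_mult using K trans_bound[OF Suc.prems(1,2), of "s' - r" y] r K0 by (intro mult_mono) auto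
      qed (use r Suc.prems in auto)
      then show "\<bar>D r (\<lambda>y. \<alpha> y * trans (s' - r) f y)\<bar> \<le> (M * (K * C) * K ^ n / fact n) * r ^ n"
        by (simp add: power_mult_distrib mult_ac)
    qed
    also have "\<dots> = (M * (K * C) * K ^ n / fact n) * (s' ^ Suc n / Suc n)"
      using integral_power[of 0 s' n] Suc.prems(3) by (simp add: set_lebesgue_integral_def mult_ac)
    also have "\<dots> = M * C * (K * s') ^ Suc n / fact (Suc n)"
      by (simp add: power_mult_distrib field_simps)
    finally show ?case .
  qed
  have "(\<lambda>n. M * C * (inverse (fact n) * (K * s) ^ n)) \<longlonglongrightarrow> M * C * 0"
    by (intro tendsto_intros summable_LIMSEQ_zero[OF summable_exp])
  then have "(\<lambda>n. M * C * (K * s) ^ n / fact n) \<longlonglongrightarrow> 0" by (simp add: divide_inverse mult_ac)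
  then have "\<bar>D s f\<bar> \<le> 0" using bd[OF f C t(2)] by (intro LIMSEQ_le_const[where X="\<lambda>n. M * C * (K * s) ^ n / fact n"]) auto
  then show ?thesis by (simp add: D_def)
qed

section \<open>Mild equations and change of semigroup\<close>

text \<open>
  The contribution of a time-dependent source \<open>G\<close> to the solution of a linear evolution equation.
\<close>

definition resolv :: "('s \<Rightarrow> real) \<Rightarrow> (real \<Rightarrow> 's \<Rightarrow> real) \<Rightarrow> real \<Rightarrow> 's \<Rightarrow> real" where
  "resolv \<alpha> G t x = (LINT s:{0..t}|lborel. FK \<alpha> s (G (t - s)) x)"

lemma resolv_measurable [measurable (raw)]:
  assumes [measurable]: "\<alpha> \<in> borel_measurable N" "(\<lambda>(s, y). G s y) \<in> borel_measurable (borel \<Otimes>\<^sub>M N)"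
    "\<tau> \<in> borel_measurable M" "\<zeta> \<in> M \<rightarrow>\<^sub>M N"
  shows "(\<lambda>p. resolv \<alpha> G (\<tau> p) (\<zeta> p)) \<in> borel_measurable M"
  unfolding resolv_def by measurable

lemma FK_time_measurable:
  assumes [measurable]: "\<alpha> \<in> borel_measurable N" "(\<lambda>(s, y). G s y) \<in> borel_measurable (borel \<Otimes>\<^sub>M N)"
  shows "(\<lambda>s. FK \<alpha> s (G (T - s)) x) \<in> borel_measurable borel"
  by measurable

lemma FK_time_bound:
  assumes [measurable]: "\<alpha> \<in> borel_measurable N" "(\<lambda>(s, y). G s y) \<in> borel_measurable (borel \<Otimes>\<^sub>M N)"
    and K: "\<And>y. \<bar>\<alpha> y\<bar> \<le> K" and C: "\<And>s y. 0 \<le> s \<Longrightarrow> s \<le> T \<Longrightarrow> \<bar>G s y\<bar> \<le> C" and s: "0 \<le> s" "s \<le> t" "t \<le> T"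
  shows "\<bar>FK \<alpha> s (G (t - s)) x\<bar> \<le> exp (K * T) * C"
proof -
  have K0: "0 \<le> K" using order_trans[OF abs_ge_zero K] .
  have C0: "0 \<le> C" using order_trans[OF abs_ge_zero C[of T]] s by auto
  have [measurable]: "G r \<in> borel_measurable N" for r using assms(2) by simp
  have "\<bar>FK \<alpha> s (G (t - s)) x\<bar> \<le> exp (K * s) * C" using s by (intro FK_bound K C) auto
  also have "\<dots> \<le> exp (K * T) * C" using s K0 C0 by (intro mult_right_mono) (auto intro: mult_left_mono)
  finally show ?thesis .
qed

lemma FK_time_integrable:
  assumes "\<alpha> \<in> borel_measurable N" "(\<lambda>(s, y). G s y) \<in> borel_measurable (borel \<Otimes>\<^sub>M N)"
    and K: "\<And>y. \<bar>\<alpha> y\<bar> \<le> K" and C: "\<And>s y. 0 \<le> s \<Longrightarrow> s \<le> T \<Longrightarrow> \<bar>G s y\<bar> \<le> C" and t: "t \<le> T"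
  shows "set_integrable lborel {0..t} (\<lambda>s. FK \<alpha> s (G (t - s)) x)"
  using FK_time_bound[OF assms(1,2) K C _ _ t] FK_time_measurable[OF assms(1,2)]
  by (intro set_integrable_bounded_interval) auto

lemma resolv_bound:
  assumes "\<alpha> \<in> borel_measurable N" "(\<lambda>(s, y). G s y) \<in> borel_measurable (borel \<Otimes>\<^sub>M N)"
    and K: "\<And>y. \<bar>\<alpha> y\<bar> \<le> K" and C: "\<And>s y. 0 \<le> s \<Longrightarrow> s \<le> T \<Longrightarrow> \<bar>G s y\<bar> \<le> C" and t: "0 \<le> t" "t \<le> T"
  shows "\<bar>resolv \<alpha> G t x\<bar> \<le> exp (K * T) * C * T"
proof -
  have C0: "0 \<le> C" using order_trans[OF abs_ge_zero C[of T]] t by auto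
  have "\<bar>resolv \<alpha> G t x\<bar> \<le> (exp (K * T) * C) * (t - 0)" unfolding resolv_def
    using FK_time_bound[OF assms(1,2) K C _ _ t(2)] t C0 by (intro abs_interval_integral_le) auto
  also have "\<dots> \<le> exp (K * T) * C * T" using t C0 by (intro mult_left_mono) auto
  finally show ?thesis .
qed

lemma resolv_diff:
  assumes [measurable]: "\<alpha> \<in> borel_measurable N" "(\<lambda>(s, y). G s y) \<in> borel_measurable (borel \<Otimes>\<^sub>M N)"
    "(\<lambda>(s, y). H s y) \<in> borel_measurable (borel \<Otimes>\<^sub>M N)"
    and K: "\<And>y. \<bar>\<alpha> y\<bar> \<le> K" and C: "\<And>s y. 0 \<le> s \<Longrightarrow> s \<le> T \<Longrightarrow> \<bar>G s y\<bar> \<le> C"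
    and D: "\<And>s y. 0 \<le> s \<Longrightarrow> s \<le> T \<Longrightarrow> \<bar>H s y\<bar> \<le> D"
  shows "resolv \<alpha> (\<lambda>s y. G s y - H s y) T x = resolv \<alpha> G T x - resolv \<alpha> H T x"
proof -
  have [measurable]: "G r \<in> borel_measurable N" "H r \<in> borel_measurable N" for r using assms(2,3) by simp_all
  have "resolv \<alpha> (\<lambda>s y. G s y - H s y) T x = (LINT s:{0..T}|lborel. FK \<alpha> s (G (T - s)) x - FK \<alpha> s (H (T - s)) x)"
    unfolding resolv_def by (intro set_lebesgue_integral_cong) (auto intro!: FK_linear(2) K C D)
  also have "\<dots> = resolv \<alpha> G T x - resolv \<alpha> H T x"
    unfolding resolv_def using FK_time_integrable[OF assms(1,2) K C order_refl] FK_time_integrable[OF assms(1,3) K D order_refl]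
    by (intro set_integral_diff) auto
  finally show ?thesis .
qed

lemma resolv_cong:
  assumes "\<And>s y. 0 \<le> s \<Longrightarrow> s \<le> T \<Longrightarrow> G s y = H s y"
  shows "resolv \<alpha> G T x = resolv \<alpha> H T x"
proof -
  have "G s = H s" if "0 \<le> s" "s \<le> T" for s using assms[OF that] by (intro ext)
  then show ?thesis unfolding resolv_def by (intro set_lebesgue_integral_cong) auto
qed

text \<open>
  Duhamel's formula for each source time, integrated over source times; the order of the two time integrals is exchanged
  on the triangle.
\<close>

lemma resolvent_identity:
  assumes \<alpha>[measurable]: "\<alpha> \<in> borel_measurable N" and G[measurable]: "(\<lambda>(s, y). G s y) \<in> borel_measurable (borel \<Otimes>\<^sub>M N)"
    and K: "\<And>y. \<bar>\<alpha> y\<bar> \<le> K" and C: "\<And>s y. 0 \<le> s \<Longrightarrow> s \<le> T \<Longrightarrow> \<bar>G s y\<bar> \<le> C" and T: "0 \<le> T"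
  shows "resolv \<alpha> G T x = resolv (\<lambda>_. 0) G T x + resolv \<alpha> (\<lambda>s y. \<alpha> y * resolv (\<lambda>_. 0) G s y) T x"
proof -
  have K0: "0 \<le> K" using order_trans[OF abs_ge_zero K] .
  have C0: "0 \<le> C" using order_trans[OF abs_ge_zero C[of T]] T by auto
  have [measurable]: "G r \<in> borel_measurable N" for r using assms(2) by simp
  define h where "h r v = FK \<alpha> r (\<lambda>y. \<alpha> y * trans v (G (T - r - v)) y) x" for r v
  have hm[measurable]: "(\<lambda>(r, v). h r v) \<in> borel_measurable (borel \<Otimes>\<^sub>M borel)"
    unfolding h_def by measurable
  have gb: "\<bar>\<alpha> y * trans v (G (T - r - v)) y\<bar> \<le> K * C" if "0 \<le> r" "0 \<le> v" "r + v \<le> T" for r v y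
    unfolding abs_mult using K trans_bound[of "G (T - r - v)" C v y] C that K0 by (intro mult_mono) auto
  have hb: "\<bar>h r v\<bar> \<le> exp (K * T) * (K * C)" if rv: "0 \<le> r" "0 \<le> v" "r + v \<le> T" for r v
  proof -
    have "\<bar>h r v\<bar> \<le> exp (K * r) * (K * C)" unfolding h_def using rv gb by (intro FK_bound K) auto
    also have "\<dots> \<le> exp (K * T) * (K * C)" using rv K0 C0 by (intro mult_right_mono) (auto intro: mult_left_mono)
    finally show ?thesis .
  qed
  have 1: "FK \<alpha> s (G (T - s)) x = trans s (G (T - s)) x + (LINT r:{0..s}|lborel. h r (s - r))" if s: "s \<in> {0..T}" for s
    using FK_duhamel[where f="G (T - s)" and t=0 and s=s and x=x, OF \<alpha> _ K C order_refl] s by (simp add: FK_zero h_def)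
  have i2: "set_integrable lborel {0..T} (\<lambda>s. LINT r:{0..s}|lborel. h r (s - r))"
  proof (rule set_integrable_bounded_interval)
    show "(\<lambda>s. LINT r:{0..s}|lborel. h r (s - r)) \<in> borel_measurable borel" by measurable
    show "\<bar>LINT r:{0..s}|lborel. h r (s - r)\<bar> \<le> exp (K * T) * (K * C) * T" if s: "s \<in> {0..T}" for s
    proof -
      have "\<bar>LINT r:{0..s}|lborel. h r (s - r)\<bar> \<le> (exp (K * T) * (K * C)) * (s - 0)"
        using s hb K0 C0 by (intro abs_interval_integral_le) auto
      also have "\<dots> \<le> exp (K * T) * (K * C) * T" using s K0 C0 by (intro mult_left_mono) auto
      finally show ?thesis .
    qed
  qed
  have "resolv \<alpha> G T x = (LINT s:{0..T}|lborel. trans s (G (T - s)) x + (LINT r:{0..s}|lborel. h r (s - r)))"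
    unfolding resolv_def using 1 by (intro set_lebesgue_integral_cong) auto
  also have "\<dots> = resolv (\<lambda>_. 0) G T x + (LINT s:{0..T}|lborel. LINT r:{0..s}|lborel. h r (s - r))"
    unfolding resolv_def using FK_time_integrable[where \<alpha>="\<lambda>_. 0" and K=0 and x=x, OF _ G _ C order_refl] i2
    by (intro set_integral_add) auto
  also have "(LINT s:{0..T}|lborel. LINT r:{0..s}|lborel. h r (s - r)) = (LINT r:{0..T}|lborel. LINT v:{0..T-r}|lborel. h r v)"
    by (rule triangle_fubini[OF hm hb])
  also have "\<dots> = resolv \<alpha> (\<lambda>s y. \<alpha> y * resolv (\<lambda>_. 0) G s y) T x"
  proof -
    have "(LINT v:{0..T-r}|lborel. h r v) = FK \<alpha> r (\<lambda>y. \<alpha> y * resolv (\<lambda>_. 0) G (T - r) y) x" if r: "r \<in> {0..T}" for r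
    proof -
      have "(LINT v:{0..T-r}|lborel. h r v) = FK \<alpha> r (\<lambda>y. LINT v:{0..T-r}|lborel. \<alpha> y * trans v (G (T - r - v)) y) x"
        unfolding h_def
      proof (rule FK_time_integral[where C="K * C", OF \<alpha> _ K, symmetric])
        show "(\<lambda>(v, y). \<alpha> y * trans v (G (T - r - v)) y) \<in> borel_measurable (borel \<Otimes>\<^sub>M N)" by measurable
      qed (use r gb in auto)
      then show ?thesis by (simp add: resolv_def)
    qed
    then show ?thesis unfolding resolv_def[of \<alpha>] by (intro set_lebesgue_integral_cong) auto
  qed
  finally show ?thesis .
qed

text \<open>
  Variation of constants: the bounded linear term \<open>\<alpha> * w\<close> of the equation may be absorbed into the semigroup.
\<close>

lemma mild_change_of_semigroup:
  assumes \<alpha>[measurable]: "\<alpha> \<in> borel_measurable N" and f[measurable]: "f \<in> borel_measurable N"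
    and w[measurable]: "(\<lambda>(s, y). w s y) \<in> borel_measurable (borel \<Otimes>\<^sub>M N)"
    and g[measurable]: "(\<lambda>(s, y). g s y) \<in> borel_measurable (borel \<Otimes>\<^sub>M N)"
    and K: "\<And>y. \<bar>\<alpha> y\<bar> \<le> K" and Cf: "\<And>y. \<bar>f y\<bar> \<le> Cf"
    and Cw: "\<And>s y. 0 \<le> s \<Longrightarrow> s \<le> T \<Longrightarrow> \<bar>w s y\<bar> \<le> Cw"
    and Cg: "\<And>s y. 0 \<le> s \<Longrightarrow> s \<le> T \<Longrightarrow> \<bar>g s y\<bar> \<le> Cg"
    and T: "0 \<le> T"
    and eq: "\<And>t y. 0 \<le> t \<Longrightarrow> t \<le> T \<Longrightarrow> w t y = trans t f y + resolv (\<lambda>_. 0) (\<lambda>s y. \<alpha> y * w s y - g s y) t y"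
  shows "w T x = FK \<alpha> T f x - resolv \<alpha> g T x"
proof -
  have K0: "0 \<le> K" using order_trans[OF abs_ge_zero K] .
  let ?h = "\<lambda>s y. \<alpha> y * w s y - g s y"
  have awb: "\<bar>\<alpha> y * w s y\<bar> \<le> K * Cw" if "0 \<le> s" "s \<le> T" for s y
    unfolding abs_mult using K Cw[OF that] K0 by (intro mult_mono) auto
  have hb: "\<bar>?h s y\<bar> \<le> K * Cw + Cg" if "0 \<le> s" "s \<le> T" for s y
    using awb[OF that, of y] Cg[OF that, of y] by linarith
  have afb: "\<bar>\<alpha> y * trans s f y\<bar> \<le> K * Cf" if "0 \<le> s" for s y
    unfolding abs_mult using K trans_bound[OF f Cf that] K0 by (intro mult_mono) auto
  have 1: "resolv \<alpha> ?h T x = resolv (\<lambda>_. 0) ?h T x + resolv \<alpha> (\<lambda>s y. \<alpha> y * resolv (\<lambda>_. 0) ?h s y) T x"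
    by (rule resolvent_identity[OF \<alpha> _ K hb T]) measurable
  have "resolv \<alpha> (\<lambda>s y. \<alpha> y * resolv (\<lambda>_. 0) ?h s y) T x = resolv \<alpha> (\<lambda>s y. \<alpha> y * w s y - \<alpha> y * trans s f y) T x"
    using eq by (intro resolv_cong) (simp add: algebra_simps)
  also have "\<dots> = resolv \<alpha> (\<lambda>s y. \<alpha> y * w s y) T x - resolv \<alpha> (\<lambda>s y. \<alpha> y * trans s f y) T x"
    by (rule resolv_diff[OF \<alpha> _ _ K awb afb]) measurable
  also have "resolv \<alpha> (\<lambda>s y. \<alpha> y * trans s f y) T x = FK \<alpha> T f x - trans T f x"
    using FK_duhamel[OF \<alpha> f K Cf order_refl T, of x] by (simp add: FK_zero resolv_def)
  finally have 2: "resolv \<alpha> (\<lambda>s y. \<alpha> y * resolv (\<lambda>_. 0) ?h s y) T x = resolv \<alpha> (\<lambda>s y. \<alpha> y * w s y) T x - (FK \<alpha> T f x - trans T f x)" .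
  have 3: "resolv \<alpha> ?h T x = resolv \<alpha> (\<lambda>s y. \<alpha> y * w s y) T x - resolv \<alpha> g T x"
    by (rule resolv_diff[OF \<alpha> _ g K awb Cg]) measurable
  show ?thesis using 1 2 3 eq[OF T order_refl, of x] by linarith
qed

text \<open>
  Restarting the equation at time \<open>r\<close> with initial value \<open>w r\<close>.
\<close>

lemma mild_flow:
  assumes \<alpha>[measurable]: "\<alpha> \<in> borel_measurable N" and f[measurable]: "f \<in> borel_measurable N"
    and g[measurable]: "(\<lambda>(s, y). g s y) \<in> borel_measurable (borel \<Otimes>\<^sub>M N)"
    and K: "\<And>y. \<bar>\<alpha> y\<bar> \<le> K" and Cf: "\<And>y. \<bar>f y\<bar> \<le> Cf"
    and Cg: "\<And>s y. 0 \<le> s \<Longrightarrow> s \<le> r + t \<Longrightarrow> \<bar>g s y\<bar> \<le> Cg"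
    and T: "0 \<le> r" "0 \<le> t"
    and eq: "\<And>t' y. 0 \<le> t' \<Longrightarrow> t' \<le> r + t \<Longrightarrow> w t' y = FK \<alpha> t' f y - resolv \<alpha> g t' y"
  shows "w (r + t) x = FK \<alpha> t (w r) x - (LINT s:{0..t}|lborel. FK \<alpha> s (g (r + t - s)) x)"
proof -
  have [measurable]: "g s \<in> borel_measurable N" for s using g by simp
  have wr: "w r = (\<lambda>y. FK \<alpha> r f y - resolv \<alpha> g r y)" using eq[of r] T by (intro ext) auto
  have rt: "r \<le> r + t" "0 \<le> r + t" using T by auto
  have "FK \<alpha> t (w r) x = FK \<alpha> t (FK \<alpha> r f) x - FK \<alpha> t (resolv \<alpha> g r) x"
    unfolding wr
  proof (rule FK_linear(2)[OF \<alpha> _ _ K _ _ T(2)])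
    show "\<bar>FK \<alpha> r f y\<bar> \<le> exp (K * r) * Cf" for y using T by (intro FK_bound K Cf) auto
    show "\<bar>resolv \<alpha> g r y\<bar> \<le> exp (K * (r + t)) * Cg * (r + t)" for y by (rule resolv_bound[OF \<alpha> g K Cg T(1) rt(1)])
  qed measurable
  also have "FK \<alpha> t (FK \<alpha> r f) x = FK \<alpha> (r + t) f x"
    using FK_semigroup[OF \<alpha> f K Cf T(2,1)] by (simp add: add.commute)
  also have "FK \<alpha> t (resolv \<alpha> g r) x = (LINT s:{0..r}|lborel. FK \<alpha> t (FK \<alpha> s (g (r - s))) x)"
    unfolding resolv_def[abs_def]
  proof (rule FK_time_integral[OF \<alpha> _ K _ T(2)])
    show "\<bar>FK \<alpha> s (g (r - s)) y\<bar> \<le> exp (K * (r + t)) * Cg" if "s \<in> {0..r}" for s y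
      using that T by (intro FK_time_bound[OF \<alpha> g K Cg]) auto
  qed measurable
  also have "\<dots> = (LINT s:{0..r}|lborel. FK \<alpha> (t + s) (g (r + t - (t + s))) x)"
  proof (rule set_lebesgue_integral_cong; (intro allI impI)?)
    fix s assume s: "s \<in> {0..r}"
    have "FK \<alpha> (t + s) (g (r - s)) x = FK \<alpha> t (FK \<alpha> s (g (r - s))) x"
      by (rule FK_semigroup[OF \<alpha> _ K Cg T(2)]) (use s T in auto)
    then show "FK \<alpha> t (FK \<alpha> s (g (r - s))) x = FK \<alpha> (t + s) (g (r + t - (t + s))) x" by simp
  qed simp
  also have "\<dots> = (LINT s:{t..t+r}|lborel. FK \<alpha> s (g (r + t - s)) x)"
    by (rule interval_integral_shift[symmetric])
  finally have 1: "FK \<alpha> t (w r) x = FK \<alpha> (r + t) f x - (LINT s:{t..t+r}|lborel. FK \<alpha> s (g (r + t - s)) x)" .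
  have 2: "(LINT s:{0..t}|lborel. FK \<alpha> s (g (r + t - s)) x) + (LINT s:{t..t+r}|lborel. FK \<alpha> s (g (r + t - s)) x) = resolv \<alpha> g (r + t) x"
    unfolding resolv_def using interval_integral_combine[OF FK_time_integrable[where x=x and t="r + t" and T="r + t", OF \<alpha> g K Cg order_refl], of t] T
    by (simp add: add.commute)
  show ?thesis using 1 2 eq[OF rt(2) order_refl, of x] by linarith
qed

end

section \<open>Integral kernels and their generators\<close>

text \<open>
  Nonnegative integrals avoid integrability conditions for functions in \<open>L\<^sup>2\<close> and for weights without bounds.
\<close>

definition kop :: "'a measure \<Rightarrow> ('a \<Rightarrow> 'a \<Rightarrow> real) \<Rightarrow> ('a \<Rightarrow> ennreal) \<Rightarrow> 'a \<Rightarrow> ennreal" where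
  "kop m k f x = (\<integral>\<^sup>+y. ennreal (k x y) * f y \<partial>m)"

lemma kop_measurable [measurable (raw)]:
  assumes "sigma_finite_measure m" and [measurable]: "(\<lambda>(x, y). k x y) \<in> borel_measurable (m \<Otimes>\<^sub>M m)" "f \<in> borel_measurable m"
  shows "kop m k f \<in> borel_measurable m"
proof -
  interpret sigma_finite_measure m by fact
  show ?thesis unfolding kop_def by measurable
qed

lemma measurable_row:
  assumes "(\<lambda>(x, y). k x y) \<in> borel_measurable (m \<Otimes>\<^sub>M m)" "x \<in> space m"
  shows "(\<lambda>y. k x y) \<in> borel_measurable m"
  using measurable_compose[OF measurable_Pair1'[OF assms(2)] assms(1)] by simp

lemma measurable_col:
  assumes "(\<lambda>(x, y). k x y) \<in> borel_measurable (m \<Otimes>\<^sub>M m)" "y \<in> space m"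
  shows "(\<lambda>x. k x y) \<in> borel_measurable m"
  using measurable_compose[OF measurable_Pair2'[OF assms(2)] assms(1)] by simp

lemma kop_adjoint:
  assumes "sigma_finite_measure m" and [measurable]: "(\<lambda>(x, y). k x y) \<in> borel_measurable (m \<Otimes>\<^sub>M m)"
    "f \<in> borel_measurable m" "g \<in> borel_measurable m"
  shows "(\<integral>\<^sup>+x. g x * kop m k f x \<partial>m) = (\<integral>\<^sup>+y. f y * kop m (\<lambda>y x. k x y) g y \<partial>m)"
proof -
  interpret m: sigma_finite_measure m by fact
  interpret pair_sigma_finite m m ..
  have "(\<integral>\<^sup>+x. g x * kop m k f x \<partial>m) = (\<integral>\<^sup>+x. (\<integral>\<^sup>+y. g x * (ennreal (k x y) * f y) \<partial>m) \<partial>m)"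
    unfolding kop_def using measurable_row[OF assms(2)]
    by (intro nn_integral_cong nn_integral_cmult[symmetric]) auto
  also have "\<dots> = (\<integral>\<^sup>+y. (\<integral>\<^sup>+x. g x * (ennreal (k x y) * f y) \<partial>m) \<partial>m)"
    by (rule Fubini') measurable
  also have "\<dots> = (\<integral>\<^sup>+y. (\<integral>\<^sup>+x. f y * (ennreal (k x y) * g x) \<partial>m) \<partial>m)"
    by (simp add: mult_ac)
  also have "\<dots> = (\<integral>\<^sup>+y. f y * kop m (\<lambda>y x. k x y) g y \<partial>m)"
    unfolding kop_def using measurable_col[OF assms(2)]
    by (intro nn_integral_cong nn_integral_cmult) auto
  finally show ?thesis .
qed

text \<open>
  Uniqueness of densities.
\<close>

lemma AE_eq_of_set_integrals:
  fixes f g :: "'a \<Rightarrow> ennreal"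
  assumes "sigma_finite_measure m" and [measurable]: "f \<in> borel_measurable m" "g \<in> borel_measurable m"
    and eq: "\<And>B. B \<in> sets m \<Longrightarrow> (\<integral>\<^sup>+x. f x * indicator B x \<partial>m) = (\<integral>\<^sup>+x. g x * indicator B x \<partial>m)"
  shows "AE x in m. f x = g x"
proof -
  interpret sigma_finite_measure m by fact
  have "density m f = density m g"
    by (rule measure_eqI) (auto simp: emeasure_density eq)
  then show ?thesis by (rule density_unique[OF assms(2,3)])
qed

lemma young_with_parameter:
  fixes a b :: real
  assumes \<delta>: "0 < \<delta>" and ab: "0 \<le> a" "0 \<le> b"
  shows "a * b \<le> \<delta> * a\<^sup>2 + 1 / \<delta> * b\<^sup>2"
proof -
  have "0 \<le> (\<delta> * a - b)\<^sup>2 + \<delta> * (a * b)" using ab \<delta> by simp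
  then have "\<delta> * (a * b) \<le> \<delta> * (\<delta> * a\<^sup>2 + 1 / \<delta> * b\<^sup>2)" using \<delta> by (simp add: power2_eq_square algebra_simps)
  then show ?thesis using \<delta> by simp
qed

text \<open>
  The semigroup identity is demanded only almost everywhere, because for the transposed kernel it is obtained by duality.
\<close>

locale kernel_semigroup =
  fixes m :: "'a measure" and k :: "real \<Rightarrow> 'a \<Rightarrow> 'a \<Rightarrow> real" and K :: real
  assumes sigma: "sigma_finite_measure m"
    and k_meas: "0 < t \<Longrightarrow> (\<lambda>(x, y). k t x y) \<in> borel_measurable (m \<Otimes>\<^sub>M m)"
    and k_nonneg: "0 < t \<Longrightarrow> 0 \<le> k t x y" and K_nonneg: "0 \<le> K"
    and row: "0 < t \<Longrightarrow> (\<integral>\<^sup>+y. ennreal (k t x y) \<partial>m) \<le> ennreal (exp (K * t))"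
    and col: "0 < t \<Longrightarrow> (\<integral>\<^sup>+x. ennreal (k t x y) \<partial>m) \<le> ennreal (exp (K * t))"
    and ae_semigroup: "0 < s \<Longrightarrow> 0 < t \<Longrightarrow> f \<in> borel_measurable m \<Longrightarrow>
       AE x in m. kop m (k (s + t)) f x = kop m (k s) (kop m (k t) f) x"
begin

lemma kop_meas: "0 < t \<Longrightarrow> f \<in> borel_measurable m \<Longrightarrow> kop m (k t) f \<in> borel_measurable m"
  by (rule kop_measurable[OF sigma k_meas])

lemma kop_mono_AE: "AE y in m. f y \<le> g y \<Longrightarrow> kop m (k t) f x \<le> kop m (k t) g x"
  unfolding kop_def by (intro nn_integral_mono_AE) (auto elim!: eventually_mono intro!: mult_left_mono)

lemma kop_lin:
  assumes "0 < t" "f \<in> borel_measurable m" "g \<in> borel_measurable m" "x \<in> space m"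
  shows "kop m (k t) (\<lambda>y. a * f y + b * g y) x = a * kop m (k t) f x + b * kop m (k t) g x"
proof -
  note [measurable] = measurable_row[OF k_meas[OF assms(1)] assms(4)] assms(2,3)
  have "kop m (k t) (\<lambda>y. a * f y + b * g y) x = (\<integral>\<^sup>+y. a * (ennreal (k t x y) * f y) + b * (ennreal (k t x y) * g y) \<partial>m)"
    unfolding kop_def by (simp add: distrib_left mult_ac)
  also have "\<dots> = a * kop m (k t) f x + b * kop m (k t) g x"
    unfolding kop_def by (subst nn_integral_add) (auto simp: nn_integral_cmult)
  finally show ?thesis .
qed

text \<open>
  The Schur test in bilinear form. Young's inequality with parameter \<open>\<delta>\<close> takes the place of the Cauchy-Schwarz inequality, so that both
  integrals on the right may be treated separately.
\<close>

lemma schur_pairing: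
  fixes g D :: "'a \<Rightarrow> real"
  assumes t: "0 < t" "t \<le> T" and [measurable]: "g \<in> borel_measurable m" "D \<in> borel_measurable m" and \<delta>: "0 < \<delta>"
    and pos: "\<And>x. 0 \<le> g x" "\<And>x. 0 \<le> D x"
  shows "(\<integral>\<^sup>+x. ennreal (g x) * kop m (k t) (\<lambda>y. ennreal (D y)) x \<partial>m)
    \<le> ennreal (exp (K * T)) * (ennreal \<delta> * (\<integral>\<^sup>+x. ennreal ((g x)\<^sup>2) \<partial>m) + ennreal (1 / \<delta>) * (\<integral>\<^sup>+x. ennreal ((D x)\<^sup>2) \<partial>m))"
proof -
  interpret m: sigma_finite_measure m by (rule sigma)
  interpret pair_sigma_finite m m ..
  note km[measurable] = k_meas[OF t(1)]
  have kr: "(\<lambda>y. k t x y) \<in> borel_measurable m" if "x \<in> space m" for x using measurable_row[OF km that] .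
  have kc: "(\<lambda>x. k t x y) \<in> borel_measurable m" if "y \<in> space m" for y using measurable_col[OF km that] .
  define e where "e = 1 / \<delta>"
  have e: "0 < e" "\<delta> * e = 1" using \<delta> by (auto simp: e_def)
  have young: "a * b \<le> \<delta> * a\<^sup>2 + e * b\<^sup>2" if "0 \<le> a" "0 \<le> b" for a b :: real
    using young_with_parameter[OF \<delta> that] by (simp add: e_def)
  have "(\<integral>\<^sup>+x. ennreal (g x) * kop m (k t) (\<lambda>y. ennreal (D y)) x \<partial>m) = (\<integral>\<^sup>+x. (\<integral>\<^sup>+y. ennreal (g x) * (ennreal (k t x y) * ennreal (D y)) \<partial>m) \<partial>m)"
    unfolding kop_def using kr by (intro nn_integral_cong nn_integral_cmult[symmetric]) auto
  also have "\<dots> \<le> (\<integral>\<^sup>+x. (\<integral>\<^sup>+y. ennreal \<delta> * ennreal ((g x)\<^sup>2) * ennreal (k t x y) + ennreal (k t x y) * (ennreal (e) * ennreal ((D y)\<^sup>2)) \<partial>m) \<partial>m)"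
  proof (intro nn_integral_mono)
    fix x y
    have "g x * D y * k t x y \<le> (\<delta> * (g x)\<^sup>2 + e * (D y)\<^sup>2) * k t x y"
      using young[OF pos(1)[of x] pos(2)[of y]] k_nonneg[OF t(1), of x y] by (intro mult_right_mono)
    then have "ennreal (g x * (k t x y * D y)) \<le> ennreal (\<delta> * (g x)\<^sup>2 * k t x y + k t x y * (e * (D y)\<^sup>2))"
      by (intro ennreal_leI) (simp add: algebra_simps)
    also have "\<dots> = ennreal \<delta> * ennreal ((g x)\<^sup>2) * ennreal (k t x y) + ennreal (k t x y) * (ennreal (e) * ennreal ((D y)\<^sup>2))"
      using \<delta> e k_nonneg[OF t(1), of x y] by (subst ennreal_plus) (auto simp: ennreal_mult)
    finally show "ennreal (g x) * (ennreal (k t x y) * ennreal (D y)) \<le> \<dots>"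
      using pos k_nonneg[OF t(1), of x y] by (simp add: ennreal_mult)
  qed
  also have "\<dots> = (\<integral>\<^sup>+x. (\<integral>\<^sup>+y. ennreal \<delta> * ennreal ((g x)\<^sup>2) * ennreal (k t x y) \<partial>m) + (\<integral>\<^sup>+y. ennreal (k t x y) * (ennreal (e) * ennreal ((D y)\<^sup>2)) \<partial>m) \<partial>m)"
    using kr by (intro nn_integral_cong nn_integral_add) auto
  also have "\<dots> = (\<integral>\<^sup>+x. (\<integral>\<^sup>+y. ennreal \<delta> * ennreal ((g x)\<^sup>2) * ennreal (k t x y) \<partial>m) \<partial>m) + (\<integral>\<^sup>+x. (\<integral>\<^sup>+y. ennreal (k t x y) * (ennreal (e) * ennreal ((D y)\<^sup>2)) \<partial>m) \<partial>m)"
    by (rule nn_integral_add) measurable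
  also have "(\<integral>\<^sup>+x. (\<integral>\<^sup>+y. ennreal \<delta> * ennreal ((g x)\<^sup>2) * ennreal (k t x y) \<partial>m) \<partial>m) = (\<integral>\<^sup>+x. ennreal \<delta> * ennreal ((g x)\<^sup>2) * (\<integral>\<^sup>+y. ennreal (k t x y) \<partial>m) \<partial>m)"
    using kr by (intro nn_integral_cong nn_integral_cmult) auto
  also have "(\<integral>\<^sup>+x. (\<integral>\<^sup>+y. ennreal (k t x y) * (ennreal (e) * ennreal ((D y)\<^sup>2)) \<partial>m) \<partial>m) = (\<integral>\<^sup>+y. (\<integral>\<^sup>+x. ennreal (k t x y) * (ennreal (e) * ennreal ((D y)\<^sup>2)) \<partial>m) \<partial>m)"
    by (rule Fubini') measurable
  also have "\<dots> = (\<integral>\<^sup>+y. (\<integral>\<^sup>+x. ennreal (k t x y) \<partial>m) * (ennreal (e) * ennreal ((D y)\<^sup>2)) \<partial>m)"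
    using kc by (intro nn_integral_cong nn_integral_multc) auto
  also have "(\<integral>\<^sup>+x. ennreal \<delta> * ennreal ((g x)\<^sup>2) * (\<integral>\<^sup>+y. ennreal (k t x y) \<partial>m) \<partial>m) + \<dots>
     \<le> (\<integral>\<^sup>+x. ennreal \<delta> * ennreal ((g x)\<^sup>2) * ennreal (exp (K * T)) \<partial>m) + (\<integral>\<^sup>+y. ennreal (exp (K * T)) * (ennreal (e) * ennreal ((D y)\<^sup>2)) \<partial>m)"
  proof -
    have "ennreal (exp (K * t)) \<le> ennreal (exp (K * T))" using t K_nonneg by (intro ennreal_leI) (auto intro: mult_left_mono)
    then have "(\<integral>\<^sup>+y. ennreal (k t x y) \<partial>m) \<le> ennreal (exp (K * T))" "(\<integral>\<^sup>+y. ennreal (k t y x) \<partial>m) \<le> ennreal (exp (K * T))" for x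
      using order_trans[OF row[OF t(1), of x]] order_trans[OF col[OF t(1), of x]] by blast+
    then show ?thesis
      by (intro add_mono nn_integral_mono mult_left_mono mult_right_mono) auto
  qed
  also have "\<dots> = ennreal (exp (K * T)) * (ennreal \<delta> * (\<integral>\<^sup>+x. ennreal ((g x)\<^sup>2) \<partial>m) + ennreal (e) * (\<integral>\<^sup>+x. ennreal ((D x)\<^sup>2) \<partial>m))"
    by (simp add: nn_integral_cmult nn_integral_multc distrib_left mult_ac)
  finally show ?thesis unfolding e_def .
qed

lemma kop_finite_AE:
  fixes f :: "'a \<Rightarrow> real"
  assumes t: "0 < t" and [measurable]: "f \<in> borel_measurable m" and f: "\<And>x. 0 \<le> f x" "(\<integral>\<^sup>+x. ennreal ((f x)\<^sup>2) \<partial>m) < \<infinity>"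
  shows "AE x in m. kop m (k t) (\<lambda>y. ennreal (f y)) x < \<infinity>"
proof -
  have [measurable]: "kop m (k t) (\<lambda>y. ennreal ((f y)\<^sup>2)) \<in> borel_measurable m" by (rule kop_meas[OF t]) measurable
  have "(\<integral>\<^sup>+x. 1 * kop m (k t) (\<lambda>y. ennreal ((f y)\<^sup>2)) x \<partial>m) = (\<integral>\<^sup>+y. ennreal ((f y)\<^sup>2) * kop m (\<lambda>y x. k t x y) (\<lambda>_. 1) y \<partial>m)"
    by (rule kop_adjoint[OF sigma k_meas[OF t]]) measurable
  also have "\<dots> \<le> (\<integral>\<^sup>+y. ennreal ((f y)\<^sup>2) * ennreal (exp (K * t)) \<partial>m)"
    using col[OF t] by (intro nn_integral_mono mult_left_mono) (auto simp: kop_def)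
  also have "\<dots> < \<infinity>" using f by (simp add: nn_integral_multc ennreal_mult_less_top)
  finally have "AE x in m. kop m (k t) (\<lambda>y. ennreal ((f y)\<^sup>2)) x \<noteq> \<infinity>" by (intro nn_integral_noteq_infinite) auto
  moreover have "AE x in m. x \<in> space m" by (rule AE_space)
  ultimately show ?thesis
  proof eventually_elim
    case (elim x)
    have "kop m (k t) (\<lambda>y. ennreal (f y)) x \<le> kop m (k t) (\<lambda>y. 1 * 1 + 1 * ennreal ((f y)\<^sup>2)) x"
    proof (rule kop_mono_AE, rule AE_I2)
      fix y
      have "0 \<le> (f y - 1)\<^sup>2 + f y" using f by simp
      then have "f y \<le> 1 + (f y)\<^sup>2" by (simp add: power2_eq_square algebra_simps)
      then have "ennreal (f y) \<le> ennreal (1 + (f y)\<^sup>2)" by (rule ennreal_leI)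
      then show "ennreal (f y) \<le> 1 * 1 + 1 * ennreal ((f y)\<^sup>2)" by (simp add: ennreal_plus)
    qed
    also have "\<dots> = 1 * kop m (k t) (\<lambda>_. 1) x + 1 * kop m (k t) (\<lambda>y. ennreal ((f y)\<^sup>2)) x"
      by (rule kop_lin[OF t _ _ elim(2)]) auto
    also have "\<dots> < \<infinity>" using elim(1) row[OF t, of x] by (auto simp: kop_def less_top[symmetric] top_unique)
    finally show ?case .
  qed
qed

end

lemma L2_realD:
  fixes f :: "'a \<Rightarrow> real"
  assumes "(\<lambda>x. complex_of_real (f x)) \<in> L2 m"
  shows "f \<in> borel_measurable m" "(\<integral>\<^sup>+x. ennreal ((f x)\<^sup>2) \<partial>m) < \<infinity>"
proof -
  have "(\<lambda>x. complex_of_real (f x)) \<in> borel_measurable m" using assms by (simp add: L2_def)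
  then have "(\<lambda>x. Re (complex_of_real (f x))) \<in> borel_measurable m"
    by (rule measurable_compose[OF _ borel_measurable_continuous_onI]) (auto intro: continuous_intros)
  then show "f \<in> borel_measurable m" by simp
  have "integrable m (\<lambda>x. (f x)\<^sup>2)" using assms by (simp add: L2_def)
  from nn_integral_eq_integral[OF this] show "(\<integral>\<^sup>+x. ennreal ((f x)\<^sup>2) \<partial>m) < \<infinity>" by simp
qed

context kernel_semigroup
begin

text \<open>
  The hypothesis concerns only the generator: with \<open>h = t / (n + 1)\<close>, one step of the semigroup maps \<open>f\<close> to
  \<open>(1 + lam h) f\<close> up to an error \<open>h D h\<close>, where \<open>D h\<close> tends to \<open>0\<close> in \<open>L\<^sup>2\<close>. Iterating \<open>n + 1\<close> times gives
  \<open>(1 + lam h) ^ (n + 1) f\<close>, which tends to \<open>exp (lam t) f\<close>, and an accumulated error of size \<open>t\<close> times that of \<open>D h\<close>. The errors are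
  measured by pairing with a fixed \<open>g\<close> in \<open>L\<^sup>2\<close>, where the Schur test controls them uniformly in the number of steps.
\<close>

lemma eigenfunction_pairing:
  fixes f g :: "'a \<Rightarrow> real"
  assumes gen: "(\<lambda>x. complex_of_real (f x), \<lambda>x. complex_of_real lam * complex_of_real (f x)) \<in> L2_generator m k"
    and f0: "\<And>x. 0 \<le> f x" and t: "0 < t"
    and g[measurable]: "g \<in> borel_measurable m" and g0: "\<And>x. 0 \<le> g x" and g2: "(\<integral>\<^sup>+x. ennreal ((g x)\<^sup>2) \<partial>m) < \<infinity>"
  shows "(\<integral>\<^sup>+x. ennreal (g x) * kop m (k t) (\<lambda>y. ennreal (f y)) x \<partial>m) = ennreal (exp (lam * t)) * (\<integral>\<^sup>+x. ennreal (g x) * ennreal (f x) \<partial>m)"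
proof -
  interpret m: sigma_finite_measure m by (rule sigma)
  have L: "(\<lambda>x. complex_of_real (f x)) \<in> L2 m" using gen by (simp add: L2_generator_def)
  note f[measurable] = L2_realD(1)[OF L] and f2 = L2_realD(2)[OF L]
  let ?f = "\<lambda>x. ennreal (f x)" and ?g = "\<lambda>x. ennreal (g x)"
  define G where "G h x = (\<integral>y. k h x y * f y \<partial>m)" for h x
  \<comment> \<open>The defect of the difference quotient, which tends to \<open>0\<close> in \<open>L\<^sup>2\<close> by definition of the generator.\<close>
  define D where "D h x = \<bar>(G h x - f x) / h - lam * f x\<bar>" for h x
  define e where "e h = (\<integral>\<^sup>+x. ennreal ((D h x)\<^sup>2) \<partial>m)" for h
  have Gm: "G h \<in> borel_measurable m" if "0 < h" for h
  proof -
    note [measurable] = k_meas[OF that]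
    show ?thesis unfolding G_def by measurable
  qed
  have Dm: "D h \<in> borel_measurable m" if "0 < h" for h
  proof -
    note [measurable] = Gm[OF that]
    show ?thesis unfolding D_def by measurable
  qed
  have e0: "(e \<longlongrightarrow> 0) (at_right 0)"
  proof -
    have "kernel_op m (k h) (\<lambda>x. complex_of_real (f x)) x = complex_of_real (G h x)" for h x
      unfolding kernel_op_def G_def by (simp flip: of_real_mult)
    then have "cmod ((kernel_op m (k h) (\<lambda>x. complex_of_real (f x)) x - complex_of_real (f x)) / complex_of_real h - complex_of_real lam * complex_of_real (f x)) = D h x" for h x
      unfolding D_def by (simp flip: of_real_mult of_real_diff of_real_divide)
    then show ?thesis using gen unfolding L2_generator_def e_def by simp
  qed
  have step: "AE x in m. kop m (k h) ?f x \<le> ennreal (1 + lam * h) * ?f x + ennreal h * ennreal (D h x) \<and>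
      ennreal (1 + lam * h) * ?f x \<le> kop m (k h) ?f x + ennreal h * ennreal (D h x)"
    if h: "0 < h" "0 \<le> 1 + lam * h" for h
    using kop_finite_AE[OF h(1) f f0 f2] AE_space
  proof eventually_elim
    case (elim x)
    have [measurable]: "(\<lambda>y. k h x y) \<in> borel_measurable m" by (rule measurable_row[OF k_meas[OF h(1)] elim(2)])
    have nn: "0 \<le> k h x y * f y" for y using k_nonneg[OF h(1)] f0 by simp
    have eq: "kop m (k h) ?f x = (\<integral>\<^sup>+y. ennreal (k h x y * f y) \<partial>m)"
      unfolding kop_def using k_nonneg[OF h(1)] f0 by (simp add: ennreal_mult)
    have "integrable m (\<lambda>y. k h x y * f y)"
      using elim(1) nn unfolding eq by (intro integrableI_nonneg) auto
    then have kG: "kop m (k h) ?f x = ennreal (G h x)" unfolding eq G_def using nn by (intro nn_integral_eq_integral) auto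
    have G0: "0 \<le> G h x" unfolding G_def using nn by simp
    have "\<bar>G h x - f x - lam * h * f x\<bar> = h * D h x"
    proof -
      have "(G h x - f x) / h - lam * f x = (G h x - f x - lam * h * f x) / h" using h by (simp add: field_simps)
      then show ?thesis unfolding D_def using h by simp
    qed
    then have "G h x \<le> (1 + lam * h) * f x + h * D h x" "(1 + lam * h) * f x \<le> G h x + h * D h x"
      by (auto simp: abs_le_iff algebra_simps)
    moreover have "0 \<le> D h x" by (simp add: D_def)
    ultimately show ?case unfolding kG using h f0[of x] G0
      by (simp add: ennreal_mult[symmetric] ennreal_plus[symmetric] del: ennreal_plus)
  qed
  define E where "E = ennreal (exp (\<bar>lam\<bar> * t))"
  have key: "(\<integral>\<^sup>+x. ?g x * kop m (k t) ?f x \<partial>m) \<le> ennreal ((1 + lam * t / Suc n) ^ Suc n) * (\<integral>\<^sup>+x. ?g x * ?f x \<partial>m) + ennreal t * E * \<beta>"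
     "ennreal ((1 + lam * t / Suc n) ^ Suc n) * (\<integral>\<^sup>+x. ?g x * ?f x \<partial>m) \<le> (\<integral>\<^sup>+x. ?g x * kop m (k t) ?f x \<partial>m) + ennreal t * E * \<beta>"
    if n: "0 \<le> 1 + lam * (t / Suc n)" and \<beta>: "\<And>s. 0 < s \<Longrightarrow> s \<le> t \<Longrightarrow> (\<integral>\<^sup>+x. ?g x * kop m (k s) (\<lambda>y. ennreal (D (t / Suc n) y)) x \<partial>m) \<le> \<beta>"
      "(\<integral>\<^sup>+x. ?g x * ennreal (D (t / Suc n) x) \<partial>m) \<le> \<beta>" for n \<beta>
  proof -
    define h where "h = t / Suc n"
    have h: "0 < h" "real (Suc n) * h = t" using t by (auto simp: h_def)
    define a where "a = ennreal (1 + lam * h)"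
    define b where "b = ennreal (exp (\<bar>lam\<bar> * h))"
    have ab: "a \<le> b" "1 \<le> b"
    proof -
      have "lam * h \<le> \<bar>lam\<bar> * h" using h by (intro mult_right_mono) auto
      then have "1 + lam * h \<le> exp (\<bar>lam\<bar> * h)" using exp_ge_add_one_self[of "\<bar>lam\<bar> * h"] by linarith
      then show "a \<le> b" unfolding a_def b_def by (rule ennreal_leI)
      show "1 \<le> b" unfolding b_def using h by simp
    qed
    let ?D = "\<lambda>x. ennreal (D h x)"
    have [measurable]: "D h \<in> borel_measurable m" by (rule Dm[OF h(1)])
    have jh: "0 < real (Suc j) * h" for j using h by simp
    have [measurable]: "kop m (k (real (Suc j) * h)) ?D \<in> borel_measurable m" "kop m (k (real (Suc j) * h)) ?f \<in> borel_measurable m" for j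
      by (intro kop_meas[OF jh]; measurable)+
    \<comment> \<open>The accumulated error after \<open>j + 1\<close> steps.\<close>
    define S where "S = rec_nat (\<lambda>x. ennreal h * ?D x) (\<lambda>j Sj x. a * Sj x + ennreal h * kop m (k (real (Suc j) * h)) ?D x)"
    have S0: "S 0 = (\<lambda>x. ennreal h * ?D x)" and SS: "S (Suc j) = (\<lambda>x. a * S j x + ennreal h * kop m (k (real (Suc j) * h)) ?D x)" for j
      by (simp_all add: S_def)
    have Sm[measurable]: "S j \<in> borel_measurable m" for j
    proof (induction j)
      case 0 show ?case unfolding S0 by measurable
    next
      case (Suc j)
      note [measurable] = this
      show ?case unfolding SS by measurable
    qed
    have it: "AE x in m. kop m (k (real (Suc j) * h)) ?f x \<le> a ^ Suc j * ?f x + S j x \<and> a ^ Suc j * ?f x \<le> kop m (k (real (Suc j) * h)) ?f x + S j x" for j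
    proof (induction j)
      case 0
      show ?case using step[OF h(1) n[folded h_def]] by (simp add: S0 a_def)
    next
      case (Suc j)
      have sg: "AE x in m. kop m (k (real (Suc (Suc j)) * h)) ?f x = kop m (k (real (Suc j) * h)) (kop m (k h) ?f) x"
        using ae_semigroup[OF jh[of j] h(1), of ?f] by (simp add: algebra_simps)
      have kf: "kop m (k h) ?f \<in> borel_measurable m" by (rule kop_meas[OF h(1)]) measurable
      have st1: "AE x in m. kop m (k h) ?f x \<le> a * ?f x + ennreal h * ?D x"
        and st2: "AE x in m. a * ?f x + 0 * ?f x \<le> 1 * kop m (k h) ?f x + ennreal h * ?D x"
        using step[OF h(1) n[folded h_def]] unfolding a_def by (auto elim: eventually_mono)
      show ?case using sg Suc.IH AE_space
      proof eventually_elim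
        case (elim x)
        let ?K = "kop m (k (real (Suc j) * h))"
        have "?K (kop m (k h) ?f) x \<le> ?K (\<lambda>x. a * ?f x + ennreal h * ?D x) x" by (rule kop_mono_AE[OF st1])
        also have "\<dots> = a * ?K ?f x + ennreal h * ?K ?D x" by (rule kop_lin[OF jh _ _ elim(3)]) measurable
        also have "\<dots> \<le> a * (a ^ Suc j * ?f x + S j x) + ennreal h * ?K ?D x"
          using elim(2) by (intro add_mono mult_left_mono) auto
        finally have 1: "kop m (k (real (Suc (Suc j)) * h)) ?f x \<le> a ^ Suc (Suc j) * ?f x + S (Suc j) x"
          unfolding elim(1) SS by (simp add: distrib_left mult_ac add_ac)
        have "a ^ Suc (Suc j) * ?f x \<le> a * (?K ?f x + S j x)" using mult_left_mono[of "a ^ Suc j * ?f x" "?K ?f x + S j x" a] elim(2) by (simp add: mult_ac)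
        also have "\<dots> = ?K (\<lambda>x. a * ?f x + 0 * ?f x) x + a * S j x"
          using kop_lin[OF jh[of j] _ _ elim(3), of ?f ?f a 0] by (simp add: distrib_left)
        also have "\<dots> \<le> ?K (\<lambda>x. 1 * kop m (k h) ?f x + ennreal h * ?D x) x + a * S j x"
          by (intro add_mono kop_mono_AE[OF st2] order_refl)
        also have "?K (\<lambda>x. 1 * kop m (k h) ?f x + ennreal h * ?D x) x = 1 * ?K (kop m (k h) ?f) x + ennreal h * ?K ?D x"
          by (rule kop_lin[OF jh kf _ elim(3)]) measurable
        finally have 2: "a ^ Suc (Suc j) * ?f x \<le> kop m (k (real (Suc (Suc j)) * h)) ?f x + S (Suc j) x"
          unfolding elim(1) SS by (simp add: add_ac)
        show ?case using 1 2 by simp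
      qed
    qed
    have Sb: "(\<integral>\<^sup>+x. ?g x * S j x \<partial>m) \<le> of_nat (Suc j) * (ennreal h * b ^ j * \<beta>)" if "j \<le> n" for j
      using that
    proof (induction j)
      case 0
      have "(\<integral>\<^sup>+x. ?g x * S 0 x \<partial>m) = ennreal h * (\<integral>\<^sup>+x. ?g x * ?D x \<partial>m)"
        unfolding S0 by (subst nn_integral_cmult[symmetric]) (auto simp: mult_ac)
      also have "\<dots> \<le> ennreal h * \<beta>" using \<beta>(2) by (intro mult_left_mono) (auto simp: h_def)
      finally show ?case by simp
    next
      case (Suc j)
      have "real (Suc j) * h \<le> real (Suc n) * h" using Suc.prems h by (intro mult_right_mono) auto
      then have bb: "(\<integral>\<^sup>+x. ?g x * kop m (k (real (Suc j) * h)) ?D x \<partial>m) \<le> \<beta>"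
        using \<beta>(1)[OF jh[of j]] unfolding h(2) by (simp add: h_def)
      have "(\<integral>\<^sup>+x. ?g x * S (Suc j) x \<partial>m) = (\<integral>\<^sup>+x. a * (?g x * S j x) + ennreal h * (?g x * kop m (k (real (Suc j) * h)) ?D x) \<partial>m)"
        unfolding SS by (simp add: distrib_left mult_ac)
      also have "\<dots> = a * (\<integral>\<^sup>+x. ?g x * S j x \<partial>m) + ennreal h * (\<integral>\<^sup>+x. ?g x * kop m (k (real (Suc j) * h)) ?D x \<partial>m)"
        by (subst nn_integral_add) (auto simp: nn_integral_cmult simp del: of_nat_Suc)
      also have "\<dots> \<le> b * (of_nat (Suc j) * (ennreal h * b ^ j * \<beta>)) + ennreal h * (b ^ Suc j * \<beta>)"
      proof (intro add_mono mult_mono ab(1) Suc.IH mult_left_mono)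
        have "1 * \<beta> \<le> b ^ Suc j * \<beta>" using ab(2) by (intro mult_right_mono one_le_power) auto
        then show "(\<integral>\<^sup>+x. ?g x * kop m (k (real (Suc j) * h)) ?D x \<partial>m) \<le> b ^ Suc j * \<beta>" using bb by simp
      qed (use Suc.prems in auto)
      also have "\<dots> = of_nat (Suc (Suc j)) * (ennreal h * b ^ Suc j * \<beta>)"
        by (simp add: distrib_right distrib_left mult_ac add_ac)
      finally show ?case .
    qed
    have "(\<integral>\<^sup>+x. ?g x * S n x \<partial>m) \<le> of_nat (Suc n) * (ennreal h * b ^ n * \<beta>)" by (rule Sb) simp
    also have "\<dots> = ennreal t * b ^ n * \<beta>"
    proof -
      have "of_nat (Suc n) * ennreal h = ennreal t"
        unfolding h(2)[symmetric] using h by (subst ennreal_mult) (auto simp: ennreal_of_nat_eq_real_of_nat)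
      then show ?thesis by (metis mult.assoc)
    qed
    also have "\<dots> \<le> ennreal t * E * \<beta>"
    proof -
      have "b ^ n \<le> b ^ Suc n" using ab(2) by (intro power_increasing) auto
      also have "b ^ Suc n = E" unfolding b_def E_def ennreal_power[OF exp_ge_zero] h(2)[symmetric]
        by (subst exp_of_nat_mult[symmetric]) (simp add: mult_ac)
      finally show ?thesis by (intro mult_right_mono mult_left_mono) auto
    qed
    finally have SE: "(\<integral>\<^sup>+x. ?g x * S n x \<partial>m) \<le> ennreal t * E * \<beta>" .
    have an: "a ^ Suc n = ennreal ((1 + lam * t / Suc n) ^ Suc n)"
      unfolding a_def using n by (subst ennreal_power) (auto simp: h_def)
    have [measurable]: "kop m (k t) ?f \<in> borel_measurable m" by (rule kop_meas[OF t]) measurable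
    have "(\<integral>\<^sup>+x. ?g x * kop m (k t) ?f x \<partial>m) \<le> (\<integral>\<^sup>+x. a ^ Suc n * (?g x * ?f x) + ?g x * S n x \<partial>m)"
    proof (rule nn_integral_mono_AE)
      show "AE x in m. ?g x * kop m (k t) ?f x \<le> a ^ Suc n * (?g x * ?f x) + ?g x * S n x"
        using it[of n] unfolding h(2)
      proof eventually_elim
        case (elim x)
        then have "?g x * kop m (k t) ?f x \<le> ?g x * (a ^ Suc n * ?f x + S n x)" by (intro mult_left_mono) auto
        also have "\<dots> = a ^ Suc n * (?g x * ?f x) + ?g x * S n x" by (simp only: distrib_left mult.left_commute)
        finally show ?case .
      qed
    qed
    also have "\<dots> = a ^ Suc n * (\<integral>\<^sup>+x. ?g x * ?f x \<partial>m) + (\<integral>\<^sup>+x. ?g x * S n x \<partial>m)"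
      by (subst nn_integral_add) (auto simp: nn_integral_cmult)
    finally show "(\<integral>\<^sup>+x. ?g x * kop m (k t) ?f x \<partial>m) \<le> ennreal ((1 + lam * t / Suc n) ^ Suc n) * (\<integral>\<^sup>+x. ?g x * ?f x \<partial>m) + ennreal t * E * \<beta>"
      using SE unfolding an by (meson add_left_mono order_trans)
    have "a ^ Suc n * (\<integral>\<^sup>+x. ?g x * ?f x \<partial>m) = (\<integral>\<^sup>+x. ?g x * (a ^ Suc n * ?f x) \<partial>m)"
      by (subst nn_integral_cmult[symmetric]) (auto simp: mult_ac)
    also have "\<dots> \<le> (\<integral>\<^sup>+x. ?g x * kop m (k t) ?f x + ?g x * S n x \<partial>m)"
    proof (rule nn_integral_mono_AE)
      show "AE x in m. ?g x * (a ^ Suc n * ?f x) \<le> ?g x * kop m (k t) ?f x + ?g x * S n x"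
        using it[of n] unfolding h(2)
      proof eventually_elim
        case (elim x)
        then have "?g x * (a ^ Suc n * ?f x) \<le> ?g x * (kop m (k t) ?f x + S n x)" by (intro mult_left_mono) auto
        then show ?case by (simp only: distrib_left)
      qed
    qed
    also have "\<dots> = (\<integral>\<^sup>+x. ?g x * kop m (k t) ?f x \<partial>m) + (\<integral>\<^sup>+x. ?g x * S n x \<partial>m)"
      by (subst nn_integral_add) auto
    finally show "ennreal ((1 + lam * t / Suc n) ^ Suc n) * (\<integral>\<^sup>+x. ?g x * ?f x \<partial>m) \<le> (\<integral>\<^sup>+x. ?g x * kop m (k t) ?f x \<partial>m) + ennreal t * E * \<beta>"
      using SE unfolding an by (meson add_left_mono order_trans)
  qed
  define I where "I = (\<integral>\<^sup>+x. ?g x * ?f x \<partial>m)"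
  define Xt where "Xt = (\<integral>\<^sup>+x. ?g x * kop m (k t) ?f x \<partial>m)"
  define G2 where "G2 = (\<integral>\<^sup>+x. ennreal ((g x)\<^sup>2) \<partial>m)"
  have G2: "G2 < \<infinity>" using g2 by (simp add: G2_def)
  have I: "I < \<infinity>"
  proof -
    have "I \<le> (\<integral>\<^sup>+x. ennreal ((g x)\<^sup>2) + ennreal ((f x)\<^sup>2) \<partial>m)" unfolding I_def
    proof (intro nn_integral_mono)
      fix x
      have "g x * f x \<le> (g x)\<^sup>2 + (f x)\<^sup>2" using young_with_parameter[of 1 "g x" "f x"] g0 f0 by simp
      then show "?g x * ?f x \<le> ennreal ((g x)\<^sup>2) + ennreal ((f x)\<^sup>2)"
        using g0[of x] f0[of x] by (simp add: ennreal_mult[symmetric] ennreal_plus[symmetric] del: ennreal_plus)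
    qed
    also have "\<dots> < \<infinity>" using g2 f2 by (subst nn_integral_add) auto
    finally show ?thesis .
  qed
  have hn: "(\<lambda>n. t / real (Suc n)) \<longlonglongrightarrow> 0" by (rule LIMSEQ_Suc) (rule lim_const_over_n)
  have hn': "filterlim (\<lambda>n. t / real (Suc n)) (at_right 0) sequentially"
    unfolding filterlim_at using hn t by auto
  have ehn: "(\<lambda>n. e (t / real (Suc n))) \<longlonglongrightarrow> 0" by (rule filterlim_compose[OF e0 hn'])
  have "(\<lambda>n. (1 + lam * t / real n) ^ n) \<longlonglongrightarrow> exp (lam * t)" by (rule tendsto_exp_limit_sequentially)
  then have pw: "(\<lambda>n. ennreal ((1 + lam * t / real (Suc n)) ^ Suc n)) \<longlonglongrightarrow> ennreal (exp (lam * t))"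
    by (intro tendsto_ennrealI) (rule LIMSEQ_Suc)
  have pwI: "(\<lambda>n. ennreal ((1 + lam * t / real (Suc n)) ^ Suc n) * I) \<longlonglongrightarrow> ennreal (exp (lam * t)) * I"
    using I by (intro tendsto_mult_ennreal[OF pw tendsto_const]) auto
  define C where "C = ennreal t * E * ennreal (exp (K * t) + 1)"
  have C: "C < \<infinity>" by (simp add: C_def E_def ennreal_mult_less_top)
  have err: "(\<lambda>n. C * (ennreal \<delta> * G2 + ennreal (1 / \<delta>) * e (t / real (Suc n)))) \<longlonglongrightarrow> C * (ennreal \<delta> * G2 + ennreal (1 / \<delta>) * 0)" for \<delta>
    using C G2 by (intro tendsto_mult_ennreal tendsto_intros ehn) (auto simp: ennreal_mult_eq_top_iff)
  have main: "Xt \<le> ennreal (exp (lam * t)) * I + C * (ennreal \<delta> * G2) \<and> ennreal (exp (lam * t)) * I \<le> Xt + C * (ennreal \<delta> * G2)" if \<delta>: "0 < \<delta>" for \<delta>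
  proof -
    have "(\<lambda>n. 1 + lam * (t / real (Suc n))) \<longlonglongrightarrow> 1 + lam * 0" by (intro tendsto_intros hn)
    then have "\<forall>\<^sub>F n in sequentially. 0 < 1 + lam * (t / real (Suc n))" by (intro order_tendstoD(1)) auto
    then have ev: "\<forall>\<^sub>F n in sequentially. Xt \<le> ennreal ((1 + lam * t / Suc n) ^ Suc n) * I + C * (ennreal \<delta> * G2 + ennreal (1 / \<delta>) * e (t / real (Suc n))) \<and>
       ennreal ((1 + lam * t / Suc n) ^ Suc n) * I \<le> Xt + C * (ennreal \<delta> * G2 + ennreal (1 / \<delta>) * e (t / real (Suc n)))"
    proof eventually_elim
      case (elim n)
      let ?h = "t / real (Suc n)"
      have h: "0 < ?h" using t by simp
      let ?b = "ennreal \<delta> * G2 + ennreal (1 / \<delta>) * e ?h"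
      let ?\<beta> = "ennreal (exp (K * t) + 1) * ?b"
      have [measurable]: "D ?h \<in> borel_measurable m" by (rule Dm[OF h])
      have D0: "0 \<le> D ?h x" for x by (simp add: D_def)
      have 1: "(\<integral>\<^sup>+x. ?g x * kop m (k s) (\<lambda>y. ennreal (D ?h y)) x \<partial>m) \<le> ?\<beta>" if "0 < s" "s \<le> t" for s
      proof -
        have "(\<integral>\<^sup>+x. ?g x * kop m (k s) (\<lambda>y. ennreal (D ?h y)) x \<partial>m) \<le> ennreal (exp (K * t)) * ?b"
          unfolding G2_def e_def by (rule schur_pairing[OF that g Dm[OF h] \<delta> g0 D0])
        also have "\<dots> \<le> ?\<beta>" by (intro mult_right_mono ennreal_leI) auto
        finally show ?thesis .
      qed
      have 2: "(\<integral>\<^sup>+x. ?g x * ennreal (D ?h x) \<partial>m) \<le> ?\<beta>"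
      proof -
        have "(\<integral>\<^sup>+x. ?g x * ennreal (D ?h x) \<partial>m) \<le> (\<integral>\<^sup>+x. ennreal \<delta> * ennreal ((g x)\<^sup>2) + ennreal (1 / \<delta>) * ennreal ((D ?h x)\<^sup>2) \<partial>m)"
        proof (intro nn_integral_mono)
          fix x
          have "g x * D ?h x \<le> \<delta> * (g x)\<^sup>2 + 1 / \<delta> * (D ?h x)\<^sup>2" by (rule young_with_parameter[OF \<delta> g0 D0])
          then have "ennreal (g x * D ?h x) \<le> ennreal (\<delta> * (g x)\<^sup>2 + 1 / \<delta> * (D ?h x)\<^sup>2)" by (rule ennreal_leI)
          also have "\<dots> = ennreal (\<delta> * (g x)\<^sup>2) + ennreal (1 / \<delta> * (D ?h x)\<^sup>2)" using \<delta> by (intro ennreal_plus) auto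
          also have "\<dots> = ennreal \<delta> * ennreal ((g x)\<^sup>2) + ennreal (1 / \<delta>) * ennreal ((D ?h x)\<^sup>2)"
            using \<delta> by (intro arg_cong2[where f="(+)"] ennreal_mult) auto
          finally show "?g x * ennreal (D ?h x) \<le> ennreal \<delta> * ennreal ((g x)\<^sup>2) + ennreal (1 / \<delta>) * ennreal ((D ?h x)\<^sup>2)"
            using g0[of x] D0[of x] by (simp add: ennreal_mult)
        qed
        also have "\<dots> = 1 * ?b" unfolding G2_def e_def by (subst nn_integral_add) (auto simp: nn_integral_cmult simp del: of_nat_Suc)
        also have "\<dots> \<le> ?\<beta>" by (intro mult_right_mono) (auto simp: ennreal_1[symmetric] simp del: ennreal_1 intro!: ennreal_leI)
        finally show ?thesis .
      qed
      have "0 \<le> 1 + lam * ?h" using elim by simp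
      from key[OF this 1 2] show ?case unfolding Xt_def I_def C_def by (simp add: mult.assoc)
    qed
    have "Xt \<le> ennreal (exp (lam * t)) * I + C * (ennreal \<delta> * G2 + ennreal (1 / \<delta>) * 0)"
      by (rule tendsto_lowerbound[OF tendsto_add[OF pwI err]]) (use ev in \<open>auto elim: eventually_mono\<close>)
    moreover have "ennreal (exp (lam * t)) * I \<le> Xt + C * (ennreal \<delta> * G2 + ennreal (1 / \<delta>) * 0)"
      by (rule tendsto_le[OF _ tendsto_add[OF tendsto_const err] pwI]) (use ev in \<open>auto elim: eventually_mono\<close>)
    ultimately show ?thesis by simp
  qed
  \<comment> \<open>Only now let \<open>\<delta>\<close> tend to \<open>0\<close>: the term with \<open>1 / \<delta>\<close> has vanished in the limit of fine steps.\<close>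
  have lim0: "((\<lambda>\<delta>. Y + C * (ennreal \<delta> * G2)) \<longlongrightarrow> Y + C * (ennreal 0 * G2)) (at_right 0)" for Y
    using C g2 by (intro tendsto_intros tendsto_mult_ennreal tendsto_ennrealI) (auto simp: G2_def)
  have ev0: "\<forall>\<^sub>F \<delta> in at_right (0::real). 0 < \<delta>" by (rule eventually_at_right_less)
  have "Xt \<le> ennreal (exp (lam * t)) * I + C * (ennreal 0 * G2)"
    by (rule tendsto_lowerbound[OF lim0]) (use ev0 main in \<open>auto elim: eventually_mono\<close>)
  moreover have "ennreal (exp (lam * t)) * I \<le> Xt + C * (ennreal 0 * G2)"
    by (rule tendsto_lowerbound[OF lim0]) (use ev0 main in \<open>auto elim: eventually_mono\<close>)
  ultimately show ?thesis unfolding Xt_def I_def by simp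
qed

text \<open>
  Test functions are the restrictions to measurable sets of a strictly positive function in \<open>L\<^sup>2\<close>, which exists by \<open>\<sigma>\<close>-finiteness.
\<close>

lemma eigenfunction_AE:
  fixes f :: "'a \<Rightarrow> real"
  assumes gen: "(\<lambda>x. complex_of_real (f x), \<lambda>x. complex_of_real lam * complex_of_real (f x)) \<in> L2_generator m k"
    and f0: "\<And>x. 0 \<le> f x" and t: "0 < t"
  shows "AE x in m. kop m (k t) (\<lambda>y. ennreal (f y)) x = ennreal (exp (lam * t) * f x)"
proof -
  interpret m: sigma_finite_measure m by (rule sigma)
  have L: "(\<lambda>x. complex_of_real (f x)) \<in> L2 m" using gen by (simp add: L2_generator_def)
  note f[measurable] = L2_realD(1)[OF L]
  have kf[measurable]: "kop m (k t) (\<lambda>y. ennreal (f y)) \<in> borel_measurable m" by (rule kop_meas[OF t]) measurable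
  obtain w where w[measurable]: "w \<in> borel_measurable m" and wi: "integral\<^sup>N m w \<noteq> \<infinity>" and wp: "\<And>x. x \<in> space m \<Longrightarrow> 0 < w x \<and> w x < \<infinity>"
    using m.Ex_finite_integrable_function by blast
  define g where "g x = min 1 (enn2real (w x))" for x
  have [measurable]: "g \<in> borel_measurable m" unfolding g_def by measurable
  have g0: "0 \<le> g x" for x by (simp add: g_def)
  have gp: "0 < g x" if "x \<in> space m" for x using wp[OF that] by (simp add: g_def enn2real_positive_iff)
  have gw: "ennreal ((g x)\<^sup>2) \<le> w x" if "x \<in> space m" for x
  proof -
    have "(g x)\<^sup>2 \<le> g x" using mult_left_le_one_le[OF g0[of x] g0[of x]] by (simp add: power2_eq_square g_def)
    then have "(g x)\<^sup>2 \<le> enn2real (w x)" by (simp add: g_def)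
    then have "ennreal ((g x)\<^sup>2) \<le> ennreal (enn2real (w x))" by (rule ennreal_leI)
    also have "\<dots> = w x" using wp[OF that] by simp
    finally show ?thesis .
  qed
  have B: "(\<integral>\<^sup>+x. (ennreal (g x) * kop m (k t) (\<lambda>y. ennreal (f y)) x) * indicator B x \<partial>m) = (\<integral>\<^sup>+x. (ennreal (g x) * ennreal (exp (lam * t) * f x)) * indicator B x \<partial>m)"
    if B[measurable]: "B \<in> sets m" for B
  proof -
    let ?g = "\<lambda>x. g x * indicator B x"
    have "(\<integral>\<^sup>+x. ennreal ((?g x)\<^sup>2) \<partial>m) \<le> (\<integral>\<^sup>+x. w x \<partial>m)"
      using gw by (intro nn_integral_mono) (auto simp: indicator_def)
    also have "\<dots> < \<infinity>" using wi by (simp add: less_top)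
    finally have "(\<integral>\<^sup>+x. ennreal ((?g x)\<^sup>2) \<partial>m) < \<infinity>" .
    note eq = eigenfunction_pairing[OF gen f0 t _ _ this]
    have ind: "ennreal (?g x) = ennreal (g x) * indicator B x" for x by (auto simp: indicator_def)
    have "(\<integral>\<^sup>+x. (ennreal (g x) * kop m (k t) (\<lambda>y. ennreal (f y)) x) * indicator B x \<partial>m) = (\<integral>\<^sup>+x. ennreal (?g x) * kop m (k t) (\<lambda>y. ennreal (f y)) x \<partial>m)"
      unfolding ind by (simp add: mult_ac)
    also have "\<dots> = ennreal (exp (lam * t)) * (\<integral>\<^sup>+x. ennreal (?g x) * ennreal (f x) \<partial>m)" using g0 by (intro eq) auto
    also have "\<dots> = (\<integral>\<^sup>+x. (ennreal (g x) * ennreal (exp (lam * t) * f x)) * indicator B x \<partial>m)"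
      unfolding ind using f0 by (subst nn_integral_cmult[symmetric]) (auto simp: mult_ac ennreal_mult)
    finally show ?thesis .
  qed
  have "AE x in m. ennreal (g x) * kop m (k t) (\<lambda>y. ennreal (f y)) x = ennreal (g x) * ennreal (exp (lam * t) * f x)"
    by (rule AE_eq_of_set_integrals[OF sigma _ _ B]) measurable
  then show ?thesis using AE_space
  proof eventually_elim
    case (elim x)
    then show ?case using gp[of x] by (subst (asm) ennreal_mult_cancel_left) auto
  qed
qed

end

section \<open>Comparison of the two kernels\<close>

text \<open>
  Both sides have equal pairings with indicators, by adjointness and the semigroup identity for \<open>k\<close>.
\<close>

lemma transpose_kernel_semigroup:
  assumes sigma: "sigma_finite_measure m"
    and km: "\<And>t. 0 < t \<Longrightarrow> (\<lambda>(x, y). k t x y) \<in> borel_measurable (m \<Otimes>\<^sub>M m)"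
    and sg: "\<And>s t f x. 0 < s \<Longrightarrow> 0 < t \<Longrightarrow> f \<in> borel_measurable m \<Longrightarrow> kop m (k (s + t)) f x = kop m (k s) (kop m (k t) f) x"
    and st: "0 < s" "0 < t" and f[measurable]: "f \<in> borel_measurable m"
  shows "AE y in m. kop m (transpose_kernel k (s + t)) f y = kop m (transpose_kernel k s) (kop m (transpose_kernel k t) f) y"
proof -
  have kT: "(\<lambda>(y, x). transpose_kernel k t y x) \<in> borel_measurable (m \<Otimes>\<^sub>M m)" if "0 < t" for t
  proof -
    note [measurable] = km[OF that]
    show ?thesis unfolding transpose_kernel_def by measurable
  qed
  have mk: "kop m (k t) g \<in> borel_measurable m" "kop m (transpose_kernel k t) g \<in> borel_measurable m" if "0 < t" "g \<in> borel_measurable m" for t g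
    using kop_measurable[OF sigma km[OF that(1)] that(2)] kop_measurable[OF sigma kT[OF that(1)] that(2)] by auto
  have adj: "(\<integral>\<^sup>+y. kop m (transpose_kernel k t) h y * g y \<partial>m) = (\<integral>\<^sup>+x. h x * kop m (k t) g x \<partial>m)"
    if "0 < t" "g \<in> borel_measurable m" "h \<in> borel_measurable m" for t g h
    using kop_adjoint[OF sigma km[OF that(1)] that(2,3)] by (simp add: transpose_kernel_def[abs_def] mult.commute)
  show ?thesis
  proof (rule AE_eq_of_set_integrals[OF sigma])
    show "kop m (transpose_kernel k (s + t)) f \<in> borel_measurable m" "kop m (transpose_kernel k s) (kop m (transpose_kernel k t) f) \<in> borel_measurable m"
      using st by (auto intro!: mk)
    fix B assume [measurable]: "B \<in> sets m"
    have "(\<integral>\<^sup>+y. kop m (transpose_kernel k (s + t)) f y * indicator B y \<partial>m) = (\<integral>\<^sup>+x. f x * kop m (k (t + s)) (indicator B) x \<partial>m)"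
      using adj[of "s + t" "indicator B" f] st by (simp add: add.commute)
    also have "\<dots> = (\<integral>\<^sup>+x. f x * kop m (k t) (kop m (k s) (indicator B)) x \<partial>m)" using st by (subst sg) auto
    also have "\<dots> = (\<integral>\<^sup>+y. kop m (transpose_kernel k t) f y * kop m (k s) (indicator B) y \<partial>m)"
      using st by (subst adj) (auto intro: mk)
    also have "\<dots> = (\<integral>\<^sup>+y. kop m (transpose_kernel k s) (kop m (transpose_kernel k t) f) y * indicator B y \<partial>m)"
      using st by (subst adj) (auto intro: mk)
    finally show "(\<integral>\<^sup>+y. kop m (transpose_kernel k (s + t)) f y * indicator B y \<partial>m) = (\<integral>\<^sup>+y. kop m (transpose_kernel k s) (kop m (transpose_kernel k t) f) y * indicator B y \<partial>m)" .
  qed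
qed

lemma principal_eigenD:
  assumes "principal_eigen m k lam \<phi> \<psi>"
  shows "(\<lambda>x. complex_of_real (\<phi> x), \<lambda>x. complex_of_real lam * complex_of_real (\<phi> x)) \<in> L2_generator m k"
    "(\<lambda>x. complex_of_real (\<psi> x), \<lambda>x. complex_of_real lam * complex_of_real (\<psi> x)) \<in> L2_generator m (transpose_kernel k)"
    "continuous_on UNIV \<phi>" "continuous_on UNIV \<psi>" "\<And>x. 0 < \<phi> x" "\<And>x. 0 < \<psi> x" "(\<integral>x. \<phi> x * \<psi> x \<partial>m) = 1"
  using assms unfolding principal_eigen_def eigenfunction_def Let_def by auto

lemma compact_exhaustion:
  assumes E: "locally_compact_space (euclidean :: ('a::{metric_space,second_countable_topology}) topology)"
  obtains C :: "nat \<Rightarrow> 'a::{metric_space,second_countable_topology} set" where "\<And>n. compact (C n)" "incseq C" "(\<Union>n. C n) = UNIV"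
proof -
  define \<F> :: "'a set set" where "\<F> = {ball x r | x r. compact (cball x r)}"
  have "\<And>S. S \<in> \<F> \<Longrightarrow> open S" by (auto simp: \<F>_def)
  then obtain \<F>' where F': "\<F>' \<subseteq> \<F>" "countable \<F>'" "\<Union>\<F>' = \<Union>\<F>" using Lindelof[of \<F>] by blast
  have U: "\<Union>\<F>' = UNIV"
  proof -
    have "x \<in> \<Union>\<F>" for x
    proof -
      obtain r where "r > 0" "compact (cball x r)" using compact_ball_exists[OF E open_UNIV, of x] by auto
      then show ?thesis unfolding \<F>_def by (auto intro!: exI[of _ "ball x r"])
    qed
    then show ?thesis using F' by auto
  qed
  have ne: "\<F>' \<noteq> {}" using U by auto
  define D where "D = from_nat_into \<F>'"
  have D: "range D = \<F>'" unfolding D_def by (rule range_from_nat_into[OF ne F'(2)])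
  define C where "C n = (\<Union>i\<le>n. closure (D i))" for n
  show ?thesis
  proof
    have "compact (closure (D i))" for i
    proof -
      have "D i \<in> \<F>" using D F' by auto
      then obtain x r where xr: "D i = ball x r" "compact (cball x r)" by (auto simp: \<F>_def)
      have "closure (D i) \<subseteq> cball x r" unfolding xr(1) by (intro closure_minimal) (auto intro: ball_subset_cball)
      then have "cball x r \<inter> closure (D i) = closure (D i)" by auto
      then show ?thesis using compact_Int_closed[OF xr(2) closed_closure[of "D i"]] by simp
    qed
    then show "compact (C n)" for n unfolding C_def by (intro compact_UN) auto
    show "incseq C" unfolding C_def incseq_def by (auto intro: order_trans)
    have "x \<in> (\<Union>n. C n)" for x
    proof -
      have "x \<in> \<Union>(range D)" using U D by simp
      then obtain i where "x \<in> D i" by auto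
      then have "x \<in> C i" unfolding C_def using closure_subset[of "D i"] by auto
      then show ?thesis by auto
    qed
    then show "(\<Union>n. C n) = UNIV" by auto
  qed
qed

lemma kernel_measurable:
  fixes m :: "'a::second_countable_topology measure"
  assumes m: "sets m = sets borel" and "continuous_positive_kernel k" "0 < t"
  shows "(\<lambda>(x, y). k t x y) \<in> borel_measurable (m \<Otimes>\<^sub>M m)"
proof -
  have "(\<lambda>(x, y). k t x y) \<in> borel_measurable borel"
    using assms by (intro borel_measurable_continuous_onI) (auto simp: continuous_positive_kernel_def)
  then show ?thesis unfolding borel_prod[symmetric] by (simp cong: measurable_cong_sets sets_pair_measure_cong add: m)
qed

text \<open>
  Here \<open>p\<close> is the kernel of the motion and \<open>q\<close> that of its Feynman-Kac semigroup with potential bounded by \<open>K\<close>, so that the two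
  operators are comparable with constant \<open>exp (K * t)\<close>. The eigenvalue of \<open>q\<close> is \<open>0\<close>.
\<close>

locale critical_kernels =
  fixes m :: "'a::{metric_space,second_countable_topology} measure" and p q :: "real \<Rightarrow> 'a \<Rightarrow> 'a \<Rightarrow> real"
    and K lamt :: real and \<phi>t \<psi>t \<phi> \<psi> :: "'a \<Rightarrow> real"
  assumes E: "locally_compact_space (euclidean :: 'a topology)"
    and sets_m [measurable_cong]: "sets m = sets borel" and sigma: "sigma_finite_measure m"
    and full_support: "\<And>U. open U \<Longrightarrow> U \<noteq> {} \<Longrightarrow> 0 < emeasure m U"
    and p: "continuous_positive_kernel p" and q: "continuous_positive_kernel q" and K_nonneg: "0 \<le> K"
    and p_row: "\<And>t x. 0 < t \<Longrightarrow> (\<integral>\<^sup>+y. ennreal (p t x y) \<partial>m) \<le> 1"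
    and p_col: "\<And>t y. 0 < t \<Longrightarrow> (\<integral>\<^sup>+x. ennreal (p t x y) \<partial>m) \<le> 1"
    and q_le_p: "\<And>t f x. 0 < t \<Longrightarrow> f \<in> borel_measurable borel \<Longrightarrow> kop m (q t) f x \<le> ennreal (exp (K * t)) * kop m (p t) f x"
    and p_le_q: "\<And>t f x. 0 < t \<Longrightarrow> f \<in> borel_measurable borel \<Longrightarrow> kop m (p t) f x \<le> ennreal (exp (K * t)) * kop m (q t) f x"
    and p_semigroup: "\<And>s t f x. 0 < s \<Longrightarrow> 0 < t \<Longrightarrow> f \<in> borel_measurable borel \<Longrightarrow> kop m (p (s + t)) f x = kop m (p s) (kop m (p t) f) x"
    and q_semigroup: "\<And>s t f x. 0 < s \<Longrightarrow> 0 < t \<Longrightarrow> f \<in> borel_measurable borel \<Longrightarrow> kop m (q (s + t)) f x = kop m (q s) (kop m (q t) f) x"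
    and eigen_P: "principal_eigen m p lamt \<phi>t \<psi>t" and \<phi>t_bounded: "bounded (range \<phi>t)"
    and ultracontractive: "\<And>t. 0 < t \<Longrightarrow> \<exists>c>0. \<forall>x y. p t x y \<le> c * \<phi>t x * \<psi>t y"
    and eigen_T: "principal_eigen m q 0 \<phi> \<psi>"
begin

lemma space_m [simp]: "space m = UNIV" using sets_eq_imp_space_eq[OF sets_m] by simp

lemma measurable_m_iff [simp]: "borel_measurable m = borel_measurable borel"
  by (rule measurable_cong_sets[OF sets_m refl])

lemma kernel_row_continuous:
  assumes "continuous_positive_kernel k" "0 < t"
  shows "continuous_on UNIV (\<lambda>y. k t x y)" "continuous_on UNIV (\<lambda>x. k t x y)"
proof -
  have c: "continuous_on UNIV (\<lambda>(x, y). k t x y)" using assms by (auto simp: continuous_positive_kernel_def)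
  have 1: "continuous_on UNIV (\<lambda>y. (x, y))" and 2: "continuous_on UNIV (\<lambda>x. (x, y))"
    by (rule continuous_on_Pair[OF continuous_on_const continuous_on_id] continuous_on_Pair[OF continuous_on_id continuous_on_const])+
  show "continuous_on UNIV (\<lambda>y. k t x y)" using continuous_on_compose2[OF c 1] by simp
  show "continuous_on UNIV (\<lambda>x. k t x y)" using continuous_on_compose2[OF c 2] by simp
qed

lemma q_pos: "0 < t \<Longrightarrow> 0 < q t x y" and p_pos: "0 < t \<Longrightarrow> 0 < p t x y"
  using p q by (auto simp: continuous_positive_kernel_def)

text \<open>
  The set where the inequality fails is open, hence not null by full support unless it is empty.
\<close>

lemma continuous_le_of_integrals:
  fixes f g :: "'a \<Rightarrow> real"
  assumes fc: "continuous_on UNIV f" and gc: "continuous_on UNIV g" and g0: "\<And>y. 0 \<le> g y"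
    and le: "\<And>B. B \<in> sets borel \<Longrightarrow> (\<integral>\<^sup>+y. ennreal (f y) * indicator B y \<partial>m) \<le> (\<integral>\<^sup>+y. ennreal (g y) * indicator B y \<partial>m)"
    and fin: "(\<integral>\<^sup>+y. ennreal (g y) \<partial>m) < \<infinity>"
  shows "f y \<le> g y"
proof (rule ccontr)
  assume "\<not> f y \<le> g y"
  define U where "U = {y. g y < f y}"
  have U: "open U" unfolding U_def by (rule open_Collect_less[OF gc fc])
  have "y \<in> U" using \<open>\<not> f y \<le> g y\<close> by (simp add: U_def)
  then have "U \<noteq> {}" by blast
  then have Upos: "0 < emeasure m U" using full_support[OF U] by simp
  have [measurable]: "f \<in> borel_measurable borel" "g \<in> borel_measurable borel" "U \<in> sets borel"
    using fc gc U by (auto intro: borel_measurable_continuous_onI)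
  have "(\<integral>\<^sup>+y. ennreal (g y) * indicator U y \<partial>m) < (\<integral>\<^sup>+y. ennreal (f y) * indicator U y \<partial>m)"
  proof (rule nn_integral_less)
    have "(\<integral>\<^sup>+y. ennreal (g y) * indicator U y \<partial>m) \<le> (\<integral>\<^sup>+y. ennreal (g y) \<partial>m)"
      by (intro nn_integral_mono) (auto simp: indicator_def)
    then show "(\<integral>\<^sup>+y. ennreal (g y) * indicator U y \<partial>m) \<noteq> \<infinity>" using fin by (auto simp: top_unique)
    show "AE y in m. ennreal (g y) * indicator U y \<le> ennreal (f y) * indicator U y"
      by (intro AE_I2) (auto simp: indicator_def U_def intro!: ennreal_leI)
    show "\<not> (AE y in m. ennreal (f y) * indicator U y \<le> ennreal (g y) * indicator U y)"
    proof
      assume "AE y in m. ennreal (f y) * indicator U y \<le> ennreal (g y) * indicator U y"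
      then have "AE y in m. y \<notin> U"
      proof eventually_elim
        case (elim y)
        show ?case
        proof
          assume "y \<in> U"
          then have "ennreal (f y) \<le> ennreal (g y)" using elim by simp
          then have "f y \<le> g y" using g0[of y] by (simp add: ennreal_le_iff)
          then show False using \<open>y \<in> U\<close> by (simp add: U_def)
        qed
      qed
      then have "emeasure m U = 0" using AE_iff_measurable[of U m "\<lambda>y. y \<notin> U"] by (simp add: sets_m)
      then show False using Upos by simp
    qed
  qed measurable
  then show False using le[of U] by (simp add: not_less[symmetric])
qed

lemma q_le_p_pointwise: assumes t: "0 < t" shows "q t x y \<le> exp (K * t) * p t x y"
proof (rule continuous_le_of_integrals[where f="\<lambda>y. q t x y" and g="\<lambda>y. exp (K * t) * p t x y"])
  show "continuous_on UNIV (\<lambda>y. q t x y)" "continuous_on UNIV (\<lambda>y. exp (K * t) * p t x y)"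
    using kernel_row_continuous[OF p t] kernel_row_continuous[OF q t] by (auto intro: continuous_intros)
  have [measurable]: "p t x \<in> borel_measurable borel" using kernel_row_continuous[OF p t] by (intro borel_measurable_continuous_onI)
  show "0 \<le> exp (K * t) * p t x y" for y using p_pos[OF t, of x y] by simp
  have eq: "(\<integral>\<^sup>+y. ennreal (exp (K * t) * p t x y) * h y \<partial>m) = ennreal (exp (K * t)) * (\<integral>\<^sup>+y. ennreal (p t x y) * h y \<partial>m)"
    if [measurable]: "h \<in> borel_measurable borel" for h
    using p_pos[OF t, of x] by (subst nn_integral_cmult[symmetric]) (auto simp: ennreal_mult less_imp_le mult.assoc)
  show "(\<integral>\<^sup>+y. ennreal (q t x y) * indicator B y \<partial>m) \<le> (\<integral>\<^sup>+y. ennreal (exp (K * t) * p t x y) * indicator B y \<partial>m)"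
    if "B \<in> sets borel" for B
    using q_le_p[OF t, of "indicator B" x] that by (simp add: eq kop_def)
  show "(\<integral>\<^sup>+y. ennreal (exp (K * t) * p t x y) \<partial>m) < \<infinity>"
    using eq[of "\<lambda>_. 1"] p_row[OF t, of x] by (auto simp: ennreal_mult_less_top intro: le_less_trans)
qed

lemma scaled_le_exp: "(\<integral>\<^sup>+z. ennreal (exp (K * t) * h z) \<partial>m) \<le> ennreal (exp (K * t))"
  if [measurable]: "h \<in> borel_measurable borel" and "\<And>z. 0 \<le> h z" and "(\<integral>\<^sup>+z. ennreal (h z) \<partial>m) \<le> 1"
proof -
  have "(\<integral>\<^sup>+z. ennreal (exp (K * t) * h z) \<partial>m) = ennreal (exp (K * t)) * (\<integral>\<^sup>+z. ennreal (h z) \<partial>m)"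
    using that by (subst nn_integral_cmult[symmetric]) (auto simp: ennreal_mult)
  also have "\<dots> \<le> ennreal (exp (K * t)) * 1" using that by (intro mult_left_mono) auto
  finally show ?thesis by simp
qed

lemma q_row: "0 < t \<Longrightarrow> (\<integral>\<^sup>+y. ennreal (q t x y) \<partial>m) \<le> ennreal (exp (K * t))"
  and q_col: "0 < t \<Longrightarrow> (\<integral>\<^sup>+x. ennreal (q t x y) \<partial>m) \<le> ennreal (exp (K * t))"
proof -
  assume t: "0 < t"
  have m: "p t x \<in> borel_measurable borel" "(\<lambda>x. p t x y) \<in> borel_measurable borel" for x y
    using kernel_row_continuous[OF p t] by (auto intro: borel_measurable_continuous_onI)
  have "(\<integral>\<^sup>+y. ennreal (q t x y) \<partial>m) \<le> (\<integral>\<^sup>+y. ennreal (exp (K * t) * p t x y) \<partial>m)"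
    "(\<integral>\<^sup>+x. ennreal (q t x y) \<partial>m) \<le> (\<integral>\<^sup>+x. ennreal (exp (K * t) * p t x y) \<partial>m)"
    by (intro nn_integral_mono ennreal_leI q_le_p_pointwise t)+
  then show "(\<integral>\<^sup>+y. ennreal (q t x y) \<partial>m) \<le> ennreal (exp (K * t))" "(\<integral>\<^sup>+x. ennreal (q t x y) \<partial>m) \<le> ennreal (exp (K * t))"
    using scaled_le_exp[OF m(1)] scaled_le_exp[OF m(2)] p_row[OF t] p_col[OF t] p_pos[OF t]
    by (meson less_imp_le order_trans)+
qed

lemma transpose_continuous: "continuous_positive_kernel k \<Longrightarrow> continuous_positive_kernel (transpose_kernel k)"
  unfolding continuous_positive_kernel_def transpose_kernel_def
proof (intro allI impI conjI)
  fix t :: real assume k: "\<forall>t>0. continuous_on UNIV (\<lambda>(x, y). k t x y) \<and> (\<forall>x y. 0 < k t x y)" and t: "0 < t"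
  then have c: "continuous_on UNIV (\<lambda>(x, y). k t x y)" by simp
  have "continuous_on UNIV (\<lambda>z. case prod.swap z of (x, y) \<Rightarrow> k t x y)"
    by (rule continuous_on_compose2[OF c continuous_on_swap]) (rule subset_UNIV)
  moreover have "(\<lambda>z. case prod.swap z of (x, y) \<Rightarrow> k t x y) = (\<lambda>(x, y). k t y x)" by (rule ext) (simp split: prod.split)
  ultimately show "continuous_on UNIV (\<lambda>(x, y). k t y x)" by simp
qed auto

lemma kernel_semigroup_and_transpose:
  assumes k: "continuous_positive_kernel k" and \<kappa>: "0 \<le> \<kappa>"
    and row: "\<And>t x. 0 < t \<Longrightarrow> (\<integral>\<^sup>+y. ennreal (k t x y) \<partial>m) \<le> ennreal (exp (\<kappa> * t))"
    and col: "\<And>t y. 0 < t \<Longrightarrow> (\<integral>\<^sup>+x. ennreal (k t x y) \<partial>m) \<le> ennreal (exp (\<kappa> * t))"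
    and sg: "\<And>s t f x. 0 < s \<Longrightarrow> 0 < t \<Longrightarrow> f \<in> borel_measurable borel \<Longrightarrow> kop m (k (s + t)) f x = kop m (k s) (kop m (k t) f) x"
  shows "kernel_semigroup m k \<kappa>" "kernel_semigroup m (transpose_kernel k) \<kappa>"
proof -
  have k0: "0 \<le> k t x y" if "0 < t" for t x y using k that by (auto simp: continuous_positive_kernel_def less_imp_le)
  have km: "(\<lambda>(x, y). k t x y) \<in> borel_measurable (m \<Otimes>\<^sub>M m)" if "0 < t" for t by (rule kernel_measurable[OF sets_m k that])
  have kTm: "(\<lambda>(x, y). transpose_kernel k t x y) \<in> borel_measurable (m \<Otimes>\<^sub>M m)" if "0 < t" for t
    by (rule kernel_measurable[OF sets_m transpose_continuous[OF k] that])
  show "kernel_semigroup m k \<kappa>"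
    by (rule kernel_semigroup.intro[OF sigma km k0 \<kappa> row col]) (simp_all add: sg)
  have kT: "0 \<le> transpose_kernel k t x y" "(\<integral>\<^sup>+y. ennreal (transpose_kernel k t x y) \<partial>m) \<le> ennreal (exp (\<kappa> * t))"
    "(\<integral>\<^sup>+x. ennreal (transpose_kernel k t x y) \<partial>m) \<le> ennreal (exp (\<kappa> * t))" if "0 < t" for t x y
    using k0[OF that] row[OF that] col[OF that] by (simp_all add: transpose_kernel_def)
  have "AE x in m. kop m (transpose_kernel k (s + t)) f x = kop m (transpose_kernel k s) (kop m (transpose_kernel k t) f) x"
    if "0 < s" "0 < t" "f \<in> borel_measurable m" for s t f
    by (rule transpose_kernel_semigroup[OF sigma km _ that]) (auto intro: sg)
  then show "kernel_semigroup m (transpose_kernel k) \<kappa>"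
    by (intro kernel_semigroup.intro[OF sigma kTm kT(1) \<kappa> kT(2,3)])
qed

lemma p_mass: "0 < t \<Longrightarrow> (\<integral>\<^sup>+y. ennreal (p t x y) \<partial>m) \<le> ennreal (exp (0 * t))"
    "0 < t \<Longrightarrow> (\<integral>\<^sup>+x. ennreal (p t x y) \<partial>m) \<le> ennreal (exp (0 * t))"
  using p_row p_col by simp_all

sublocale pS: kernel_semigroup m p 0 by (rule kernel_semigroup_and_transpose[OF p order_refl p_mass p_semigroup])

sublocale pT: kernel_semigroup m "transpose_kernel p" 0
  by (rule kernel_semigroup_and_transpose[OF p order_refl p_mass p_semigroup])

sublocale qS: kernel_semigroup m q K by (rule kernel_semigroup_and_transpose[OF q K_nonneg q_row q_col q_semigroup])

sublocale qT: kernel_semigroup m "transpose_kernel q" K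
  by (rule kernel_semigroup_and_transpose[OF q K_nonneg q_row q_col q_semigroup])

end

section \<open>Intrinsic ultracontractivity\<close>

lemma ennreal_div_le:
  assumes M: "0 < M" and le: "ennreal a \<le> ennreal M * J" shows "ennreal (a / M) \<le> J"
proof -
  have "ennreal (1 / M) * ennreal a \<le> ennreal (1 / M) * (ennreal M * J)" by (intro mult_left_mono le) simp
  also have "\<dots> = (ennreal (1 / M) * ennreal M) * J" by (simp add: mult.assoc)
  also have "ennreal (1 / M) * ennreal M = 1" using M by (simp add: ennreal_mult[symmetric])
  also have "ennreal (1 / M) * ennreal a = ennreal (a / M)" using M by (subst ennreal_mult'[symmetric]) auto
  finally show ?thesis by simp
qed

text \<open>
  The upper bound on \<open>k\<close> limits what the complement of \<open>C\<close> contributes to \<open>total\<close> to one half.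
\<close>

lemma compact_part_lower:
  fixes k f g :: "'a \<Rightarrow> real"
  assumes [measurable]: "k \<in> borel_measurable m" "f \<in> borel_measurable m" "g \<in> borel_measurable m" "C \<in> sets m"
    and pos: "\<And>y. 0 \<le> k y" "\<And>y. 0 \<le> f y" "\<And>y. 0 \<le> g y" "0 \<le> s" "0 < c" "0 < e"
    and total: "(\<integral>\<^sup>+y. ennreal (k y) * ennreal (f y) \<partial>m) = ennreal (e * s)"
    and le: "\<And>y. k y \<le> c * s * g y"
    and tail: "(\<integral>\<^sup>+y. ennreal (g y * f y) * indicator (- C) y \<partial>m) \<le> ennreal (e / (2 * c))"
  shows "ennreal (e / 2 * s) \<le> (\<integral>\<^sup>+y. ennreal (k y) * ennreal (f y) * indicator C y \<partial>m)"
proof -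
  have Cc[measurable]: "- C \<inter> space m \<in> sets m" by (simp add: Compl_eq_Diff_UNIV Diff_Int2 Int_commute Diff_eq[symmetric])
  have [measurable]: "(\<lambda>y. indicator (- C) y :: ennreal) \<in> borel_measurable m"
    by (subst borel_measurable_indicator_iff) (rule Cc)
  have "ennreal (e / 2 * s) + ennreal (e / 2 * s) = ennreal (e * s)"
    using pos by (subst ennreal_plus[symmetric]) auto
  also have "\<dots> = (\<integral>\<^sup>+y. ennreal (k y) * ennreal (f y) * indicator (- C) y + ennreal (k y) * ennreal (f y) * indicator C y \<partial>m)"
    unfolding total[symmetric] by (intro nn_integral_cong) (auto simp: indicator_def)
  also have "\<dots> = (\<integral>\<^sup>+y. ennreal (k y) * ennreal (f y) * indicator (- C) y \<partial>m) + (\<integral>\<^sup>+y. ennreal (k y) * ennreal (f y) * indicator C y \<partial>m)"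
    by (rule nn_integral_add) measurable
  also have "(\<integral>\<^sup>+y. ennreal (k y) * ennreal (f y) * indicator (- C) y \<partial>m) \<le> (\<integral>\<^sup>+y. ennreal (c * s) * (ennreal (g y * f y) * indicator (- C) y) \<partial>m)"
  proof (intro nn_integral_mono)
    fix y
    have "k y * f y \<le> c * s * g y * f y" using le[of y] pos(2) by (intro mult_right_mono)
    then have "ennreal (k y * f y) \<le> ennreal (c * s * (g y * f y))" by (intro ennreal_leI) (simp add: mult.assoc)
    then show "ennreal (k y) * ennreal (f y) * indicator (- C) y \<le> ennreal (c * s) * (ennreal (g y * f y) * indicator (- C) y)"
      using pos by (auto simp: indicator_def ennreal_mult)
  qed
  also have "\<dots> = ennreal (c * s) * (\<integral>\<^sup>+y. ennreal (g y * f y) * indicator (- C) y \<partial>m)" by (rule nn_integral_cmult) measurable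
  also have "\<dots> \<le> ennreal (c * s) * ennreal (e / (2 * c))" by (intro mult_left_mono tail) simp
  also have "\<dots> = ennreal (e / 2 * s)" using pos by (subst ennreal_mult[symmetric]) (auto simp: field_simps)
  finally have "ennreal (e / 2 * s) + ennreal (e / 2 * s) \<le> ennreal (e / 2 * s) + (\<integral>\<^sup>+y. ennreal (k y) * ennreal (f y) * indicator C y \<partial>m)"
    by (simp add: add_right_mono)
  then show ?thesis by (subst (asm) ennreal_add_left_cancel_le) auto
qed

lemma nn_integral_of_integral_one:
  fixes h :: "'a \<Rightarrow> real"
  assumes "(\<integral>x. h x \<partial>m) = 1" "\<And>x. 0 \<le> h x" shows "(\<integral>\<^sup>+x. ennreal (h x) \<partial>m) = 1"
proof -
  have "integrable m h" using assms(1) not_integrable_integral_eq by fastforce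
  then show ?thesis using nn_integral_eq_integral[of m h] assms by simp
qed

context critical_kernels
begin

lemmas \<phi>t_facts = principal_eigenD[OF eigen_P]
lemmas \<phi>_facts = principal_eigenD[OF eigen_T]

lemma eigen_measurable [measurable]:
  "\<phi>t \<in> borel_measurable borel" "\<psi>t \<in> borel_measurable borel" "\<phi> \<in> borel_measurable borel" "\<psi> \<in> borel_measurable borel"
  using \<phi>t_facts(3,4) \<phi>_facts(3,4) by (auto intro: borel_measurable_continuous_onI)

lemma L2_facts: "(\<integral>\<^sup>+x. ennreal ((\<phi>t x)\<^sup>2) \<partial>m) < \<infinity>" "(\<integral>\<^sup>+x. ennreal ((\<psi>t x)\<^sup>2) \<partial>m) < \<infinity>"
  "(\<integral>\<^sup>+x. ennreal ((\<phi> x)\<^sup>2) \<partial>m) < \<infinity>" "(\<integral>\<^sup>+x. ennreal ((\<psi> x)\<^sup>2) \<partial>m) < \<infinity>"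
proof -
  have "(\<lambda>x. complex_of_real (\<phi>t x)) \<in> L2 m" "(\<lambda>x. complex_of_real (\<psi>t x)) \<in> L2 m"
    "(\<lambda>x. complex_of_real (\<phi> x)) \<in> L2 m" "(\<lambda>x. complex_of_real (\<psi> x)) \<in> L2 m"
    using \<phi>t_facts(1,2) \<phi>_facts(1,2) by (simp_all add: L2_generator_def)
  note L = this
  show "(\<integral>\<^sup>+x. ennreal ((\<phi>t x)\<^sup>2) \<partial>m) < \<infinity>" "(\<integral>\<^sup>+x. ennreal ((\<psi>t x)\<^sup>2) \<partial>m) < \<infinity>"
    "(\<integral>\<^sup>+x. ennreal ((\<phi> x)\<^sup>2) \<partial>m) < \<infinity>" "(\<integral>\<^sup>+x. ennreal ((\<psi> x)\<^sup>2) \<partial>m) < \<infinity>"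
    by (rule L2_realD(2), rule L)+
qed

lemma product_finite:
  fixes f g :: "'a \<Rightarrow> real"
  assumes [measurable]: "f \<in> borel_measurable borel" "g \<in> borel_measurable borel" and pos: "\<And>x. 0 < f x" "\<And>x. 0 < g x"
    and fin: "(\<integral>\<^sup>+x. ennreal ((f x)\<^sup>2) \<partial>m) < \<infinity>" "(\<integral>\<^sup>+x. ennreal ((g x)\<^sup>2) \<partial>m) < \<infinity>"
  shows "(\<integral>\<^sup>+x. ennreal (f x * g x) \<partial>m) < \<infinity>"
proof -
  have "(\<integral>\<^sup>+x. ennreal (f x * g x) \<partial>m) \<le> (\<integral>\<^sup>+x. ennreal ((f x)\<^sup>2) + ennreal ((g x)\<^sup>2) \<partial>m)"
  proof (intro nn_integral_mono)
    fix x
    have "0 \<le> (f x - g x)\<^sup>2 + f x * g x" using pos[of x] by simp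
    then have "f x * g x \<le> (f x)\<^sup>2 + (g x)\<^sup>2" by (simp add: power2_eq_square algebra_simps)
    then show "ennreal (f x * g x) \<le> ennreal ((f x)\<^sup>2) + ennreal ((g x)\<^sup>2)"
      by (simp add: ennreal_plus[symmetric] del: ennreal_plus)
  qed
  also have "\<dots> < \<infinity>" using fin by (subst nn_integral_add) auto
  finally show ?thesis .
qed

lemma m_positive:
  fixes f :: "'a \<Rightarrow> real"
  assumes [measurable]: "f \<in> borel_measurable borel" and pos: "\<And>x. 0 < f x"
  shows "0 < (\<integral>\<^sup>+x. ennreal (f x) \<partial>m)"
proof -
  have "(\<integral>\<^sup>+x. ennreal (f x) \<partial>m) \<noteq> 0"
  proof
    assume "(\<integral>\<^sup>+x. ennreal (f x) \<partial>m) = 0"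
    then have "AE x in m. ennreal (f x) = 0" by (subst (asm) nn_integral_0_iff_AE) auto
    then have "AE x in m. x \<notin> UNIV" by eventually_elim (use pos in \<open>auto simp: ennreal_eq_0_iff not_le[symmetric]\<close>)
    then have "emeasure m UNIV = 0" using AE_iff_measurable[of UNIV m "\<lambda>y. y \<notin> UNIV"] by (simp add: sets_m)
    then show False using full_support[of UNIV] by simp
  qed
  then show ?thesis by (simp add: zero_less_iff_neq_zero)
qed

lemma \<phi>t_bound: obtains M where "0 < M" "\<And>x. \<phi>t x \<le> M"
proof -
  obtain B where "\<And>x. \<bar>\<phi>t x\<bar> \<le> B" using \<phi>t_bounded by (auto simp: bounded_iff)
  then have "\<phi>t x \<le> max B 1" for x by (meson abs_le_D1 max.coboundedI1)
  then show ?thesis using that[of "max B 1"] by simp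
qed

text \<open>
  Ultracontractivity dominates the kernel uniformly in \<open>x\<close>, so that the left-hand side is continuous in \<open>x\<close>; two continuous
  functions that agree almost everywhere agree, since the measure has full support.
\<close>

lemma kop_continuous:
  fixes f :: "'a \<Rightarrow> real"
  assumes k: "continuous_positive_kernel k" "0 < t" and c: "0 < c" "\<And>x y. k t x y \<le> c * \<phi>t x * \<psi>t y"
    and f[measurable]: "f \<in> borel_measurable borel" and f0: "\<And>x. 0 < f x" and fin: "(\<integral>\<^sup>+y. ennreal (\<psi>t y * f y) \<partial>m) < \<infinity>"
    and h: "continuous_on UNIV h" "\<And>x. 0 \<le> h x" and AE: "AE x in m. kop m (k t) (\<lambda>y. ennreal (f y)) x = ennreal (h x)"
  shows "kop m (k t) (\<lambda>y. ennreal (f y)) x = ennreal (h x)"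
proof -
  obtain M where M: "0 < M" "\<And>x. \<phi>t x \<le> M" by (rule \<phi>t_bound) auto
  have k0: "0 \<le> k t x y" for x y using k by (auto simp: continuous_positive_kernel_def less_imp_le)
  have [measurable]: "k t x \<in> borel_measurable borel" for x
    using kernel_row_continuous[OF k] by (intro borel_measurable_continuous_onI)
  let ?w = "\<lambda>y. c * M * (\<psi>t y * f y)"
  have bound: "k t x y * f y \<le> ?w y" for x y
  proof -
    have "c * \<phi>t x * \<psi>t y \<le> c * M * \<psi>t y" using M c \<phi>t_facts(6)[of y] by (intro mult_right_mono mult_left_mono) auto
    then have "k t x y * f y \<le> c * M * \<psi>t y * f y" using c(2)[of x y] f0[of y] by (intro mult_right_mono) auto
    then show ?thesis by (simp add: mult.assoc)
  qed
  have "integrable m (\<lambda>y. \<psi>t y * f y)"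
    using fin \<phi>t_facts(6) f0 by (intro integrableI_nonneg) (auto simp: less_imp_le)
  then have iw: "integrable m ?w" by simp
  have ik: "integrable m (\<lambda>y. k t x y * f y)" for x
  proof (rule Bochner_Integration.integrable_bound[OF iw])
    have "norm (k t x y * f y) \<le> norm (?w y)" for y
    proof -
      have "0 \<le> k t x y * f y" using k0 f0 by (simp add: less_imp_le)
      then show ?thesis using bound[of x y] unfolding real_norm_def by linarith
    qed
    then show "AE y in m. norm (k t x y * f y) \<le> norm (?w y)" by simp
  qed measurable
  define G where "G x = (\<integral>y. k t x y * f y \<partial>m)" for x
  have G: "kop m (k t) (\<lambda>y. ennreal (f y)) x = ennreal (G x)" "0 \<le> G x" for x
  proof -
    have "kop m (k t) (\<lambda>y. ennreal (f y)) x = (\<integral>\<^sup>+y. ennreal (k t x y * f y) \<partial>m)"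
      unfolding kop_def using k0 f0 by (simp add: ennreal_mult less_imp_le)
    also have "\<dots> = ennreal (G x)" unfolding G_def using k0 f0 by (intro nn_integral_eq_integral ik) (auto simp: less_imp_le)
    finally show "kop m (k t) (\<lambda>y. ennreal (f y)) x = ennreal (G x)" .
    show "0 \<le> G x" unfolding G_def using k0 f0 by (simp add: less_imp_le)
  qed
  have Gc: "continuous_on UNIV G"
  proof (rule continuous_on_sequentiallyI)
    fix v a assume v: "v \<longlonglongrightarrow> (a::'a)"
    show "(\<lambda>n. G (v n)) \<longlonglongrightarrow> G a" unfolding G_def
    proof (rule integral_dominated_convergence[where w="?w"])
      show "AE y in m. (\<lambda>n. k t (v n) y * f y) \<longlonglongrightarrow> k t a y * f y"
        using continuous_on_tendsto_compose[OF kernel_row_continuous(2)[OF k] v] by (intro AE_I2 tendsto_intros) auto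
      show "\<And>n. AE y in m. norm (k t (v n) y * f y) \<le> ?w y"
        using k0 f0 bound by (intro AE_I2) (simp add: abs_mult less_imp_le)
    qed (use iw in auto)
  qed
  define U where "U = {x. G x \<noteq> h x}"
  have U: "open U" unfolding U_def using Gc h(1) by (rule open_Collect_neq)
  have "AE x in m. x \<notin> U" using AE
  proof eventually_elim
    case (elim x)
    then show ?case unfolding G(1) U_def using G(2)[of x] h(2)[of x] by simp
  qed
  then have "emeasure m U = 0" using AE_iff_measurable[of U m "\<lambda>y. y \<notin> U"] U by (simp add: sets_m)
  then have "U = {}" using full_support[OF U] by auto
  then have "G x = h x" unfolding U_def by auto
  then show ?thesis using G(1) by simp
qed

lemma p_eigen: assumes t: "0 < t" shows "kop m (p t) (\<lambda>y. ennreal (\<phi>t y)) x = ennreal (exp (lamt * t) * \<phi>t x)"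
proof -
  obtain c where c: "0 < c" "\<And>x y. p t x y \<le> c * \<phi>t x * \<psi>t y" using ultracontractive[OF t] by auto
  have AE: "AE x in m. kop m (p t) (\<lambda>y. ennreal (\<phi>t y)) x = ennreal (exp (lamt * t) * \<phi>t x)"
    using \<phi>t_facts(5) by (intro pS.eigenfunction_AE[OF \<phi>t_facts(1) _ t]) (auto simp: less_imp_le)
  show ?thesis
    by (rule kop_continuous[OF p t c _ _ product_finite _ _ AE])
      (use \<phi>t_facts(3,5,6) L2_facts in \<open>auto intro!: continuous_intros simp: less_imp_le\<close>)
qed

lemma p_dual_eigen: assumes t: "0 < t" shows "AE y in m. kop m (\<lambda>y x. p t x y) (\<lambda>x. ennreal (\<psi>t x)) y = ennreal (exp (lamt * t) * \<psi>t y)"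
  using pT.eigenfunction_AE[OF \<phi>t_facts(2) _ t] \<phi>t_facts(6) by (simp add: transpose_kernel_def[abs_def] less_imp_le)

lemma q_upper_by_p_eigenfunctions: assumes t: "0 < t" obtains c where "0 < c" "\<And>x y. q t x y \<le> c * \<phi>t x * \<psi>t y"
proof -
  obtain c where c: "0 < c" "\<And>x y. p t x y \<le> c * \<phi>t x * \<psi>t y" using ultracontractive[OF t] by auto
  show ?thesis
  proof (rule that[of "exp (K * t) * c"])
    fix x y
    have "q t x y \<le> exp (K * t) * p t x y" by (rule q_le_p_pointwise[OF t])
    also have "\<dots> \<le> exp (K * t) * (c * \<phi>t x * \<psi>t y)" using c(2) by (intro mult_left_mono) auto
    finally show "q t x y \<le> exp (K * t) * c * \<phi>t x * \<psi>t y" by (simp add: mult.assoc)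
  qed (use c in auto)
qed

lemma q_eigen: assumes t: "0 < t" shows "kop m (q t) (\<lambda>y. ennreal (\<phi> y)) x = ennreal (\<phi> x)"
proof -
  obtain c where c: "0 < c" "\<And>x y. q t x y \<le> c * \<phi>t x * \<psi>t y" using q_upper_by_p_eigenfunctions[OF t] by blast
  have AE: "AE x in m. kop m (q t) (\<lambda>y. ennreal (\<phi> y)) x = ennreal (\<phi> x)"
    using qS.eigenfunction_AE[OF \<phi>_facts(1) _ t] \<phi>_facts(5) by (simp add: less_imp_le)
  show ?thesis
    by (rule kop_continuous[OF q t c _ _ product_finite _ _ AE])
      (use \<phi>t_facts(3,5,6) \<phi>_facts(3,5) L2_facts in \<open>auto intro!: continuous_intros simp: less_imp_le\<close>)
qed

lemma q_dual:
  assumes t: "0 < t" and f[measurable]: "f \<in> borel_measurable borel"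
  shows "(\<integral>\<^sup>+x. ennreal (\<psi> x) * kop m (q t) f x \<partial>m) = (\<integral>\<^sup>+x. ennreal (\<psi> x) * f x \<partial>m)"
proof -
  have "AE y in m. kop m (transpose_kernel q t) (\<lambda>x. ennreal (\<psi> x)) y = ennreal (\<psi> y)"
    using qT.eigenfunction_AE[OF \<phi>_facts(2) _ t] \<phi>_facts(6) by (simp add: less_imp_le)
  then have AE: "AE y in m. kop m (\<lambda>y x. q t x y) (\<lambda>x. ennreal (\<psi> x)) y = ennreal (\<psi> y)"
    by (simp add: transpose_kernel_def[abs_def])
  have "(\<integral>\<^sup>+x. ennreal (\<psi> x) * kop m (q t) f x \<partial>m) = (\<integral>\<^sup>+y. f y * kop m (\<lambda>y x. q t x y) (\<lambda>x. ennreal (\<psi> x)) y \<partial>m)"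
    by (rule kop_adjoint[OF sigma kernel_measurable[OF sets_m q t]]) simp_all
  also have "\<dots> = (\<integral>\<^sup>+x. ennreal (\<psi> x) * f x \<partial>m)"
    using AE by (intro nn_integral_cong_AE) (auto elim!: eventually_mono simp: mult.commute)
  finally show ?thesis .
qed

text \<open>
  Choose a compact set \<open>C\<close> that carries all but a small part of \<open>\<phi>t * \<psi>t * m\<close>. Split \<open>h\<close> into three equal parts. By the eigenvalue
  equation and the upper bound, a path from \<open>x\<close> enters \<open>C\<close> in the first part with probability at least a multiple of \<open>\<phi>t x\<close>; dually, the
  last part leads from \<open>C\<close> to \<open>y\<close> with density at least a multiple of \<open>\<psi>t y\<close>. In between, the continuous positive kernel is bounded below on
  \<open>C \<times> C\<close>.
\<close>

lemma p_lower:
  assumes h: "0 < h"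
  shows "\<exists>c>0. \<forall>f\<in>borel_measurable borel. \<forall>x. ennreal (c * \<phi>t x) * (\<integral>\<^sup>+y. ennreal (\<psi>t y) * f y \<partial>m) \<le> kop m (p h) f x"
proof -
  define t where "t = h / 3"
  have t: "0 < t" "h = t + (t + t)" using h by (auto simp: t_def)
  obtain c0 where c0: "0 < c0" "\<And>x y. p t x y \<le> c0 * \<phi>t x * \<psi>t y" using ultracontractive[OF t(1)] by auto
  define e where "e = exp (lamt * t)"
  have e: "0 < e" by (simp add: e_def)
  have fp: "0 \<le> \<phi>t x" "0 \<le> \<psi>t x" "0 \<le> p t x y" for x y using \<phi>t_facts(5,6) p_pos[OF t(1)] by (auto simp: less_imp_le)
  obtain Cn :: "nat \<Rightarrow> 'a set" where Cn: "\<And>n. compact (Cn n)" "incseq Cn" "(\<Union>n. Cn n) = UNIV"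
    using compact_exhaustion[OF E] by blast
  have [measurable]: "Cn n \<in> sets borel" for n using Cn(1) by (intro borel_closed compact_imp_closed)
  have one: "(\<integral>\<^sup>+y. ennreal (\<phi>t y * \<psi>t y) \<partial>m) = 1"
    using \<phi>t_facts(7) fp by (intro nn_integral_of_integral_one) auto
  have "\<exists>n. (\<integral>\<^sup>+y. ennreal (\<phi>t y * \<psi>t y) * indicator (- Cn n) y \<partial>m) < ennreal (e / (2 * c0))"
  proof -
    let ?N = "density m (\<lambda>y. ennreal (\<phi>t y * \<psi>t y))"
    have "(\<lambda>n. emeasure ?N (- Cn n)) \<longlonglongrightarrow> emeasure ?N (\<Inter>n. - Cn n)"
    proof (rule Lim_emeasure_decseq)
      show "range (\<lambda>n. - Cn n) \<subseteq> sets ?N" by (auto simp: sets_m)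
      show "decseq (\<lambda>n. - Cn n)" using Cn(2) by (auto simp: decseq_def incseq_def)
      fix n
      have "emeasure ?N (- Cn n) \<le> (\<integral>\<^sup>+y. ennreal (\<phi>t y * \<psi>t y) \<partial>m)"
        by (subst emeasure_density) (auto simp: sets_m indicator_def intro!: nn_integral_mono)
      then show "emeasure ?N (- Cn n) \<noteq> \<infinity>" unfolding one by (auto simp: top_unique)
    qed
    moreover have "(\<Inter>n. - Cn n) = {}" using Cn(3) by auto
    ultimately have "(\<lambda>n. emeasure ?N (- Cn n)) \<longlonglongrightarrow> 0" by simp
    then have "\<forall>\<^sub>F n in sequentially. emeasure ?N (- Cn n) < ennreal (e / (2 * c0))"
      using e c0 by (intro order_tendstoD(2)) auto
    then obtain n where "emeasure ?N (- Cn n) < ennreal (e / (2 * c0))" by (meson eventually_happens' sequentially_bot)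
    then show ?thesis by (intro exI[of _ n]) (subst (asm) emeasure_density, auto simp: sets_m)
  qed
  then obtain n where n: "(\<integral>\<^sup>+y. ennreal (\<phi>t y * \<psi>t y) * indicator (- Cn n) y \<partial>m) \<le> ennreal (e / (2 * c0))" by (auto intro: less_imp_le)
  define C where "C = Cn n"
  have C: "compact C" and [measurable]: "C \<in> sets borel" by (simp_all add: C_def Cn(1))
  have tail: "(\<integral>\<^sup>+y. ennreal (\<phi>t y * \<psi>t y) * indicator (- C) y \<partial>m) \<le> ennreal (e / (2 * c0))"
    "(\<integral>\<^sup>+y. ennreal (\<psi>t y * \<phi>t y) * indicator (- C) y \<partial>m) \<le> ennreal (e / (2 * c0))"
    using n by (simp_all add: C_def mult.commute)
  obtain M where M: "0 < M" "\<And>x. \<phi>t x \<le> M" by (rule \<phi>t_bound) auto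
  obtain M' where M': "0 < M'" "\<And>x. x \<in> C \<Longrightarrow> \<psi>t x \<le> M'"
  proof -
    have "compact (\<psi>t ` C)" by (rule compact_continuous_image[OF continuous_on_subset[OF \<phi>t_facts(4)] C]) simp
    then have "bounded (\<psi>t ` C)" by (rule compact_imp_bounded)
    then obtain B where "\<And>x. x \<in> C \<Longrightarrow> \<bar>\<psi>t x\<bar> \<le> B" by (auto simp: bounded_iff)
    then have "\<psi>t x \<le> max B 1" if "x \<in> C" for x using that by (meson abs_le_D1 max.coboundedI1)
    then show ?thesis using that[of "max B 1"] by simp
  qed
  obtain \<epsilon> where \<epsilon>: "0 < \<epsilon>" "\<And>z w. z \<in> C \<Longrightarrow> w \<in> C \<Longrightarrow> \<epsilon> \<le> p t z w"
  proof (cases "C = {}")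
    case True then show ?thesis using that[of 1] by simp
  next
    case False
    have cont: "continuous_on (C \<times> C) (\<lambda>(x, y). p t x y)"
      using p t(1) by (auto simp: continuous_positive_kernel_def intro: continuous_on_subset)
    have "compact (C \<times> C)" by (rule compact_Times[OF C C])
    moreover have "C \<times> C \<noteq> {}" using False by auto
    ultimately obtain z where "z \<in> C \<times> C" and z: "\<forall>y\<in>C \<times> C. (\<lambda>(x, y). p t x y) z \<le> (\<lambda>(x, y). p t x y) y"
      using continuous_attains_inf[OF _ _ cont] by blast
    show ?thesis
    proof (rule that[of "p t (fst z) (snd z)"])
      show "0 < p t (fst z) (snd z)" by (rule p_pos[OF t(1)])
      fix a b assume "a \<in> C" "b \<in> C"
      then show "p t (fst z) (snd z) \<le> p t a b" using z[rule_format, of "(a, b)"] by (simp add: split_beta)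
    qed
  qed
  have [measurable]: "p t x \<in> borel_measurable borel" "(\<lambda>x. p t x y) \<in> borel_measurable borel" for x y
    using kernel_row_continuous[OF p t(1)] by (auto intro!: borel_measurable_continuous_onI)
  \<comment> \<open>The first part of the path ends in \<open>C\<close>.\<close>
  have a1: "ennreal (e / 2 * \<phi>t x / M) \<le> (\<integral>\<^sup>+z. ennreal (p t x z) * indicator C z \<partial>m)" for x
  proof (rule ennreal_div_le[OF M(1)])
    have "ennreal (e / 2 * \<phi>t x) \<le> (\<integral>\<^sup>+y. ennreal (p t x y) * ennreal (\<phi>t y) * indicator C y \<partial>m)"
      using p_eigen[OF t(1), of x] c0 e fp tail(2)
      by (intro compact_part_lower[where c=c0 and g=\<psi>t and k="p t x" and f=\<phi>t]) (auto simp: kop_def e_def sets_m)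
    also have "\<dots> \<le> (\<integral>\<^sup>+y. ennreal M * (ennreal (p t x y) * indicator C y) \<partial>m)"
    proof (intro nn_integral_mono)
      fix y show "ennreal (p t x y) * ennreal (\<phi>t y) * indicator C y \<le> ennreal M * (ennreal (p t x y) * indicator C y)"
        using mult_left_mono[OF ennreal_leI[OF M(2)[of y]], of "ennreal (p t x y) * indicator C y"] by (simp add: mult_ac)
    qed
    also have "\<dots> = ennreal M * (\<integral>\<^sup>+z. ennreal (p t x z) * indicator C z \<partial>m)" by (rule nn_integral_cmult) measurable
    finally show "ennreal (e / 2 * \<phi>t x) \<le> ennreal M * (\<integral>\<^sup>+z. ennreal (p t x z) * indicator C z \<partial>m)" .
  qed
  \<comment> \<open>The last part of the path starts in \<open>C\<close>.\<close>
  have a2: "AE y in m. ennreal (e / 2 * \<psi>t y / M') \<le> kop m (\<lambda>y x. p t x y) (indicator C) y"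
    using p_dual_eigen[OF t(1)]
  proof eventually_elim
    case (elim y)
    show ?case
    proof (rule ennreal_div_le[OF M'(1)])
      have "p t w y \<le> c0 * \<psi>t y * \<phi>t w" for w using c0(2)[of w y] by (simp add: mult_ac)
      then have "ennreal (e / 2 * \<psi>t y) \<le> (\<integral>\<^sup>+w. ennreal (p t w y) * ennreal (\<psi>t w) * indicator C w \<partial>m)"
        using elim c0 e fp tail(1)
        by (intro compact_part_lower[where c=c0 and g=\<phi>t and k="\<lambda>w. p t w y" and f=\<psi>t]) (auto simp: kop_def e_def sets_m)
      also have "\<dots> \<le> (\<integral>\<^sup>+w. ennreal M' * (ennreal (p t w y) * indicator C w) \<partial>m)"
      proof (intro nn_integral_mono)
        fix w show "ennreal (p t w y) * ennreal (\<psi>t w) * indicator C w \<le> ennreal M' * (ennreal (p t w y) * indicator C w)"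
          using mult_left_mono[OF ennreal_leI[OF M'(2)[of w]], of "ennreal (p t w y)"]
          by (cases "w \<in> C") (simp_all add: mult_ac)
      qed
      also have "\<dots> = ennreal M' * kop m (\<lambda>y x. p t x y) (indicator C) y" unfolding kop_def by (rule nn_integral_cmult) measurable
      finally show "ennreal (e / 2 * \<psi>t y) \<le> ennreal M' * kop m (\<lambda>y x. p t x y) (indicator C) y" .
    qed
  qed
  define c where "c = (e / 2 / M) * \<epsilon> * (e / 2 / M')"
  have "ennreal (c * \<phi>t x) * (\<integral>\<^sup>+y. ennreal (\<psi>t y) * f y \<partial>m) \<le> kop m (p h) f x" if f[measurable]: "f \<in> borel_measurable borel" for f x
  proof -
    have kf[measurable]: "kop m (p t) f \<in> borel_measurable borel" using pS.kop_meas[OF t(1), of f] f by simp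
    have kkf[measurable]: "kop m (p t) (kop m (p t) f) \<in> borel_measurable borel" using pS.kop_meas[OF t(1), of "kop m (p t) f"] kf by simp
    define W where "W = (\<integral>\<^sup>+w. indicator C w * kop m (p t) f w \<partial>m)"
    have Wl: "ennreal (e / 2 / M') * (\<integral>\<^sup>+y. ennreal (\<psi>t y) * f y \<partial>m) \<le> W"
    proof -
      have "ennreal (e / 2 / M') * (\<integral>\<^sup>+y. ennreal (\<psi>t y) * f y \<partial>m) = (\<integral>\<^sup>+y. f y * ennreal (e / 2 * \<psi>t y / M') \<partial>m)"
      proof (subst nn_integral_cmult[symmetric])
        have "ennreal (e / 2 * \<psi>t y / M') = ennreal (e / 2 / M') * ennreal (\<psi>t y)" for y
          using e M' fp(2)[of y] by (subst ennreal_mult[symmetric]) auto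
        then show "(\<integral>\<^sup>+y. ennreal (e / 2 / M') * (ennreal (\<psi>t y) * f y) \<partial>m) = (\<integral>\<^sup>+y. f y * ennreal (e / 2 * \<psi>t y / M') \<partial>m)"
          by (simp only: mult_ac)
      qed measurable
      also have "\<dots> \<le> (\<integral>\<^sup>+y. f y * kop m (\<lambda>y x. p t x y) (indicator C) y \<partial>m)"
        using a2 by (intro nn_integral_mono_AE) (auto elim!: eventually_mono intro!: mult_left_mono)
      also have "\<dots> = W" unfolding W_def by (rule kop_adjoint[OF sigma kernel_measurable[OF sets_m p t(1)], symmetric]) simp_all
      finally show ?thesis .
    qed
    have inner: "ennreal \<epsilon> * W \<le> kop m (p t) (kop m (p t) f) z" if z: "z \<in> C" for z
    proof -
      have "ennreal \<epsilon> * W = (\<integral>\<^sup>+w. ennreal \<epsilon> * (indicator C w * kop m (p t) f w) \<partial>m)" unfolding W_def by (rule nn_integral_cmult[symmetric]) measurable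
      also have "\<dots> \<le> (\<integral>\<^sup>+w. ennreal (p t z w) * kop m (p t) f w \<partial>m)"
        using \<epsilon>(2)[OF z] by (intro nn_integral_mono) (auto simp: indicator_def intro!: mult_right_mono ennreal_leI)
      finally show ?thesis by (simp add: kop_def)
    qed
    have "ennreal (c * \<phi>t x) * (\<integral>\<^sup>+y. ennreal (\<psi>t y) * f y \<partial>m) = ennreal (e / 2 * \<phi>t x / M) * (ennreal \<epsilon> * (ennreal (e / 2 / M') * (\<integral>\<^sup>+y. ennreal (\<psi>t y) * f y \<partial>m)))"
    proof -
      have "c * \<phi>t x = (e / 2 * \<phi>t x / M) * (\<epsilon> * (e / 2 / M'))" by (simp add: c_def)
      also have "ennreal \<dots> = ennreal (e / 2 * \<phi>t x / M) * (ennreal \<epsilon> * ennreal (e / 2 / M'))"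
        using e M M' \<epsilon> fp by (subst ennreal_mult, simp, simp, subst ennreal_mult) auto
      finally show ?thesis by (simp only: mult.assoc)
    qed
    also have "\<dots> \<le> (\<integral>\<^sup>+z. ennreal (p t x z) * indicator C z \<partial>m) * (ennreal \<epsilon> * W)"
      using Wl by (intro mult_mono a1 mult_left_mono) auto
    also have "\<dots> = (\<integral>\<^sup>+z. ennreal (p t x z) * indicator C z * (ennreal \<epsilon> * W) \<partial>m)" by (rule nn_integral_multc[symmetric]) measurable
    also have "\<dots> \<le> (\<integral>\<^sup>+z. ennreal (p t x z) * kop m (p t) (kop m (p t) f) z \<partial>m)"
      using inner by (intro nn_integral_mono) (auto simp: indicator_def intro!: mult_left_mono)
    also have "\<dots> = kop m (p h) f x"
    proof -
      have e1: "kop m (p (t + t)) f = kop m (p t) (kop m (p t) f)" by (rule ext) (rule p_semigroup[OF t(1) t(1) f])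
      have "kop m (p h) f x = kop m (p t) (kop m (p (t + t)) f) x"
        unfolding t(2) using t(1) by (intro p_semigroup f) auto
      then show ?thesis unfolding e1 by (simp add: kop_def)
    qed
    finally show ?thesis .
  qed
  moreover have "0 < c" using e M M' \<epsilon> by (simp add: c_def)
  ultimately show ?thesis by blast
qed

lemma \<psi>t_integrable: "(\<integral>\<^sup>+y. ennreal (\<psi>t y) \<partial>m) < \<infinity>"
proof -
  obtain c where c: "0 < c" "\<And>f x. f \<in> borel_measurable borel \<Longrightarrow> ennreal (c * \<phi>t x) * (\<integral>\<^sup>+y. ennreal (\<psi>t y) * f y \<partial>m) \<le> kop m (p 1) f x"
    using p_lower[of 1] by auto
  have "ennreal (c * \<phi>t undefined) * (\<integral>\<^sup>+y. ennreal (\<psi>t y) * 1 \<partial>m) \<le> kop m (p 1) (\<lambda>_. 1) undefined" by (rule c(2)) simp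
  also have "\<dots> \<le> 1" using p_row[of 1] by (simp add: kop_def)
  finally have "ennreal (c * \<phi>t undefined) * (\<integral>\<^sup>+y. ennreal (\<psi>t y) \<partial>m) < \<infinity>" by (simp add: le_less_trans)
  moreover have "0 < c * \<phi>t undefined" using c(1) \<phi>t_facts(5) by simp
  ultimately show ?thesis by (auto simp: ennreal_mult_less_top ennreal_eq_0_iff)
qed

lemma ennreal_invert:
  assumes "0 < a" "ennreal a * x \<le> y" shows "x \<le> ennreal (1 / a) * y"
proof -
  have "ennreal (1 / a) * (ennreal a * x) \<le> ennreal (1 / a) * y" by (intro mult_left_mono assms(2)) simp
  moreover have "ennreal (1 / a) * (ennreal a * x) = x" using assms(1) by (simp add: mult.assoc[symmetric] ennreal_mult[symmetric])
  ultimately show ?thesis by simp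
qed

text \<open>
  The bounds for \<open>p\<close>, transferred by comparability of the two operators.
\<close>

lemma q_bounds_by_p_eigenfunctions:
  assumes h: "0 < h"
  obtains c C where "0 < c" "0 < C"
    "\<And>f x. f \<in> borel_measurable borel \<Longrightarrow> ennreal (c * \<phi>t x) * (\<integral>\<^sup>+y. ennreal (\<psi>t y) * f y \<partial>m) \<le> kop m (q h) f x"
    "\<And>f x. f \<in> borel_measurable borel \<Longrightarrow> kop m (q h) f x \<le> ennreal (C * \<phi>t x) * (\<integral>\<^sup>+y. ennreal (\<psi>t y) * f y \<partial>m)"
proof -
  obtain C where C: "0 < C" "\<And>x y. q h x y \<le> C * \<phi>t x * \<psi>t y" using q_upper_by_p_eigenfunctions[OF h] by blast
  obtain c where c: "0 < c" "\<And>f x. f \<in> borel_measurable borel \<Longrightarrow> ennreal (c * \<phi>t x) * (\<integral>\<^sup>+y. ennreal (\<psi>t y) * f y \<partial>m) \<le> kop m (p h) f x"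
    using p_lower[OF h] by auto
  show ?thesis
  proof (rule that[of "1 / exp (K * h) * c" C])
    fix f :: "'a \<Rightarrow> ennreal" and x assume f[measurable]: "f \<in> borel_measurable borel"
    let ?I = "\<integral>\<^sup>+y. ennreal (\<psi>t y) * f y \<partial>m"
    have "ennreal (c * \<phi>t x) * ?I \<le> ennreal (exp (K * h)) * kop m (q h) f x"
      using c(2)[OF f, of x] p_le_q[OF h f, of x] by (rule order_trans)
    then have "ennreal (1 / exp (K * h)) * (ennreal (c * \<phi>t x) * ?I) \<le> ennreal (1 / exp (K * h)) * (ennreal (exp (K * h)) * kop m (q h) f x)"
      by (intro mult_left_mono) auto
    moreover have "ennreal (1 / exp (K * h)) * (ennreal (exp (K * h)) * kop m (q h) f x) = kop m (q h) f x"
      by (simp add: mult.assoc[symmetric] ennreal_mult[symmetric])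
    moreover have "ennreal (1 / exp (K * h)) * (ennreal (c * \<phi>t x) * ?I) = ennreal (1 / exp (K * h) * c * \<phi>t x) * ?I"
      using c(1) \<phi>t_facts(5)[of x] by (simp only: mult.assoc[symmetric] ennreal_mult[symmetric]) (subst ennreal_mult[symmetric], auto simp: less_imp_le)
    ultimately show "ennreal (1 / exp (K * h) * c * \<phi>t x) * ?I \<le> kop m (q h) f x" by simp
    have "kop m (q h) f x \<le> (\<integral>\<^sup>+y. ennreal (C * \<phi>t x) * (ennreal (\<psi>t y) * f y) \<partial>m)"
      unfolding kop_def
    proof (intro nn_integral_mono)
      fix y
      have "ennreal (q h x y) \<le> ennreal (C * \<phi>t x * \<psi>t y)" by (intro ennreal_leI C)
      also have "\<dots> = ennreal (C * \<phi>t x) * ennreal (\<psi>t y)" using C(1) \<phi>t_facts(5,6) by (intro ennreal_mult) (auto simp: less_imp_le)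
      finally show "ennreal (q h x y) * f y \<le> ennreal (C * \<phi>t x) * (ennreal (\<psi>t y) * f y)"
        by (simp add: mult.assoc[symmetric] mult_right_mono)
    qed
    also have "\<dots> = ennreal (C * \<phi>t x) * ?I" by (rule nn_integral_cmult) measurable
    finally show "kop m (q h) f x \<le> ennreal (C * \<phi>t x) * ?I" .
  qed (use c C in auto)
qed

text \<open>
  Apply the two-sided bounds at time \<open>1\<close> to \<open>\<phi>\<close>, which the operator reproduces.
\<close>

lemma eigenfunctions_comparable:
  obtains r s where "0 < r" "0 < s" "\<And>x. r * \<phi>t x \<le> \<phi> x" "\<And>x. \<phi> x \<le> s * \<phi>t x"
proof -
  obtain c C where cC: "0 < c" "0 < C"
    "\<And>f x. f \<in> borel_measurable borel \<Longrightarrow> ennreal (c * \<phi>t x) * (\<integral>\<^sup>+y. ennreal (\<psi>t y) * f y \<partial>m) \<le> kop m (q 1) f x"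
    "\<And>f x. f \<in> borel_measurable borel \<Longrightarrow> kop m (q 1) f x \<le> ennreal (C * \<phi>t x) * (\<integral>\<^sup>+y. ennreal (\<psi>t y) * f y \<partial>m)"
    by (rule q_bounds_by_p_eigenfunctions[OF zero_less_one]) (rule that)
  define A where "A = (\<integral>\<^sup>+y. ennreal (\<psi>t y * \<phi> y) \<partial>m)"
  have A: "0 < A" unfolding A_def using \<phi>t_facts(6) \<phi>_facts(5) by (intro m_positive) auto
  have A': "A < \<infinity>" unfolding A_def
    by (rule product_finite[OF _ _ _ _ L2_facts(2,3)]) (use \<phi>t_facts(6) \<phi>_facts(5) in auto)
  with A obtain Ar where Ar: "A = ennreal Ar" "0 < Ar" by (cases A) auto
  have eqA: "(\<integral>\<^sup>+y. ennreal (\<psi>t y) * ennreal (\<phi> y) \<partial>m) = ennreal Ar"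
    using \<phi>t_facts(6) \<phi>_facts(5) Ar(1) unfolding A_def by (simp add: ennreal_mult less_imp_le)
  show ?thesis
  proof (rule that[of "c * Ar" "C * Ar"])
    fix x
    have "ennreal (c * \<phi>t x) * ennreal Ar \<le> ennreal (\<phi> x)" "ennreal (\<phi> x) \<le> ennreal (C * \<phi>t x) * ennreal Ar"
      using cC(3)[of "\<lambda>y. ennreal (\<phi> y)" x] cC(4)[of "\<lambda>y. ennreal (\<phi> y)" x] q_eigen[of 1 x] by (simp_all add: eqA)
    then have "c * \<phi>t x * Ar \<le> \<phi> x" "\<phi> x \<le> C * \<phi>t x * Ar"
      using cC(1,2) \<phi>t_facts(5)[of x] \<phi>_facts(5)[of x] Ar(2)
      by (auto simp: ennreal_mult[symmetric] less_imp_le)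
    then show "c * Ar * \<phi>t x \<le> \<phi> x" "\<phi> x \<le> C * Ar * \<phi>t x" by (simp_all add: mult_ac)
  qed (use cC Ar in auto)
qed

text \<open>
  Integrate the two-sided bounds at time \<open>1\<close> against \<open>\<psi>\<close>, which is invariant. Comparing \<open>\<psi>\<close> with \<open>\<psi>t\<close> as measures
  avoids a pointwise form of the dual eigenvalue equation.
\<close>

lemma dual_eigenfunctions_comparable:
  obtains r s where "0 < r" "0 < s"
    "\<And>f. f \<in> borel_measurable borel \<Longrightarrow> ennreal r * (\<integral>\<^sup>+y. ennreal (\<psi>t y) * f y \<partial>m) \<le> (\<integral>\<^sup>+y. ennreal (\<psi> y) * f y \<partial>m)"
    "\<And>f. f \<in> borel_measurable borel \<Longrightarrow> (\<integral>\<^sup>+y. ennreal (\<psi> y) * f y \<partial>m) \<le> ennreal s * (\<integral>\<^sup>+y. ennreal (\<psi>t y) * f y \<partial>m)"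
proof -
  obtain c C where cC: "0 < c" "0 < C"
    "\<And>f x. f \<in> borel_measurable borel \<Longrightarrow> ennreal (c * \<phi>t x) * (\<integral>\<^sup>+y. ennreal (\<psi>t y) * f y \<partial>m) \<le> kop m (q 1) f x"
    "\<And>f x. f \<in> borel_measurable borel \<Longrightarrow> kop m (q 1) f x \<le> ennreal (C * \<phi>t x) * (\<integral>\<^sup>+y. ennreal (\<psi>t y) * f y \<partial>m)"
    by (rule q_bounds_by_p_eigenfunctions[OF zero_less_one]) (rule that)
  define B where "B = (\<integral>\<^sup>+y. ennreal (\<psi> y * \<phi>t y) \<partial>m)"
  have B: "0 < B" unfolding B_def using \<phi>t_facts(5) \<phi>_facts(6) by (intro m_positive) auto
  have B': "B < \<infinity>" unfolding B_def
    by (rule product_finite[OF _ _ _ _ L2_facts(4,1)]) (use \<phi>t_facts(5) \<phi>_facts(6) in auto)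
  with B obtain Br where Br: "B = ennreal Br" "0 < Br" by (cases B) auto
  have eqB: "(\<integral>\<^sup>+x. ennreal (\<psi> x) * (ennreal (a * \<phi>t x) * J) \<partial>m) = ennreal (a * Br) * J" if "0 < a" for a J
  proof -
    have "(\<integral>\<^sup>+x. ennreal (\<psi> x) * (ennreal (a * \<phi>t x) * J) \<partial>m) = (\<integral>\<^sup>+x. (ennreal a * J) * ennreal (\<psi> x * \<phi>t x) \<partial>m)"
      using that \<phi>t_facts(5) \<phi>_facts(6) by (simp add: ennreal_mult less_imp_le mult_ac)
    also have "\<dots> = (ennreal a * J) * ennreal Br" unfolding Br(1)[symmetric] B_def by (rule nn_integral_cmult) measurable
    finally show ?thesis using that Br(2) by (simp add: ennreal_mult less_imp_le mult_ac)
  qed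
  show ?thesis
  proof (rule that[of "c * Br" "C * Br"])
    fix f :: "'a \<Rightarrow> ennreal" assume f[measurable]: "f \<in> borel_measurable borel"
    have "ennreal (c * Br) * (\<integral>\<^sup>+y. ennreal (\<psi>t y) * f y \<partial>m) \<le> (\<integral>\<^sup>+x. ennreal (\<psi> x) * kop m (q 1) f x \<partial>m)"
      unfolding eqB[OF cC(1), symmetric] by (intro nn_integral_mono mult_left_mono cC(3) f) auto
    then show "ennreal (c * Br) * (\<integral>\<^sup>+y. ennreal (\<psi>t y) * f y \<partial>m) \<le> (\<integral>\<^sup>+y. ennreal (\<psi> y) * f y \<partial>m)" using q_dual[of 1 f] by simp
    have "(\<integral>\<^sup>+x. ennreal (\<psi> x) * kop m (q 1) f x \<partial>m) \<le> ennreal (C * Br) * (\<integral>\<^sup>+y. ennreal (\<psi>t y) * f y \<partial>m)"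
      unfolding eqB[OF cC(2), symmetric] by (intro nn_integral_mono mult_left_mono cC(4) f) auto
    then show "(\<integral>\<^sup>+y. ennreal (\<psi> y) * f y \<partial>m) \<le> ennreal (C * Br) * (\<integral>\<^sup>+y. ennreal (\<psi>t y) * f y \<partial>m)" using q_dual[of 1 f] by simp
  qed (use cC Br in auto)
qed

lemma \<phi>_bound: obtains \<Phi> where "0 < \<Phi>" "\<And>x. \<phi> x \<le> \<Phi>"
proof -
  obtain r s where rs': "0 < r" and rs: "0 < s" and rs'': "\<And>x. r * \<phi>t x \<le> \<phi> x" and rs2: "\<And>x. \<phi> x \<le> s * \<phi>t x"
    by (rule eigenfunctions_comparable) (rule that)
  obtain M where M: "0 < M" "\<And>x. \<phi>t x \<le> M" by (rule \<phi>t_bound) auto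
  show ?thesis
  proof (rule that[of "s * M"])
    show "\<phi> x \<le> s * M" for x using rs2[of x] mult_left_mono[OF M(2)[of x], of s] rs by linarith
  qed (use rs M in auto)
qed

lemma \<psi>_integrable: "(\<integral>\<^sup>+y. ennreal (\<psi> y) \<partial>m) < \<infinity>"
proof -
  obtain r s where "0 < r" "0 < s"
    "\<And>f. f \<in> borel_measurable borel \<Longrightarrow> ennreal r * (\<integral>\<^sup>+y. ennreal (\<psi>t y) * f y \<partial>m) \<le> (\<integral>\<^sup>+y. ennreal (\<psi> y) * f y \<partial>m)"
    and s: "\<And>f. f \<in> borel_measurable borel \<Longrightarrow> (\<integral>\<^sup>+y. ennreal (\<psi> y) * f y \<partial>m) \<le> ennreal s * (\<integral>\<^sup>+y. ennreal (\<psi>t y) * f y \<partial>m)"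
    by (rule dual_eigenfunctions_comparable) (rule that)
  have "(\<integral>\<^sup>+y. ennreal (\<psi> y) * 1 \<partial>m) \<le> ennreal s * (\<integral>\<^sup>+y. ennreal (\<psi>t y) * 1 \<partial>m)" by (rule s) simp
  then show ?thesis using \<psi>t_integrable by (auto intro: le_less_trans simp: ennreal_mult_less_top)
qed

text \<open>
  Intrinsic ultracontractivity of the Feynman-Kac semigroup with respect to its own eigenfunctions: replace \<open>\<phi>t\<close> and \<open>\<psi>t\<close> in the
  two-sided bounds by the comparable \<open>\<phi>\<close> and \<open>\<psi>\<close>.
\<close>

lemma intrinsic_bounds:
  assumes h: "0 < h"
  obtains \<epsilon> C where "0 < \<epsilon>" "0 < C"
    "\<And>f x. f \<in> borel_measurable borel \<Longrightarrow> ennreal (\<epsilon> * \<phi> x) * (\<integral>\<^sup>+y. ennreal (\<psi> y) * f y \<partial>m) \<le> kop m (q h) f x"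
    "\<And>f x. f \<in> borel_measurable borel \<Longrightarrow> kop m (q h) f x \<le> ennreal (C * \<phi> x) * (\<integral>\<^sup>+y. ennreal (\<psi> y) * f y \<partial>m)"
proof -
  obtain c C where cC: "0 < c" "0 < C"
    "\<And>f x. f \<in> borel_measurable borel \<Longrightarrow> ennreal (c * \<phi>t x) * (\<integral>\<^sup>+y. ennreal (\<psi>t y) * f y \<partial>m) \<le> kop m (q h) f x"
    "\<And>f x. f \<in> borel_measurable borel \<Longrightarrow> kop m (q h) f x \<le> ennreal (C * \<phi>t x) * (\<integral>\<^sup>+y. ennreal (\<psi>t y) * f y \<partial>m)"
    by (rule q_bounds_by_p_eigenfunctions[OF h]) (rule that)
  obtain r s where rs: "0 < r" "0 < s" "\<And>x. r * \<phi>t x \<le> \<phi> x" "\<And>x. \<phi> x \<le> s * \<phi>t x"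
    by (rule eigenfunctions_comparable) (rule that)
  obtain r' s' where rs': "0 < r'" "0 < s'"
    "\<And>f. f \<in> borel_measurable borel \<Longrightarrow> ennreal r' * (\<integral>\<^sup>+y. ennreal (\<psi>t y) * f y \<partial>m) \<le> (\<integral>\<^sup>+y. ennreal (\<psi> y) * f y \<partial>m)"
    "\<And>f. f \<in> borel_measurable borel \<Longrightarrow> (\<integral>\<^sup>+y. ennreal (\<psi> y) * f y \<partial>m) \<le> ennreal s' * (\<integral>\<^sup>+y. ennreal (\<psi>t y) * f y \<partial>m)"
    by (rule dual_eigenfunctions_comparable) (rule that)
  show ?thesis
  proof (rule that[of "c / s * (1 / s')" "C / r * (1 / r')"])
    fix f :: "'a \<Rightarrow> ennreal" and x assume f: "f \<in> borel_measurable borel"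
    let ?I = "\<integral>\<^sup>+y. ennreal (\<psi>t y) * f y \<partial>m" and ?J = "\<integral>\<^sup>+y. ennreal (\<psi> y) * f y \<partial>m"
    have \<phi>0: "0 \<le> \<phi> x" using \<phi>_facts(5)[of x] by simp
    have "ennreal (c / s * (1 / s') * \<phi> x) * ?J = ennreal (c / s * \<phi> x) * (ennreal (1 / s') * ?J)"
    proof -
      have "c / s * (1 / s') * \<phi> x = (c / s * \<phi> x) * (1 / s')" by simp
      also have "ennreal \<dots> = ennreal (c / s * \<phi> x) * ennreal (1 / s')" using cC rs rs' \<phi>0 by (intro ennreal_mult) auto
      finally show ?thesis by (simp only: mult.assoc)
    qed
    also have "\<dots> \<le> ennreal (c * \<phi>t x) * ?I"
    proof (rule mult_mono)
      have "c / s * \<phi> x \<le> c / s * (s * \<phi>t x)" using rs cC by (intro mult_left_mono) auto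
      then show "ennreal (c / s * \<phi> x) \<le> ennreal (c * \<phi>t x)" using rs by (intro ennreal_leI) simp
      have "ennreal (1 / s') * ?J \<le> ennreal (1 / s') * (ennreal s' * ?I)" by (intro mult_left_mono rs'(4) f) simp
      also have "\<dots> = ?I" using rs'(2) by (simp add: mult.assoc[symmetric] ennreal_mult[symmetric])
      finally show "ennreal (1 / s') * ?J \<le> ?I" .
    qed auto
    also have "\<dots> \<le> kop m (q h) f x" by (rule cC(3)[OF f])
    finally show "ennreal (c / s * (1 / s') * \<phi> x) * ?J \<le> kop m (q h) f x" .
    have "kop m (q h) f x \<le> ennreal (C * \<phi>t x) * ?I" by (rule cC(4)[OF f])
    also have "\<dots> \<le> ennreal (C / r * \<phi> x) * (ennreal (1 / r') * ?J)"
    proof (rule mult_mono)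
      have "C / r * (r * \<phi>t x) \<le> C / r * \<phi> x" using rs cC by (intro mult_left_mono) auto
      then show "ennreal (C * \<phi>t x) \<le> ennreal (C / r * \<phi> x)" using rs by (intro ennreal_leI) simp
      show "?I \<le> ennreal (1 / r') * ?J" by (rule ennreal_invert[OF rs'(1) rs'(3)[OF f]])
    qed auto
    also have "\<dots> = ennreal (C / r * (1 / r') * \<phi> x) * ?J"
    proof -
      have "C / r * (1 / r') * \<phi> x = (C / r * \<phi> x) * (1 / r')" by simp
      also have "ennreal \<dots> = ennreal (C / r * \<phi> x) * ennreal (1 / r')" using cC rs rs' \<phi>0 by (intro ennreal_mult) auto
      finally show ?thesis by (simp only: mult.assoc)
    qed
    finally show "kop m (q h) f x \<le> ennreal (C / r * (1 / r') * \<phi> x) * ?J" .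
  qed (use cC rs rs' in auto)
qed

end

section \<open>The nonlinear part of the branching mechanism\<close>

lemma nn_integral_is_kernel_measurable:
  assumes k: "is_kernel M N k" and f: "f \<in> borel_measurable N"
  shows "(\<lambda>x. \<integral>\<^sup>+y. f y \<partial>k x) \<in> borel_measurable M"
  using f
proof (induction rule: borel_measurable_induct)
  case (cong f g)
  have "(\<integral>\<^sup>+y. f y \<partial>k x) = (\<integral>\<^sup>+y. g y \<partial>k x)" if "x \<in> space M" for x
  proof (rule nn_integral_cong)
    fix y assume "y \<in> space (k x)"
    moreover have "space (k x) = space N" using k that by (intro sets_eq_imp_space_eq) (auto simp: is_kernel_def)
    ultimately show "f y = g y" using cong by simp
  qed
  then show ?case using cong(4) by (simp cong: measurable_cong)
next
  case (set A)
  have "(\<integral>\<^sup>+y. indicator A y \<partial>k x) = emeasure (k x) A" if "x \<in> space M" for x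
    using k that set by (intro nn_integral_indicator) (auto simp: is_kernel_def)
  then show ?case using k set by (simp cong: measurable_cong add: is_kernel_def)
next
  case (mult u c)
  have "(\<integral>\<^sup>+y. c * u y \<partial>k x) = c * (\<integral>\<^sup>+y. u y \<partial>k x)" if "x \<in> space M" for x
    using k that mult(2) by (intro nn_integral_cmult) (auto simp: is_kernel_def cong: measurable_cong_sets)
  then show ?case using mult(4) by (simp cong: measurable_cong)
next
  case (add u v)
  have m: "u \<in> borel_measurable N" "v \<in> borel_measurable N" by fact+
  have "(\<integral>\<^sup>+y. v y + u y \<partial>k x) = (\<integral>\<^sup>+y. v y \<partial>k x) + (\<integral>\<^sup>+y. u y \<partial>k x)" if "x \<in> space M" for x
    using k that m by (intro nn_integral_add) (auto simp: is_kernel_def cong: measurable_cong_sets)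
  then show ?case using add.IH by (simp cong: measurable_cong)
next
  case (seq U)
  have "(\<integral>\<^sup>+y. (SUP i. U i) y \<partial>k x) = (SUP i. \<integral>\<^sup>+y. U i y \<partial>k x)" if "x \<in> space M" for x
    using k that seq(1,3) by (simp add: image_comp) (intro nn_integral_monotone_convergence_SUP, auto simp: is_kernel_def cong: measurable_cong_sets)
  then show ?case using seq.IH by (simp cong: measurable_cong)
qed

text \<open>
  The integrand of the jump part of the branching mechanism, with the argument \<open>z\<close> first.
\<close>

definition levy_int :: "real \<Rightarrow> real \<Rightarrow> real" where "levy_int z y = exp (- z * y) - 1 + z * y"

lemma levy_int_nonneg: "0 \<le> levy_int z y"
  using exp_ge_add_one_self[of "- z * y"] by (simp add: levy_int_def)

lemma levy_int_le: assumes "0 \<le> z * y" shows "levy_int z y \<le> z\<^sup>2 * y\<^sup>2 / 2"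
proof -
  define s where "s = z * y"
  have s: "0 \<le> s" using assms by (simp add: s_def)
  have "(1 - s + s\<^sup>2 / 2) * (1 + s + s\<^sup>2 / 2) = 1 + (s\<^sup>2 / 2)\<^sup>2" by (simp add: power2_eq_square field_simps)
  then have "1 \<le> (1 - s + s\<^sup>2 / 2) * (1 + s + s\<^sup>2 / 2)" by simp
  moreover have p: "0 \<le> 1 - s + s\<^sup>2 / 2"
  proof -
    have "0 \<le> ((1 - s)\<^sup>2 + 1) / 2" by simp
    then show ?thesis by (simp add: power2_eq_square field_simps)
  qed
  ultimately have "1 \<le> (1 - s + s\<^sup>2 / 2) * exp s"
    using mult_left_mono[OF exp_lower_Taylor_quadratic[OF s] p] by linarith
  then have "exp (- s) \<le> 1 - s + s\<^sup>2 / 2" by (simp add: exp_minus divide_simps)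
  then show ?thesis unfolding levy_int_def s_def by (simp add: power_mult_distrib)
qed

lemma levy_int_mono: assumes "0 \<le> z" "z \<le> z'" "0 \<le> y" shows "levy_int z y \<le> levy_int z' y"
proof -
  define s s' where "s = z * y" and "s' = z' * y"
  have s: "0 \<le> s" "s \<le> s'" using assms by (auto simp: s_def s'_def mult_right_mono)
  have "exp (- s) * (1 + (s - s')) \<le> exp (- s) * exp (s - s')" by (intro mult_left_mono exp_ge_add_one_self) simp
  then have "exp (- s) - exp (- s') \<le> exp (- s) * (s' - s)" by (simp add: exp_add[symmetric] algebra_simps)
  also have "\<dots> \<le> 1 * (s' - s)" using s by (intro mult_right_mono) auto
  finally show ?thesis unfolding levy_int_def by (simp add: s_def s'_def)
qed

lemma levy_int_limit: assumes "0 < k" shows "((\<lambda>c. levy_int c k / c\<^sup>2) \<longlongrightarrow> k\<^sup>2 / 2) (at_right 0)"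
proof -
  have "((\<lambda>c. levy_int c k / c\<^sup>2) \<longlongrightarrow> k * k / 2) (at_right 0)"
    unfolding levy_int_def using assms by real_asymp
  then show ?thesis by (simp add: power2_eq_square)
qed

text \<open>
  The branching mechanism times \<open>\<beta>\<close>, without its linear term.
\<close>

definition nonlin :: "('a \<Rightarrow> real) \<Rightarrow> ('a \<Rightarrow> real) \<Rightarrow> ('a \<Rightarrow> real measure) \<Rightarrow> 'a \<Rightarrow> real \<Rightarrow> real" where
  "nonlin \<beta> b n x z = \<beta> x * (b x * z\<^sup>2 + (\<integral>y. levy_int z y \<partial>n x))"

lemma Psi_Some: "Psi \<beta> a b n (Some x) z = nonlin \<beta> b n x z - \<beta> x * a x * z"
  by (simp add: Psi_def ext0_def branching_mechanism_def nonlin_def levy_int_def algebra_simps)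

lemma Psi_None: "Psi \<beta> a b n None z = 0"
  by (simp add: Psi_def ext0_def)

locale branching =
  fixes \<beta> b :: "'a::topological_space \<Rightarrow> real" and n :: "'a \<Rightarrow> real measure"
  assumes \<beta>: "\<beta> \<in> bounded_borel_nonneg" and b: "b \<in> bounded_borel_nonneg"
    and n: "is_kernel borel (restrict_space borel {0<..}) n"
    and n_sq: "(SUP x. \<integral>\<^sup>+y. ennreal (y\<^sup>2) \<partial>n x) < \<infinity>"
begin

abbreviation R where "R \<equiv> nonlin \<beta> b n"
abbreviation A where "A \<equiv> variance_A \<beta> b n"

lemma \<beta>_meas [measurable]: "\<beta> \<in> borel_measurable borel" and b_meas [measurable]: "b \<in> borel_measurable borel"
  and \<beta>_nonneg: "0 \<le> \<beta> x" and b_nonneg: "0 \<le> b x"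
  using \<beta> b by (auto simp: bounded_borel_nonneg_def bounded_borel_def)

lemma sets_n [measurable_cong]: "sets (n x) = sets (restrict_space borel {0<..})"
  using n by (simp add: is_kernel_def)

lemma space_n: "space (n x) = {0<..}"
  using sets_eq_imp_space_eq[OF sets_n, of x] by (simp add: space_restrict_space)

lemma borel_n: "f \<in> borel_measurable borel \<Longrightarrow> f \<in> borel_measurable (n x)"
  by (subst measurable_cong_sets[OF sets_n refl]) (rule measurable_restrict_space1)

lemma sq_finite: obtains C where "0 < C" "\<And>x. (\<integral>\<^sup>+y. ennreal (y\<^sup>2) \<partial>n x) \<le> ennreal C"
proof -
  obtain C where C: "(SUP x. \<integral>\<^sup>+y. ennreal (y\<^sup>2) \<partial>n x) = ennreal C" "0 \<le> C"
    using n_sq by (cases "SUP x. \<integral>\<^sup>+y. ennreal (y\<^sup>2) \<partial>n x") auto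
  have "(\<integral>\<^sup>+y. ennreal (y\<^sup>2) \<partial>n x) \<le> ennreal (C + 1)" for x
  proof -
    have "(\<integral>\<^sup>+y. ennreal (y\<^sup>2) \<partial>n x) \<le> (SUP x. \<integral>\<^sup>+y. ennreal (y\<^sup>2) \<partial>n x)" by (rule SUP_upper) simp
    also have "\<dots> \<le> ennreal (C + 1)" unfolding C(1) by (rule ennreal_leI) simp
    finally show ?thesis .
  qed
  then show ?thesis using that[of "C + 1"] C(2) by simp
qed

lemma sq_integrable: "integrable (n x) (\<lambda>y. y\<^sup>2)"
proof (rule integrableI_nonneg)
  show "(\<lambda>y. y\<^sup>2) \<in> borel_measurable (n x)" by (rule borel_n) measurable
  obtain C where "0 < C" "\<And>x. (\<integral>\<^sup>+y. ennreal (y\<^sup>2) \<partial>n x) \<le> ennreal C" by (rule sq_finite) (rule that)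
  from le_less_trans[OF this(2) ennreal_less_top]
  show "(\<integral>\<^sup>+y. ennreal (y\<^sup>2) \<partial>n x) < \<infinity>" by simp
qed simp

lemma levy_measurable: "levy_int z \<in> borel_measurable (n x)"
  by (rule borel_n) (simp add: levy_int_def[abs_def])

lemma levy_integrable: assumes "0 \<le> z" shows "integrable (n x) (levy_int z)"
proof (rule Bochner_Integration.integrable_bound)
  show "integrable (n x) (\<lambda>y. z\<^sup>2 * y\<^sup>2 / 2)" using sq_integrable by simp
  show "AE y in n x. norm (levy_int z y) \<le> norm (z\<^sup>2 * y\<^sup>2 / 2)"
    using levy_int_nonneg levy_int_le[of z] assms by (intro AE_I2) (auto simp: space_n)
qed (rule levy_measurable)

lemma R_nonneg: "0 \<le> R x z"
  unfolding nonlin_def using \<beta>_nonneg b_nonneg levy_int_nonneg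
  by (intro mult_nonneg_nonneg add_nonneg_nonneg Bochner_Integration.integral_nonneg) auto

lemma R_le: assumes "0 \<le> z" shows "R x z \<le> A x / 2 * z\<^sup>2"
proof -
  have "(\<integral>y. levy_int z y \<partial>n x) \<le> (\<integral>y. z\<^sup>2 * y\<^sup>2 / 2 \<partial>n x)"
    using assms sq_integrable levy_int_le[of z] by (intro integral_mono levy_integrable) (auto simp: space_n)
  also have "\<dots> = z\<^sup>2 / 2 * (\<integral>y. y\<^sup>2 \<partial>n x)" by simp
  finally have "R x z \<le> \<beta> x * (b x * z\<^sup>2 + z\<^sup>2 / 2 * (\<integral>y. y\<^sup>2 \<partial>n x))"
    unfolding nonlin_def using \<beta>_nonneg by (intro mult_left_mono add_left_mono) auto
  also have "\<dots> = A x / 2 * z\<^sup>2" by (simp add: variance_A_def field_simps)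
  finally show ?thesis .
qed

lemma R_mono: assumes "0 \<le> z" "z \<le> z'" shows "R x z \<le> R x z'"
  unfolding nonlin_def using assms \<beta>_nonneg b_nonneg levy_int_mono[OF assms]
  by (intro mult_left_mono add_mono power_mono integral_mono levy_integrable) (auto simp: space_n)

lemma A_nonneg: "0 \<le> A x"
  unfolding variance_A_def using \<beta>_nonneg b_nonneg by (intro mult_nonneg_nonneg add_nonneg_nonneg) auto

lemma A_measurable [measurable]: "A \<in> borel_measurable borel"
proof -
  have "(\<lambda>y. ennreal (y\<^sup>2)) \<in> borel_measurable (restrict_space borel {0<..})" by (rule measurable_restrict_space1) measurable
  note [measurable] = nn_integral_is_kernel_measurable[OF n this]
  have "(\<integral>y. y\<^sup>2 \<partial>n x) = enn2real (\<integral>\<^sup>+y. ennreal (y\<^sup>2) \<partial>n x)" for x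
    by (rule integral_eq_nn_integral) (auto intro: borel_n)
  then show ?thesis unfolding variance_A_def[abs_def] by simp
qed

text \<open>
  The kernel \<open>n\<close> may have infinite mass near \<open>0\<close>, so that Fubini-type measurability does not apply to it directly. Its reweighting
  by \<open>y\<^sup>2 / C\<close> is a kernel of subprobability measures.
\<close>

lemma R_measurable: "(\<lambda>(x, z). R x (max 0 z)) \<in> borel_measurable (borel \<Otimes>\<^sub>M borel)"
proof -
  obtain C where C: "0 < C" "\<And>x. (\<integral>\<^sup>+y. ennreal (y\<^sup>2) \<partial>n x) \<le> ennreal C" by (rule sq_finite) auto
  let ?N = "restrict_space borel {0<..} :: real measure"
  have id[measurable]: "(\<lambda>y. y) \<in> borel_measurable ?N" by (rule measurable_restrict_space1) simp
  define n' where "n' x = density (n x) (\<lambda>y. ennreal (y\<^sup>2 / C))" for x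
  have [measurable]: "(\<lambda>y. ennreal (y\<^sup>2 / C)) \<in> borel_measurable ?N" by measurable
  have mn: "(\<lambda>y. ennreal (y\<^sup>2 / C)) \<in> borel_measurable (n x)" for x by (rule borel_n) measurable
  have n'k[measurable]: "n' \<in> borel \<rightarrow>\<^sub>M subprob_algebra ?N"
  proof (rule measurable_subprob_algebra)
    fix x :: 'a
    show "sets (n' x) = sets ?N" by (simp add: n'_def sets_n)
    show "subprob_space (n' x)"
    proof
      have "emeasure (n' x) (space (n' x)) = (\<integral>\<^sup>+y. ennreal (y\<^sup>2 / C) * indicator (space (n x)) y \<partial>n x)"
        unfolding n'_def space_density using mn by (rule emeasure_density) simp
      also have "\<dots> = (\<integral>\<^sup>+y. ennreal (1 / C) * ennreal (y\<^sup>2) \<partial>n x)"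
        using C(1) by (intro nn_integral_cong) (simp add: ennreal_mult[symmetric])
      also have "\<dots> = ennreal (1 / C) * (\<integral>\<^sup>+y. ennreal (y\<^sup>2) \<partial>n x)" by (rule nn_integral_cmult) (rule borel_n, measurable)
      also have "\<dots> \<le> ennreal (1 / C) * ennreal C" by (intro mult_left_mono C) simp
      also have "\<dots> = 1" using C(1) by (simp add: ennreal_mult[symmetric])
      finally show "emeasure (n' x) (space (n' x)) \<le> 1" .
      show "space (n' x) \<noteq> {}" by (auto simp: n'_def space_n intro: exI[of _ 1])
    qed
  next
    fix S assume S[measurable]: "S \<in> sets ?N"
    have "(\<lambda>x. \<integral>\<^sup>+y. ennreal (y\<^sup>2 / C) * indicator S y \<partial>n x) \<in> borel_measurable borel"
      by (rule nn_integral_is_kernel_measurable[OF n]) measurable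
    moreover have "emeasure (n' x) S = (\<integral>\<^sup>+y. ennreal (y\<^sup>2 / C) * indicator S y \<partial>n x)" for x
      unfolding n'_def using mn S by (intro emeasure_density) (auto simp: sets_n)
    ultimately show "(\<lambda>x. emeasure (n' x) S) \<in> borel_measurable borel" by simp
  qed
  have k[measurable]: "(\<lambda>(p, y). ennreal (C * (levy_int (max 0 (snd p)) y / y\<^sup>2))) \<in> borel_measurable (((borel :: 'a measure) \<Otimes>\<^sub>M borel) \<Otimes>\<^sub>M ?N)"
    unfolding levy_int_def by measurable
  have "(\<lambda>p. \<integral>\<^sup>+y. ennreal (C * (levy_int (max 0 (snd p)) y / y\<^sup>2)) \<partial>n' (fst p)) \<in> borel_measurable ((borel :: 'a measure) \<Otimes>\<^sub>M borel)"
    by (rule nn_integral_measurable_subprob_algebra2[OF k]) measurable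
  also have "(\<lambda>p. \<integral>\<^sup>+y. ennreal (C * (levy_int (max 0 (snd p)) y / y\<^sup>2)) \<partial>n' (fst p)) = (\<lambda>p. \<integral>\<^sup>+y. ennreal (levy_int (max 0 (snd p)) y) \<partial>n (fst p))"
  proof
    fix p :: "'a \<times> real"
    have "(\<integral>\<^sup>+y. ennreal (C * (levy_int (max 0 (snd p)) y / y\<^sup>2)) \<partial>n' (fst p)) = (\<integral>\<^sup>+y. ennreal (y\<^sup>2 / C) * ennreal (C * (levy_int (max 0 (snd p)) y / y\<^sup>2)) \<partial>n (fst p))"
      unfolding n'_def by (rule nn_integral_density[OF mn]) (rule borel_n, simp add: levy_int_def)
    also have "\<dots> = (\<integral>\<^sup>+y. ennreal (levy_int (max 0 (snd p)) y) \<partial>n (fst p))"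
      using C(1) levy_int_nonneg by (intro nn_integral_cong) (auto simp: space_n ennreal_mult[symmetric])
    finally show "(\<integral>\<^sup>+y. ennreal (C * (levy_int (max 0 (snd p)) y / y\<^sup>2)) \<partial>n' (fst p)) = (\<integral>\<^sup>+y. ennreal (levy_int (max 0 (snd p)) y) \<partial>n (fst p))" .
  qed
  finally have [measurable]: "(\<lambda>p. \<integral>\<^sup>+y. ennreal (levy_int (max 0 (snd p)) y) \<partial>n (fst p)) \<in> borel_measurable ((borel :: 'a measure) \<Otimes>\<^sub>M borel)" .
  have "(\<integral>y. levy_int z y \<partial>n x) = enn2real (\<integral>\<^sup>+y. ennreal (levy_int z y) \<partial>n x)" for x z
    by (rule integral_eq_nn_integral) (auto intro: levy_measurable levy_int_nonneg)
  then show ?thesis unfolding nonlin_def split_beta by simp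
qed

text \<open>
  The second order expansion at \<open>0\<close>, by dominated convergence with the second moment as bound.
\<close>

lemma R_limit:
  assumes w: "0 < w" shows "((\<lambda>c. R x (c * w) / c\<^sup>2) \<longlongrightarrow> A x * w\<^sup>2 / 2) (at_right 0)"
proof (rule tendsto_at_right_sequentially[OF zero_less_one])
  fix S :: "nat \<Rightarrow> real" assume S: "\<And>n. 0 < S n" "S \<longlonglongrightarrow> 0"
  have "S k \<noteq> 0" for k using S(1)[of k] by simp
  then have S': "filterlim S (at_right 0) sequentially" unfolding filterlim_at using S by auto
  have "(\<lambda>k. \<integral>y. levy_int (S k * w) y / (S k)\<^sup>2 \<partial>n x) \<longlonglongrightarrow> (\<integral>y. w\<^sup>2 * y\<^sup>2 / 2 \<partial>n x)"
  proof (rule integral_dominated_convergence[where w="\<lambda>y. w\<^sup>2 * y\<^sup>2 / 2"])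
    show "integrable (n x) (\<lambda>y. w\<^sup>2 * y\<^sup>2 / 2)" using sq_integrable by simp
    show "(\<lambda>y. w\<^sup>2 * y\<^sup>2 / 2) \<in> borel_measurable (n x)" by (rule borel_n) measurable
    show "(\<lambda>y. levy_int (S k * w) y / (S k)\<^sup>2) \<in> borel_measurable (n x)" for k by (rule borel_n) (simp add: levy_int_def)
    show "AE y in n x. (\<lambda>k. levy_int (S k * w) y / (S k)\<^sup>2) \<longlonglongrightarrow> w\<^sup>2 * y\<^sup>2 / 2"
    proof (rule AE_I2)
      fix y assume "y \<in> space (n x)"
      then have "0 < w * y" using w by (simp add: space_n)
      from filterlim_compose[OF levy_int_limit[OF this] S']
      show "(\<lambda>k. levy_int (S k * w) y / (S k)\<^sup>2) \<longlonglongrightarrow> w\<^sup>2 * y\<^sup>2 / 2"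
        by (simp add: levy_int_def power_mult_distrib mult.assoc)
    qed
    show "AE y in n x. norm (levy_int (S k * w) y / (S k)\<^sup>2) \<le> w\<^sup>2 * y\<^sup>2 / 2" for k
    proof (rule AE_I2)
      fix y assume "y \<in> space (n x)"
      then have "0 \<le> S k * w * y" using w S(1)[of k] by (simp add: space_n)
      from levy_int_le[OF this] S(1)[of k] show "norm (levy_int (S k * w) y / (S k)\<^sup>2) \<le> w\<^sup>2 * y\<^sup>2 / 2"
        using levy_int_nonneg by (simp add: pos_divide_le_eq power_mult_distrib mult_ac)
    qed
  qed
  then have lim: "(\<lambda>k. \<beta> x * (b x * w\<^sup>2 + (\<integral>y. levy_int (S k * w) y / (S k)\<^sup>2 \<partial>n x))) \<longlonglongrightarrow> \<beta> x * (b x * w\<^sup>2 + (\<integral>y. w\<^sup>2 * y\<^sup>2 / 2 \<partial>n x))"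
    by (intro tendsto_intros)
  have e1: "\<beta> x * (b x * w\<^sup>2 + (\<integral>y. levy_int (S k * w) y / (S k)\<^sup>2 \<partial>n x)) = R x (S k * w) / (S k)\<^sup>2" for k
    using S(1)[of k] by (simp add: nonlin_def power_mult_distrib field_simps)
  have e2: "\<beta> x * (b x * w\<^sup>2 + (\<integral>y. w\<^sup>2 * y\<^sup>2 / 2 \<partial>n x)) = A x * w\<^sup>2 / 2"
    by (simp add: variance_A_def field_simps)
  from lim show "(\<lambda>k. R x (S k * w) / (S k)\<^sup>2) \<longlonglongrightarrow> A x * w\<^sup>2 / 2" unfolding e1 e2 .
qed

text \<open>
  This is how nondegeneracy of the branching gives \<open>\<nu> > 0\<close>.
\<close>

lemma A_zero_imp:
  assumes "A x = 0" shows "ennreal (\<beta> x) * (ennreal (b x) + emeasure (n x) {0<..}) = 0"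
proof (cases "\<beta> x = 0")
  case False
  have i0: "0 \<le> (\<integral>y. y\<^sup>2 \<partial>n x)" by simp
  have "2 * b x + (\<integral>y. y\<^sup>2 \<partial>n x) = 0" using assms False by (simp add: variance_A_def)
  then have bz: "b x = 0" and "(\<integral>y. y\<^sup>2 \<partial>n x) = 0" using b_nonneg[of x] i0 by linarith+
  then have "AE y in n x. y\<^sup>2 = 0" using integral_nonneg_eq_0_iff_AE[OF sq_integrable] by simp
  then have "AE y in n x. y \<notin> space (n x)" by eventually_elim (simp add: space_n)
  then have "emeasure (n x) (space (n x)) = 0"
    using AE_iff_measurable[OF sets.top, of "n x" "\<lambda>y. y \<notin> space (n x)"] by simp
  then have "emeasure (n x) {0<..} = 0" by (simp add: space_n)
  then show ?thesis using bz by simp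
qed simp

end

section \<open>Extinction probabilities of the superprocess\<close>

lemma topspace_weak_top [simp]: "topspace weak_top = finite_measures"
proof -
  have "UNIV \<in> {{\<mu>. (\<integral>x. f x \<partial>\<mu>) \<in> U} | (f :: 'a \<Rightarrow> real) U. continuous_on UNIV f \<and> bounded (range f) \<and> open U}"
    by (auto intro!: exI[of _ "\<lambda>_. 0"] exI[of _ UNIV])
  then show ?thesis unfolding weak_top_def by (auto simp: topology_generated_by_topspace topspace_subtopology)
qed

lemma space_finite_measures: "\<mu> \<in> finite_measures \<Longrightarrow> space \<mu> = UNIV"
  unfolding finite_measures_def using sets_eq_imp_space_eq[of \<mu> borel] by auto

lemma mass_measurable [measurable]: "(\<lambda>\<mu>. measure \<mu> UNIV) \<in> borel_measurable (borel_of (weak_top :: ('a::topological_space) measure topology))"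
proof (rule borel_measurableI)
  fix U :: "real set" assume U: "open U"
  have "openin weak_top ({\<mu>. (\<integral>x. 1 \<partial>\<mu>) \<in> U} \<inter> (finite_measures :: 'a measure set))"
    unfolding weak_top_def
  proof (rule openin_subtopology_Int, rule topology_generated_by_Basis)
    show "{\<mu>. (\<integral>x. 1 \<partial>\<mu>) \<in> U} \<in> {{\<mu>. (\<integral>x. f x \<partial>\<mu>) \<in> U} | (f :: 'a \<Rightarrow> real) U. continuous_on UNIV f \<and> bounded (range f) \<and> open U}"
      using U by (intro CollectI exI[of _ "\<lambda>_. 1"] exI[of _ U]) auto
  qed
  moreover have "(\<lambda>\<mu>. measure \<mu> UNIV) -` U \<inter> space (borel_of weak_top) = {\<mu>. (\<integral>x. 1 \<partial>\<mu>) \<in> U} \<inter> (finite_measures :: 'a measure set)"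
    by (auto simp: space_borel_of space_finite_measures)
  ultimately show "(\<lambda>\<mu>. measure \<mu> UNIV) -` U \<inter> space (borel_of weak_top) \<in> sets (borel_of (weak_top :: 'a measure topology))"
    by (simp add: openin_borel_of)
qed

lemma return_finite_measures [simp]: "return borel x \<in> finite_measures"
  unfolding finite_measures_def using prob_space_return[of x borel] by (auto simp: prob_space_def)

text \<open>
  A constant is a stopping time, whose \<open>\<sigma>\<close>-algebra contains all events known at that time.
\<close>

lemma strong_markov_constant_time:
  assumes F: "filtration (space \<Omega>) F" and sm: "strong_markov T \<Omega> F X P"
    and x: "x \<in> topspace T" and rs: "0 \<le> r" "0 \<le> s" and B: "B \<in> sets (borel_of T)" and L: "\<Lambda> \<in> sets (F (ennreal r))"
  shows "emeasure (P x) {\<omega> \<in> \<Lambda>. X (r + s) \<omega> \<in> B} =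
    (\<integral>\<^sup>+\<omega>. indicator \<Lambda> \<omega> * emeasure (P (X r \<omega>)) {\<omega>' \<in> space \<Omega>. X s \<omega>' \<in> B} \<partial>P x)"
proof -
  interpret F: filtration "space \<Omega>" F by fact
  have st: "stopping_time F (\<lambda>_. ennreal r)" by (rule stopping_time_const)
  have "\<Lambda> \<in> sets (F.pre_sigma (\<lambda>_. ennreal r))"
  proof (rule F.sets_pre_sigmaI[OF st])
    fix t show "{\<omega> \<in> \<Lambda>. ennreal r \<le> t} \<in> sets (F t)"
      using L F.sets_F_mono[of "ennreal r" t] by (cases "ennreal r \<le> t") auto
  qed
  then have "emeasure (P x) {\<omega> \<in> \<Lambda>. ennreal r < \<infinity> \<and> X (enn2real (ennreal r) + s) \<omega> \<in> B} =
        (\<integral>\<^sup>+\<omega>\<in>{\<omega> \<in> \<Lambda>. ennreal r < \<infinity>}. emeasure (P (X (enn2real (ennreal r)) \<omega>)) {\<omega>' \<in> space \<Omega>. X s \<omega>' \<in> B} \<partial>P x)"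
    using sm[unfolded strong_markov_def, rule_format, OF st x rs(2) B] by blast
  then show ?thesis using rs(1) by (simp add: mult.commute)
qed

text \<open>
  As \<open>k\<close> grows, \<open>exp (- k * \<parallel>X\<parallel>)\<close> decreases to the indicator of extinction. The corresponding solutions at time \<open>t0\<close> converge pointwise to
  \<open>v x = - ln P\<^sub>x (extinct at t0)\<close>, which is bounded because the extinction probabilities are bounded below. Thus extinction at \<open>t0\<close> has
  probability \<open>exp (- \<langle>v, \<mu>\<rangle>)\<close> from every \<open>\<mu>\<close>, and the Markov property at time \<open>s\<close> identifies extinction at \<open>t0 + s\<close> with the
  Laplace functional of \<open>v\<close>. The initial value \<open>v\<close> is bounded, in contrast to the infinite initial value that corresponds to extinction
  without the delay \<open>t0\<close>.
\<close>

theorem superprocess_extinction: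
  fixes X :: "real \<Rightarrow> 'v \<Rightarrow> ('a::{metric_space,second_countable_topology}) measure"
  assumes sp: "superprocess \<xi> Px \<Psi> \<Omega> X PX"
    and t0: "0 < t0" and inf: "0 < (INF x. measure (PX (return borel x)) (extinct \<Omega> X t0))"
  obtains f u where "f \<in> bounded_borel_nonneg" "mild_solution \<xi> Px \<Psi> f u"
    "\<And>\<mu> s. \<mu> \<in> finite_measures \<Longrightarrow> 0 \<le> s \<Longrightarrow> measure (PX \<mu>) (extinct \<Omega> X (t0 + s)) = exp (- (\<integral>x. u s (Some x) \<partial>\<mu>))"
    "\<And>\<mu> s. \<mu> \<in> finite_measures \<Longrightarrow> 0 \<le> s \<Longrightarrow> measure (PX \<mu>) (survives \<Omega> X (t0 + s)) = 1 - exp (- (\<integral>x. u s (Some x) \<partial>\<mu>))"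
proof -
  have hunt: "hunt_process weak_top \<Omega> X PX" using sp by (simp add: superprocess_def)
  have ker[measurable]: "PX \<in> borel_of weak_top \<rightarrow>\<^sub>M prob_algebra \<Omega>" using hunt by (simp add: hunt_process_def)
  obtain F where F: "filtration (space \<Omega>) F" "\<And>t. subalgebra \<Omega> (F t)" "\<And>t. 0 \<le> t \<Longrightarrow> X t \<in> F (ennreal t) \<rightarrow>\<^sub>M borel_of weak_top"
    "strong_markov weak_top \<Omega> F X PX"
    using hunt unfolding hunt_process_def by auto
  have Xm: "X t \<in> \<Omega> \<rightarrow>\<^sub>M borel_of weak_top" if "0 \<le> t" for t
    using measurable_from_subalg[OF F(2) F(3)[OF that]] .
  have Xfin: "X t \<omega> \<in> finite_measures" if "0 \<le> t" "\<omega> \<in> space \<Omega>" for t \<omega>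
    using measurable_space[OF Xm[OF that(1)] that(2)] by (simp add: space_borel_of)
  have PXs: "PX \<mu> \<in> space (prob_algebra \<Omega>)" if "\<mu> \<in> finite_measures" for \<mu>
    using measurable_space[OF ker, of \<mu>] that by (simp add: space_borel_of)
  have prob: "prob_space (PX \<mu>)" and setsP: "sets (PX \<mu>) = sets \<Omega>" if "\<mu> \<in> finite_measures" for \<mu>
    using PXs[OF that] by (auto simp: space_prob_algebra)
  have spaceP: "space (PX \<mu>) = space \<Omega>" if "\<mu> \<in> finite_measures" for \<mu>
    using sets_eq_imp_space_eq[OF setsP[OF that]] .
  define Z where "Z t \<omega> = measure (X t \<omega>) UNIV" for t \<omega>
  have Zm: "Z t \<in> borel_measurable \<Omega>" if "0 \<le> t" for t
    unfolding Z_def using Xm[OF that] by measurable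
  have Zm': "Z t \<in> borel_measurable (PX \<mu>)" if "0 \<le> t" "\<mu> \<in> finite_measures" for t \<mu>
    using Zm[OF that(1)] by (simp add: measurable_cong_sets[OF setsP[OF that(2)] refl])
  have Z0: "0 \<le> Z t \<omega>" for t \<omega> by (simp add: Z_def)
  have ext: "extinct \<Omega> X t = {\<omega> \<in> space \<Omega>. Z t \<omega> = 0}" for t by (simp add: extinct_def Z_def)
  have ext_m: "extinct \<Omega> X t \<in> sets \<Omega>" if "0 \<le> t" for t
  proof -
    note [measurable] = Zm[OF that]
    show ?thesis unfolding ext by measurable
  qed
  have laplace: "\<exists>u. mild_solution \<xi> Px \<Psi> f u \<and> (\<forall>\<mu>\<in>finite_measures. \<forall>t\<ge>0.
               - ln (\<integral>\<omega>. exp (- (\<integral>x. f x \<partial>X t \<omega>)) \<partial>PX \<mu>) = (\<integral>x. u t (Some x) \<partial>\<mu>))" if "f \<in> bounded_borel_nonneg" for f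
    using sp that unfolding superprocess_def by blast
  have exp_pos: "0 < (\<integral>\<omega>. exp (- g \<omega> :: real) \<partial>PX \<mu>)" if "\<mu> \<in> finite_measures" "g \<in> borel_measurable (PX \<mu>)" "\<And>\<omega>. \<omega> \<in> space \<Omega> \<Longrightarrow> 0 \<le> g \<omega>" for g \<mu>
  proof -
    interpret prob_space "PX \<mu>" by (rule prob[OF that(1)])
    have i: "integrable (PX \<mu>) (\<lambda>\<omega>. exp (- g \<omega>))"
    proof (rule integrable_const_bound[where B=1])
      show "AE \<omega> in PX \<mu>. norm (exp (- g \<omega>)) \<le> 1" using that(3) by (intro AE_I2) (simp add: spaceP[OF that(1)])
      show "(\<lambda>\<omega>. exp (- g \<omega>)) \<in> borel_measurable (PX \<mu>)" using that(2) by measurable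
    qed
    have "(\<integral>\<omega>. exp (- g \<omega>) \<partial>PX \<mu>) \<noteq> 0"
    proof
      assume "(\<integral>\<omega>. exp (- g \<omega>) \<partial>PX \<mu>) = 0"
      then have "AE \<omega> in PX \<mu>. exp (- g \<omega>) = 0" by (subst (asm) integral_nonneg_eq_0_iff_AE[OF i]) auto
      then show False by simp
    qed
    then show ?thesis by (simp add: less_le)
  qed
  have const: "(\<lambda>_. real k) \<in> bounded_borel_nonneg" for k by (simp add: bounded_borel_nonneg_def bounded_borel_def)
  have massint: "(\<integral>x. c \<partial>X t \<omega>) = c * Z t \<omega>" if "0 \<le> t" "\<omega> \<in> space \<Omega>" for c t \<omega>
    using space_finite_measures[OF Xfin[OF that]] by (simp add: Z_def)
  have "\<exists>uk. \<forall>k. mild_solution \<xi> Px \<Psi> (\<lambda>_. real k) (uk k) \<and> (\<forall>\<mu>\<in>finite_measures. \<forall>t\<ge>0.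
               - ln (\<integral>\<omega>. exp (- (\<integral>x. real k \<partial>X t \<omega>)) \<partial>PX \<mu>) = (\<integral>x. uk k t (Some x) \<partial>\<mu>))"
    using laplace[OF const] by (intro choice allI)
  then obtain uk where uk: "\<And>k. mild_solution \<xi> Px \<Psi> (\<lambda>_. real k) (uk k)"
    and uk_eq: "\<And>k \<mu> t. \<mu> \<in> finite_measures \<Longrightarrow> 0 \<le> t \<Longrightarrow> - ln (\<integral>\<omega>. exp (- (\<integral>x. real k \<partial>X t \<omega>)) \<partial>PX \<mu>) = (\<integral>x. uk k t (Some x) \<partial>\<mu>)"
    by blast
  define E where "E k \<mu> = (\<integral>\<omega>. exp (- (real k * Z t0 \<omega>)) \<partial>PX \<mu>)" for k \<mu>
  have E_eq: "E k \<mu> = exp (- (\<integral>x. uk k t0 (Some x) \<partial>\<mu>))" "0 < E k \<mu>" if "\<mu> \<in> finite_measures" for k \<mu>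
  proof -
    note [measurable] = Zm'[OF less_imp_le[OF t0] that]
    show pos: "0 < E k \<mu>" unfolding E_def using Z0 by (intro exp_pos that) auto
    have "(\<integral>\<omega>. exp (- (\<integral>x. real k \<partial>X t0 \<omega>)) \<partial>PX \<mu>) = E k \<mu>"
      unfolding E_def
      by (intro Bochner_Integration.integral_cong refl) (simp only: spaceP[OF that] massint[OF less_imp_le[OF t0]])
    then have "- ln (E k \<mu>) = (\<integral>x. uk k t0 (Some x) \<partial>\<mu>)" using uk_eq[OF that, of t0 k] t0 by simp
    then have "ln (E k \<mu>) = - (\<integral>x. uk k t0 (Some x) \<partial>\<mu>)" by simp
    then show "E k \<mu> = exp (- (\<integral>x. uk k t0 (Some x) \<partial>\<mu>))" using exp_ln[OF pos] by simp
  qed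
  have E_lim: "(\<lambda>k. E k \<mu>) \<longlonglongrightarrow> measure (PX \<mu>) (extinct \<Omega> X t0)" if "\<mu> \<in> finite_measures" for \<mu>
  proof -
    interpret prob_space "PX \<mu>" by (rule prob[OF that])
    note [measurable] = Zm'[OF less_imp_le[OF t0] that]
    have em: "extinct \<Omega> X t0 \<in> sets (PX \<mu>)" using ext_m[of t0] t0 by (simp add: setsP[OF that])
    have "(\<lambda>k. E k \<mu>) \<longlonglongrightarrow> (\<integral>\<omega>. indicator (extinct \<Omega> X t0) \<omega> \<partial>PX \<mu>)"
      unfolding E_def
    proof (rule integral_dominated_convergence[where w="\<lambda>_. 1"])
      show "(\<lambda>\<omega>. indicat_real (extinct \<Omega> X t0) \<omega>) \<in> borel_measurable (PX \<mu>)" using em by measurable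
      show "AE \<omega> in PX \<mu>. (\<lambda>k. exp (- (real k * Z t0 \<omega>))) \<longlonglongrightarrow> indicator (extinct \<Omega> X t0) \<omega>"
      proof (rule AE_I2)
        fix \<omega> assume "\<omega> \<in> space (PX \<mu>)"
        then have \<omega>: "\<omega> \<in> space \<Omega>" by (simp add: spaceP[OF that])
        show "(\<lambda>k. exp (- (real k * Z t0 \<omega>))) \<longlonglongrightarrow> indicator (extinct \<Omega> X t0) \<omega>"
        proof (cases "Z t0 \<omega> = 0")
          case True then show ?thesis using \<omega> by (simp add: ext)
        next
          case False
          then have z: "0 < Z t0 \<omega>" using Z0[of t0 \<omega>] by simp
          have "filterlim (\<lambda>k. Z t0 \<omega> * real k) at_top sequentially"
            by (rule filterlim_tendsto_pos_mult_at_top[OF tendsto_const z filterlim_real_sequentially])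
          then have "(\<lambda>k. exp (- (Z t0 \<omega> * real k))) \<longlonglongrightarrow> 0"
            by (intro filterlim_compose[OF exp_at_bot] filterlim_compose[OF filterlim_uminus_at_bot_at_top])
          then show ?thesis using False by (simp add: ext mult.commute)
        qed
      qed
      show "AE \<omega> in PX \<mu>. norm (exp (- (real k * Z t0 \<omega>))) \<le> 1" for k using Z0 by simp
    qed auto
    then show ?thesis using em by simp
  qed
  have uk_meas: "(\<lambda>x. uk k t0 (Some x)) \<in> borel_measurable borel" for k
  proof -
    have m: "(\<lambda>(t, x). uk k t x) \<in> borel_measurable (restrict_space borel {0..} \<Otimes>\<^sub>M borel_of cemetery_top)"
      using uk[of k] by (simp add: mild_solution_def)
    have "(\<lambda>x. (t0, Some x)) \<in> borel \<rightarrow>\<^sub>M restrict_space borel {0..} \<Otimes>\<^sub>M borel_of cemetery_top"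
      using t0 by (intro measurable_Pair Some_measurable) (simp add: space_restrict_space)
    from measurable_compose[OF this m] show ?thesis by simp
  qed
  define v where "v x = - ln (measure (PX (return borel x)) (extinct \<Omega> X t0))" for x
  \<comment> \<open>The lower bound of the extinction probabilities makes the solutions below bounded uniformly in \<open>k\<close>.\<close>
  define i0 where "i0 = (INF x. measure (PX (return borel x)) (extinct \<Omega> X t0))"
  have i0: "0 < i0" "i0 \<le> measure (PX (return borel x)) (extinct \<Omega> X t0)" for x
    using inf unfolding i0_def by (auto intro!: cINF_lower bdd_belowI[of _ 0])
  have uk_ret: "uk k t0 (Some x) = - ln (E k (return borel x))" for k x
  proof -
    have "(\<integral>y. uk k t0 (Some y) \<partial>return borel x) = uk k t0 (Some x)" by (rule integral_return) (auto intro: uk_meas)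
    then show ?thesis using E_eq[OF return_finite_measures[of x], of k] by simp
  qed
  have uk_lim: "(\<lambda>k. uk k t0 (Some x)) \<longlonglongrightarrow> v x" for x
    unfolding uk_ret v_def using E_lim[OF return_finite_measures[of x]] i0(1) i0(2)[of x] by (intro tendsto_intros) auto
  have uk_nonneg: "0 \<le> uk k t0 (Some x)" for k x using uk[of k] t0 by (auto simp: mild_solution_def)
  have uk_le: "uk k t0 (Some x) \<le> - ln i0" for k x
  proof -
    let ?\<mu> = "return borel x"
    interpret prob_space "PX ?\<mu>" by (rule prob) simp
    note [measurable] = Zm'[OF less_imp_le[OF t0] return_finite_measures]
    have em: "extinct \<Omega> X t0 \<in> sets (PX ?\<mu>)" using ext_m[of t0] t0 by (simp add: setsP)
    have "measure (PX ?\<mu>) (extinct \<Omega> X t0) = (\<integral>\<omega>. indicator (extinct \<Omega> X t0) \<omega> \<partial>PX ?\<mu>)" using em by simp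
    also have "\<dots> \<le> E k ?\<mu>" unfolding E_def
    proof (rule integral_mono)
      show "integrable (PX ?\<mu>) (\<lambda>\<omega>. indicat_real (extinct \<Omega> X t0) \<omega>)" using em by (simp add: integrable_real_indicator emeasure_eq_measure)
      show "integrable (PX ?\<mu>) (\<lambda>\<omega>. exp (- (real k * Z t0 \<omega>)))" using Z0 by (intro integrable_const_bound[where B=1]) auto
      show "indicat_real (extinct \<Omega> X t0) \<omega> \<le> exp (- (real k * Z t0 \<omega>))" for \<omega> by (auto simp: indicator_def ext)
    qed
    finally have "i0 \<le> E k ?\<mu>" using i0(2)[of x] by simp
    then have "ln i0 \<le> ln (E k ?\<mu>)" using i0(1) by (intro ln_mono) auto
    then show ?thesis by (simp add: uk_ret)
  qed
  have vm[measurable]: "v \<in> borel_measurable borel"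
    by (rule borel_measurable_LIMSEQ_real[OF uk_lim]) (auto intro: uk_meas)
  have v0: "0 \<le> v x" for x by (rule LIMSEQ_le_const[OF uk_lim]) (use uk_nonneg in auto)
  have v1: "v x \<le> - ln i0" for x by (rule LIMSEQ_le_const2[OF uk_lim]) (use uk_le in auto)
  have ext_prob: "measure (PX \<mu>) (extinct \<Omega> X t0) = exp (- (\<integral>x. v x \<partial>\<mu>))" if "\<mu> \<in> finite_measures" for \<mu>
  proof -
    interpret finite_measure \<mu> using that by (simp add: finite_measures_def)
    have sm: "sets \<mu> = sets borel" using that by (simp add: finite_measures_def)
    have mc: "borel_measurable \<mu> = borel_measurable borel" by (rule measurable_cong_sets[OF sm refl])
    have "(\<lambda>k. (\<integral>x. uk k t0 (Some x) \<partial>\<mu>)) \<longlonglongrightarrow> (\<integral>x. v x \<partial>\<mu>)"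
    proof (rule integral_dominated_convergence[where w="\<lambda>_. - ln i0"])
      show "\<And>k. AE x in \<mu>. norm (uk k t0 (Some x)) \<le> - ln i0" using uk_nonneg uk_le by simp
    qed (auto simp: mc uk_meas uk_lim)
    then have "(\<lambda>k. exp (- (\<integral>x. uk k t0 (Some x) \<partial>\<mu>))) \<longlonglongrightarrow> exp (- (\<integral>x. v x \<partial>\<mu>))" by (intro tendsto_intros)
    then have "(\<lambda>k. E k \<mu>) \<longlonglongrightarrow> exp (- (\<integral>x. v x \<partial>\<mu>))" by (simp add: E_eq(1)[OF that])
    then show ?thesis using E_lim[OF that] LIMSEQ_unique by blast
  qed
  have vb: "v \<in> bounded_borel_nonneg"
    unfolding bounded_borel_nonneg_def bounded_borel_def using v0 v1
    by (auto simp: bounded_iff intro!: exI[of _ "- ln i0"])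
  obtain u where u: "mild_solution \<xi> Px \<Psi> v u" and u_eq: "\<And>\<mu> t. \<mu> \<in> finite_measures \<Longrightarrow> 0 \<le> t \<Longrightarrow>
      - ln (\<integral>\<omega>. exp (- (\<integral>x. v x \<partial>X t \<omega>)) \<partial>PX \<mu>) = (\<integral>x. u t (Some x) \<partial>\<mu>)"
    using laplace[OF vb] by blast
  have main: "measure (PX \<mu>) (extinct \<Omega> X (t0 + s)) = exp (- (\<integral>x. u s (Some x) \<partial>\<mu>))" if \<mu>: "\<mu> \<in> finite_measures" and s: "0 \<le> s" for \<mu> s
  proof -
    interpret prob_space "PX \<mu>" by (rule prob[OF \<mu>])
    define B where "B = {\<eta> \<in> space (borel_of (weak_top :: 'a measure topology)). measure \<eta> UNIV = 0}"
    have B: "B \<in> sets (borel_of weak_top)" unfolding B_def by measurable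
    have inB: "X t \<omega> \<in> B \<longleftrightarrow> Z t \<omega> = 0" if "0 \<le> t" "\<omega> \<in> space \<Omega>" for t \<omega>
      using Xfin[OF that] by (simp add: B_def Z_def space_borel_of)
    have e1: "{\<omega> \<in> space \<Omega>. X t \<omega> \<in> B} = extinct \<Omega> X t" if "0 \<le> t" for t using inB[OF that] by (auto simp: ext)
    have m: "(\<lambda>\<omega>. exp (- (\<integral>x. v x \<partial>X s \<omega>))) \<in> borel_measurable (PX \<mu>)"
    proof -
      have "(\<lambda>\<omega>. measure (PX (X s \<omega>)) (extinct \<Omega> X t0)) \<in> borel_measurable (PX \<mu>)"
      proof -
        have 1: "X s \<in> PX \<mu> \<rightarrow>\<^sub>M borel_of weak_top" using Xm[OF s] by (simp add: measurable_cong_sets[OF setsP[OF \<mu>] refl])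
        have 2: "(\<lambda>M. measure M (extinct \<Omega> X t0)) \<in> borel_measurable (subprob_algebra \<Omega>)"
          using ext_m[of t0] t0 by (intro measurable_measure_subprob_algebra) auto
        show ?thesis by (rule measurable_compose[OF measurable_compose[OF 1 measurable_prob_algebraD[OF ker]] 2])
      qed
      moreover have "measure (PX (X s \<omega>)) (extinct \<Omega> X t0) = exp (- (\<integral>x. v x \<partial>X s \<omega>))" if "\<omega> \<in> space (PX \<mu>)" for \<omega>
        using that ext_prob[OF Xfin[OF s]] by (simp add: spaceP[OF \<mu>])
      ultimately show ?thesis by (simp cong: measurable_cong)
    qed
    have "(\<lambda>\<omega>. - ln (exp (- (\<integral>x. v x \<partial>X s \<omega>)))) \<in> borel_measurable (PX \<mu>)" using m by measurable
    then have gm: "(\<lambda>\<omega>. \<integral>x. v x \<partial>X s \<omega>) \<in> borel_measurable (PX \<mu>)" by simp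
    have "space \<Omega> \<in> sets (F (ennreal s))" using F(2)[of "ennreal s"] by (metis sets.top subalgebra_def)
    from strong_markov_constant_time[OF F(1,4) _ s less_imp_le[OF t0] B this, of \<mu>]
    have "emeasure (PX \<mu>) (extinct \<Omega> X (s + t0)) = (\<integral>\<^sup>+\<omega>. indicator (space \<Omega>) \<omega> * emeasure (PX (X s \<omega>)) (extinct \<Omega> X t0) \<partial>PX \<mu>)"
      using \<mu> s t0 by (simp add: e1)
    also have "\<dots> = (\<integral>\<^sup>+\<omega>. ennreal (exp (- (\<integral>x. v x \<partial>X s \<omega>))) \<partial>PX \<mu>)"
    proof (rule nn_integral_cong)
      fix \<omega> assume "\<omega> \<in> space (PX \<mu>)"
      then have \<omega>: "\<omega> \<in> space \<Omega>" by (simp add: spaceP[OF \<mu>])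
      note Xs = Xfin[OF s \<omega>]
      interpret XX: prob_space "PX (X s \<omega>)" by (rule prob[OF Xs])
      show "indicator (space \<Omega>) \<omega> * emeasure (PX (X s \<omega>)) (extinct \<Omega> X t0) = ennreal (exp (- (\<integral>x. v x \<partial>X s \<omega>)))"
        using \<omega> ext_prob[OF Xs] by (simp add: XX.emeasure_eq_measure)
    qed
    also have "\<dots> = ennreal (\<integral>\<omega>. exp (- (\<integral>x. v x \<partial>X s \<omega>)) \<partial>PX \<mu>)"
    proof (rule nn_integral_eq_integral)
      show "integrable (PX \<mu>) (\<lambda>\<omega>. exp (- (\<integral>x. v x \<partial>X s \<omega>)))"
        using m v0 by (intro integrable_const_bound[where B=1]) auto
    qed simp
    finally have eq: "measure (PX \<mu>) (extinct \<Omega> X (t0 + s)) = (\<integral>\<omega>. exp (- (\<integral>x. v x \<partial>X s \<omega>)) \<partial>PX \<mu>)"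
      by (simp add: emeasure_eq_measure add.commute)
    have pos: "0 < (\<integral>\<omega>. exp (- (\<integral>x. v x \<partial>X s \<omega>)) \<partial>PX \<mu>)"
      using v0 by (intro exp_pos[OF \<mu> gm]) simp
    have "ln (\<integral>\<omega>. exp (- (\<integral>x. v x \<partial>X s \<omega>)) \<partial>PX \<mu>) = - (\<integral>x. u s (Some x) \<partial>\<mu>)" using u_eq[OF \<mu> s] by simp
    then show ?thesis unfolding eq using exp_ln[OF pos] by simp
  qed
  show ?thesis
  proof (rule that[OF vb u main])
    fix \<mu> :: "'a measure" and s :: real assume \<mu>: "\<mu> \<in> finite_measures" and s: "0 \<le> s"
    interpret prob_space "PX \<mu>" by (rule prob[OF \<mu>])
    have ts: "0 \<le> t0 + s" using t0 s by simp
    have "survives \<Omega> X (t0 + s) = space (PX \<mu>) - extinct \<Omega> X (t0 + s)" by (auto simp: survives_def extinct_def spaceP[OF \<mu>])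
    then have "measure (PX \<mu>) (survives \<Omega> X (t0 + s)) = 1 - measure (PX \<mu>) (extinct \<Omega> X (t0 + s))"
      using prob_compl[of "extinct \<Omega> X (t0 + s)"] ext_m[OF ts] by (simp add: setsP[OF \<mu>])
    then show "measure (PX \<mu>) (survives \<Omega> X (t0 + s)) = 1 - exp (- (\<integral>x. u s (Some x) \<partial>\<mu>))" using main[OF \<mu> s] by simp
  qed
qed

section \<open>Asymptotics of a critical nonlinear flow\<close>

text \<open>
  A continuous-time Cesaro theorem; boundedness on intervals of length one is needed to pass from integer steps to real times.
\<close>

lemma tendsto_div_of_increments:
  fixes x :: "real \<Rightarrow> real"
  assumes inc: "((\<lambda>t. x (t + 1) - x t) \<longlongrightarrow> \<nu>) at_top"
    and bdd: "\<And>a. 0 \<le> a \<Longrightarrow> \<exists>B. \<forall>t\<in>{a..a+1}. \<bar>x t\<bar> \<le> B"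
  shows "((\<lambda>t. x t / t) \<longlongrightarrow> \<nu>) at_top"
proof (rule tendstoI)
  fix e :: real assume e: "e > 0"
  have "\<forall>\<^sub>F t in at_top. dist (x (t + 1) - x t) \<nu> < e / 2" using tendstoD[OF inc, of "e / 2"] e by simp
  then obtain a0 where a0: "\<And>t. t \<ge> a0 \<Longrightarrow> \<bar>x (t + 1) - x t - \<nu>\<bar> < e / 2"
    by (auto simp: eventually_at_top_linorder dist_real_def)
  define a where "a = max a0 0"
  have "0 \<le> a" by (simp add: a_def)
  from bdd[OF this] obtain B where "\<forall>t\<in>{a..a+1}. \<bar>x t\<bar> \<le> B" ..
  then have B: "\<And>t. a \<le> t \<Longrightarrow> t \<le> a + 1 \<Longrightarrow> \<bar>x t\<bar> \<le> B" by simp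
  have step: "\<bar>x (s + real k) - x s - \<nu> * real k\<bar> \<le> e / 2 * real k" if s: "a \<le> s" for s k
  proof (induction k)
    case (Suc k)
    have "\<bar>x (s + real k + 1) - x (s + real k) - \<nu>\<bar> < e / 2" using s by (intro a0) (simp add: a_def)
    moreover have "s + real k + 1 = s + real (Suc k)" by simp
    ultimately have "\<bar>x (s + real (Suc k)) - x (s + real k) - \<nu>\<bar> < e / 2" by metis
    then show ?case using Suc unfolding of_nat_Suc distrib_left by linarith
  qed simp
  define Q where "Q = B + \<bar>\<nu>\<bar> * (a + 1)"
  have bound: "\<bar>x t - \<nu> * t\<bar> \<le> e / 2 * t + Q" if t: "a \<le> t" for t
  proof -
    define k where "k = nat \<lfloor>t - a\<rfloor>"
    define s where "s = t - real k"
    have k: "real k \<le> t - a" "t - a < real k + 1" using t unfolding k_def by linarith+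
    have s: "a \<le> s" "s \<le> a + 1" "t = s + real k" using k by (auto simp: s_def)
    have a0': "0 \<le> a" by (simp add: a_def)
    have "x t - \<nu> * t = (x (s + real k) - x s - \<nu> * real k) + x s - \<nu> * s" unfolding s(3) by (simp add: algebra_simps)
    then have "\<bar>x t - \<nu> * t\<bar> \<le> \<bar>x (s + real k) - x s - \<nu> * real k\<bar> + \<bar>x s\<bar> + \<bar>\<nu> * s\<bar>" by linarith
    also have "\<dots> \<le> e / 2 * real k + B + \<bar>\<nu>\<bar> * (a + 1)"
      using step[OF s(1), of k] B[OF s(1,2)] s a0' by (intro add_mono) (auto simp: abs_mult intro!: mult_left_mono)
    also have "\<dots> \<le> e / 2 * t + Q" using k a0' e by (simp add: Q_def)
    finally show ?thesis .
  qed
  have "\<forall>\<^sub>F t in at_top. t > 4 * \<bar>Q\<bar> / e" by (rule eventually_gt_at_top)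
  moreover have "\<forall>\<^sub>F t in at_top. t > max a 0" by (rule eventually_gt_at_top)
  ultimately show "\<forall>\<^sub>F t in at_top. dist (x t / t) \<nu> < e"
  proof eventually_elim
    case (elim t)
    then have t: "0 < t" "a \<le> t" by auto
    have "4 * \<bar>Q\<bar> < t * e" using elim(1) e by (simp add: divide_less_eq)
    then have "\<bar>x t - \<nu> * t\<bar> < e * t" using bound[OF t(2)] e t by (simp add: mult.commute)
    moreover have "\<bar>x t / t - \<nu>\<bar> = \<bar>x t - \<nu> * t\<bar> / t" using t by (simp add: field_simps abs_divide)
    ultimately show ?case using t by (simp add: dist_real_def divide_less_eq)
  qed
qed

text \<open>
  The analytic core in abstract form. The measure \<open>M0\<close> plays the role of \<open>\<psi> dm\<close> and \<open>\<kappa> t x\<close> that of the Feynman-Kac kernel; the assumption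
  \<open>pairing\<close> is the flow equation integrated against the invariant measure \<open>M0\<close>.
\<close>

locale critical_flow =
  fixes M0 :: "'a measure" and \<kappa> :: "real \<Rightarrow> 'a \<Rightarrow> 'a measure" and \<phi> :: "'a \<Rightarrow> real"
    and u :: "real \<Rightarrow> 'a \<Rightarrow> real" and R :: "'a \<Rightarrow> real \<Rightarrow> real" and L \<Phi> \<nu> :: real
  assumes fin: "finite_measure M0" and space_M0 [simp]: "space M0 = UNIV"
    and fin_\<kappa>: "0 \<le> t \<Longrightarrow> finite_measure (\<kappa> t x)" and sets_\<kappa> [measurable_cong]: "sets (\<kappa> t x) = sets M0"
    and T_meas: "0 \<le> t \<Longrightarrow> f \<in> borel_measurable M0 \<Longrightarrow> (\<And>y. 0 \<le> f y) \<Longrightarrow> (\<And>y. f y \<le> (b::real)) \<Longrightarrow> (\<lambda>x. \<integral>y. f y \<partial>\<kappa> t x) \<in> borel_measurable M0"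
    and \<phi>_meas [measurable]: "\<phi> \<in> borel_measurable M0" and \<phi>_pos: "0 < \<phi> x" and \<phi>_le: "\<phi> x \<le> \<Phi>"
    and \<phi>_int: "(\<integral>x. \<phi> x \<partial>M0) = 1"
    and inv: "0 \<le> t \<Longrightarrow> (\<integral>y. \<phi> y \<partial>\<kappa> t x) = \<phi> x"
    and dual: "0 \<le> t \<Longrightarrow> f \<in> borel_measurable M0 \<Longrightarrow> (\<And>y. 0 \<le> f y) \<Longrightarrow> (\<And>y. f y \<le> (b::real)) \<Longrightarrow>
       (\<integral>x. (\<integral>y. f y \<partial>\<kappa> t x) \<partial>M0) = (\<integral>x. f x \<partial>M0)"
    and IU: "0 < h \<Longrightarrow> \<exists>\<epsilon>>0. \<exists>C. \<forall>f b. f \<in> borel_measurable M0 \<longrightarrow> (\<forall>y. 0 \<le> f y \<and> f y \<le> b) \<longrightarrow>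
       (\<forall>x. \<epsilon> * \<phi> x * (\<integral>y. f y \<partial>M0) \<le> (\<integral>y. f y \<partial>\<kappa> h x) \<and> (\<integral>y. f y \<partial>\<kappa> h x) \<le> C * \<phi> x * (\<integral>y. f y \<partial>M0))"
    and semigroup: "0 \<le> s \<Longrightarrow> 0 \<le> t \<Longrightarrow> f \<in> borel_measurable M0 \<Longrightarrow> (\<And>y. 0 \<le> f y) \<Longrightarrow> (\<And>y. f y \<le> (b::real)) \<Longrightarrow>
       (\<integral>y. (\<integral>z. f z \<partial>\<kappa> t y) \<partial>\<kappa> s x) = (\<integral>z. f z \<partial>\<kappa> (s + t) x)"
    and u_meas: "0 \<le> t \<Longrightarrow> u t \<in> borel_measurable M0" and u_pos: "0 \<le> t \<Longrightarrow> 0 < u t x"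
    and u_bdd: "0 \<le> t \<Longrightarrow> \<exists>b. \<forall>x. u t x \<le> b"
    and R_nonneg: "0 \<le> z \<Longrightarrow> 0 \<le> R x z" and R_le: "0 \<le> z \<Longrightarrow> R x z \<le> L * z\<^sup>2"
    and R_mono: "0 \<le> z \<Longrightarrow> z \<le> z' \<Longrightarrow> R x z \<le> R x z'"
    and R_meas: "g \<in> borel_measurable M0 \<Longrightarrow> (\<And>x. 0 \<le> g x) \<Longrightarrow> (\<lambda>x. R x (g x)) \<in> borel_measurable M0"
    and flow: "0 \<le> r \<Longrightarrow> 0 \<le> t \<Longrightarrow>
       u (r + t) x = (\<integral>y. u r y \<partial>\<kappa> t x) - (LINT s:{0..t}|lborel. (\<integral>y. R y (u (r + t - s) y) \<partial>\<kappa> s x))"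
    and pairing: "0 \<le> r \<Longrightarrow> 0 \<le> t \<Longrightarrow>
       (\<integral>y. u (r + t) y \<partial>M0) = (\<integral>y. u r y \<partial>M0) - (LINT s:{0..t}|lborel. (\<integral>y. R y (u (r + t - s) y) \<partial>M0))"
    and pairing_int: "0 \<le> r \<Longrightarrow> 0 \<le> t \<Longrightarrow> set_integrable lborel {0..t} (\<lambda>s. (\<integral>y. R y (u (r + t - s) y) \<partial>M0))"
    and lim: "((\<lambda>c. (\<integral>x. R x (c * \<phi> x) \<partial>M0) / c\<^sup>2) \<longlongrightarrow> \<nu>) (at_right 0)" and \<nu>_pos: "0 < \<nu>" and L_nonneg: "0 \<le> L"
begin

abbreviation T :: "real \<Rightarrow> ('a \<Rightarrow> real) \<Rightarrow> 'a \<Rightarrow> real" where "T t f x \<equiv> (\<integral>y. f y \<partial>\<kappa> t x)"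

definition c :: "real \<Rightarrow> real" where "c t = (\<integral>y. u t y \<partial>M0)"

lemma integrable_bdd:
  fixes f :: "'a \<Rightarrow> real"
  assumes "f \<in> borel_measurable M0" "\<And>y. 0 \<le> f y" "\<And>y. f y \<le> b"
  shows "integrable M0 f" "0 \<le> t \<Longrightarrow> integrable (\<kappa> t x) f"
proof -
  show "integrable M0 f" using assms fin by (intro finite_measure.integrable_const_bound[where B=b]) auto
  have "f \<in> borel_measurable (\<kappa> t x)" using assms(1) by (simp add: measurable_cong_sets[OF sets_\<kappa> refl])
  then show "0 \<le> t \<Longrightarrow> integrable (\<kappa> t x) f"
    using assms fin_\<kappa> by (intro finite_measure.integrable_const_bound[where B=b]) auto
qed

lemma T_mono:
  assumes "0 \<le> t" "f \<in> borel_measurable M0" "g \<in> borel_measurable M0" "\<And>y. 0 \<le> f y" "\<And>y. f y \<le> g y" "\<And>y. g y \<le> b"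
  shows "T t f x \<le> T t g x"
  using assms by (intro integral_mono integrable_bdd(2)[where b=b]) (auto intro: order_trans)

lemma M0_mono:
  assumes "f \<in> borel_measurable M0" "g \<in> borel_measurable M0" "\<And>y. 0 \<le> f y" "\<And>y. f y \<le> g y" "\<And>y. g y \<le> (b::real)"
  shows "(\<integral>y. f y \<partial>M0) \<le> (\<integral>y. g y \<partial>M0)"
  using assms by (intro integral_mono integrable_bdd(1)[where b=b]) (auto intro: order_trans)

text \<open>
  A Doeblin condition relative to the invariant function \<open>\<phi>\<close>.
\<close>

definition minorised :: "real \<Rightarrow> real \<Rightarrow> bool" where
  "minorised h \<epsilon> \<longleftrightarrow> (\<forall>f b x. f \<in> borel_measurable M0 \<longrightarrow> (\<forall>y. 0 \<le> f y) \<longrightarrow> (\<forall>y. f y \<le> b) \<longrightarrow>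
     \<epsilon> * \<phi> x * (\<integral>y. f y \<partial>M0) \<le> T h f x)"

lemma \<Phi>_pos: "0 < \<Phi>" using \<phi>_pos \<phi>_le less_le_trans by blast

lemma u_bound: assumes "0 \<le> t" obtains b where "\<And>x. u t x \<le> b" "0 \<le> b"
  using u_bdd[OF assms] u_pos[OF assms] by (meson less_imp_le order_trans)

lemma u_nonneg: "0 \<le> t \<Longrightarrow> 0 \<le> u t x" using u_pos[of t x] by simp

lemma R_comp:
  assumes "0 \<le> t"
  shows "(\<lambda>y. R y (u t y)) \<in> borel_measurable M0" "0 \<le> R y (u t y)" "(\<And>x. u t x \<le> b) \<Longrightarrow> R y (u t y) \<le> L * b\<^sup>2"
proof -
  show "(\<lambda>y. R y (u t y)) \<in> borel_measurable M0" by (intro R_meas u_meas u_nonneg assms)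
  show "0 \<le> R y (u t y)" by (intro R_nonneg u_nonneg assms)
  assume "\<And>x. u t x \<le> b"
  then have "L * (u t y)\<^sup>2 \<le> L * b\<^sup>2" using u_nonneg[OF assms] L_nonneg by (intro mult_left_mono power_mono) auto
  then show "R y (u t y) \<le> L * b\<^sup>2" using R_le[OF u_nonneg[OF assms, of y], of y] by linarith
qed

lemma c_pos: assumes "0 \<le> t" shows "0 < c t"
proof -
  obtain b where b: "\<And>x. u t x \<le> b" using u_bound[OF assms] by blast
  have i: "integrable M0 (u t)" by (rule integrable_bdd(1)[OF u_meas[OF assms] u_nonneg[OF assms] b])
  have "c t \<noteq> 0"
  proof
    assume "c t = 0"
    then have "AE x in M0. u t x = 0"
      using integral_nonneg_eq_0_iff_AE[OF i] u_nonneg[OF assms] by (simp add: c_def)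
    then have "AE x in M0. False" by eventually_elim (metis assms less_irrefl u_pos)
    then have "(\<integral>x. \<phi> x \<partial>M0) = (\<integral>x. 0 \<partial>M0)" by (intro integral_cong_AE) (auto elim: eventually_mono)
    then show False using \<phi>_int by simp
  qed
  moreover have "0 \<le> c t" unfolding c_def using u_nonneg[OF assms] by simp
  ultimately show ?thesis by simp
qed

lemma time_integral_nonneg: "(\<And>s. s \<in> {0..t} \<Longrightarrow> 0 \<le> g s) \<Longrightarrow> 0 \<le> (LINT s:{0..t}|lborel. (g s :: real))"
  unfolding set_lebesgue_integral_def by (intro Bochner_Integration.integral_nonneg) (auto simp: indicator_def)

lemma c_antimono: assumes "0 \<le> s" "s \<le> t" shows "c t \<le> c s"
proof -
  have "0 \<le> (LINT v:{0..t - s}|lborel. (\<integral>y. R y (u (s + (t - s) - v) y) \<partial>M0))"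
    using assms by (intro time_integral_nonneg Bochner_Integration.integral_nonneg R_comp(2)) auto
  then show ?thesis using pairing[of s "t - s"] assms by (simp add: c_def)
qed

lemma u_le_T: assumes "0 \<le> r" "0 \<le> t" shows "u (r + t) x \<le> T t (u r) x"
proof -
  have "0 \<le> (LINT v:{0..t}|lborel. (\<integral>y. R y (u (r + t - v) y) \<partial>\<kappa> v x))"
    using assms by (intro time_integral_nonneg Bochner_Integration.integral_nonneg R_comp(2)) auto
  then show ?thesis using flow[OF assms, of x] by simp
qed

lemma IU_bounds:
  assumes "0 < h"
  obtains \<epsilon> C where "0 < \<epsilon>" "\<epsilon> \<le> 1" "1 \<le> C"
    "\<And>f b x. f \<in> borel_measurable M0 \<Longrightarrow> (\<And>y. 0 \<le> f y) \<Longrightarrow> (\<And>y. f y \<le> b) \<Longrightarrow> \<epsilon> * \<phi> x * (\<integral>y. f y \<partial>M0) \<le> T h f x"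
    "\<And>f b x. f \<in> borel_measurable M0 \<Longrightarrow> (\<And>y. 0 \<le> f y) \<Longrightarrow> (\<And>y. f y \<le> b) \<Longrightarrow> T h f x \<le> C * \<phi> x * (\<integral>y. f y \<partial>M0)"
proof -
  obtain \<epsilon> C where e: "0 < \<epsilon>" and *: "\<And>f b x. f \<in> borel_measurable M0 \<Longrightarrow> (\<And>y. 0 \<le> f y) \<Longrightarrow> (\<And>y. f y \<le> b) \<Longrightarrow>
      \<epsilon> * \<phi> x * (\<integral>y. f y \<partial>M0) \<le> T h f x \<and> T h f x \<le> C * \<phi> x * (\<integral>y. f y \<partial>M0)"
    using IU[OF assms] by metis
  have "\<epsilon> * \<phi> x \<le> \<phi> x \<and> \<phi> x \<le> C * \<phi> x" for x
    using *[OF \<phi>_meas less_imp_le[OF \<phi>_pos] \<phi>_le, of x] inv[of h x] assms by (simp add: \<phi>_int)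
  then have "\<epsilon> \<le> 1" "1 \<le> C" using \<phi>_pos[of undefined] by (auto simp: mult_le_cancel_right1 mult_le_cancel_right2)
  then show ?thesis using that[OF e] * by blast
qed

text \<open>
  The upper bound \<open>u \<le> T u\<close> is immediate, as \<open>R\<close> is nonnegative. It makes \<open>u\<close> bounded by a constant times \<open>\<phi>\<close> after one unit of time, so that
  \<open>R u\<close> is at most a multiple of \<open>u\<close>. Over a short time \<open>h\<close> the nonlinear term then removes at most half of \<open>T\<^sub>h u\<close>, and \<open>u\<^bsub>r+h\<^esub>\<close> lies
  between \<open>T\<^sub>h u\<^sub>r / 2\<close> and \<open>T\<^sub>h u\<^sub>r\<close>. Intrinsic ultracontractivity at time \<open>h\<close> compares \<open>T\<^sub>h u\<^sub>r\<close> with \<open>c r * \<phi>\<close>.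
\<close>

lemma eventual_two_sided_bounds:
  obtains h \<epsilon> D where "0 < h" "0 < \<epsilon>" "\<epsilon> \<le> 1" "1 \<le> D"
    "minorised h \<epsilon>"
    "\<And>t x. 1 + h \<le> t \<Longrightarrow> u t x \<le> D * c t * \<phi> x"
    "\<And>t x. 1 + h \<le> t \<Longrightarrow> \<epsilon> / 2 * c t * \<phi> x \<le> u t x"
proof -
  obtain \<epsilon>1 C1 where C1: "1 \<le> C1"
    "\<And>f b x. f \<in> borel_measurable M0 \<Longrightarrow> (\<And>y. 0 \<le> f y) \<Longrightarrow> (\<And>y. f y \<le> b) \<Longrightarrow> T 1 f x \<le> C1 * \<phi> x * (\<integral>y. f y \<partial>M0)"
    using IU_bounds[of 1] by (metis zero_less_one)
  define B where "B = C1 * c 0"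
  have B0: "0 < B" using C1(1) c_pos[of 0] by (simp add: B_def)
  have uB: "u t x \<le> B * \<phi> x" if "1 \<le> t" for t x
  proof -
    have t: "0 \<le> t - 1" using that by simp
    obtain b where b: "\<And>x. u (t - 1) x \<le> b" using u_bound[OF t] by blast
    have "u t x \<le> T 1 (u (t - 1)) x" using u_le_T[OF t, of 1 x] by simp
    also have "\<dots> \<le> C1 * \<phi> x * c (t - 1)" unfolding c_def by (rule C1(2)[OF u_meas[OF t] u_nonneg[OF t] b])
    also have "\<dots> \<le> C1 * \<phi> x * c 0" using c_antimono[of 0 "t - 1"] t C1(1) \<phi>_pos[of x] by (intro mult_left_mono) auto
    finally show ?thesis by (simp add: B_def mult_ac)
  qed
  \<comment> \<open>This \<open>h\<close> is so short that the nonlinear term removes at most one half.\<close>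
  define h where "h = 1 / (2 * (L * B * \<Phi> + 1))"
  have q0: "0 \<le> L * B * \<Phi>" using L_nonneg B0 \<Phi>_pos by simp
  have h0: "0 < h" and hq: "L * B * \<Phi> * h \<le> 1 / 2" using q0 by (auto simp: h_def divide_simps)
  obtain \<epsilon> C where C: "0 < \<epsilon>" "\<epsilon> \<le> 1" "1 \<le> C"
    "\<And>f b x. f \<in> borel_measurable M0 \<Longrightarrow> (\<And>y. 0 \<le> f y) \<Longrightarrow> (\<And>y. f y \<le> b) \<Longrightarrow> \<epsilon> * \<phi> x * (\<integral>y. f y \<partial>M0) \<le> T h f x"
    "\<And>f b x. f \<in> borel_measurable M0 \<Longrightarrow> (\<And>y. 0 \<le> f y) \<Longrightarrow> (\<And>y. f y \<le> b) \<Longrightarrow> T h f x \<le> C * \<phi> x * (\<integral>y. f y \<partial>M0)"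
    using IU_bounds[OF h0] by metis
  have min: "minorised h \<epsilon>" unfolding minorised_def using C(4) by blast
  have half: "T h (u r) x / 2 \<le> u (r + h) x" if r: "1 \<le> r" for r x
  proof -
    have r0: "0 \<le> r" using r by simp
    obtain br where br: "\<And>x. u r x \<le> br" using u_bound[OF r0] by blast
    have Th0: "0 \<le> T h (u r) x" using u_nonneg[OF r0] by simp
    have "\<bar>LINT s:{0..h}|lborel. (\<integral>y. R y (u (r + h - s) y) \<partial>\<kappa> s x)\<bar> \<le> (L * B * \<Phi> * T h (u r) x) * (h - 0)"
    proof (rule abs_interval_integral_le)
      fix s assume s: "s \<in> {0..h}"
      then have s0: "0 \<le> s" and rs: "1 \<le> r + h - s" "0 \<le> r + h - s" "0 \<le> h - s" using r by auto
      obtain b where b: "\<And>x. u (r + h - s) x \<le> b" using u_bound[OF rs(2)] by blast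
      note m = u_meas[OF rs(2)]
      have b': "L * B * \<Phi> * u (r + h - s) y \<le> L * B * \<Phi> * b" for y using b q0 by (intro mult_left_mono)
      have "T s (\<lambda>y. R y (u (r + h - s) y)) x \<le> T s (\<lambda>y. L * B * \<Phi> * u (r + h - s) y) x"
      proof (rule T_mono[OF s0 R_comp(1)[OF rs(2)] _ R_comp(2)[OF rs(2)] _ b'])
        show "(\<lambda>y. L * B * \<Phi> * u (r + h - s) y) \<in> borel_measurable M0" using m by measurable
        fix y
        let ?v = "u (r + h - s) y"
        have v0: "0 \<le> ?v" by (rule u_nonneg[OF rs(2)])
        have "?v \<le> B * \<Phi>" using uB[OF rs(1), of y] \<phi>_le[of y] B0 by (meson less_imp_le mult_left_mono order_trans)
        then have "L * ?v\<^sup>2 \<le> L * (B * \<Phi> * ?v)" using L_nonneg v0 by (simp add: power2_eq_square mult_left_mono mult_right_mono)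
        then show "R y ?v \<le> L * B * \<Phi> * ?v" using R_le[OF v0, of y] by (simp add: mult.assoc)
      qed
      also have "\<dots> = L * B * \<Phi> * T s (u (r + h - s)) x" by simp
      also have "\<dots> \<le> L * B * \<Phi> * T s (T (h - s) (u r)) x"
      proof (rule mult_left_mono[OF _ q0], rule integral_mono)
        show "integrable (\<kappa> s x) (u (r + h - s))" by (rule integrable_bdd(2)[OF m u_nonneg[OF rs(2)] b s0])
        have i: "integrable (\<kappa> (h - s) y) (u r)" for y by (rule integrable_bdd(2)[OF u_meas[OF r0] u_nonneg[OF r0] br rs(3)])
        have le: "T (h - s) (u r) y \<le> C' * \<Phi>" if "\<And>y. T (h - s) (u r) y \<le> C' * \<phi> y" "0 \<le> C'" for C' y
          using that(1)[of y] \<phi>_le[of y] that(2) by (meson mult_left_mono order_trans)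
        have "T (h - s) (u r) y \<le> B * \<phi> y" for y
        proof -
          have "T (h - s) (u r) y \<le> T (h - s) (\<lambda>y. B * \<phi> y) y"
          proof (rule T_mono[OF rs(3) u_meas[OF r0] _ u_nonneg[OF r0] uB[OF r]])
            show "B * \<phi> y \<le> B * \<Phi>" for y using \<phi>_le B0 by simp
          qed measurable
          then show ?thesis using inv[OF rs(3)] by simp
        qed
        then show "integrable (\<kappa> s x) (T (h - s) (u r))"
          using u_nonneg[OF r0] B0
          by (intro integrable_bdd(2)[OF T_meas[OF rs(3) u_meas[OF r0] u_nonneg[OF r0] br] _ le s0]) auto
        show "u (r + h - s) y \<le> T (h - s) (u r) y" for y
          using u_le_T[OF r0 rs(3), of y] by (simp add: algebra_simps)
      qed
      also have "T s (T (h - s) (u r)) x = T h (u r) x"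
        using semigroup[OF s0 rs(3) u_meas[OF r0] u_nonneg[OF r0] br, of x] by simp
      finally show "\<bar>\<integral>y. R y (u (r + h - s) y) \<partial>\<kappa> s x\<bar> \<le> L * B * \<Phi> * T h (u r) x"
        using R_comp(2)[OF rs(2)] by simp
    qed (use h0 q0 Th0 in auto)
    also have "\<dots> \<le> T h (u r) x / 2" using mult_right_mono[OF hq Th0] by (simp add: mult_ac)
    finally show ?thesis using flow[OF r0 less_imp_le[OF h0], of x] by linarith
  qed
  \<comment> \<open>Integrating the lower bound against the invariant measure shows that \<open>c\<close> at most halves in time \<open>h\<close>.\<close>
  have chalf: "c r / 2 \<le> c (r + h)" if r: "1 \<le> r" for r
  proof -
    have r0: "0 \<le> r" "0 \<le> r + h" using r h0 by auto
    obtain b where b: "\<And>x. u r x \<le> b" using u_bound[OF r0(1)] by blast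
    obtain b' where b': "\<And>x. u (r + h) x \<le> b'" using u_bound[OF r0(2)] by blast
    have m: "T h (u r) \<in> borel_measurable M0" by (rule T_meas[OF less_imp_le[OF h0] u_meas[OF r0(1)] u_nonneg[OF r0(1)] b])
    have "c r / 2 = (\<integral>x. T h (u r) x / 2 \<partial>M0)"
      using dual[OF less_imp_le[OF h0] u_meas[OF r0(1)] u_nonneg[OF r0(1)] b] by (simp add: c_def)
    also have "\<dots> \<le> c (r + h)" unfolding c_def
      using half[OF r] u_nonneg[OF r0(1)] by (intro M0_mono[OF _ u_meas[OF r0(2)] _ _ b']) (use m in auto)
    finally show ?thesis .
  qed
  show ?thesis
  proof (rule that[OF h0 C(1,2) _ min])
    show "1 \<le> 2 * C" using C(3) by simp
    fix t x assume t: "1 + h \<le> t"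
    then have r: "1 \<le> t - h" "0 \<le> t - h" using h0 by auto
    obtain b where b: "\<And>x. u (t - h) x \<le> b" using u_bound[OF r(2)] by blast
    note f = u_meas[OF r(2)] u_nonneg[OF r(2)] b
    have "u t x \<le> T h (u (t - h)) x" using u_le_T[OF r(2) less_imp_le[OF h0], of x] by simp
    also have "\<dots> \<le> C * \<phi> x * c (t - h)" unfolding c_def by (rule C(5)[OF f])
    also have "\<dots> \<le> C * \<phi> x * (2 * c t)" using chalf[OF r(1)] C(3) \<phi>_pos[of x] by (intro mult_left_mono) auto
    finally show "u t x \<le> 2 * C * c t * \<phi> x" by (simp add: mult_ac)
    have "\<epsilon> / 2 * c t * \<phi> x \<le> \<epsilon> / 2 * c (t - h) * \<phi> x"
      using c_antimono[of "t - h" t] r h0 C(1) \<phi>_pos[of x] by (intro mult_right_mono mult_left_mono) auto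
    also have "\<dots> = \<epsilon> * \<phi> x * c (t - h) / 2" by simp
    also have "\<dots> \<le> T h (u (t - h)) x / 2" unfolding c_def using C(4)[OF f] by (intro divide_right_mono) auto
    also have "\<dots> \<le> u t x" using half[OF r(1), of x] by simp
    finally show "\<epsilon> / 2 * c t * \<phi> x \<le> u t x" .
  qed
qed

text \<open>
  If \<open>c\<close> stayed above \<open>e > 0\<close>, then \<open>u\<close> would stay above a multiple \<open>\<delta> * \<phi>\<close>, and \<open>c\<close> would lose at least the fixed positive amount
  \<open>\<integral> R (\<delta> \<phi>) dM0\<close> per unit of time, which is impossible for a positive function.
\<close>

lemma c_tendsto_0: "(c \<longlongrightarrow> 0) at_top"
proof -
  obtain h \<epsilon> D where h: "0 < h" "0 < \<epsilon>"
    "\<And>t x. 1 + h \<le> t \<Longrightarrow> \<epsilon> / 2 * c t * \<phi> x \<le> u t x"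
    using eventual_two_sided_bounds by metis
  have "\<exists>t\<ge>0. c t < e" if e: "0 < e" for e
  proof (rule ccontr)
    assume "\<not> (\<exists>t\<ge>0. c t < e)"
    then have ce: "e \<le> c t" if "0 \<le> t" for t using that by (auto simp: not_less)
    define \<delta> where "\<delta> = \<epsilon> / 2 * e"
    have d: "0 < \<delta>" using h e by (simp add: \<delta>_def)
    have lower: "\<delta> * \<phi> x \<le> u t x" if "1 + h \<le> t" for t x
    proof -
      have "\<epsilon> / 2 * e * \<phi> x \<le> \<epsilon> / 2 * c t * \<phi> x" using ce[of t] that h \<phi>_pos[of x] by (intro mult_right_mono mult_left_mono) auto
      then show ?thesis using h(3)[OF that, of x] by (simp add: \<delta>_def)
    qed
    define \<rho> where "\<rho> = (\<integral>x. R x (\<delta> * \<phi> x) \<partial>M0)"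
    have Rm: "(\<lambda>x. R x (a * \<phi> x)) \<in> borel_measurable M0" if "0 \<le> a" for a
      using that \<phi>_pos by (intro R_meas) (simp_all add: less_imp_le)
    have Rb: "R x (a * \<phi> x) \<le> L * (a * \<Phi>)\<^sup>2" if "0 \<le> a" for a x
      using R_le[of "a * \<phi> x" x] L_nonneg that \<phi>_pos[of x] \<phi>_le[of x]
      by (meson less_imp_le mult_left_mono mult_nonneg_nonneg order_trans power_mono)
    have \<rho>: "0 < \<rho>"
    proof -
      have "\<forall>\<^sub>F a in at_right 0. 0 < (\<integral>x. R x (a * \<phi> x) \<partial>M0) / a\<^sup>2" by (rule order_tendstoD(1)[OF lim \<nu>_pos])
      moreover have "\<forall>\<^sub>F a in at_right 0. a < \<delta>" using d by (intro eventually_at_right_less order_tendstoD) (auto intro: tendsto_intros eventually_at_right_real simp: eventually_at_right)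
      ultimately have ev: "\<forall>\<^sub>F a in at_right 0. 0 < (\<integral>x. R x (a * \<phi> x) \<partial>M0) / a\<^sup>2 \<and> a < \<delta> \<and> a > 0"
        using eventually_at_right_less[of "0::real"] by eventually_elim auto
      then obtain a where a: "0 < (\<integral>x. R x (a * \<phi> x) \<partial>M0) / a\<^sup>2" "a < \<delta>" "0 < a"
        using eventually_happens'[OF trivial_limit_at_right_real ev] by blast
      have "(\<integral>x. R x (a * \<phi> x) \<partial>M0) \<le> \<rho>" unfolding \<rho>_def
        using a d \<phi>_pos by (intro M0_mono[OF Rm Rm _ _ Rb] R_nonneg R_mono mult_right_mono) (auto intro: less_imp_le)
      moreover have "0 < (\<integral>x. R x (a * \<phi> x) \<partial>M0)" using a by (simp add: zero_less_divide_iff)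
      ultimately show ?thesis by linarith
    qed
    define r where "r = 1 + h"
    have r: "0 \<le> r" using h by (simp add: r_def)
    have dec: "c (r + t) \<le> c r - \<rho> * t" if t: "0 \<le> t" for t
    proof -
      have "(LINT s:{0..t}|lborel. \<rho>) \<le> (LINT s:{0..t}|lborel. (\<integral>y. R y (u (r + t - s) y) \<partial>M0))"
      proof (rule set_integral_mono[OF _ pairing_int[OF r t]])
        show "set_integrable lborel {0..t} (\<lambda>s. \<rho>)" by (rule set_integrable_bounded_interval[where C="\<bar>\<rho>\<bar>"]) auto
        fix s assume s: "s \<in> {0..t}"
        then have rs: "0 \<le> r + t - s" "1 + h \<le> r + t - s" using r by (auto simp: r_def)
        obtain b where b: "\<And>x. u (r + t - s) x \<le> b" using u_bound[OF rs(1)] by blast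
        show "\<rho> \<le> (\<integral>y. R y (u (r + t - s) y) \<partial>M0)" unfolding \<rho>_def
          using d \<phi>_pos lower[OF rs(2)]
          by (intro M0_mono[OF Rm R_comp(1)[OF rs(1)] _ _ R_comp(3)[OF rs(1) b]] R_nonneg R_mono) (auto intro: less_imp_le)
      qed
      moreover have "(LINT s:{0..t}|lborel. \<rho>) = \<rho> * t" using t by (simp add: set_lebesgue_integral_def)
      ultimately show ?thesis using pairing[OF r t] by (simp add: c_def)
    qed
    have "c (r + c r / \<rho>) \<le> 0" using dec[of "c r / \<rho>"] \<rho> c_pos[OF r] by simp
    moreover have "0 \<le> r + c r / \<rho>" using r \<rho> c_pos[OF r] by simp
    ultimately show False using c_pos by (meson not_less)
  qed
  show ?thesis
  proof (rule tendstoI)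
    fix e :: real assume "0 < e"
    then obtain t0 where t0: "0 \<le> t0" "c t0 < e" using \<open>\<And>e. 0 < e \<Longrightarrow> \<exists>t\<ge>0. c t < e\<close> by blast
    show "\<forall>\<^sub>F t in at_top. dist (c t) 0 < e"
      using eventually_ge_at_top[of t0]
    proof eventually_elim
      case (elim t)
      then show ?case using t0 c_antimono[of t0 t] c_pos[of t] by simp
    qed
  qed
qed

lemma T_affine:
  assumes "0 \<le> t" "f \<in> borel_measurable M0" "\<And>y. 0 \<le> f y" "\<And>y. f y \<le> b"
  shows "T t (\<lambda>y. f y - a * \<phi> y) x = T t f x - a * \<phi> x" "T t (\<lambda>y. a * \<phi> y - f y) x = a * \<phi> x - T t f x"
    "(\<integral>y. f y - a * \<phi> y \<partial>M0) = (\<integral>y. f y \<partial>M0) - a" "(\<integral>y. a * \<phi> y - f y \<partial>M0) = a - (\<integral>y. f y \<partial>M0)"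
  using integrable_bdd[OF assms(2-4)] integrable_bdd[OF \<phi>_meas less_imp_le[OF \<phi>_pos] \<phi>_le] assms(1)
  by (auto simp: inv \<phi>_int)

text \<open>
  Subtracting the minorised part \<open>\<epsilon> * \<phi> * m\<close> leaves a positive operator of norm \<open>1 - \<epsilon>\<close> relative to \<open>\<phi>\<close>: apply the minorisation to
  \<open>f - a * \<phi>\<close> and to \<open>b * \<phi> - f\<close>.
\<close>

lemma doeblin_step:
  assumes h: "0 < h"
    and low: "minorised h \<epsilon>"
    and f[measurable]: "f \<in> borel_measurable M0" and f': "\<And>y. 0 \<le> f y" "\<And>y. a * \<phi> y \<le> f y" "\<And>y. f y \<le> b * \<phi> y"
  defines "m \<equiv> (\<integral>y. f y \<partial>M0)"
  shows "((1 - \<epsilon>) * a + \<epsilon> * m) * \<phi> x \<le> T h f x" "T h f x \<le> ((1 - \<epsilon>) * b + \<epsilon> * m) * \<phi> x"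
proof -
  have b: "0 \<le> b" using order_trans[OF f'(1) f'(3), of undefined] \<phi>_pos[of undefined] by (simp add: zero_le_mult_iff)
  have fb: "f y \<le> b * \<Phi>" for y using f'(3)[of y] mult_left_mono[OF \<phi>_le b, of y] by linarith
  have a: "- (a * \<phi> y) \<le> \<bar>a\<bar> * \<Phi>" for y
  proof -
    have "- (a * \<phi> y) \<le> \<bar>a\<bar> * \<phi> y" using mult_right_mono[of "- a" "\<bar>a\<bar>" "\<phi> y"] \<phi>_pos[of y] by simp
    also have "\<dots> \<le> \<bar>a\<bar> * \<Phi>" using \<phi>_le by (intro mult_left_mono) auto
    finally show ?thesis .
  qed
  note aff = T_affine[OF less_imp_le[OF h] f f'(1) fb]
  have "\<epsilon> * \<phi> x * (\<integral>y. f y - a * \<phi> y \<partial>M0) \<le> T h (\<lambda>y. f y - a * \<phi> y) x"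
  proof (rule low[unfolded minorised_def, rule_format])
    show "f y - a * \<phi> y \<le> b * \<Phi> + \<bar>a\<bar> * \<Phi>" for y using fb[of y] a[of y] by linarith
  qed (use f' in auto)
  then show "((1 - \<epsilon>) * a + \<epsilon> * m) * \<phi> x \<le> T h f x" unfolding aff m_def by (simp add: algebra_simps)
  have "\<epsilon> * \<phi> x * (\<integral>y. b * \<phi> y - f y \<partial>M0) \<le> T h (\<lambda>y. b * \<phi> y - f y) x"
  proof (rule low[unfolded minorised_def, rule_format])
    show "b * \<phi> y - f y \<le> b * \<Phi>" for y using f'(1)[of y] mult_left_mono[OF \<phi>_le b, of y] by linarith
  qed (use f' in auto)
  then show "T h f x \<le> ((1 - \<epsilon>) * b + \<epsilon> * m) * \<phi> x" unfolding aff m_def by (simp add: algebra_simps)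
qed

lemma doeblin:
  assumes h: "0 < h"
    and low: "minorised h \<epsilon>"
    and f: "f \<in> borel_measurable M0" "\<And>y. 0 \<le> f y" "\<And>y. f y \<le> a * \<phi> y"
  defines "m \<equiv> (\<integral>y. f y \<partial>M0)"
  shows "(m - (1 - \<epsilon>) ^ Suc n * m) * \<phi> x \<le> T (real (Suc n) * h) f x \<and> T (real (Suc n) * h) f x \<le> (m + (1 - \<epsilon>) ^ Suc n * (a - m)) * \<phi> x"
proof (induction n arbitrary: x)
  case 0
  show ?case using doeblin_step[OF h low f(1,2) _ f(3), where a=0] f(2) by (simp add: m_def algebra_simps)
next
  case (Suc n)
  have a: "0 \<le> a" using order_trans[OF f(2) f(3), of undefined] \<phi>_pos[of undefined] by (simp add: zero_le_mult_iff)
  have fb: "f y \<le> a * \<Phi>" for y using f(3)[of y] mult_left_mono[OF \<phi>_le a, of y] by linarith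
  let ?s = "real (Suc n) * h"
  have s: "0 \<le> ?s" using h by simp
  have g: "T ?s f \<in> borel_measurable M0" "\<And>y. 0 \<le> T ?s f y" using T_meas[OF s f(1,2) fb] f(2) by auto
  have m: "(\<integral>y. T ?s f y \<partial>M0) = m" unfolding m_def by (rule dual[OF s f(1,2) fb])
  have "T (real (Suc (Suc n)) * h) f x = T h (T ?s f) x"
    using semigroup[OF less_imp_le[OF h] s f(1,2) fb, of x] by (simp add: algebra_simps)
  moreover have "((1 - \<epsilon>) * (m - (1 - \<epsilon>) ^ Suc n * m) + \<epsilon> * m) * \<phi> x \<le> T h (T ?s f) x"
    "T h (T ?s f) x \<le> ((1 - \<epsilon>) * (m + (1 - \<epsilon>) ^ Suc n * (a - m)) + \<epsilon> * m) * \<phi> x"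
    using doeblin_step[OF h low g, of "m - (1 - \<epsilon>) ^ Suc n * m" "m + (1 - \<epsilon>) ^ Suc n * (a - m)" x] Suc.IH
    unfolding m by blast+
  moreover have "(1 - \<epsilon>) * (m - (1 - \<epsilon>) ^ Suc n * m) + \<epsilon> * m = m - (1 - \<epsilon>) ^ Suc (Suc n) * m"
    "(1 - \<epsilon>) * (m + (1 - \<epsilon>) ^ Suc n * (a - m)) + \<epsilon> * m = m + (1 - \<epsilon>) ^ Suc (Suc n) * (a - m)"
    by (simp_all add: algebra_simps)
  ultimately show ?case by simp
qed

text \<open>
  Go back from \<open>t\<close> by a fixed time \<open>\<tau>\<close>, so long that \<open>T\<^bsub>\<tau>\<^esub> u\<^bsub>t-\<tau>\<^esub>\<close> is close to \<open>c (t - \<tau>) * \<phi>\<close> by the Doeblin estimate. On that interval \<open>u\<close>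
  is of order \<open>c * \<phi>\<close>, so that the nonlinear term contributes only \<open>O(c\<^sup>2) * \<phi>\<close>, both to \<open>u\<close> and to \<open>c\<close>. This is negligible because \<open>c\<close> tends to \<open>0\<close>.
\<close>

lemma asymptotic_profile:
  assumes \<delta>: "0 < \<delta>"
  shows "\<forall>\<^sub>F t in at_top. \<forall>x. \<bar>u t x - c t * \<phi> x\<bar> \<le> \<delta> * c t * \<phi> x"
proof -
  obtain h \<epsilon> D where h: "0 < h" and \<epsilon>: "0 < \<epsilon>" "\<epsilon> \<le> 1" and D: "1 \<le> D" and
    low: "minorised h \<epsilon>"
    and up: "\<And>t x. 1 + h \<le> t \<Longrightarrow> u t x \<le> D * c t * \<phi> x"
    using eventual_two_sided_bounds by metis
  have "(\<lambda>n. (1 - \<epsilon>) ^ n * D) \<longlonglongrightarrow> 0 * D" using \<epsilon> by (intro tendsto_intros LIMSEQ_realpow_zero) auto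
  then have "\<forall>\<^sub>F n in sequentially. (1 - \<epsilon>) ^ n * D < \<delta> / 4" using \<delta> by (intro order_tendstoD(2)) auto
  then obtain n0 where n0: "\<And>n. n \<ge> n0 \<Longrightarrow> (1 - \<epsilon>) ^ n * D < \<delta> / 4" by (auto simp: eventually_sequentially)
  define p where "p = (1 - \<epsilon>) ^ Suc n0"
  have p: "p * D < \<delta> / 4" "0 \<le> p" using n0[of "Suc n0"] \<epsilon> by (auto simp: p_def)
  define \<tau> where "\<tau> = real (Suc n0) * h"
  have \<tau>: "0 < \<tau>" using h by (simp add: \<tau>_def)
  define Q where "Q = L * D\<^sup>2 * \<Phi> * \<tau>"
  have Q: "0 \<le> Q" using L_nonneg \<Phi>_pos \<tau> by (simp add: Q_def)
  \<comment> \<open>Below this level of \<open>c\<close> the nonlinear error \<open>Q * c\<^sup>2\<close> is at most \<open>c / 2\<close> and at most \<open>\<delta> * c / 8\<close>.\<close>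
  define \<eta> where "\<eta> = min (1 / 2) (\<delta> / 8) / (Q + 1)"
  have \<eta>: "0 < \<eta>" using Q \<delta> by (simp add: \<eta>_def)
  have shift: "filterlim (\<lambda>t. t - \<tau>) at_top at_top"
    by (rule filterlim_tendsto_add_at_top[of "\<lambda>_. - \<tau>", OF tendsto_const filterlim_ident, simplified])
  have "\<forall>\<^sub>F t in at_top. c (t - \<tau>) < \<eta>"
    using order_tendstoD(2)[OF filterlim_compose[OF c_tendsto_0 shift] \<eta>] .
  moreover have "\<forall>\<^sub>F t in at_top. t \<ge> 1 + h + \<tau>" by (rule eventually_ge_at_top)
  ultimately show ?thesis
  proof eventually_elim
    case (elim t)
    define r where "r = t - \<tau>"
    have r: "1 + h \<le> r" "0 \<le> r" "t = r + \<tau>" using elim h by (auto simp: r_def)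
    have cr: "0 < c r" by (rule c_pos[OF r(2)])
    have Qc: "Q * c r \<le> 1 / 2" "Q * c r \<le> \<delta> / 8"
    proof -
      have "Q * c r \<le> (Q + 1) * \<eta>" using elim(1) Q cr by (intro mult_mono) (auto simp: r_def)
      also have "\<dots> = min (1 / 2) (\<delta> / 8)" using Q by (simp add: \<eta>_def)
      finally show "Q * c r \<le> 1 / 2" "Q * c r \<le> \<delta> / 8" by auto
    qed
    define B where "B = L * D\<^sup>2 * (c r)\<^sup>2 * \<Phi>"
    have B0: "0 \<le> B" using L_nonneg \<Phi>_pos by (simp add: B_def)
    have BQ: "B * \<tau> = Q * c r * c r" by (simp add: B_def Q_def power2_eq_square)
    have Rb: "R y (u (r + \<tau> - s) y) \<le> B * \<phi> y" if s: "s \<in> {0..\<tau>}" for s y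
    proof -
      let ?v = "u (r + \<tau> - s) y"
      have rs: "0 \<le> r + \<tau> - s" "1 + h \<le> r + \<tau> - s" "r \<le> r + \<tau> - s" using s r by auto
      have v0: "0 \<le> ?v" by (rule u_nonneg[OF rs(1)])
      have "?v \<le> D * c (r + \<tau> - s) * \<phi> y" by (rule up[OF rs(2)])
      also have "\<dots> \<le> D * c r * \<phi> y" using c_antimono[OF r(2) rs(3)] D \<phi>_pos[of y] by (intro mult_right_mono mult_left_mono) auto
      finally have v: "?v \<le> D * c r * \<phi> y" .
      have "R y ?v \<le> L * ?v\<^sup>2" by (rule R_le[OF v0])
      also have "\<dots> \<le> L * (D * c r * \<phi> y)\<^sup>2" using v v0 L_nonneg by (intro mult_left_mono power_mono)
      also have "\<dots> = L * D\<^sup>2 * (c r)\<^sup>2 * (\<phi> y * \<phi> y)" by (simp add: power2_eq_square mult_ac)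
      also have "\<dots> \<le> L * D\<^sup>2 * (c r)\<^sup>2 * (\<Phi> * \<phi> y)"
        using \<phi>_le[of y] \<phi>_pos[of y] L_nonneg by (intro mult_left_mono mult_right_mono) auto
      finally show ?thesis by (simp add: B_def mult_ac)
    qed
    have phiB: "B * \<phi> y \<le> B * \<Phi>" for y using \<phi>_le B0 by (intro mult_left_mono)
    have J: "\<bar>LINT s:{0..\<tau>}|lborel. T s (\<lambda>y. R y (u (r + \<tau> - s) y)) x\<bar> \<le> B * \<phi> x * (\<tau> - 0)" for x
    proof (rule abs_interval_integral_le)
      fix s assume s: "s \<in> {0..\<tau>}"
      then have rs: "0 \<le> r + \<tau> - s" using r by auto
      have "T s (\<lambda>y. R y (u (r + \<tau> - s) y)) x \<le> T s (\<lambda>y. B * \<phi> y) x"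
        using s by (intro T_mono[OF _ R_comp(1)[OF rs] _ R_comp(2)[OF rs] Rb phiB]) auto
      then show "\<bar>T s (\<lambda>y. R y (u (r + \<tau> - s) y)) x\<bar> \<le> B * \<phi> x"
        using R_comp(2)[OF rs] s by (simp add: inv)
    qed (use \<tau> B0 \<phi>_pos[of x] in auto)
    have Kc: "\<bar>LINT s:{0..\<tau>}|lborel. (\<integral>y. R y (u (r + \<tau> - s) y) \<partial>M0)\<bar> \<le> B * (\<tau> - 0)"
    proof (rule abs_interval_integral_le)
      fix s assume s: "s \<in> {0..\<tau>}"
      then have rs: "0 \<le> r + \<tau> - s" using r by auto
      have "(\<integral>y. R y (u (r + \<tau> - s) y) \<partial>M0) \<le> (\<integral>y. B * \<phi> y \<partial>M0)"
        by (intro M0_mono[OF R_comp(1)[OF rs] _ R_comp(2)[OF rs] Rb[OF s] phiB]) auto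
      then show "\<bar>\<integral>y. R y (u (r + \<tau> - s) y) \<partial>M0\<bar> \<le> B"
        using R_comp(2)[OF rs] s by (simp add: \<phi>_int)
    qed (use \<tau> B0 in auto)
    have ct: "\<bar>c t - c r\<bar> \<le> Q * c r * c r"
      using Kc pairing[OF r(2) less_imp_le[OF \<tau>]] r(3) BQ by (simp add: c_def)
    have "Q * c r * c r \<le> 1 / 2 * c r" using Qc(1) cr by (intro mult_right_mono) auto
    then have ch: "c r \<le> 2 * c t" using ct by linarith
    have Qd: "Q * c r * c r \<le> \<delta> / 8 * c r" using Qc(2) cr by (intro mult_right_mono) auto
    show ?case
    proof
      fix x
      define S where "S = \<delta> * (c r * \<phi> x)"
      have \<phi>0: "0 \<le> \<phi> x" using \<phi>_pos[of x] by simp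
      have d: "(c r - p * c r) * \<phi> x \<le> T \<tau> (u r) x" "T \<tau> (u r) x \<le> (c r + p * (D * c r - c r)) * \<phi> x"
        using doeblin[OF h low u_meas[OF r(2)] u_nonneg[OF r(2)] up[OF r(1)], where x=x and n=n0]
        by (auto simp: \<tau>_def p_def c_def simp del: power_Suc of_nat_Suc)
      have 1: "p * D * (c r * \<phi> x) \<le> \<delta> / 4 * (c r * \<phi> x)"
        using p cr \<phi>0 by (intro mult_right_mono) auto
      have 2: "p * 1 * (c r * \<phi> x) \<le> p * D * (c r * \<phi> x)"
        using p D cr \<phi>0 by (intro mult_right_mono mult_left_mono) auto
      have 3: "0 \<le> p * (c r * \<phi> x)" using p cr \<phi>0 by simp
      have 4: "(c r - p * c r) * \<phi> x = c r * \<phi> x - p * (c r * \<phi> x)"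
        "(c r + p * (D * c r - c r)) * \<phi> x = c r * \<phi> x + p * D * (c r * \<phi> x) - p * (c r * \<phi> x)"
        by (simp_all add: algebra_simps)
      have 5: "p * D * (c r * \<phi> x) \<le> S / 4" using 1 by (simp add: S_def)
      have e1: "\<bar>T \<tau> (u r) x - c r * \<phi> x\<bar> \<le> S / 4"
        using d 2 3 5 unfolding 4 mult_1_right by linarith
      have "\<bar>u t x - T \<tau> (u r) x\<bar> \<le> Q * c r * c r * \<phi> x"
      proof -
        have "B * \<phi> x * (\<tau> - 0) = Q * c r * c r * \<phi> x" unfolding BQ[symmetric] by simp
        then have "\<bar>LINT s:{0..\<tau>}|lborel. T s (\<lambda>y. R y (u (r + \<tau> - s) y)) x\<bar> \<le> Q * c r * c r * \<phi> x"
          using J[of x] by metis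
        then show ?thesis using flow[OF r(2) less_imp_le[OF \<tau>], of x] r(3) by simp
      qed
      moreover have Qx: "Q * c r * c r * \<phi> x \<le> S / 8" using mult_right_mono[OF Qd \<phi>0] by (simp add: S_def mult.assoc)
      ultimately have e2: "\<bar>u t x - T \<tau> (u r) x\<bar> \<le> S / 8" by linarith
      have "\<bar>c t - c r\<bar> * \<phi> x \<le> Q * c r * c r * \<phi> x" by (rule mult_right_mono[OF ct \<phi>0])
      moreover have "\<bar>c r * \<phi> x - c t * \<phi> x\<bar> = \<bar>c t - c r\<bar> * \<phi> x"
        using \<phi>0 by (simp add: left_diff_distrib[symmetric] abs_mult abs_minus_commute)
      ultimately have e3: "\<bar>c r * \<phi> x - c t * \<phi> x\<bar> \<le> S / 8" using Qx by linarith
      have "\<delta> / 2 * (c r * \<phi> x) \<le> \<delta> / 2 * (2 * c t * \<phi> x)"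
        using ch \<delta> \<phi>0 by (intro mult_left_mono mult_right_mono) auto
      then have "S / 2 \<le> \<delta> * c t * \<phi> x" by (simp add: S_def)
      then show "\<bar>u t x - c t * \<phi> x\<bar> \<le> \<delta> * c t * \<phi> x" using e1 e2 e3 by linarith
    qed
  qed
qed

text \<open>
  Monotonicity of \<open>R\<close> places \<open>\<integral> R u dM0\<close> between its values for \<open>(1 - \<eta>) c \<phi>\<close> and \<open>(1 + \<eta>) c \<phi>\<close>; the
  second order expansion of \<open>R\<close> is needed only along multiples of \<open>\<phi>\<close>.
\<close>

lemma second_order_loss:
  assumes e: "0 < e"
  shows "\<forall>\<^sub>F t in at_top. \<bar>(\<integral>y. R y (u t y) \<partial>M0) - \<nu> * (c t)\<^sup>2\<bar> \<le> e * (c t)\<^sup>2"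
proof -
  have "((\<lambda>\<eta>. (\<nu> + \<eta>) * (1 + \<eta>)\<^sup>2) \<longlongrightarrow> (\<nu> + 0) * (1 + 0)\<^sup>2) (at_right 0)" by (intro tendsto_intros)
  then have 1: "\<forall>\<^sub>F \<eta> in at_right 0. (\<nu> + \<eta>) * (1 + \<eta>)\<^sup>2 < \<nu> + e" using e by (intro order_tendstoD(2)) auto
  have "((\<lambda>\<eta>. (\<nu> - \<eta>) * (1 - \<eta>)\<^sup>2) \<longlongrightarrow> (\<nu> - 0) * (1 - 0)\<^sup>2) (at_right 0)" by (intro tendsto_intros)
  then have 2: "\<forall>\<^sub>F \<eta> in at_right 0. \<nu> - e < (\<nu> - \<eta>) * (1 - \<eta>)\<^sup>2" using e by (intro order_tendstoD(1)) auto
  have 3: "\<forall>\<^sub>F \<eta> in at_right (0::real). \<eta> \<in> {0<..<1}" by (rule eventually_at_right_real) simp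
  obtain \<eta> where \<eta>: "(\<nu> + \<eta>) * (1 + \<eta>)\<^sup>2 < \<nu> + e" "\<nu> - e < (\<nu> - \<eta>) * (1 - \<eta>)\<^sup>2" "0 < \<eta>" "\<eta> < 1"
    using eventually_happens'[OF trivial_limit_at_right_real eventually_conj[OF 1 eventually_conj[OF 2 3]]] by auto
  define I where "I a = (\<integral>x. R x (a * \<phi> x) \<partial>M0)" for a
  have "\<forall>\<^sub>F a in at_right 0. dist (I a / a\<^sup>2) \<nu> < \<eta>" unfolding I_def using tendstoD[OF lim \<eta>(3)] .
  then obtain a0 where a0: "0 < a0" "\<And>a. 0 < a \<Longrightarrow> a < a0 \<Longrightarrow> \<bar>I a / a\<^sup>2 - \<nu>\<bar> < \<eta>"
    by (auto simp: eventually_at_right_field dist_real_def)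
  have Ib: "(\<nu> - \<eta>) * a\<^sup>2 \<le> I a" "I a \<le> (\<nu> + \<eta>) * a\<^sup>2" if "0 < a" "a < a0" for a
  proof -
    have "\<nu> - \<eta> \<le> I a / a\<^sup>2" "I a / a\<^sup>2 \<le> \<nu> + \<eta>" using a0(2)[OF that] by linarith+
    then show "(\<nu> - \<eta>) * a\<^sup>2 \<le> I a" "I a \<le> (\<nu> + \<eta>) * a\<^sup>2" using that by (simp_all add: pos_le_divide_eq pos_divide_le_eq)
  qed
  have Rm: "(\<lambda>x. R x (a * \<phi> x)) \<in> borel_measurable M0" if "0 \<le> a" for a
    using that \<phi>_pos by (intro R_meas) (simp_all add: less_imp_le)
  have Rb: "R x (a * \<phi> x) \<le> L * (a * \<Phi>)\<^sup>2" if "0 \<le> a" for a x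
    using R_le[of "a * \<phi> x" x] L_nonneg that \<phi>_pos[of x] \<phi>_le[of x]
    by (meson less_imp_le mult_left_mono mult_nonneg_nonneg order_trans power_mono)
  have "\<forall>\<^sub>F t in at_top. c t < a0 / 2" using a0(1) by (intro order_tendstoD(2)[OF c_tendsto_0]) simp
  moreover note asymptotic_profile[OF \<eta>(3)]
  moreover have "\<forall>\<^sub>F t in at_top. (0::real) \<le> t" by (rule eventually_ge_at_top)
  ultimately show ?thesis
  proof eventually_elim
    case (elim t)
    have ct: "0 < c t" using c_pos elim(3) by simp
    have b: "(1 - \<eta>) * c t * \<phi> x \<le> u t x" "u t x \<le> (1 + \<eta>) * c t * \<phi> x" for x
    proof -
      have "\<bar>u t x - c t * \<phi> x\<bar> \<le> \<eta> * (c t * \<phi> x)" using elim(2)[rule_format, of x] by (simp add: mult.assoc)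
      then show "(1 - \<eta>) * c t * \<phi> x \<le> u t x" "u t x \<le> (1 + \<eta>) * c t * \<phi> x"
        by (auto simp: left_diff_distrib distrib_right mult.assoc abs_le_iff)
    qed
    have p: "0 < (1 + \<eta>) * c t" "(1 + \<eta>) * c t < a0" "0 < (1 - \<eta>) * c t" "(1 - \<eta>) * c t < a0"
    proof -
      show "0 < (1 + \<eta>) * c t" "0 < (1 - \<eta>) * c t" using \<eta> ct by auto
      have "(1 + \<eta>) * c t \<le> 2 * c t" "(1 - \<eta>) * c t \<le> 1 * c t" using \<eta> ct by (intro mult_right_mono; simp)+
      then show "(1 + \<eta>) * c t < a0" "(1 - \<eta>) * c t < a0" using elim(1) ct by linarith+
    qed
    note Ru = R_comp(1,2)[OF elim(3)]
    have Rbu: "R y (u t y) \<le> R y ((1 + \<eta>) * c t * \<phi> y)" for y by (intro R_mono u_nonneg b elim(3))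
    have "(\<integral>y. R y (u t y) \<partial>M0) \<le> I ((1 + \<eta>) * c t)" unfolding I_def
      using p by (intro M0_mono[OF Ru(1) Rm Ru(2) Rbu Rb]) auto
    also have "\<dots> \<le> (\<nu> + \<eta>) * ((1 + \<eta>) * c t)\<^sup>2" by (rule Ib(2)[OF p(1,2)])
    also have "\<dots> = ((\<nu> + \<eta>) * (1 + \<eta>)\<^sup>2) * (c t)\<^sup>2" by (simp add: power_mult_distrib mult.assoc)
    also have "\<dots> \<le> (\<nu> + e) * (c t)\<^sup>2" using \<eta>(1) by (intro mult_right_mono) auto
    finally have up: "(\<integral>y. R y (u t y) \<partial>M0) \<le> (\<nu> + e) * (c t)\<^sup>2" .
    have Rl: "0 \<le> R y ((1 - \<eta>) * c t * \<phi> y)" "R y ((1 - \<eta>) * c t * \<phi> y) \<le> R y (u t y)" for y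
    proof -
      have "0 \<le> (1 - \<eta>) * c t * \<phi> y" using p(3) \<phi>_pos[of y] by (intro mult_nonneg_nonneg less_imp_le)
      then show "0 \<le> R y ((1 - \<eta>) * c t * \<phi> y)" "R y ((1 - \<eta>) * c t * \<phi> y) \<le> R y (u t y)"
        using b(1) by (auto intro: R_nonneg R_mono)
    qed
    obtain bt where bt: "\<And>x. u t x \<le> bt" using u_bound[OF elim(3)] by blast
    have "(\<nu> - e) * (c t)\<^sup>2 \<le> ((\<nu> - \<eta>) * (1 - \<eta>)\<^sup>2) * (c t)\<^sup>2" using \<eta>(2) by (intro mult_right_mono) auto
    also have "\<dots> = (\<nu> - \<eta>) * ((1 - \<eta>) * c t)\<^sup>2" by (simp add: power_mult_distrib mult.assoc)
    also have "\<dots> \<le> I ((1 - \<eta>) * c t)" by (rule Ib(1)[OF p(3,4)])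
    also have "\<dots> \<le> (\<integral>y. R y (u t y) \<partial>M0)" unfolding I_def
      using p by (intro M0_mono[OF Rm Ru(1) Rl R_comp(3)[OF elim(3) bt]]) auto
    finally have lo: "(\<nu> - e) * (c t)\<^sup>2 \<le> (\<integral>y. R y (u t y) \<partial>M0)" .
    show ?case using up lo by (simp add: left_diff_distrib distrib_right abs_le_iff)
  qed
qed

text \<open>
  Integrating over one unit of time avoids differentiating \<open>c\<close>.
\<close>

lemma c_step:
  assumes e: "0 < e"
  shows "\<forall>\<^sub>F t in at_top. (\<nu> - e) * (c (t + 1))\<^sup>2 \<le> c t - c (t + 1) \<and> c t - c (t + 1) \<le> (\<nu> + e) * (c t)\<^sup>2"
proof -
  have e': "0 < min e \<nu>" using e \<nu>_pos by simp
  obtain t0 where t0: "\<And>t. t0 \<le> t \<Longrightarrow> \<bar>(\<integral>y. R y (u t y) \<partial>M0) - \<nu> * (c t)\<^sup>2\<bar> \<le> min e \<nu> * (c t)\<^sup>2"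
    using second_order_loss[OF e'] by (auto simp: eventually_at_top_linorder)
  show ?thesis using eventually_ge_at_top[of "max t0 0"]
  proof eventually_elim
    case (elim t)
    let ?g = "\<lambda>s. (\<integral>y. R y (u (t + 1 - s) y) \<partial>M0)"
    have t: "0 \<le> t" "t0 \<le> t" using elim by auto
    have g: "(\<nu> - min e \<nu>) * (c (t + 1))\<^sup>2 \<le> ?g s" "?g s \<le> (\<nu> + min e \<nu>) * (c t)\<^sup>2" if s: "s \<in> {0..1}" for s
    proof -
      have ts: "0 \<le> t + 1 - s" "t0 \<le> t + 1 - s" "t \<le> t + 1 - s" "t + 1 - s \<le> t + 1" using s t by auto
      have cs: "c (t + 1) \<le> c (t + 1 - s)" "c (t + 1 - s) \<le> c t" "0 < c (t + 1)" "0 < c (t + 1 - s)"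
        using c_antimono[OF ts(1,4)] c_antimono[OF t(1) ts(3)] c_pos[of "t + 1"] c_pos[OF ts(1)] t by auto
      have a: "(\<nu> - min e \<nu>) * (c (t + 1 - s))\<^sup>2 \<le> ?g s" "?g s \<le> (\<nu> + min e \<nu>) * (c (t + 1 - s))\<^sup>2"
        using t0[OF ts(2)] unfolding left_diff_distrib distrib_right by linarith+
      have "(\<nu> - min e \<nu>) * (c (t + 1))\<^sup>2 \<le> (\<nu> - min e \<nu>) * (c (t + 1 - s))\<^sup>2"
        using cs by (intro mult_left_mono power_mono) auto
      then show "(\<nu> - min e \<nu>) * (c (t + 1))\<^sup>2 \<le> ?g s" using a by linarith
      have "(\<nu> + min e \<nu>) * (c (t + 1 - s))\<^sup>2 \<le> (\<nu> + min e \<nu>) * (c t)\<^sup>2"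
        using cs e' \<nu>_pos by (intro mult_left_mono power_mono) auto
      then show "?g s \<le> (\<nu> + min e \<nu>) * (c t)\<^sup>2" using a by linarith
    qed
    have const: "set_integrable lborel {0..1::real} (\<lambda>s. k)" "(LINT s:{0..1::real}|lborel. k) = k" for k :: real
      by (rule set_integrable_bounded_interval[where C="\<bar>k\<bar>"]) (auto simp: set_lebesgue_integral_def)
    have i: "set_integrable lborel {0..1} ?g" using pairing_int[OF t(1), of 1] by simp
    have "(\<nu> - min e \<nu>) * (c (t + 1))\<^sup>2 \<le> (LINT s:{0..1}|lborel. ?g s)"
      using set_integral_mono[OF const(1) i g(1)] by (simp add: const(2))
    moreover have "(LINT s:{0..1}|lborel. ?g s) \<le> (\<nu> + min e \<nu>) * (c t)\<^sup>2"
      using set_integral_mono[OF i const(1) g(2)] by (simp add: const(2))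
    moreover have "c t - c (t + 1) = (LINT s:{0..1}|lborel. ?g s)" using pairing[OF t(1), of 1] by (simp add: c_def)
    moreover have "(\<nu> - e) * (c (t + 1))\<^sup>2 \<le> (\<nu> - min e \<nu>) * (c (t + 1))\<^sup>2" "(\<nu> + min e \<nu>) * (c t)\<^sup>2 \<le> (\<nu> + e) * (c t)\<^sup>2"
      by (intro mult_right_mono; simp)+
    ultimately show ?case by linarith
  qed
qed

text \<open>
  Divide the increment of \<open>c\<close> by \<open>c t * c (t + 1)\<close>; the quotient \<open>q\<close> of consecutive values tends to \<open>1\<close>.
\<close>

lemma inverse_c_increments: "((\<lambda>t. 1 / c (t + 1) - 1 / c t) \<longlongrightarrow> \<nu>) at_top"
proof -
  define q where "q t = c (t + 1) / c t" for t
  have pos: "\<forall>\<^sub>F t in at_top. (0::real) \<le> t" by (rule eventually_ge_at_top)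
  have q: "(q \<longlongrightarrow> 1) at_top"
  proof (rule tendsto_sandwich)
    show "\<forall>\<^sub>F t in at_top. 1 - (\<nu> + 1) * c t \<le> q t"
      using c_step[OF zero_less_one] pos
    proof eventually_elim
      case (elim t)
      then have "c t * (1 - (\<nu> + 1) * c t) \<le> c (t + 1)" by (simp add: algebra_simps power2_eq_square)
      then show ?case using c_pos[OF elim(2)] by (simp add: q_def pos_le_divide_eq mult.commute)
    qed
    show "\<forall>\<^sub>F t in at_top. q t \<le> 1" using pos
    proof eventually_elim
      case (elim t)
      then show ?case using c_antimono[of t "t + 1"] c_pos[OF elim] by (simp add: q_def)
    qed
    have "((\<lambda>t. 1 - (\<nu> + 1) * c t) \<longlongrightarrow> 1 - (\<nu> + 1) * 0) at_top" by (intro tendsto_intros c_tendsto_0)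
    then show "((\<lambda>t. 1 - (\<nu> + 1) * c t) \<longlongrightarrow> 1) at_top" by simp
  qed simp
  have b: "\<forall>\<^sub>F t in at_top. (\<nu> - e) * q t \<le> 1 / c (t + 1) - 1 / c t \<and> 1 / c (t + 1) - 1 / c t \<le> (\<nu> + e) / q t" if "0 < e" for e
    using c_step[OF that] pos
  proof eventually_elim
    case (elim t)
    have c: "0 < c t" "0 < c (t + 1)" using elim(2) by (auto intro: c_pos)
    have d: "1 / c (t + 1) - 1 / c t = (c t - c (t + 1)) / (c t * c (t + 1))" using c by (simp add: field_simps)
    have "(\<nu> - e) * q t = (\<nu> - e) * (c (t + 1))\<^sup>2 / (c t * c (t + 1))" using c by (simp add: q_def power2_eq_square)
    also have "\<dots> \<le> 1 / c (t + 1) - 1 / c t" unfolding d using elim(1) c by (intro divide_right_mono) auto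
    finally have 1: "(\<nu> - e) * q t \<le> 1 / c (t + 1) - 1 / c t" .
    have "1 / c (t + 1) - 1 / c t \<le> (\<nu> + e) * (c t)\<^sup>2 / (c t * c (t + 1))" unfolding d using elim(1) c by (intro divide_right_mono) auto
    also have "\<dots> = (\<nu> + e) / q t" using c by (simp add: q_def power2_eq_square)
    finally show ?case using 1 by simp
  qed
  show ?thesis
  proof (rule order_tendstoI)
    fix a assume "a < \<nu>"
    define e where "e = (\<nu> - a) / 2"
    have e: "0 < e" "a < \<nu> - e" using \<open>a < \<nu>\<close> by (auto simp: e_def field_simps)
    have "((\<lambda>t. (\<nu> - e) * q t) \<longlongrightarrow> (\<nu> - e) * 1) at_top" by (intro tendsto_intros q)
    then have "\<forall>\<^sub>F t in at_top. a < (\<nu> - e) * q t" using e by (intro order_tendstoD(1)) auto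
    then show "\<forall>\<^sub>F t in at_top. a < 1 / c (t + 1) - 1 / c t" using b[OF e(1)] by eventually_elim linarith
  next
    fix a assume "\<nu> < a"
    define e where "e = (a - \<nu>) / 2"
    have e: "0 < e" "\<nu> + e < a" using \<open>\<nu> < a\<close> by (auto simp: e_def field_simps)
    have "((\<lambda>t. (\<nu> + e) / q t) \<longlongrightarrow> (\<nu> + e) / 1) at_top" by (intro tendsto_intros q) simp
    then have "\<forall>\<^sub>F t in at_top. (\<nu> + e) / q t < a" using e by (intro order_tendstoD(2)) auto
    then show "\<forall>\<^sub>F t in at_top. 1 / c (t + 1) - 1 / c t < a" using b[OF e(1)] by eventually_elim linarith
  qed
qed

lemma tc_tendsto: "((\<lambda>t. t * c t) \<longlongrightarrow> 1 / \<nu>) at_top"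
proof -
  have "((\<lambda>t. (1 / c t) / t) \<longlongrightarrow> \<nu>) at_top"
  proof (rule tendsto_div_of_increments[OF inverse_c_increments])
    fix a :: real assume a: "0 \<le> a"
    have "\<bar>1 / c t\<bar> \<le> 1 / c (a + 1)" if t: "t \<in> {a..a+1}" for t
      using c_antimono[of t "a + 1"] c_pos[of t] c_pos[of "a + 1"] t a by (simp add: frac_le)
    then show "\<exists>B. \<forall>t\<in>{a..a+1}. \<bar>1 / c t\<bar> \<le> B" by blast
  qed
  then have "((\<lambda>t. 1 / ((1 / c t) / t)) \<longlongrightarrow> 1 / \<nu>) at_top" using \<nu>_pos by (intro tendsto_intros) auto
  then show ?thesis by (simp add: mult.commute)
qed

text \<open>
  The errors in \<open>t * c t\<close> and in the profile are both relative to \<open>\<phi>\<close>, which gives uniformity in the state.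
\<close>

theorem kolmogorov_uniform:
  assumes e: "0 < e"
  shows "\<forall>\<^sub>F t in at_top. \<forall>x. \<bar>t * u t x - \<phi> x / \<nu>\<bar> \<le> e * \<phi> x"
proof -
  have n: "0 < 1 / \<nu> + 1" using \<nu>_pos by (simp add: add_pos_pos)
  have cancel: "e / 2 / N * N = e / 2" if "0 < N" for N using that by simp
  \<comment> \<open>Eventually \<open>t * c t\<close> is at most \<open>1 / \<nu> + 1\<close>, which multiplies the relative error of the profile.\<close>
  define \<delta> where "\<delta> = e / 2 / (1 / \<nu> + 1)"
  have \<delta>: "0 < \<delta>" using e n by (simp add: \<delta>_def)
  have "\<forall>\<^sub>F t in at_top. dist (t * c t) (1 / \<nu>) < min 1 (e / 2)" using e by (intro tendstoD[OF tc_tendsto]) simp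
  moreover note asymptotic_profile[OF \<delta>]
  moreover have "\<forall>\<^sub>F t in at_top. (0::real) < t" by (rule eventually_gt_at_top)
  ultimately show ?thesis
  proof eventually_elim
    case (elim t)
    have tc: "\<bar>t * c t - 1 / \<nu>\<bar> \<le> e / 2" "t * c t \<le> 1 / \<nu> + 1" using elim(1) by (auto simp: dist_real_def)
    show ?case
    proof
      fix x
      have \<phi>0: "0 \<le> \<phi> x" using \<phi>_pos[of x] by simp
      have "\<bar>t * u t x - t * c t * \<phi> x\<bar> = t * \<bar>u t x - c t * \<phi> x\<bar>"
      proof -
        have "t * u t x - t * c t * \<phi> x = t * (u t x - c t * \<phi> x)" by (simp add: right_diff_distrib)
        then show ?thesis using elim(3) by (simp only: abs_mult)
      qed
      also have "\<dots> \<le> t * (\<delta> * c t * \<phi> x)" using elim(2,3) by (intro mult_left_mono) auto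
      also have "\<dots> = \<delta> * (t * c t) * \<phi> x" by simp
      also have "\<dots> \<le> \<delta> * (1 / \<nu> + 1) * \<phi> x" using tc(2) \<delta> \<phi>0 by (intro mult_right_mono mult_left_mono) auto
      also have "\<delta> * (1 / \<nu> + 1) = e / 2" unfolding \<delta>_def by (rule cancel[OF n])
      finally have 1: "\<bar>t * u t x - t * c t * \<phi> x\<bar> \<le> e / 2 * \<phi> x" .
      have "\<bar>t * c t * \<phi> x - \<phi> x / \<nu>\<bar> = \<bar>t * c t - 1 / \<nu>\<bar> * \<phi> x"
      proof -
        have "t * c t * \<phi> x - \<phi> x / \<nu> = (t * c t - 1 / \<nu>) * \<phi> x" by (simp add: left_diff_distrib)
        then show ?thesis using \<phi>0 by (simp only: abs_mult abs_of_nonneg)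
      qed
      also have "\<dots> \<le> e / 2 * \<phi> x" using tc(1) \<phi>0 by (rule mult_right_mono)
      finally show "\<bar>t * u t x - \<phi> x / \<nu>\<bar> \<le> e * \<phi> x" using 1 by linarith
    qed
  qed
qed

end

section \<open>The motion of the superprocess as a Markov family\<close>

lemma the_measurable: "the \<in> borel_of cemetery_top \<rightarrow>\<^sub>M (borel :: ('a::topological_space) measure)"
proof (rule borel_measurableI)
  fix S :: "'a set" assume "open S"
  then have A: "Some ` S \<in> sets (borel_of cemetery_top)" by (intro Some_image_borel) simp
  have N: "{None :: 'a option} \<in> sets (borel_of cemetery_top)"
  proof -
    have "{None :: 'a option} = space (borel_of cemetery_top) - Some ` UNIV" by (auto simp: UNIV_option_conv)
    then show ?thesis using Some_image_borel[of "UNIV :: 'a set"] by (metis sets.compl_sets sets.top space_borel)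
  qed
  have "the -` S \<inter> space (borel_of cemetery_top) = Some ` S \<union> (if the None \<in> S then {None} else {})" (is "?L = ?R")
  proof (rule set_eqI)
    fix z :: "'a option" show "z \<in> ?L \<longleftrightarrow> z \<in> ?R" by (cases z) auto
  qed
  then show "the -` S \<inter> space (borel_of cemetery_top) \<in> sets (borel_of cemetery_top)"
    using sets.Un[OF A N] A by simp
qed

lemma ext0_joint_measurable:
  fixes h :: "'a::second_countable_topology \<Rightarrow> real \<Rightarrow> real"
  assumes h: "(\<lambda>(x, z). h x z) \<in> borel_measurable (borel \<Otimes>\<^sub>M borel)"
  shows "(\<lambda>(y, z). ext0 (\<lambda>x. h x z) y) \<in> borel_measurable (borel_of cemetery_top \<Otimes>\<^sub>M borel)"
proof -
  have 1: "(\<lambda>w. (the (fst w), snd w)) \<in> borel_of cemetery_top \<Otimes>\<^sub>M borel \<rightarrow>\<^sub>M borel \<Otimes>\<^sub>M borel"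
    by (intro measurable_Pair measurable_compose[OF measurable_fst the_measurable] measurable_snd)
  have 2: "ext0 (\<lambda>_. 1 :: real) \<in> borel_measurable (borel_of (cemetery_top :: 'a option topology))" by (rule ext0_measurable) simp
  note [measurable] = measurable_compose[OF 1 h, unfolded prod.case] measurable_compose[OF measurable_fst 2]
  have "(\<lambda>w. ext0 (\<lambda>_. 1) (fst w) * h (the (fst w)) (snd w)) \<in> borel_measurable (borel_of cemetery_top \<Otimes>\<^sub>M borel)"
    by measurable
  moreover have "(\<lambda>w. ext0 (\<lambda>_. 1) (fst w) * h (the (fst w)) (snd w)) = (\<lambda>(y, z). ext0 (\<lambda>x. h x z) y)"
    by (rule ext) (auto simp: ext0_def split: option.split)
  ultimately show ?thesis by simp
qed

lemma hunt_markov_family: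
  fixes \<xi> :: "real \<Rightarrow> 'w \<Rightarrow> ('a::{metric_space,second_countable_topology}) option"
  assumes E: "locally_compact_space (euclidean :: 'a topology)" and hunt: "hunt_process cemetery_top \<Omega> \<xi> Px"
  obtains F where "markov_family (borel_of cemetery_top) \<Omega> F \<xi> Px"
proof -
  obtain F where F: "filtration (space \<Omega>) F" "\<And>t. subalgebra \<Omega> (F t)" "\<And>t. 0 \<le> t \<Longrightarrow> \<xi> t \<in> F (ennreal t) \<rightarrow>\<^sub>M borel_of cemetery_top"
    "strong_markov cemetery_top \<Omega> F \<xi> Px"
    using hunt unfolding hunt_process_def by auto
  interpret F: filtration "space \<Omega>" F by (rule F(1))
  have cad: "cadlag_path cemetery_top (\<lambda>t. \<xi> t \<omega>)" if "\<omega> \<in> space \<Omega>" for \<omega> using hunt that by (simp add: hunt_process_def)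
  have \<xi>m: "\<xi> s \<in> \<Omega> \<rightarrow>\<^sub>M borel_of cemetery_top" if "0 \<le> s" for s
    using measurable_from_subalg[OF F(2) F(3)[OF that]] .
  have \<xi>mt: "\<xi> s \<in> F (ennreal t) \<rightarrow>\<^sub>M borel_of cemetery_top" if "0 \<le> s" "s \<le> t" for s t
  proof (rule measurable_from_subalg[OF _ F(3)[OF that(1)]])
    show "subalgebra (F (ennreal t)) (F (ennreal s))"
      using F.sets_F_mono[of "ennreal s" "ennreal t"] that by (auto simp: subalgebra_def F.space_F intro: ennreal_leI)
  qed
  have "markov_family (borel_of cemetery_top) \<Omega> (\<lambda>t. F (ennreal t)) \<xi> Px"
  proof
    show "space (borel_of cemetery_top) = (UNIV :: 'a option set)" by simp
    show "Px \<in> borel_of cemetery_top \<rightarrow>\<^sub>M prob_algebra \<Omega>" "AE \<omega> in Px x. \<xi> 0 \<omega> = x" for x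
      using hunt by (auto simp: hunt_process_def)
    show "(\<lambda>(s, \<omega>). \<xi> (max 0 s) \<omega>) \<in> borel \<Otimes>\<^sub>M \<Omega> \<rightarrow>\<^sub>M borel_of cemetery_top"
    proof -
      have k: "(\<lambda>z. nat \<lceil>fst z\<rceil>) \<in> (borel :: real measure) \<Otimes>\<^sub>M \<Omega> \<rightarrow>\<^sub>M count_space UNIV" by measurable
      have p: "(\<lambda>z. \<xi> (max 0 (min (fst z) (real i))) (snd z)) \<in> borel \<Otimes>\<^sub>M \<Omega> \<rightarrow>\<^sub>M borel_of cemetery_top" for i
        using progressive_measurable[OF E of_nat_0_le_iff \<xi>m cad, of i] by (simp add: split_beta)
      have "(\<lambda>z. \<xi> (max 0 (min (fst z) (real (nat \<lceil>fst z\<rceil>)))) (snd z)) \<in> borel \<Otimes>\<^sub>M \<Omega> \<rightarrow>\<^sub>M borel_of cemetery_top"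
        by (rule measurable_compose_countable[OF p k])
      moreover have "max 0 (min s (real (nat \<lceil>s\<rceil>))) = max 0 s" for s :: real by linarith
      ultimately show ?thesis by (simp add: split_beta)
    qed
    fix t :: real assume t: "0 \<le> t"
    show "subalgebra \<Omega> (F (ennreal t))" by (rule F(2))
    show "(\<lambda>(s, \<omega>). \<xi> (max 0 (min s t)) \<omega>) \<in> borel \<Otimes>\<^sub>M F (ennreal t) \<rightarrow>\<^sub>M borel_of cemetery_top"
      by (rule progressive_measurable[OF E t \<xi>mt]) (auto simp: F.space_F intro: cad)
  next
    fix r s :: real and B :: "'a option set" and \<Lambda> x assume "0 \<le> r" "0 \<le> s" "B \<in> sets (borel_of cemetery_top)" "\<Lambda> \<in> sets (F (ennreal r))"
    then show "emeasure (Px x) {\<omega> \<in> \<Lambda>. \<xi> (r + s) \<omega> \<in> B} = (\<integral>\<^sup>+\<omega>. indicator \<Lambda> \<omega> * emeasure (Px (\<xi> r \<omega>)) {\<omega>' \<in> space \<Omega>. \<xi> s \<omega>' \<in> B} \<partial>Px x)"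
      by (intro strong_markov_constant_time[OF F(1,4)]) auto
  qed
  then show ?thesis by (rule that)
qed

text \<open>
  Truncation and monotone convergence.
\<close>

lemma kop_semigroup_of_bounded:
  fixes s t :: real
  assumes km: "\<And>t. 0 < t \<Longrightarrow> (\<lambda>(x, y). k t x y) \<in> borel_measurable (m \<Otimes>\<^sub>M m)" and sigma: "sigma_finite_measure m"
    and sp: "space m = UNIV" and st: "0 < s" "0 < t" and f: "f \<in> borel_measurable m"
    and bdd: "\<And>g C. g \<in> borel_measurable m \<Longrightarrow> (\<And>x. 0 \<le> g x) \<Longrightarrow> (\<And>x. g x \<le> (C::real)) \<Longrightarrow>
      kop m (k (s + t)) (\<lambda>x. ennreal (g x)) x = kop m (k s) (kop m (k t) (\<lambda>x. ennreal (g x))) x"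
  shows "kop m (k (s + t)) f x = kop m (k s) (kop m (k t) f) x"
proof -
  define g where "g i x = enn2real (min (f x) (of_nat i))" for i x
  have gm[measurable]: "g i \<in> borel_measurable m" for i unfolding g_def using f by measurable
  have ge: "ennreal (g i x) = min (f x) (of_nat i)" for i x unfolding g_def
    by (rule ennreal_enn2real) (rule le_less_trans[OF min.cobounded2 of_nat_less_top])
  have gi: "incseq (\<lambda>i x. ennreal (g i x))" unfolding ge by (auto simp: incseq_def le_fun_def min_le_iff_disj of_nat_mono)
  have sup: "(SUP i. ennreal (g i x)) = f x" for x
  proof -
    have "(SUP i. min (f x) (of_nat i)) = min (f x) (SUP i. of_nat i)" by (simp add: inf_min[symmetric] inf_SUP)
    then show ?thesis unfolding ge by (simp add: ennreal_SUP_of_nat_eq_top)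
  qed
  have gb: "g i x \<le> real i" for i x
  proof -
    have "ennreal (g i x) \<le> ennreal (real i)" unfolding ge by (simp add: ennreal_of_nat_eq_real_of_nat)
    then show ?thesis by (simp add: ennreal_le_iff)
  qed
  have mono_kop: "kop m (k t) (\<lambda>y. SUP i. h i y) x = (SUP i. kop m (k t) (h i) x)"
    if "0 < t" and h: "incseq h" "\<And>i. h i \<in> borel_measurable m" for t h x
  proof -
    note [measurable] = measurable_row[OF km[OF that(1)], of x] h(2)
    have [measurable]: "k t x \<in> borel_measurable m" using measurable_row[OF km[OF that(1)], of x] sp by simp
    show ?thesis unfolding kop_def SUP_mult_left_ennreal
      using h(1) by (intro nn_integral_monotone_convergence_SUP) (auto simp: incseq_def le_fun_def intro: mult_left_mono)
  qed
  have kgm: "kop m (k t) (\<lambda>y. ennreal (g i y)) \<in> borel_measurable m" for i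
    by (intro kop_measurable[OF sigma km[OF st(2)]]) measurable
  have kgi: "incseq (\<lambda>i. kop m (k t) (\<lambda>y. ennreal (g i y)))"
    using gi by (auto simp: incseq_def le_fun_def kop_def intro!: nn_integral_mono mult_left_mono)
  have "kop m (k (s + t)) f x = kop m (k (s + t)) (\<lambda>y. SUP i. ennreal (g i y)) x" by (simp add: sup)
  also have "\<dots> = (SUP i. kop m (k (s + t)) (\<lambda>y. ennreal (g i y)) x)" by (rule mono_kop[OF add_pos_pos[OF st] gi]) measurable
  also have "\<dots> = (SUP i. kop m (k s) (kop m (k t) (\<lambda>y. ennreal (g i y))) x)"
  proof -
    have "kop m (k (s + t)) (\<lambda>y. ennreal (g i y)) x = kop m (k s) (kop m (k t) (\<lambda>y. ennreal (g i y))) x" for i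
      by (rule bdd[OF gm _ gb]) (simp add: g_def)
    then show ?thesis by simp
  qed
  also have "\<dots> = kop m (k s) (\<lambda>z. SUP i. kop m (k t) (\<lambda>y. ennreal (g i y)) z) x"
    by (rule mono_kop[OF st(1) kgi kgm, symmetric])
  also have "(\<lambda>z. SUP i. kop m (k t) (\<lambda>y. ennreal (g i y)) z) = kop m (k t) (\<lambda>y. SUP i. ennreal (g i y))"
    by (rule ext, rule mono_kop[OF st(2) gi, symmetric]) measurable
  finally show ?thesis by (simp add: sup)
qed

section \<open>The semigroups of a critical superprocess\<close>

text \<open>
  The assumptions on the motion, the branching mechanism and the kernels, with the potential \<open>\<beta> * a\<close> in place of \<open>\<alpha>\<close> and eigenvalue \<open>0\<close>.
\<close>

locale critical_superprocess =
  fixes m :: "'a::{metric_space, second_countable_topology} measure"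
    and \<Omega> :: "'w measure" and \<xi> :: "real \<Rightarrow> 'w \<Rightarrow> 'a option" and Px :: "'a option \<Rightarrow> 'w measure"
    and \<beta> a b :: "'a \<Rightarrow> real" and n :: "'a \<Rightarrow> real measure"
    and p q :: "real \<Rightarrow> 'a \<Rightarrow> 'a \<Rightarrow> real"
    and lamt K :: real and \<phi>t \<psi>t \<phi> \<psi> :: "'a \<Rightarrow> real"
  assumes E: "locally_compact_space (euclidean :: 'a topology)"
    and m: "sets m = sets borel" "sigma_finite_measure m"
    and full_support: "\<And>U. open U \<Longrightarrow> U \<noteq> {} \<Longrightarrow> 0 < emeasure m U"
    and \<xi>: "hunt_process_on_E \<Omega> \<xi> Px"
    and \<beta>: "\<beta> \<in> bounded_borel_nonneg"
    and a: "a \<in> bounded_borel"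
    and b: "b \<in> bounded_borel_nonneg"
    and n: "is_kernel borel (restrict_space borel {0<..}) n"
    and n_sq: "(SUP x. \<integral>\<^sup>+y. ennreal (y\<^sup>2) \<partial>n x) < \<infinity>"
    and nondegenerate: "\<not> (AE x in m. ennreal (\<beta> x) * (ennreal (b x) + emeasure (n x) {0<..}) = 0)"
    and K: "0 < K" "\<And>x. \<bar>\<beta> x * a x\<bar> + variance_A \<beta> b n x \<le> K"
    and p: "continuous_positive_kernel p" "is_density m (semigroup_P \<xi> Px) p"
    and p_dual: "\<And>t y. 0 < t \<Longrightarrow> (\<integral>\<^sup>+x. ennreal (p t x y) \<partial>m) \<le> 1"
    and eigen_P: "principal_eigen m p lamt \<phi>t \<psi>t"
    and \<phi>t_bounded: "bounded (range \<phi>t)"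
    and ultracontractive: "\<And>t. 0 < t \<Longrightarrow> \<exists>c>0. \<forall>x y. p t x y \<le> c * \<phi>t x * \<psi>t y"
    and q: "continuous_positive_kernel q" "is_density m (feynman_kac \<xi> Px (\<lambda>x. \<beta> x * a x)) q"
    and eigen_T: "principal_eigen m q 0 \<phi> \<psi>"
begin

sublocale branching \<beta> b n
  by unfold_locales (rule \<beta> b n n_sq)+

abbreviation \<alpha> :: "'a \<Rightarrow> real" where "\<alpha> \<equiv> \<lambda>x. \<beta> x * a x"

lemma hunt: "hunt_process cemetery_top \<Omega> \<xi> Px" and absorbing: "\<omega> \<in> space \<Omega> \<Longrightarrow> 0 \<le> s \<Longrightarrow> s \<le> t \<Longrightarrow> \<xi> s \<omega> = None \<Longrightarrow> \<xi> t \<omega> = None"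
  using \<xi> unfolding hunt_process_on_E_def by blast+

text \<open>
  A filtration that exists by the Hunt property; a choice is needed to have one Markov family throughout.
\<close>

definition motion_filtration where "motion_filtration = (SOME F. markov_family (borel_of cemetery_top) \<Omega> F \<xi> Px)"

lemma markov_family_motion: "markov_family (borel_of cemetery_top) \<Omega> motion_filtration \<xi> Px"
proof -
  obtain F where "markov_family (borel_of cemetery_top) \<Omega> F \<xi> Px" using hunt_markov_family[OF E hunt] by blast
  then show ?thesis unfolding motion_filtration_def by (rule someI[where P="\<lambda>F. markov_family (borel_of cemetery_top) \<Omega> F \<xi> Px"])
qed

sublocale mk: markov_family "borel_of cemetery_top" \<Omega> motion_filtration \<xi> Px
  by (rule markov_family_motion)

lemma \<alpha>_meas [measurable]: "\<alpha> \<in> borel_measurable borel"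
proof -
  have [measurable]: "a \<in> borel_measurable borel" using a by (simp add: bounded_borel_def)
  show ?thesis by measurable
qed

lemma \<alpha>_bound: "\<bar>\<alpha> x\<bar> \<le> K" and A_bound: "A x \<le> K"
  using K(2)[of x] A_nonneg[of x] by linarith+

lemma ext0_bound: "(\<And>x. \<bar>f x\<bar> \<le> C) \<Longrightarrow> 0 \<le> C \<Longrightarrow> \<bar>ext0 f y\<bar> \<le> (C::real)"
  by (cases y) (auto simp: ext0_def)

lemma FK_None:
  assumes t: "0 \<le> t" and [measurable]: "\<alpha>' \<in> borel_measurable (borel_of cemetery_top)" "G \<in> borel_measurable (borel_of cemetery_top)" and G: "G None = 0"
  shows "mk.FK \<alpha>' t G None = 0"
proof -
  have [measurable]: "\<xi> t \<in> \<Omega> \<rightarrow>\<^sub>M borel_of cemetery_top" using mk.X_measurable'[OF t] .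
  have ae: "AE \<omega> in Px None. \<omega> \<in> space \<Omega>" using AE_space[of "Px None"] by simp
  have "mk.FK \<alpha>' t G None = (\<integral>\<omega>. 0 \<partial>Px None)" unfolding mk.FK_def
  proof (rule integral_cong_AE)
    show "AE \<omega> in Px None. mk.mult_fun \<alpha>' t \<omega> * G (\<xi> (max 0 t) \<omega>) = 0"
      using mk.start[of None] ae
    proof eventually_elim
      case (elim \<omega>)
      then have "\<xi> t \<omega> = None" using absorbing[of \<omega> 0 t] t by simp
      then show ?case using G t by simp
    qed
  qed measurable
  then show ?thesis by simp
qed

text \<open>
  The Feynman-Kac semigroup on the original space, where functions vanish at the cemetery point.
\<close>

definition FKe :: "('a \<Rightarrow> real) \<Rightarrow> real \<Rightarrow> ('a \<Rightarrow> real) \<Rightarrow> 'a \<Rightarrow> real" where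
  "FKe \<alpha>' t h x = mk.FK (ext0 \<alpha>') t (ext0 h) (Some x)"

lemma FK_ext0:
  assumes "0 \<le> t" "\<alpha>' \<in> borel_measurable borel" "h \<in> borel_measurable borel"
  shows "mk.FK (ext0 \<alpha>') t (ext0 h) = ext0 (FKe \<alpha>' t h)"
proof
  fix y show "mk.FK (ext0 \<alpha>') t (ext0 h) y = ext0 (FKe \<alpha>' t h) y"
    using FK_None[OF assms(1) ext0_measurable[OF assms(2)] ext0_measurable[OF assms(3)]]
    by (cases y) (auto simp: ext0_def FKe_def)
qed

lemma FKe_measurable [measurable]:
  assumes "\<alpha>' \<in> borel_measurable borel" "h \<in> borel_measurable borel"
  shows "FKe \<alpha>' t h \<in> borel_measurable borel"
  unfolding FKe_def[abs_def]
  by (rule measurable_compose[OF Some_measurable mk.FK_fun_measurable]) (use assms in \<open>auto intro: ext0_measurable\<close>)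

lemma FKe_bounds:
  assumes "\<alpha>' \<in> borel_measurable borel" "h \<in> borel_measurable borel" "\<And>x. \<bar>\<alpha>' x\<bar> \<le> k" "\<And>x. 0 \<le> h x" "\<And>x. h x \<le> C" "0 \<le> t"
  shows "0 \<le> FKe \<alpha>' t h x" "FKe \<alpha>' t h x \<le> exp (k * t) * C"
proof -
  have k: "0 \<le> k" using order_trans[OF abs_ge_zero assms(3)] .
  have C: "0 \<le> C" using order_trans[OF assms(4,5)] .
  have h0: "0 \<le> ext0 h y" for y using assms(4) by (cases y) (auto simp: ext0_def)
  show "0 \<le> FKe \<alpha>' t h x" unfolding FKe_def mk.FK_def
    using h0 mk.mult_fun_pos by (intro Bochner_Integration.integral_nonneg mult_nonneg_nonneg) (auto simp: less_imp_le)
  have "\<bar>FKe \<alpha>' t h x\<bar> \<le> exp (k * t) * C" unfolding FKe_def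
    using assms k C by (intro mk.FK_bound ext0_measurable ext0_bound) auto
  then show "FKe \<alpha>' t h x \<le> exp (k * t) * C" by simp
qed

lemma exp_path_integral: "exp (LINT s:{0..t}|lborel. ext0 \<alpha>' (\<xi> s \<omega>)) = mk.mult_fun (ext0 \<alpha>') t \<omega>"
proof -
  have "(LINT s:{0..t}|lborel. ext0 \<alpha>' (\<xi> s \<omega>)) = (LINT s:{0..t}|lborel. ext0 \<alpha>' (\<xi> (max 0 s) \<omega>))"
    by (intro set_lebesgue_integral_cong) auto
  then show ?thesis by (simp add: mk.mult_fun_def)
qed

lemma feynman_kac_eq:
  assumes \<alpha>': "\<alpha>' \<in> borel_measurable borel" "\<And>x. \<bar>\<alpha>' x\<bar> \<le> k" and h: "h \<in> borel_measurable borel" "\<And>x. 0 \<le> h x" "\<And>x. h x \<le> C" and t: "0 \<le> t"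
  shows "feynman_kac \<xi> Px \<alpha>' t (\<lambda>x. ennreal (h x)) x = ennreal (FKe \<alpha>' t h x)"
proof -
  have k: "0 \<le> k" using order_trans[OF abs_ge_zero \<alpha>'(2)] .
  have C: "0 \<le> C" using order_trans[OF h(2,3)] .
  have h0: "0 \<le> ext0 h y" for y using h(2) by (cases y) (auto simp: ext0_def)
  have e: "ext0 (\<lambda>x. ennreal (h x)) y = ennreal (ext0 h y)" for y by (cases y) (auto simp: ext0_def)
  have "feynman_kac \<xi> Px \<alpha>' t (\<lambda>x. ennreal (h x)) x = (\<integral>\<^sup>+\<omega>. ennreal (mk.mult_fun (ext0 \<alpha>') t \<omega> * ext0 h (\<xi> (max 0 t) \<omega>)) \<partial>Px (Some x))"
    unfolding feynman_kac_def e exp_path_integral using h0 t mk.mult_fun_pos by (simp add: ennreal_mult less_imp_le)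
  also have "\<dots> = ennreal (FKe \<alpha>' t h x)" unfolding FKe_def mk.FK_def
  proof (rule nn_integral_eq_integral)
    show "integrable (Px (Some x)) (\<lambda>\<omega>. mk.mult_fun (ext0 \<alpha>') t \<omega> * ext0 h (\<xi> (max 0 t) \<omega>))"
      using \<alpha>' h k C t by (intro mk.FK_integrable[where K=k and C=C] ext0_measurable ext0_bound) auto
  qed (use h0 mk.mult_fun_pos in \<open>auto simp: less_imp_le\<close>)
  finally show ?thesis .
qed

lemma FKe_semigroup:
  assumes \<alpha>': "\<alpha>' \<in> borel_measurable borel" "\<And>x. \<bar>\<alpha>' x\<bar> \<le> k" and h: "h \<in> borel_measurable borel" "\<And>x. 0 \<le> h x" "\<And>x. h x \<le> C" and t: "0 \<le> s" "0 \<le> t"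
  shows "FKe \<alpha>' (s + t) h x = FKe \<alpha>' s (FKe \<alpha>' t h) x"
proof -
  have k: "0 \<le> k" using order_trans[OF abs_ge_zero \<alpha>'(2)] .
  have C: "0 \<le> C" using order_trans[OF h(2,3)] .
  show ?thesis unfolding FKe_def[of _ s] FKe_def[of _ "s + t"] FK_ext0[OF t(2) \<alpha>'(1) h(1), symmetric]
    using \<alpha>' h k C by (intro mk.FK_semigroup[where K=k and C=C] ext0_measurable ext0_bound t) auto
qed

lemma space_m: "space m = UNIV" using sets_eq_imp_space_eq[OF m(1)] by simp

lemma density_kop:
  assumes "is_density m (feynman_kac \<xi> Px \<alpha>') k" "0 < t" "f \<in> borel_measurable borel"
  shows "kop m (k t) f x = feynman_kac \<xi> Px \<alpha>' t f x"
  using assms unfolding is_density_def kop_def by simp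

lemma density_semigroup:
  assumes k: "continuous_positive_kernel k" "is_density m (feynman_kac \<xi> Px \<alpha>') k"
    and \<alpha>': "\<alpha>' \<in> borel_measurable borel" "\<And>x. \<bar>\<alpha>' x\<bar> \<le> \<kappa>"
    and st: "0 < s" "0 < t" and f: "f \<in> borel_measurable borel"
  shows "kop m (k (s + t)) f x = kop m (k s) (kop m (k t) f) x"
proof (rule kop_semigroup_of_bounded[OF kernel_measurable[OF m(1) k(1)] m(2) space_m st])
  show "f \<in> borel_measurable m" using f by (simp add: measurable_cong_sets[OF m(1) refl])
  fix g :: "'a \<Rightarrow> real" and C assume g: "g \<in> borel_measurable m" "\<And>x. 0 \<le> g x" "\<And>x. g x \<le> C"
  then have gb[measurable]: "g \<in> borel_measurable borel" by (simp add: measurable_cong_sets[OF m(1) refl])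
  have e: "kop m (k r) (\<lambda>x. ennreal (g' x)) = (\<lambda>x. ennreal (FKe \<alpha>' r g' x))"
    if "0 < r" "g' \<in> borel_measurable borel" "\<And>x. 0 \<le> g' x" "\<And>x. g' x \<le> C'" for r g' C'
  proof
    fix x
    have "(\<lambda>x. ennreal (g' x)) \<in> borel_measurable borel" using that(2) by measurable
    then show "kop m (k r) (\<lambda>x. ennreal (g' x)) x = ennreal (FKe \<alpha>' r g' x)"
      using density_kop[OF k(2) that(1)] feynman_kac_eq[OF \<alpha>' that(2-4), of r] that(1) by simp
  qed
  have g'm: "FKe \<alpha>' t g \<in> borel_measurable borel" by (rule FKe_measurable[OF \<alpha>'(1) gb])
  have t0: "0 \<le> t" using st by simp
  note g'b = FKe_bounds[OF \<alpha>'(1) gb \<alpha>'(2) g(2,3) t0]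
  have st0: "0 < s + t" using st by simp
  show "kop m (k (s + t)) (\<lambda>x. ennreal (g x)) x = kop m (k s) (kop m (k t) (\<lambda>x. ennreal (g x))) x"
    unfolding e[OF st0 gb g(2,3)] e[OF st(2) gb g(2,3)] e[OF st(1) g'm g'b]
    using FKe_semigroup[OF \<alpha>' gb g(2,3), of s t x] st by simp
qed

lemma p_density: "is_density m (feynman_kac \<xi> Px (\<lambda>_. 0)) p"
proof -
  have "ext0 (\<lambda>_. 0 :: real) = (\<lambda>_::'a option. 0)" by (auto simp: ext0_def fun_eq_iff split: option.split)
  then have "feynman_kac \<xi> Px (\<lambda>_. 0) = semigroup_P \<xi> Px"
    by (intro ext) (simp add: feynman_kac_def semigroup_P_def set_lebesgue_integral_def)
  then show ?thesis using p(2) by simp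
qed

lemma exp_integral_bounds:
  assumes t: "0 \<le> t"
  shows "exp (LINT s:{0..t}|lborel. ext0 \<alpha> (\<xi> s \<omega>)) \<le> exp (K * t)" "1 \<le> exp (K * t) * exp (LINT s:{0..t}|lborel. ext0 \<alpha> (\<xi> s \<omega>))"
proof -
  have "\<bar>LINT s:{0..t}|lborel. ext0 \<alpha> (\<xi> s \<omega>)\<bar> \<le> K * (t - 0)"
    using t K(1) \<alpha>_bound by (intro abs_interval_integral_le ext0_bound) auto
  then show "exp (LINT s:{0..t}|lborel. ext0 \<alpha> (\<xi> s \<omega>)) \<le> exp (K * t)" "1 \<le> exp (K * t) * exp (LINT s:{0..t}|lborel. ext0 \<alpha> (\<xi> s \<omega>))"
    by (auto simp: exp_add[symmetric])
qed

lemma ext0_ennreal_measurable: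
  assumes "f \<in> borel_measurable borel" "0 \<le> t"
  shows "(\<lambda>\<omega>. ext0 f (\<xi> t \<omega>) :: ennreal) \<in> borel_measurable (Px y)"
  using measurable_compose[OF mk.X_measurable'[OF assms(2)] ext0_measurable[OF assms(1)]] by simp

sublocale ck: critical_kernels m p q K lamt \<phi>t \<psi>t \<phi> \<psi>
proof (rule critical_kernels.intro[OF E m full_support p(1) q(1) less_imp_le[OF K(1)] _ p_dual _ _ _ _ eigen_P \<phi>t_bounded ultracontractive eigen_T])
  fix t :: real and x assume t: "0 < t"
  have "kop m (p t) (\<lambda>_. 1) x = semigroup_P \<xi> Px t (\<lambda>_. 1) x" using p(2) t unfolding is_density_def kop_def by simp
  also have "\<dots> \<le> (\<integral>\<^sup>+\<omega>. 1 \<partial>Px (Some x))" unfolding semigroup_P_def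
    by (intro nn_integral_mono) (auto simp: ext0_def split: option.split)
  also have "\<dots> = 1" using prob_space.emeasure_space_1[OF mk.prob_P, of "Some x"] by simp
  finally show "(\<integral>\<^sup>+y. ennreal (p t x y) \<partial>m) \<le> 1" by (simp add: kop_def)
next
  fix t :: real and f :: "'a \<Rightarrow> ennreal" and x assume t: "0 < t" and f: "f \<in> borel_measurable borel"
  have t0: "0 \<le> t" using t by simp
  note m1 = ext0_ennreal_measurable[OF f t0, of "Some x"]
  have eq: "kop m (q t) f x = feynman_kac \<xi> Px \<alpha> t f x" "kop m (p t) f x = semigroup_P \<xi> Px t f x"
    using p(2) q(2) t f unfolding is_density_def kop_def by simp_all
  have "feynman_kac \<xi> Px \<alpha> t f x \<le> (\<integral>\<^sup>+\<omega>. ennreal (exp (K * t)) * ext0 f (\<xi> t \<omega>) \<partial>Px (Some x))"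
    unfolding feynman_kac_def using exp_integral_bounds(1)[OF t0] by (intro nn_integral_mono mult_right_mono ennreal_leI) auto
  also have "\<dots> = ennreal (exp (K * t)) * semigroup_P \<xi> Px t f x" unfolding semigroup_P_def by (rule nn_integral_cmult[OF m1])
  finally show "kop m (q t) f x \<le> ennreal (exp (K * t)) * kop m (p t) f x" unfolding eq .
  have m2: "(\<lambda>\<omega>. ennreal (exp (LINT s:{0..t}|lborel. ext0 \<alpha> (\<xi> s \<omega>)))) \<in> borel_measurable (Px (Some x))"
    unfolding exp_path_integral using mk.mult_fun_measurable[OF ext0_measurable[OF \<alpha>_meas], of t] by simp
  have "semigroup_P \<xi> Px t f x \<le> (\<integral>\<^sup>+\<omega>. ennreal (exp (K * t)) * (ennreal (exp (LINT s:{0..t}|lborel. ext0 \<alpha> (\<xi> s \<omega>))) * ext0 f (\<xi> t \<omega>)) \<partial>Px (Some x))"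
    unfolding semigroup_P_def
  proof (intro nn_integral_mono)
    fix \<omega>
    have "1 \<le> ennreal (exp (K * t)) * ennreal (exp (LINT s:{0..t}|lborel. ext0 \<alpha> (\<xi> s \<omega>)))"
      using exp_integral_bounds(2)[OF t0, of \<omega>] by (simp add: ennreal_mult[symmetric] del: ennreal_1 add: ennreal_1[symmetric])
    from mult_right_mono[OF this, of "ext0 f (\<xi> t \<omega>)"]
    show "ext0 f (\<xi> t \<omega>) \<le> ennreal (exp (K * t)) * (ennreal (exp (LINT s:{0..t}|lborel. ext0 \<alpha> (\<xi> s \<omega>))) * ext0 f (\<xi> t \<omega>))"
      by (simp add: mult.assoc)
  qed
  also have "\<dots> = ennreal (exp (K * t)) * feynman_kac \<xi> Px \<alpha> t f x" unfolding feynman_kac_def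
    by (rule nn_integral_cmult) (intro borel_measurable_times_ennreal m1 m2)
  finally show "kop m (p t) f x \<le> ennreal (exp (K * t)) * kop m (q t) f x" unfolding eq .
next
  fix s t :: real and f :: "'a \<Rightarrow> ennreal" and x assume st: "0 < s" "0 < t" and f: "f \<in> borel_measurable borel"
  show "kop m (p (s + t)) f x = kop m (p s) (kop m (p t) f) x"
    by (rule density_semigroup[OF p(1) p_density _ _ st f, where \<kappa>=0]) simp_all
  show "kop m (q (s + t)) f x = kop m (q s) (kop m (q t) f) x"
    by (rule density_semigroup[OF q \<alpha>_meas \<alpha>_bound st f])
qed

definition reference :: "'a measure" where "reference = density m (\<lambda>x. ennreal (\<psi> x))"

text \<open>
  At time \<open>0\<close>, where there is no density, the kernel is the identity.
\<close>

definition kernel_of :: "real \<Rightarrow> 'a \<Rightarrow> 'a measure" where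
  "kernel_of t x = (if t \<le> 0 then return m x else density m (\<lambda>y. ennreal (q t x y)))"

lemma sets_reference [measurable_cong]: "sets reference = sets borel"
  and space_reference [simp]: "space reference = UNIV"
  by (simp_all add: reference_def m(1) space_m)

lemma sets_kernel_of [measurable_cong]: "sets (kernel_of t x) = sets borel"
  and space_kernel_of [simp]: "space (kernel_of t x) = UNIV"
  by (simp_all add: kernel_of_def m(1) space_m)

lemma measurable_m_iff: "(h \<in> borel_measurable m) = (h \<in> borel_measurable borel)"
  by (simp add: measurable_cong_sets[OF m(1) refl])

lemma eigenfunctions_measurable [measurable]: "\<phi> \<in> borel_measurable borel" "\<psi> \<in> borel_measurable borel"
  using ck.eigen_measurable by auto

lemma nn_integral_reference:
  assumes "h \<in> borel_measurable borel"
  shows "(\<integral>\<^sup>+x. h x \<partial>reference) = (\<integral>\<^sup>+x. ennreal (\<psi> x) * h x \<partial>m)"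
  unfolding reference_def using assms by (intro nn_integral_density) (auto simp: measurable_m_iff)

lemma finite_reference: "finite_measure reference"
proof (rule finite_measureI)
  have "emeasure reference (space reference) = (\<integral>\<^sup>+x. 1 \<partial>reference)" by simp
  also have "\<dots> = (\<integral>\<^sup>+x. ennreal (\<psi> x) \<partial>m)" using nn_integral_reference[of "\<lambda>_. 1"] by simp
  finally show "emeasure reference (space reference) \<noteq> \<infinity>" using ck.\<psi>_integrable by simp
qed

lemma integrable_reference:
  fixes h :: "'a \<Rightarrow> real"
  assumes "h \<in> borel_measurable borel" "\<And>x. \<bar>h x\<bar> \<le> C"
  shows "integrable reference h"
proof -
  have "h \<in> borel_measurable reference" using assms(1) by (simp add: measurable_cong_sets[OF sets_reference refl])
  then show ?thesis using assms(2) by (intro finite_measure.integrable_const_bound[OF finite_reference, of h C]) auto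
qed

lemma reference_integral:
  fixes h :: "'a \<Rightarrow> real"
  assumes "h \<in> borel_measurable borel" "\<And>x. 0 \<le> h x" "\<And>x. h x \<le> C"
  shows "(\<integral>\<^sup>+x. ennreal (\<psi> x) * ennreal (h x) \<partial>m) = ennreal (\<integral>x. h x \<partial>reference)"
proof -
  have "integrable reference h" using assms by (intro integrable_reference[where C=C]) auto
  then have "ennreal (\<integral>x. h x \<partial>reference) = (\<integral>\<^sup>+x. ennreal (h x) \<partial>reference)"
    using assms(2) by (intro nn_integral_eq_integral[symmetric]) auto
  also have "\<dots> = (\<integral>\<^sup>+x. ennreal (\<psi> x) * ennreal (h x) \<partial>m)" using assms(1) by (intro nn_integral_reference) measurable
  finally show ?thesis ..
qed

lemma kop_q_FKe:
  assumes h: "h \<in> borel_measurable borel" "\<And>x. 0 \<le> h x" "\<And>x. h x \<le> C" and t: "0 < t"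
  shows "kop m (q t) (\<lambda>y. ennreal (h y)) x = ennreal (FKe \<alpha> t h x)"
proof -
  have hm: "(\<lambda>x. ennreal (h x)) \<in> borel_measurable borel" using h(1) by measurable
  show ?thesis using density_kop[OF q(2) t hm, of x] feynman_kac_eq[OF \<alpha>_meas \<alpha>_bound h less_imp_le[OF t], of x] by simp
qed

lemma FKe_zero: "h \<in> borel_measurable borel \<Longrightarrow> FKe \<alpha>' 0 h x = h x"
  unfolding FKe_def mk.FK_zero[OF ext0_measurable] by (simp add: ext0_def)

lemma nn_integral_kernel_of:
  assumes h: "h \<in> borel_measurable borel" "\<And>x. 0 \<le> h x" "\<And>x. h x \<le> C" and t: "0 \<le> t"
  shows "(\<integral>\<^sup>+y. ennreal (h y) \<partial>kernel_of t x) = ennreal (FKe \<alpha> t h x)"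
proof (cases "t = 0")
  case True
  have "(\<lambda>x. ennreal (h x)) \<in> borel_measurable m" using h(1) by (simp add: measurable_m_iff)
  then show ?thesis using True h(1) by (simp add: kernel_of_def FKe_zero nn_integral_return space_m)
next
  case False
  have 1: "(\<lambda>x. ennreal (h x)) \<in> borel_measurable m" using h(1) by (simp add: measurable_m_iff)
  have 2: "(\<lambda>y. ennreal (q t x y)) \<in> borel_measurable m"
    using measurable_row[OF kernel_measurable[OF m(1) q(1), of t], of x] False t by (simp add: space_m)
  have "(\<integral>\<^sup>+y. ennreal (h y) \<partial>kernel_of t x) = kop m (q t) (\<lambda>y. ennreal (h y)) x"
    using False t unfolding kernel_of_def kop_def by (simp add: nn_integral_density[OF 2 1])
  then show ?thesis using kop_q_FKe[OF h] False t by simp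
qed

lemma kernel_of_integral:
  assumes h: "h \<in> borel_measurable borel" "\<And>x. 0 \<le> h x" "\<And>x. h x \<le> C" and t: "0 \<le> t"
  shows "(\<integral>y. h y \<partial>kernel_of t x) = FKe \<alpha> t h x"
proof -
  have "h \<in> borel_measurable (kernel_of t x)" using h(1) by (simp add: measurable_cong_sets[OF sets_kernel_of refl])
  then have "(\<integral>y. h y \<partial>kernel_of t x) = enn2real (\<integral>\<^sup>+y. ennreal (h y) \<partial>kernel_of t x)"
    using h(2) by (intro integral_eq_nn_integral) auto
  then show ?thesis using nn_integral_kernel_of[OF h t, of x] FKe_bounds(1)[OF \<alpha>_meas h(1) \<alpha>_bound h(2,3) t, of x] by simp
qed

lemma finite_kernel_of: assumes "0 \<le> t" shows "finite_measure (kernel_of t x)"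
proof (rule finite_measureI)
  have "emeasure (kernel_of t x) (space (kernel_of t x)) = (\<integral>\<^sup>+y. ennreal 1 \<partial>kernel_of t x)" by simp
  also have "\<dots> = ennreal (FKe \<alpha> t (\<lambda>_. 1) x)" by (rule nn_integral_kernel_of[where C=1]) (use assms in auto)
  finally show "emeasure (kernel_of t x) (space (kernel_of t x)) \<noteq> \<infinity>" by simp
qed

lemma FKe_eigen: assumes "0 \<le> t" shows "FKe \<alpha> t \<phi> x = \<phi> x"
proof (cases "t = 0")
  case False
  obtain \<Phi> where \<Phi>: "\<And>x. \<phi> x \<le> \<Phi>" by (rule ck.\<phi>_bound) blast
  have \<phi>0: "0 \<le> \<phi> x" for x using ck.\<phi>_facts(5)[of x] by simp
  have "ennreal (FKe \<alpha> t \<phi> x) = ennreal (\<phi> x)"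
    using kop_q_FKe[OF eigenfunctions_measurable(1) \<phi>0 \<Phi>, of t x] ck.q_eigen[of t x] assms False by simp
  then show ?thesis using FKe_bounds(1)[OF \<alpha>_meas eigenfunctions_measurable(1) \<alpha>_bound \<phi>0 \<Phi> assms, of x] \<phi>0 by simp
qed (simp add: FKe_zero)

lemma FKe_dual:
  assumes h: "h \<in> borel_measurable borel" "\<And>x. 0 \<le> h x" "\<And>x. h x \<le> C" and t: "0 \<le> t"
  shows "(\<integral>x. FKe \<alpha> t h x \<partial>reference) = (\<integral>x. h x \<partial>reference)"
proof (cases "t = 0")
  case False
  note b = FKe_bounds[OF \<alpha>_meas h(1) \<alpha>_bound h(2,3) t]
  have hm: "(\<lambda>x. ennreal (h x)) \<in> borel_measurable borel" using h(1) by measurable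
  have "ennreal (\<integral>x. FKe \<alpha> t h x \<partial>reference) = (\<integral>\<^sup>+x. ennreal (\<psi> x) * ennreal (FKe \<alpha> t h x) \<partial>m)"
    by (rule reference_integral[OF FKe_measurable[OF \<alpha>_meas h(1)] b, symmetric])
  also have "\<dots> = (\<integral>\<^sup>+x. ennreal (\<psi> x) * kop m (q t) (\<lambda>y. ennreal (h y)) x \<partial>m)"
    using kop_q_FKe[OF h, of t] False t by simp
  also have "\<dots> = (\<integral>\<^sup>+x. ennreal (\<psi> x) * ennreal (h x) \<partial>m)" using False t by (intro ck.q_dual hm) simp
  also have "\<dots> = ennreal (\<integral>x. h x \<partial>reference)" by (rule reference_integral[OF h])
  finally show ?thesis using b(1) h(2) by (simp add: Bochner_Integration.integral_nonneg)
qed (simp add: FKe_zero h)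

lemma FKe_intrinsic:
  assumes "0 < t"
  shows "\<exists>\<epsilon>>0. \<exists>C. \<forall>h b. h \<in> borel_measurable borel \<longrightarrow> (\<forall>y. 0 \<le> h y \<and> h y \<le> b) \<longrightarrow>
     (\<forall>x. \<epsilon> * \<phi> x * (\<integral>y. h y \<partial>reference) \<le> FKe \<alpha> t h x \<and> FKe \<alpha> t h x \<le> C * \<phi> x * (\<integral>y. h y \<partial>reference))"
proof -
  obtain \<epsilon> C where \<epsilon>: "0 < \<epsilon>" and C: "0 < C"
    and lo: "\<And>f x. f \<in> borel_measurable borel \<Longrightarrow> ennreal (\<epsilon> * \<phi> x) * (\<integral>\<^sup>+y. ennreal (\<psi> y) * f y \<partial>m) \<le> kop m (q t) f x"
    and hi: "\<And>f x. f \<in> borel_measurable borel \<Longrightarrow> kop m (q t) f x \<le> ennreal (C * \<phi> x) * (\<integral>\<^sup>+y. ennreal (\<psi> y) * f y \<partial>m)"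
    by (rule ck.intrinsic_bounds[OF assms]) (rule that)
  show ?thesis
  proof (rule exI[of _ \<epsilon>], rule conjI[OF \<epsilon>], rule exI[of _ C], intro allI impI)
    fix h :: "'a \<Rightarrow> real" and b x assume "h \<in> borel_measurable borel" "\<forall>y. 0 \<le> h y \<and> h y \<le> b"
    then have h: "h \<in> borel_measurable borel" "\<And>y. 0 \<le> h y" "\<And>y. h y \<le> b" by auto
    have hm: "(\<lambda>x. ennreal (h x)) \<in> borel_measurable borel" using h(1) by measurable
    have \<phi>0: "0 \<le> \<phi> x" using ck.\<phi>_facts(5)[of x] by simp
    have I0: "0 \<le> (\<integral>y. h y \<partial>reference)" using h(2) by simp
    have F0: "0 \<le> FKe \<alpha> t h x" using FKe_bounds(1)[OF \<alpha>_meas h(1) \<alpha>_bound h(2,3)] assms by simp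
    have "ennreal (\<epsilon> * \<phi> x) * ennreal (\<integral>y. h y \<partial>reference) \<le> ennreal (FKe \<alpha> t h x)"
      "ennreal (FKe \<alpha> t h x) \<le> ennreal (C * \<phi> x) * ennreal (\<integral>y. h y \<partial>reference)"
      using lo[OF hm, of x] hi[OF hm, of x] kop_q_FKe[OF h assms, of x] reference_integral[OF h] by simp_all
    then have "ennreal (\<epsilon> * \<phi> x * (\<integral>y. h y \<partial>reference)) \<le> ennreal (FKe \<alpha> t h x)"
      "ennreal (FKe \<alpha> t h x) \<le> ennreal (C * \<phi> x * (\<integral>y. h y \<partial>reference))"
      using \<epsilon> C \<phi>0 I0 by (simp_all add: ennreal_mult)
    moreover have "0 \<le> C * \<phi> x * (\<integral>y. h y \<partial>reference)" using C \<phi>0 I0 by simp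
    ultimately show "\<epsilon> * \<phi> x * (\<integral>y. h y \<partial>reference) \<le> FKe \<alpha> t h x \<and> FKe \<alpha> t h x \<le> C * \<phi> x * (\<integral>y. h y \<partial>reference)"
      using F0 by (simp add: ennreal_le_iff)
  qed
qed

lemma integral_reference_eq:
  fixes h :: "'a \<Rightarrow> real"
  assumes "h \<in> borel_measurable borel"
  shows "(\<integral>x. h x \<partial>reference) = (\<integral>x. \<psi> x * h x \<partial>m)"
  unfolding reference_def using assms ck.\<phi>_facts(6)
  by (subst integral_density) (auto simp: measurable_m_iff less_imp_le)

lemma eigen_normalised: "(\<integral>x. \<phi> x \<partial>reference) = 1"
  using ck.\<phi>_facts(7) by (subst integral_reference_eq) (auto simp: mult.commute)

end

section \<open>The mild solution as a critical flow\<close>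

text \<open>
  Positivity of the solution is a hypothesis here; for the superprocess it holds because survival has positive probability.
\<close>

locale critical_solution = critical_superprocess m \<Omega> \<xi> Px \<beta> a b n p q lamt K \<phi>t \<psi>t \<phi> \<psi>
  for m :: "'a::{metric_space, second_countable_topology} measure"
    and \<Omega> :: "'w measure" and \<xi> Px \<beta> a b n p q lamt K \<phi>t \<psi>t \<phi> \<psi> +
  fixes f :: "'a \<Rightarrow> real" and u :: "real \<Rightarrow> 'a option \<Rightarrow> real"
  assumes f: "f \<in> bounded_borel_nonneg" and u: "mild_solution \<xi> Px (Psi \<beta> a b n) f u"
    and u_pos: "0 \<le> t \<Longrightarrow> 0 < u t (Some x)"
begin

abbreviation "C\<^sub>E \<equiv> borel_of (cemetery_top :: 'a option topology)"

text \<open>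
  Solutions are only specified for nonnegative times; the extension makes them measurable in all times.
\<close>

definition w where "w s y = u (max 0 s) y"
text \<open>
  The cut-off at \<open>0\<close> matches the form in which \<open>R\<close> is jointly measurable.
\<close>

definition g where "g s y = ext0 (\<lambda>x. R x (max 0 (w s y))) y"

lemma w_measurable [measurable]: "(\<lambda>(s, y). w s y) \<in> borel_measurable (borel \<Otimes>\<^sub>M C\<^sub>E)"
proof -
  have 1: "(\<lambda>z. (max 0 (fst z), snd z)) \<in> borel \<Otimes>\<^sub>M C\<^sub>E \<rightarrow>\<^sub>M restrict_space borel {0::real..} \<Otimes>\<^sub>M C\<^sub>E"
    by (intro measurable_Pair measurable_restrict_space2 measurable_snd) auto
  have 2: "(\<lambda>(t, x). u t x) \<in> borel_measurable (restrict_space borel {0..} \<Otimes>\<^sub>M C\<^sub>E)"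
    using u by (simp add: mild_solution_def)
  from measurable_compose[OF 1 2] show ?thesis by (simp add: w_def split_beta')
qed

lemma w_row [measurable]: "w s \<in> borel_measurable C\<^sub>E"
proof -
  have "(\<lambda>y. case (s, y) of (s, y) \<Rightarrow> w s y) \<in> borel_measurable C\<^sub>E" by measurable
  then show ?thesis by simp
qed

lemma g_measurable [measurable]: "(\<lambda>(s, y). g s y) \<in> borel_measurable (borel \<Otimes>\<^sub>M C\<^sub>E)"
proof -
  have 1: "(\<lambda>z. (snd z, w (fst z) (snd z))) \<in> borel \<Otimes>\<^sub>M C\<^sub>E \<rightarrow>\<^sub>M C\<^sub>E \<Otimes>\<^sub>M borel" by measurable
  show ?thesis using measurable_compose[OF 1 ext0_joint_measurable[OF R_measurable]] by (simp add: g_def split_beta')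
qed

lemma f_facts: "f \<in> borel_measurable borel" "0 \<le> f x"
  using f by (auto simp: bounded_borel_nonneg_def bounded_borel_def)

lemma f_bound: obtains C where "0 \<le> C" "\<And>x. \<bar>f x\<bar> \<le> C"
proof -
  have "bounded (range f)" using f by (simp add: bounded_borel_nonneg_def bounded_borel_def)
  then obtain C where "\<forall>y\<in>range f. norm y \<le> C" unfolding bounded_iff by blast
  then have "\<bar>f x\<bar> \<le> C" for x by simp
  moreover from this have "0 \<le> C" by (rule order_trans[OF abs_ge_zero])
  ultimately show thesis using that by blast
qed

lemma w_nonneg: "0 \<le> w s y"
  using u by (simp add: mild_solution_def w_def)

lemma w_bound: obtains C where "0 \<le> C" "\<And>s y. s \<le> T \<Longrightarrow> \<bar>w s y\<bar> \<le> C"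
proof -
  have bdd: "\<forall>t>0. \<exists>C. \<forall>s\<in>{0..t}. \<forall>x. u s x \<le> C" using u unfolding mild_solution_def by (elim conjE)
  have "0 < max 1 T" by simp
  from bdd[rule_format, OF this] obtain C where "\<forall>s\<in>{0..max 1 T}. \<forall>x. u s x \<le> C" ..
  then have C: "\<And>s y. s \<in> {0..max 1 T} \<Longrightarrow> u s y \<le> C" by simp
  have b: "\<bar>w s y\<bar> \<le> C" if "s \<le> T" for s y
  proof -
    have "max 0 s \<in> {0..max 1 T}" using that by auto
    from C[OF this, of y] show ?thesis using w_nonneg[of s y] by (simp add: w_def)
  qed
  show ?thesis by (rule that[OF _ b]) (use order_trans[OF abs_ge_zero b[OF order_refl]] in auto)
qed

lemma R_bound: "0 \<le> z \<Longrightarrow> R x z \<le> K / 2 * z\<^sup>2"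
  using R_le[of z x] mult_right_mono[OF A_bound[of x], of "z\<^sup>2"] by simp

lemma g_bound: assumes "\<bar>w s y\<bar> \<le> C" shows "\<bar>g s y\<bar> \<le> K / 2 * C\<^sup>2"
proof (cases y)
  case (Some x)
  have "R x (w s y) \<le> K / 2 * (w s y)\<^sup>2" by (rule R_bound[OF w_nonneg])
  also have "\<dots> \<le> K / 2 * C\<^sup>2" using assms K(1) w_nonneg[of s y] by (intro mult_left_mono power_mono) auto
  finally show ?thesis using Some R_nonneg[of x] w_nonneg[of s y] by (simp add: g_def ext0_def)
qed (use K(1) in \<open>simp add: g_def ext0_def\<close>)

lemma Psi_w: "0 \<le> s \<Longrightarrow> Psi \<beta> a b n y (u s y) = - (ext0 \<alpha> y * w s y - g s y)"
  using w_nonneg[of s y] by (cases y) (auto simp: Psi_Some Psi_None g_def ext0_def w_def)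

lemma ext0_\<alpha>: "ext0 \<alpha> \<in> borel_measurable C\<^sub>E" "\<bar>ext0 \<alpha> y\<bar> \<le> K"
  using K(1) \<alpha>_bound by (auto intro!: ext0_measurable ext0_bound)

text \<open>
  The mild equation in terms of the transition semigroup: the path integral of the branching mechanism is exchanged with the expectation, and the
  linear term is separated from \<open>R\<close>.
\<close>

lemma w_mild:
  assumes t: "0 \<le> t"
  shows "w t y = mk.FK (\<lambda>_. 0) t (ext0 f) y + mk.resolv (\<lambda>_. 0) (\<lambda>s y. ext0 \<alpha> y * w s y - g s y) t y"
proof -
  note [measurable] = ext0_\<alpha>(1)
  let ?h = "\<lambda>s y. ext0 \<alpha> y * w s y - g s y"
  obtain C where C: "0 \<le> C" "\<And>s y. s \<le> t \<Longrightarrow> \<bar>w s y\<bar> \<le> C" by (rule w_bound) blast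
  have hb: "\<bar>?h s y\<bar> \<le> K * C + K / 2 * C\<^sup>2" if "s \<le> t" for s y
  proof -
    have "\<bar>ext0 \<alpha> y * w s y\<bar> \<le> K * C" unfolding abs_mult using ext0_\<alpha>(2) C(2)[OF that] K(1) by (intro mult_mono) auto
    then show ?thesis using g_bound[OF C(2)[OF that], of y] abs_triangle_ineq4[of "ext0 \<alpha> y * w s y" "g s y"] by linarith
  qed
  have m1[measurable]: "mk.mult_fun (\<lambda>_. 0) s \<omega> = 1" for s \<omega> by (simp add: mk.mult_fun_def set_lebesgue_integral_def)
  have "(\<integral>\<omega>. (LINT s:{0..t}|lborel. Psi \<beta> a b n (\<xi> s \<omega>) (u (t - s) (\<xi> s \<omega>))) \<partial>Px y) =
    (\<integral>\<omega>. (LINT s:{0..t}|lborel. - ?h (t - s) (\<xi> (max 0 s) \<omega>)) \<partial>Px y)"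
    by (rule Bochner_Integration.integral_cong[OF refl], rule set_lebesgue_integral_cong) (auto simp: Psi_w)
  also have "\<dots> = (LINT s:{0..t}|lborel. (\<integral>\<omega>. - ?h (t - s) (\<xi> (max 0 s) \<omega>) \<partial>Px y))"
  proof (rule fubini_time)
    show "finite_measure (Px y)" using mk.prob_P[of y] by (rule prob_space.finite_measure)
    have [measurable]: "(\<lambda>z. \<xi> (max 0 (fst z)) (snd z)) \<in> borel \<Otimes>\<^sub>M Px y \<rightarrow>\<^sub>M C\<^sub>E"
      using mk.joint by (simp add: split_beta')
    show "(\<lambda>(s, \<omega>). - ?h (t - s) (\<xi> (max 0 s) \<omega>)) \<in> borel_measurable (borel \<Otimes>\<^sub>M Px y)"
      by measurable
    show "\<bar>- ?h (t - s) (\<xi> (max 0 s) \<omega>)\<bar> \<le> K * C + K / 2 * C\<^sup>2" if "s \<in> {0..t}" for s \<omega>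
    proof -
      have "t - s \<le> t" using that by simp
      from hb[OF this] show ?thesis by (simp only: abs_minus_cancel)
    qed
  qed
  also have "\<dots> = (LINT s:{0..t}|lborel. - mk.FK (\<lambda>_. 0) s (?h (t - s)) y)"
    by (rule set_lebesgue_integral_cong) (simp, simp only: mk.FK_def m1 mult_1 Bochner_Integration.integral_minus, simp)
  also have "\<dots> = - mk.resolv (\<lambda>_. 0) ?h t y"
    unfolding mk.resolv_def by (simp add: set_lebesgue_integral_def)
  finally have "(\<integral>\<omega>. (LINT s:{0..t}|lborel. Psi \<beta> a b n (\<xi> s \<omega>) (u (t - s) (\<xi> s \<omega>))) \<partial>Px y) = - mk.resolv (\<lambda>_. 0) ?h t y" .
  moreover have "(\<integral>\<omega>. ext0 f (\<xi> t \<omega>) \<partial>Px y) = mk.FK (\<lambda>_. 0) t (ext0 f) y"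
    using t by (simp add: mk.FK_def m1)
  moreover have "\<forall>t\<ge>0. \<forall>x. u t x + (\<integral>\<omega>. (LINT s:{0..t}|lborel. Psi \<beta> a b n (\<xi> s \<omega>) (u (t - s) (\<xi> s \<omega>))) \<partial>Px x) =
      (\<integral>\<omega>. ext0 f (\<xi> t \<omega>) \<partial>Px x)"
    using u unfolding mild_solution_def by (elim conjE)
  note this[rule_format, OF t, of y]
  moreover have "w t y = u t y" using t by (simp add: w_def)
  ultimately show ?thesis by linarith
qed

lemma ext0_f: "ext0 f \<in> borel_measurable C\<^sub>E" by (rule ext0_measurable) (rule f_facts)

lemma w_FK:
  assumes T: "0 \<le> T"
  shows "w T y = mk.FK (ext0 \<alpha>) T (ext0 f) y - mk.resolv (ext0 \<alpha>) g T y"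
proof -
  obtain C where C: "0 \<le> C" "\<And>s y. s \<le> T \<Longrightarrow> \<bar>w s y\<bar> \<le> C" by (rule w_bound) blast
  obtain D where D: "0 \<le> D" "\<And>x. \<bar>f x\<bar> \<le> D" by (rule f_bound) blast
  show ?thesis
    by (rule mk.mild_change_of_semigroup[OF ext0_\<alpha>(1) ext0_f w_measurable g_measurable ext0_\<alpha>(2) ext0_bound[OF D(2,1)] C(2) g_bound[OF C(2)] T])
      (use w_mild in auto)
qed

lemma w_flow:
  assumes "0 \<le> r" "0 \<le> t"
  shows "w (r + t) y = mk.FK (ext0 \<alpha>) t (w r) y - (LINT s:{0..t}|lborel. mk.FK (ext0 \<alpha>) s (g (r + t - s)) y)"
proof -
  obtain C where C: "0 \<le> C" "\<And>s y. s \<le> r + t \<Longrightarrow> \<bar>w s y\<bar> \<le> C" by (rule w_bound) blast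
  obtain D where D: "0 \<le> D" "\<And>x. \<bar>f x\<bar> \<le> D" by (rule f_bound) blast
  show ?thesis
    by (rule mk.mild_flow[OF ext0_\<alpha>(1) ext0_f g_measurable ext0_\<alpha>(2) ext0_bound[OF D(2,1)] g_bound[OF C(2)] assms w_FK]) auto
qed

lemma w_None: "w s None = 0"
proof -
  have g0: "g s None = 0" for s by (simp add: g_def ext0_def)
  have [measurable]: "g s \<in> borel_measurable C\<^sub>E" for s
  proof -
    have "(\<lambda>y. case (s, y) of (s, y) \<Rightarrow> g s y) \<in> borel_measurable C\<^sub>E" by measurable
    then show ?thesis by simp
  qed
  have "mk.resolv (ext0 \<alpha>) g T None = (LINT s:{0..T}|lborel. 0)" for T
    unfolding mk.resolv_def
    by (rule set_lebesgue_integral_cong) (auto intro!: FK_None ext0_\<alpha> g0)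
  then have "w (max 0 s) None = 0"
    using w_FK[of "max 0 s" None] FK_None[OF _ ext0_\<alpha>(1) ext0_f, of "max 0 s"] by (simp add: ext0_def set_lebesgue_integral_def)
  then show ?thesis by (simp add: w_def)
qed

definition v where "v s x = w s (Some x)"

lemma w_eq: "w s = ext0 (v s)" and g_eq: "g s = ext0 (\<lambda>x. R x (v s x))"
proof -
  show "w s = ext0 (v s)"
  proof
    fix y show "w s y = ext0 (v s) y" using w_None by (cases y) (simp_all add: v_def ext0_def)
  qed
  show "g s = ext0 (\<lambda>x. R x (v s x))"
  proof
    fix y show "g s y = ext0 (\<lambda>x. R x (v s x)) y" using w_nonneg[of s y] by (cases y) (simp_all add: v_def g_def ext0_def)
  qed
qed

lemma v_flow:
  assumes "0 \<le> r" "0 \<le> t"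
  shows "v (r + t) x = FKe \<alpha> t (v r) x - (LINT s:{0..t}|lborel. FKe \<alpha> s (\<lambda>y. R y (v (r + t - s) y)) x)"
  unfolding FKe_def w_eq[symmetric] g_eq[symmetric] using w_flow[OF assms] by (simp add: v_def)

lemma v_measurable [measurable]: "(\<lambda>(s, x). v s x) \<in> borel_measurable (borel \<Otimes>\<^sub>M borel)"
proof -
  have "(\<lambda>z. (fst z, Some (snd z))) \<in> borel \<Otimes>\<^sub>M borel \<rightarrow>\<^sub>M borel \<Otimes>\<^sub>M C\<^sub>E"
    by (intro measurable_Pair measurable_fst measurable_compose[OF measurable_snd Some_measurable])
  from measurable_compose[OF this w_measurable] show ?thesis by (simp add: v_def split_beta')
qed

lemma v_row [measurable]: "v s \<in> borel_measurable borel"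
proof -
  have "(\<lambda>x. case (s, x) of (s, x) \<Rightarrow> v s x) \<in> borel_measurable borel" by measurable
  then show ?thesis by simp
qed

lemma v_nonneg: "0 \<le> v s x" using w_nonneg by (simp add: v_def)

lemma v_bound: obtains C where "0 \<le> C" "\<And>s x. s \<le> T \<Longrightarrow> v s x \<le> C"
proof -
  obtain C where C: "0 \<le> C" "\<And>s y. s \<le> T \<Longrightarrow> \<bar>w s y\<bar> \<le> C" by (rule w_bound) blast
  show ?thesis by (rule that[OF C(1)]) (use C(2) in \<open>auto simp: v_def abs_le_iff\<close>)
qed

lemma R_compose [measurable (raw)]:
  assumes "X \<in> M \<rightarrow>\<^sub>M borel" "Z \<in> borel_measurable M" "\<And>z. z \<in> space M \<Longrightarrow> 0 \<le> Z z"
  shows "(\<lambda>z. R (X z) (Z z)) \<in> borel_measurable M"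
proof -
  have "(\<lambda>z. (X z, Z z)) \<in> M \<rightarrow>\<^sub>M borel \<Otimes>\<^sub>M borel" using assms(1,2) by measurable
  from measurable_compose[OF this R_measurable]
  have "(\<lambda>z. R (X z) (max 0 (Z z))) \<in> borel_measurable M" by simp
  then show ?thesis by (rule measurable_cong[THEN iffD1, rotated]) (use assms(3) in simp)
qed

lemma R_v_measurable: "(\<lambda>(s, x). R x (v (T - s) x)) \<in> borel_measurable (borel \<Otimes>\<^sub>M borel)"
  unfolding split_beta' by (rule R_compose) (measurable, rule v_nonneg)

lemma R_v_bound: assumes "v s x \<le> C" shows "\<bar>R x (v s x)\<bar> \<le> K / 2 * C\<^sup>2"
proof -
  have "R x (v s x) \<le> K / 2 * (v s x)\<^sup>2" by (rule R_bound[OF v_nonneg])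
  also have "\<dots> \<le> K / 2 * C\<^sup>2" using assms K(1) v_nonneg[of s x] by (intro mult_left_mono power_mono) auto
  finally show ?thesis using R_nonneg by simp
qed

lemma R_v_row: "(\<lambda>x. R x (v s x)) \<in> borel_measurable borel"
  by (rule R_compose) (measurable, rule v_nonneg)

text \<open>
  Integrate the flow equation against the reference measure, which is invariant under the Feynman-Kac semigroup.
\<close>

lemma pairing:
  assumes rt: "0 \<le> r" "0 \<le> t"
  shows "(\<integral>x. v (r + t) x \<partial>reference) = (\<integral>x. v r x \<partial>reference) - (LINT s:{0..t}|lborel. (\<integral>x. R x (v (r + t - s) x) \<partial>reference))"
proof -
  obtain C where C: "0 \<le> C" "\<And>s x. s \<le> r + t \<Longrightarrow> v s x \<le> C" by (rule v_bound) blast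
  let ?F = "\<lambda>s x. FKe \<alpha> s (\<lambda>y. R y (v (r + t - s) y)) x"
  have Fm: "(\<lambda>(s, x). ?F s x) \<in> borel_measurable (borel \<Otimes>\<^sub>M reference)"
  proof -
    have 1: "(\<lambda>p. Some (snd p)) \<in> borel \<Otimes>\<^sub>M borel \<rightarrow>\<^sub>M C\<^sub>E" by (rule measurable_compose[OF measurable_snd Some_measurable])
    have "(\<lambda>p. mk.FK (ext0 \<alpha>) (fst p) (\<lambda>y. g (r + t - fst p) y) (Some (snd p))) \<in> borel_measurable (borel \<Otimes>\<^sub>M borel)"
      by (rule mk.FK_measurable[OF ext0_\<alpha>(1) measurable_fst 1]) measurable
    then show ?thesis unfolding FKe_def g_eq[symmetric] by (simp add: split_beta' cong: measurable_cong_sets sets_pair_measure_cong add: sets_reference)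
  qed
  have Fb: "\<bar>?F s x\<bar> \<le> exp (K * t) * (K / 2 * C\<^sup>2)" if s: "s \<in> {0..t}" for s x
  proof -
    have vb: "v (r + t - s) y \<le> C" for y using s rt by (intro C(2)) auto
    have Rb: "R y (v (r + t - s) y) \<le> K / 2 * C\<^sup>2" for y using R_v_bound[OF vb, of y] by simp
    have s0: "0 \<le> s" using s by simp
    note b = FKe_bounds[OF \<alpha>_meas R_v_row \<alpha>_bound R_nonneg Rb s0, of x]
    note b(2)
    also have "exp (K * s) * (K / 2 * C\<^sup>2) \<le> exp (K * t) * (K / 2 * C\<^sup>2)"
      using s K(1) by (intro mult_right_mono) auto
    finally show ?thesis using b(1) by simp
  qed
  have vr: "v r y \<le> C" for y using rt by (intro C(2)) auto
  note FKb = FKe_bounds[OF \<alpha>_meas v_row \<alpha>_bound v_nonneg vr rt(2)]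
  have i1: "integrable reference (FKe \<alpha> t (v r))"
    using FKb by (intro integrable_reference[where C="exp (K * t) * C"] FKe_measurable \<alpha>_meas v_row) (auto simp: abs_le_iff intro: order_trans[OF _ FKb(1)])
  have "(\<lambda>x. LINT s:{0..t}|lborel. ?F s x) \<in> borel_measurable reference"
    by (rule interval_integral_measurable) (use measurable_pair_swap[OF Fm] in \<open>auto simp: split_beta'\<close>)
  then have i2: "integrable reference (\<lambda>x. LINT s:{0..t}|lborel. ?F s x)"
    using abs_interval_integral_le[OF rt(2) Fb] K(1)
    by (intro integrable_reference[where C="exp (K * t) * (K / 2 * C\<^sup>2) * (t - 0)"]) (auto simp: measurable_cong_sets[OF sets_reference refl])
  have "(\<integral>x. v (r + t) x \<partial>reference) = (\<integral>x. FKe \<alpha> t (v r) x \<partial>reference) - (\<integral>x. (LINT s:{0..t}|lborel. ?F s x) \<partial>reference)"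
    unfolding v_flow[OF rt] by (rule Bochner_Integration.integral_diff[OF i1 i2])
  also have "(\<integral>x. FKe \<alpha> t (v r) x \<partial>reference) = (\<integral>x. v r x \<partial>reference)"
    by (rule FKe_dual[OF v_row v_nonneg vr rt(2)])
  also have "(\<integral>x. (LINT s:{0..t}|lborel. ?F s x) \<partial>reference) = (LINT s:{0..t}|lborel. (\<integral>x. ?F s x \<partial>reference))"
    by (rule fubini_time[OF finite_reference Fm Fb])
  also have "\<dots> = (LINT s:{0..t}|lborel. (\<integral>x. R x (v (r + t - s) x) \<partial>reference))"
  proof (rule set_lebesgue_integral_cong; (intro allI impI)?)
    fix s assume s: "s \<in> {0..t}"
    have vb: "v (r + t - s) y \<le> C" for y using s rt by (intro C(2)) auto
    show "(\<integral>x. ?F s x \<partial>reference) = (\<integral>x. R x (v (r + t - s) x) \<partial>reference)"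
      by (rule FKe_dual[OF R_v_row R_nonneg abs_le_D1[OF R_v_bound[OF vb]]]) (use s in auto)
  qed simp
  finally show ?thesis .
qed

lemma pairing_integrable:
  assumes rt: "0 \<le> r" "0 \<le> t"
  shows "set_integrable lborel {0..t} (\<lambda>s. \<integral>x. R x (v (r + t - s) x) \<partial>reference)"
proof -
  interpret finite_measure reference by (rule finite_reference)
  obtain C where C: "0 \<le> C" "\<And>s x. s \<le> r + t \<Longrightarrow> v s x \<le> C" by (rule v_bound) blast
  have [measurable]: "(\<lambda>(s, x). R x (v (r + t - s) x)) \<in> borel_measurable (borel \<Otimes>\<^sub>M reference)"
    using R_v_measurable by (simp cong: measurable_cong_sets sets_pair_measure_cong add: sets_reference)
  have m: "(\<lambda>s. \<integral>x. R x (v (r + t - s) x) \<partial>reference) \<in> borel_measurable borel" by measurable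
  have b: "\<bar>\<integral>x. R x (v (r + t - s) x) \<partial>reference\<bar> \<le> (\<integral>x. K / 2 * C\<^sup>2 \<partial>reference)" if s: "s \<in> {0..t}" for s
  proof -
  have vb: "v (r + t - s) y \<le> C" for y using s rt by (intro C(2)) auto
  have "\<bar>\<integral>x. R x (v (r + t - s) x) \<partial>reference\<bar> \<le> (\<integral>x. \<bar>R x (v (r + t - s) x)\<bar> \<partial>reference)" by (rule integral_abs_bound)
  also have "\<dots> \<le> (\<integral>x. K / 2 * C\<^sup>2 \<partial>reference)"
    using R_v_bound[OF vb] K(1) by (intro integral_mono integrable_abs integrable_reference[where C="K / 2 * C\<^sup>2"] R_v_row) auto
  finally show ?thesis .
  qed
  show ?thesis by (rule set_integrable_bounded_interval[OF m b])
qed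

abbreviation "\<nu> \<equiv> (\<integral>x. A x * (\<phi> x)\<^sup>2 * \<psi> x \<partial>m) / 2"

lemma eigen_sq_bound: assumes "\<And>x. \<phi> x \<le> \<Phi>" shows "\<bar>A x * (\<phi> x)\<^sup>2\<bar> \<le> K * \<Phi>\<^sup>2"
proof -
  have \<phi>0: "0 \<le> \<phi> x" using ck.\<phi>_facts(5)[of x] by simp
  show ?thesis using A_nonneg A_bound K(1) \<phi>0 assms
    by (auto simp: abs_mult intro!: mult_mono power_mono)
qed

lemma \<nu>_eq: "\<nu> = (\<integral>x. A x * (\<phi> x)\<^sup>2 / 2 \<partial>reference)"
  by (subst integral_reference_eq) (measurable, simp add: mult_ac)

lemma R_second_order: "((\<lambda>c. (\<integral>x. R x (c * \<phi> x) \<partial>reference) / c\<^sup>2) \<longlongrightarrow> \<nu>) (at_right 0)"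
  unfolding \<nu>_eq
proof (rule tendsto_at_right_sequentially[OF zero_less_one])
  fix S :: "nat \<Rightarrow> real" assume S: "\<And>n. 0 < S n" "S \<longlonglongrightarrow> 0"
  have "S k \<noteq> 0" for k using S(1)[of k] by simp
  then have S': "filterlim S (at_right 0) sequentially" unfolding filterlim_at using S by auto
  obtain \<Phi> where \<Phi>: "\<And>x. \<phi> x \<le> \<Phi>" by (rule ck.\<phi>_bound) blast
  have \<phi>0: "0 \<le> \<phi> x" for x using ck.\<phi>_facts(5)[of x] by simp
  have Sp: "0 \<le> S k * \<phi> x" for k x using S(1)[of k] \<phi>0[of x] by simp
  have "(\<lambda>k. \<integral>x. R x (S k * \<phi> x) / (S k)\<^sup>2 \<partial>reference) \<longlonglongrightarrow> (\<integral>x. A x * (\<phi> x)\<^sup>2 / 2 \<partial>reference)"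
  proof (rule integral_dominated_convergence[where w="\<lambda>_. K / 2 * \<Phi>\<^sup>2"])
    show "(\<lambda>x. A x * (\<phi> x)\<^sup>2 / 2) \<in> borel_measurable reference"
      by (simp add: measurable_cong_sets[OF sets_reference refl])
    have "(\<lambda>x. R x (S k * \<phi> x)) \<in> borel_measurable borel" for k
      by (rule R_compose) (measurable, rule Sp)
    then show "(\<lambda>x. R x (S k * \<phi> x) / (S k)\<^sup>2) \<in> borel_measurable reference" for k
      by (simp add: measurable_cong_sets[OF sets_reference refl])
    show "integrable reference (\<lambda>_. K / 2 * \<Phi>\<^sup>2)" by (rule integrable_reference[where C="\<bar>K / 2 * \<Phi>\<^sup>2\<bar>"]) auto
    have "(\<lambda>k. R x (S k * \<phi> x) / (S k)\<^sup>2) \<longlonglongrightarrow> A x * (\<phi> x)\<^sup>2 / 2" for x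
      by (rule filterlim_compose[OF R_limit[OF ck.\<phi>_facts(5)] S'])
    then show "AE x in reference. (\<lambda>k. R x (S k * \<phi> x) / (S k)\<^sup>2) \<longlonglongrightarrow> A x * (\<phi> x)\<^sup>2 / 2" by simp
    have "norm (R x (S k * \<phi> x) / (S k)\<^sup>2) \<le> K / 2 * \<Phi>\<^sup>2" for k x
    proof -
      have "R x (S k * \<phi> x) \<le> K / 2 * (S k * \<phi> x)\<^sup>2" by (rule R_bound[OF Sp])
      also have "\<dots> \<le> K / 2 * (S k * \<Phi>)\<^sup>2"
        using S(1)[of k] Sp[of k x] \<Phi>[of x] K(1) by (intro mult_left_mono power_mono) auto
      also have "\<dots> = K / 2 * \<Phi>\<^sup>2 * (S k)\<^sup>2" by (simp add: power_mult_distrib)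
      finally show ?thesis using R_nonneg S(1)[of k] by (simp add: pos_divide_le_eq)
    qed
    then show "AE x in reference. norm (R x (S k * \<phi> x) / (S k)\<^sup>2) \<le> K / 2 * \<Phi>\<^sup>2" for k by simp
  qed
  then show "(\<lambda>k. (\<integral>x. R x (S k * \<phi> x) \<partial>reference) / (S k)\<^sup>2) \<longlonglongrightarrow> (\<integral>x. A x * (\<phi> x)\<^sup>2 / 2 \<partial>reference)" by simp
qed

lemma \<nu>_pos: "0 < \<nu>"
proof -
  obtain \<Phi> where \<Phi>: "\<And>x. \<phi> x \<le> \<Phi>" by (rule ck.\<phi>_bound) blast
  have nn: "0 \<le> A x * (\<phi> x)\<^sup>2 / 2" for x using A_nonneg by simp
  have "integrable reference (\<lambda>x. A x * (\<phi> x)\<^sup>2)"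
    by (rule integrable_reference[OF _ eigen_sq_bound[OF \<Phi>]]) measurable
  then have int: "integrable reference (\<lambda>x. A x * (\<phi> x)\<^sup>2 / 2)" by simp
  have "\<nu> \<noteq> 0"
  proof
    assume "\<nu> = 0"
    then have "AE x in reference. A x * (\<phi> x)\<^sup>2 / 2 = 0"
      unfolding \<nu>_eq using integral_nonneg_eq_0_iff_AE[OF int] nn by simp
    then have "AE x in m. 0 < ennreal (\<psi> x) \<longrightarrow> A x * (\<phi> x)\<^sup>2 / 2 = 0"
      unfolding reference_def by (subst (asm) AE_density) (simp_all add: measurable_m_iff)
    then have "AE x in m. A x = 0"
      by (rule eventually_mono) (use ck.\<phi>_facts(5,6) in \<open>auto simp: less_le\<close>)
    then have "AE x in m. ennreal (\<beta> x) * (ennreal (b x) + emeasure (n x) {0<..}) = 0"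
      by (rule eventually_mono) (rule A_zero_imp)
    with nondegenerate show False by contradiction
  qed
  moreover have "0 \<le> \<nu>" unfolding \<nu>_eq by (rule Bochner_Integration.integral_nonneg) (rule nn)
  ultimately show ?thesis by simp
qed

lemma v_asymptotics:
  assumes e: "0 < e"
  shows "\<forall>\<^sub>F t in at_top. \<forall>x. \<bar>t * v t x - \<phi> x / \<nu>\<bar> \<le> e * \<phi> x"
proof -
  obtain \<Phi> where \<Phi>: "\<And>x. \<phi> x \<le> \<Phi>" by (rule ck.\<phi>_bound) blast
  have mr: "(h \<in> borel_measurable reference) = (h \<in> borel_measurable borel)" for h :: "'a \<Rightarrow> real"
    by (simp add: measurable_cong_sets[OF sets_reference refl])
  have sk: "sets (kernel_of t x) = sets reference" for t x by (simp add: sets_kernel_of sets_reference)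
  have \<phi>0: "0 \<le> \<phi> x" for x using ck.\<phi>_facts(5)[of x] by simp
  have vb: "\<exists>b. \<forall>x. v t x \<le> b" for t
  proof -
    obtain C where "\<And>s x. s \<le> t \<Longrightarrow> v s x \<le> C" by (rule v_bound) blast
    then show ?thesis by blast
  qed
  have KI: "(\<integral>y. h y \<partial>kernel_of t x) = FKe \<alpha> t h x"
    if "0 \<le> t" "h \<in> borel_measurable reference" "\<And>y. 0 \<le> h y" "\<And>y. h y \<le> b" for h b t x
    using that by (intro kernel_of_integral[where C=b]) (auto simp: mr)
  have KI': "(\<lambda>x. \<integral>y. h y \<partial>kernel_of t x) = FKe \<alpha> t h"
    if "0 \<le> t" "h \<in> borel_measurable reference" "\<And>y. 0 \<le> h y" "\<And>y. h y \<le> b" for h b t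
    by (rule ext) (rule KI[OF that])
  interpret flow: critical_flow reference kernel_of \<phi> v R "K / 2" \<Phi> \<nu>
  proof (rule critical_flow.intro)
    show "finite_measure reference" by (rule finite_reference)
    show "space reference = UNIV" by simp
    show "0 \<le> t \<Longrightarrow> finite_measure (kernel_of t x)" for t x by (rule finite_kernel_of)
    show "sets (kernel_of t x) = sets reference" for t x by (rule sk)
    show "(\<lambda>x. \<integral>y. h y \<partial>kernel_of t x) \<in> borel_measurable reference"
      if "0 \<le> t" "h \<in> borel_measurable reference" "\<And>y. 0 \<le> h y" "\<And>y. h y \<le> b" for t b and h :: "'a \<Rightarrow> real"
      unfolding KI'[OF that] mr using that(2) by (intro FKe_measurable \<alpha>_meas) (simp add: mr)
    show "\<phi> \<in> borel_measurable reference" by (simp add: mr)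
    show "0 < \<phi> x" for x by (rule ck.\<phi>_facts(5))
    show "\<phi> x \<le> \<Phi>" for x by (rule \<Phi>)
    show "(\<integral>x. \<phi> x \<partial>reference) = 1" by (rule eigen_normalised)
    show "(\<integral>y. \<phi> y \<partial>kernel_of t x) = \<phi> x" if "0 \<le> t" for t x
      using kernel_of_integral[OF eigenfunctions_measurable(1) \<phi>0 \<Phi> that] FKe_eigen[OF that] by simp
    show "(\<integral>x. (\<integral>y. h y \<partial>kernel_of t x) \<partial>reference) = (\<integral>x. h x \<partial>reference)"
      if "0 \<le> t" "h \<in> borel_measurable reference" "\<And>y. 0 \<le> h y" "\<And>y. h y \<le> b" for t b and h :: "'a \<Rightarrow> real"
      unfolding KI'[OF that] using that(2) by (intro FKe_dual[OF _ that(3,4,1)]) (simp add: mr)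
    show "\<exists>\<epsilon>>0. \<exists>C. \<forall>h b. h \<in> borel_measurable reference \<longrightarrow> (\<forall>y. 0 \<le> h y \<and> h y \<le> b) \<longrightarrow>
       (\<forall>x. \<epsilon> * \<phi> x * (\<integral>y. h y \<partial>reference) \<le> (\<integral>y. h y \<partial>kernel_of t x) \<and> (\<integral>y. h y \<partial>kernel_of t x) \<le> C * \<phi> x * (\<integral>y. h y \<partial>reference))"
      if t: "0 < t" for t
    proof -
      from FKe_intrinsic[OF t] obtain \<epsilon> C where \<epsilon>: "0 < \<epsilon>"
        and b: "\<forall>h b. h \<in> borel_measurable borel \<longrightarrow> (\<forall>y. 0 \<le> h y \<and> h y \<le> b) \<longrightarrow>
          (\<forall>x. \<epsilon> * \<phi> x * (\<integral>y. h y \<partial>reference) \<le> FKe \<alpha> t h x \<and> FKe \<alpha> t h x \<le> C * \<phi> x * (\<integral>y. h y \<partial>reference))"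
        by (elim exE conjE)
      show ?thesis
      proof (rule exI[of _ \<epsilon>], rule conjI[OF \<epsilon>], rule exI[of _ C], intro allI impI conjI)
        fix h b x assume h: "h \<in> borel_measurable reference" "\<forall>y. 0 \<le> h y \<and> h y \<le> (b::real)"
        have h': "\<And>y. 0 \<le> h y" "\<And>y. h y \<le> b" "h \<in> borel_measurable borel" using h by (auto simp: mr)
        show "\<epsilon> * \<phi> x * (\<integral>y. h y \<partial>reference) \<le> (\<integral>y. h y \<partial>kernel_of t x)"
          "(\<integral>y. h y \<partial>kernel_of t x) \<le> C * \<phi> x * (\<integral>y. h y \<partial>reference)"
          using b[rule_format, OF h'(3) conjI[OF h'(1,2)], of x] KI[OF less_imp_le[OF t] h(1) h'(1,2), of x] by simp_all
      qed
    qed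
    show "(\<integral>y. (\<integral>z. h z \<partial>kernel_of t y) \<partial>kernel_of s x) = (\<integral>z. h z \<partial>kernel_of (s + t) x)"
      if st: "0 \<le> s" "0 \<le> t" and h: "h \<in> borel_measurable reference" "\<And>y. 0 \<le> h y" "\<And>y. h y \<le> b" for s t b x and h :: "'a \<Rightarrow> real"
    proof -
      have hm: "h \<in> borel_measurable borel" using h(1) by (simp add: mr)
      have "(\<integral>y. (\<integral>z. h z \<partial>kernel_of t y) \<partial>kernel_of s x) = FKe \<alpha> s (FKe \<alpha> t h) x"
        unfolding KI'[OF st(2) h]
        by (rule kernel_of_integral[OF FKe_measurable[OF \<alpha>_meas hm] FKe_bounds[OF \<alpha>_meas hm \<alpha>_bound h(2,3) st(2)] st(1)])
      also have "\<dots> = FKe \<alpha> (s + t) h x" by (rule FKe_semigroup[OF \<alpha>_meas \<alpha>_bound hm h(2,3) st, symmetric])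
      also have "\<dots> = (\<integral>z. h z \<partial>kernel_of (s + t) x)"
        by (rule KI[OF add_nonneg_nonneg[OF st] h, symmetric])
      finally show ?thesis .
    qed
    show "v t \<in> borel_measurable reference" for t by (simp add: mr)
    show "0 < v t x" if "0 \<le> t" for t x using u_pos[OF that, of x] that by (simp add: v_def w_def)
    show "\<exists>b. \<forall>x. v t x \<le> b" for t by (rule vb)
    show "0 \<le> R x z" for x z by (rule R_nonneg)
    show "R x z \<le> K / 2 * z\<^sup>2" if "0 \<le> z" for x z by (rule R_bound[OF that])
    show "R x z \<le> R x z'" if "0 \<le> z" "z \<le> z'" for x z z' by (rule R_mono[OF that])
    show "(\<lambda>x. R x (h x)) \<in> borel_measurable reference" if "h \<in> borel_measurable reference" "\<And>x. 0 \<le> h x" for h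
      unfolding mr by (rule R_compose) (use that in \<open>simp_all add: mr\<close>)
    show "v (r + t) x = (\<integral>y. v r y \<partial>kernel_of t x) - (LINT s:{0..t}|lborel. (\<integral>y. R y (v (r + t - s) y) \<partial>kernel_of s x))"
      if rt: "0 \<le> r" "0 \<le> t" for r t x
    proof -
      obtain C where C: "0 \<le> C" "\<And>s x. s \<le> r + t \<Longrightarrow> v s x \<le> C" by (rule v_bound) blast
      have vr: "v r y \<le> C" for y using rt by (intro C(2)) auto
      have 1: "(\<integral>y. v r y \<partial>kernel_of t x) = FKe \<alpha> t (v r) x" by (rule kernel_of_integral[OF v_row v_nonneg vr rt(2)])
      have 2: "(\<integral>y. R y (v (r + t - s) y) \<partial>kernel_of s x) = FKe \<alpha> s (\<lambda>y. R y (v (r + t - s) y)) x" if s: "s \<in> {0..t}" for s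
      proof -
        have vb: "v (r + t - s) y \<le> C" for y using s rt by (intro C(2)) auto
        show ?thesis by (rule kernel_of_integral[OF R_v_row R_nonneg abs_le_D1[OF R_v_bound[OF vb]]]) (use s in auto)
      qed
      have "(LINT s:{0..t}|lborel. (\<integral>y. R y (v (r + t - s) y) \<partial>kernel_of s x)) = (LINT s:{0..t}|lborel. FKe \<alpha> s (\<lambda>y. R y (v (r + t - s) y)) x)"
        by (rule set_lebesgue_integral_cong) (simp, use 2 in blast)
      then show ?thesis unfolding 1 using v_flow[OF rt, of x] by simp
    qed
    show "(\<integral>y. v (r + t) y \<partial>reference) = (\<integral>y. v r y \<partial>reference) - (LINT s:{0..t}|lborel. (\<integral>y. R y (v (r + t - s) y) \<partial>reference))"
      if "0 \<le> r" "0 \<le> t" for r t by (rule pairing[OF that])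
    show "set_integrable lborel {0..t} (\<lambda>s. (\<integral>y. R y (v (r + t - s) y) \<partial>reference))" if "0 \<le> r" "0 \<le> t" for r t
      by (rule pairing_integrable[OF that])
    show "((\<lambda>c. (\<integral>x. R x (c * \<phi> x) \<partial>reference) / c\<^sup>2) \<longlongrightarrow> \<nu>) (at_right 0)" by (rule R_second_order)
    show "0 < \<nu>" by (rule \<nu>_pos)
    show "0 \<le> K / 2" using K(1) by simp
  qed
  show ?thesis by (rule flow.kolmogorov_uniform[OF e])
qed

end

section \<open>The survival probability\<close>

text \<open>
  The shift by \<open>\<tau>\<close> and the quadratic remainder of \<open>1 - exp (- U)\<close> cost \<open>O(1 / s)\<close>, because \<open>s * U\<close> is bounded on \<open>S\<close>.
\<close>

lemma survival_from_log:
  fixes U :: "real \<Rightarrow> 'b \<Rightarrow> real" and P :: "real \<Rightarrow> 'b \<Rightarrow> real"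
  assumes \<nu>: "0 < \<nu>" and \<tau>: "0 \<le> \<tau>"
    and U: "\<And>s \<mu>. \<mu> \<in> S \<Longrightarrow> 0 \<le> s \<Longrightarrow> 0 \<le> U s \<mu>"
    and P: "\<And>s \<mu>. \<mu> \<in> S \<Longrightarrow> 0 \<le> s \<Longrightarrow> P (\<tau> + s) \<mu> = 1 - exp (- U s \<mu>)"
    and I: "\<And>\<mu>. \<mu> \<in> S \<Longrightarrow> 0 \<le> I \<mu>" "\<And>\<mu>. \<mu> \<in> S \<Longrightarrow> I \<mu> \<le> D"
    and lim: "\<And>e. 0 < e \<Longrightarrow> \<forall>\<^sub>F s in at_top. \<forall>\<mu>\<in>S. \<bar>s * U s \<mu> - I \<mu> / \<nu>\<bar> \<le> e * I \<mu>"
  shows "uniform_limit S (\<lambda>t \<mu>. t * P t \<mu>) (\<lambda>\<mu>. inverse \<nu> * I \<mu>) at_top"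
proof (rule uniform_limitI)
  fix \<delta> :: real assume \<delta>: "0 < \<delta>"
  define D' where "D' = max D 1"
  have D': "0 < D'" "\<And>\<mu>. \<mu> \<in> S \<Longrightarrow> I \<mu> \<le> D'" using I(2) unfolding D'_def by (auto simp: le_max_iff_disj)
  define e where "e = min 1 (\<delta> / (2 * D'))"
  have e: "0 < e" "e \<le> 1" "e * D' \<le> \<delta> / 2" using \<delta> D'(1) by (auto simp: e_def min_def field_simps)
  \<comment> \<open>An eventual bound for \<open>s * U s\<close>.\<close>
  define B where "B = (1 / \<nu> + 1) * D'"
  have B: "0 < B" unfolding B_def using \<nu> D'(1) by (intro mult_pos_pos add_pos_pos) auto
  define H where "H = \<tau> * B + (\<tau> + 1) * B\<^sup>2 / 2"
  have "\<forall>\<^sub>F s in at_top. (\<forall>\<mu>\<in>S. \<bar>s * U s \<mu> - I \<mu> / \<nu>\<bar> \<le> e * I \<mu>) \<and> max 1 (2 * H / \<delta> + 1) \<le> s"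
    using lim[OF e(1)] eventually_ge_at_top by (rule eventually_conj)
  then obtain N where N: "\<And>s. N \<le> s \<Longrightarrow> (\<forall>\<mu>\<in>S. \<bar>s * U s \<mu> - I \<mu> / \<nu>\<bar> \<le> e * I \<mu>) \<and> max 1 (2 * H / \<delta> + 1) \<le> s"
    unfolding eventually_at_top_linorder by blast
  show "\<forall>\<^sub>F t in at_top. \<forall>\<mu>\<in>S. dist (t * P t \<mu>) (inverse \<nu> * I \<mu>) < \<delta>"
  proof (rule eventually_mono[OF eventually_ge_at_top[of "N + \<tau>"]], rule ballI)
    fix t \<mu> assume t: "N + \<tau> \<le> t" and \<mu>: "\<mu> \<in> S"
    define s where "s = t - \<tau>"
    define V where "V = U s \<mu>"
    have "N \<le> s" using t by (simp add: s_def)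
    from N[OF this] have s: "\<bar>s * V - I \<mu> / \<nu>\<bar> \<le> e * I \<mu>" "1 \<le> s" "2 * H / \<delta> + 1 \<le> s" using \<mu> by (auto simp: V_def)
    have V0: "0 \<le> V" using U[OF \<mu>] s(2) by (simp add: V_def)
    have Pt: "P t \<mu> = 1 - exp (- V)" using P[OF \<mu>, of s] s(2) by (simp add: V_def s_def)
    have err: "0 \<le> V - (1 - exp (- V))" "V - (1 - exp (- V)) \<le> V\<^sup>2 / 2"
      using levy_int_nonneg[of V 1] levy_int_le[of V 1] V0 by (simp_all add: levy_int_def)
    have eI: "e * I \<mu> \<le> \<delta> / 2" using mult_left_mono[OF D'(2)[OF \<mu>], of e] e by linarith
    have "s * V \<le> I \<mu> / \<nu> + e * I \<mu>" using s(1) by linarith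
    also have "\<dots> \<le> D' / \<nu> + 1 * D'"
      using D'(2)[OF \<mu>] I(1)[OF \<mu>] \<nu> e by (intro add_mono divide_right_mono mult_mono) auto
    also have "\<dots> = B" by (simp add: B_def field_simps)
    finally have sV: "s * V \<le> B" .
    have s0: "0 < s" using s(2) by simp
    have VB: "V \<le> B / s" using sV s0 by (simp add: pos_le_divide_eq mult.commute)
    have "t * P t \<mu> - inverse \<nu> * I \<mu> = (s * V - I \<mu> / \<nu>) + \<tau> * V - (\<tau> + s) * (V - (1 - exp (- V)))"
      unfolding Pt by (simp add: s_def field_simps)
    then have "\<bar>t * P t \<mu> - inverse \<nu> * I \<mu>\<bar> \<le> \<bar>s * V - I \<mu> / \<nu>\<bar> + \<bar>\<tau> * V\<bar> + \<bar>(\<tau> + s) * (V - (1 - exp (- V)))\<bar>"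
      by linarith
    also have "\<bar>\<tau> * V\<bar> \<le> \<tau> * (B / s)" using mult_left_mono[OF VB \<tau>] \<tau> V0 by (simp add: abs_mult)
    also have "\<bar>(\<tau> + s) * (V - (1 - exp (- V)))\<bar> \<le> ((\<tau> + 1) * s) * ((B / s)\<^sup>2 / 2)"
    proof -
      have "V\<^sup>2 \<le> (B / s)\<^sup>2" by (rule power_mono[OF VB V0])
      moreover have "\<tau> + s \<le> (\<tau> + 1) * s" using mult_left_mono[OF s(2) \<tau>] by (simp add: algebra_simps)
      ultimately show ?thesis using err \<tau> s0 unfolding abs_mult
        by (intro mult_mono) auto
    qed
    also have "((\<tau> + 1) * s) * ((B / s)\<^sup>2 / 2) = (\<tau> + 1) * B\<^sup>2 / 2 / s" using s0 by (simp add: power2_eq_square field_simps)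
    also have "\<bar>s * V - I \<mu> / \<nu>\<bar> \<le> \<delta> / 2" using s(1) eI by linarith
    finally have "\<bar>t * P t \<mu> - inverse \<nu> * I \<mu>\<bar> \<le> \<delta> / 2 + H / s" by (simp add: H_def add_divide_distrib)
    also have "H / s < \<delta> / 2" using s(3) s0 \<delta> by (simp add: field_simps)
    finally show "dist (t * P t \<mu>) (inverse \<nu> * I \<mu>) < \<delta>" by (simp add: dist_real_def)
  qed
qed

theorem theorem1p5:
  fixes m :: "'a::{metric_space, second_countable_topology} measure"
    and \<Omega> :: "'w measure" and \<xi> :: "real \<Rightarrow> 'w \<Rightarrow> 'a option" and Px :: "'a option \<Rightarrow> 'w measure"
    and \<beta> a b \<alpha> A :: "'a \<Rightarrow> real" and n :: "'a \<Rightarrow> real measure"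
    and \<Omega>' :: "'v measure" and X :: "real \<Rightarrow> 'v \<Rightarrow> 'a measure" and PX :: "'a measure \<Rightarrow> 'v measure"
    and p q :: "real \<Rightarrow> 'a \<Rightarrow> 'a \<Rightarrow> real"
    and lamt\<^sub>0 lam\<^sub>0 K \<nu> :: real and \<phi>t\<^sub>0 \<psi>t\<^sub>0 \<phi>\<^sub>0 \<psi>\<^sub>0 :: "'a \<Rightarrow> real"
  assumes E: "locally_compact_space (euclidean :: 'a topology)"
    and m: "sets m = sets borel" "sigma_finite_measure m"
    and full_support: "\<And>U. open U \<Longrightarrow> U \<noteq> {} \<Longrightarrow> 0 < emeasure m U"
    and \<xi>: "hunt_process_on_E \<Omega> \<xi> Px"
    and \<beta>: "\<beta> \<in> bounded_borel_nonneg"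
    and a: "a \<in> bounded_borel"
    and b: "b \<in> bounded_borel_nonneg"
    and n: "is_kernel borel (restrict_space borel {0<..}) n"
    and n_sq: "(SUP x. \<integral>\<^sup>+y. ennreal (y\<^sup>2) \<partial>n x) < \<infinity>"
    and nondegenerate: "\<not> (AE x in m. ennreal (\<beta> x) * (ennreal (b x) + emeasure (n x) {0<..}) = 0)"
    and X: "superprocess \<xi> Px (Psi \<beta> a b n) \<Omega>' X PX"
    and \<alpha>_def: "\<alpha> = (\<lambda>x. \<beta> x * a x)"
    and A_def: "A = variance_A \<beta> b n"
    and K: "0 < K" "\<And>x. \<bar>\<alpha> x\<bar> + A x \<le> K"
    and p: "continuous_positive_kernel p" "is_density m (semigroup_P \<xi> Px) p"
    and p_dual: "\<And>t y. 0 < t \<Longrightarrow> (\<integral>\<^sup>+x. ennreal (p t x y) \<partial>m) \<le> 1"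
    and a_integrable: "\<And>t. 0 < t \<Longrightarrow> (\<integral>\<^sup>+x. row_sq m p t x \<partial>m) < \<infinity>"
    and a_cont: "\<And>t. 0 < t \<Longrightarrow> continuous_finite (row_sq m p t)"
    and ahat_cont: "\<And>t. 0 < t \<Longrightarrow> continuous_finite (row_sq m (transpose_kernel p) t)"
    and eigen_P: "principal_eigen m p lamt\<^sub>0 \<phi>t\<^sub>0 \<psi>t\<^sub>0"
    and \<phi>t_bounded: "bounded (range \<phi>t\<^sub>0)"
    and ultracontractive: "\<And>t. 0 < t \<Longrightarrow> \<exists>c>0. \<forall>x y. p t x y \<le> c * \<phi>t\<^sub>0 x * \<psi>t\<^sub>0 y"
    and q: "continuous_positive_kernel q" "is_density m (feynman_kac \<xi> Px \<alpha>) q"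
    and eigen_T: "principal_eigen m q lam\<^sub>0 \<phi>\<^sub>0 \<psi>\<^sub>0"
    and critical: "lam\<^sub>0 = 0"
    and extinction: "\<And>t x. 0 < t \<Longrightarrow> measure (PX (return borel x)) (extinct \<Omega>' X t) \<in> {0<..<1}"
    and extinction_unif: "\<exists>t\<^sub>0>0. 0 < (INF x. measure (PX (return borel x)) (extinct \<Omega>' X t\<^sub>0))"
    and \<nu>_def: "\<nu> = (\<integral>x. A x * (\<phi>\<^sub>0 x)\<^sup>2 * \<psi>\<^sub>0 x \<partial>m) / 2"
  shows "(\<forall>\<mu>\<in>finite_measures. \<mu> \<noteq> null_measure borel \<longrightarrow>
            ((\<lambda>t. t * measure (PX \<mu>) (survives \<Omega>' X t)) \<longlongrightarrow> inverse \<nu> * (\<integral>x. \<phi>\<^sub>0 x \<partial>\<mu>)) at_top) \<and>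
         (\<forall>M>0. uniform_limit {\<mu> \<in> finite_measures. measure \<mu> UNIV \<le> M}
            (\<lambda>t \<mu>. t * measure (PX \<mu>) (survives \<Omega>' X t))
            (\<lambda>\<mu>. inverse \<nu> * (\<integral>x. \<phi>\<^sub>0 x \<partial>\<mu>)) at_top)"
proof -
  have Ke: "\<And>x. \<bar>\<beta> x * a x\<bar> + variance_A \<beta> b n x \<le> K" using K(2) unfolding \<alpha>_def A_def .
  interpret cs: critical_superprocess m \<Omega> \<xi> Px \<beta> a b n p q lamt\<^sub>0 K \<phi>t\<^sub>0 \<psi>t\<^sub>0 \<phi>\<^sub>0 \<psi>\<^sub>0
    by (rule critical_superprocess.intro[OF E m full_support \<xi> \<beta> a b n n_sq nondegenerate K(1) Ke p p_dual eigen_P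
        \<phi>t_bounded ultracontractive q(1) q(2)[unfolded \<alpha>_def] eigen_T[unfolded critical]])
  obtain \<tau> where \<tau>: "0 < \<tau>" "0 < (INF x. measure (PX (return borel x)) (extinct \<Omega>' X \<tau>))"
    using extinction_unif by blast
  obtain f u where f: "f \<in> bounded_borel_nonneg" and u: "mild_solution \<xi> Px (Psi \<beta> a b n) f u"
    and ext: "\<And>\<mu> s. \<mu> \<in> finite_measures \<Longrightarrow> 0 \<le> s \<Longrightarrow> measure (PX \<mu>) (extinct \<Omega>' X (\<tau> + s)) = exp (- (\<integral>x. u s (Some x) \<partial>\<mu>))"
    and surv: "\<And>\<mu> s. \<mu> \<in> finite_measures \<Longrightarrow> 0 \<le> s \<Longrightarrow> measure (PX \<mu>) (survives \<Omega>' X (\<tau> + s)) = 1 - exp (- (\<integral>x. u s (Some x) \<partial>\<mu>))"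
    by (rule superprocess_extinction[OF X \<tau>]) (rule that)
  have u_pos: "0 < u s (Some x)" if s: "0 \<le> s" for s x
  proof -
    have "0 < \<tau> + s" using \<tau>(1) s by simp
    from extinction[OF this, of x] have "exp (- (\<integral>y. u s (Some y) \<partial>return borel x)) < 1"
      using ext[OF return_finite_measures s, of x] by simp
    then have pos: "0 < (\<integral>y. u s (Some y) \<partial>return borel x)" by simp
    \<comment> \<open>The integral of a function that is not integrable is \<open>0\<close> by convention.\<close>
    then have "integrable (return borel x) (\<lambda>y. u s (Some y))" using not_integrable_integral_eq by fastforce
    then have "(\<lambda>y. u s (Some y)) \<in> borel_measurable (return borel x)" by (rule borel_measurable_integrable)
    then have "(\<lambda>y. u s (Some y)) \<in> borel_measurable (borel :: 'a measure)"
      by (simp add: measurable_cong_sets[OF sets_return refl])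
    then show ?thesis using pos by (simp add: integral_return)
  qed
  interpret sol: critical_solution m \<Omega> \<xi> Px \<beta> a b n p q lamt\<^sub>0 K \<phi>t\<^sub>0 \<psi>t\<^sub>0 \<phi>\<^sub>0 \<psi>\<^sub>0 f u
    by unfold_locales (rule f u u_pos, assumption?)+
  have \<nu>: "\<nu> = sol.\<nu>" unfolding \<nu>_def A_def ..
  have \<nu>0: "0 < \<nu>" unfolding \<nu> by (rule sol.\<nu>_pos)
  obtain \<Phi> where \<Phi>: "0 < \<Phi>" "\<And>x. \<phi>\<^sub>0 x \<le> \<Phi>" by (rule cs.ck.\<phi>_bound) blast
  have \<phi>0: "0 \<le> \<phi>\<^sub>0 x" for x using cs.ck.\<phi>_facts(5)[of x] by simp
  have v: "sol.v s x = u s (Some x)" if "0 \<le> s" for s x using that by (simp add: sol.v_def sol.w_def)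
  have int: "integrable \<mu> h" if \<mu>: "\<mu> \<in> finite_measures" and h: "h \<in> borel_measurable borel" "\<And>x. \<bar>h x\<bar> \<le> C"
    for \<mu> :: "'a measure" and h and C :: real
  proof -
    have fm: "finite_measure \<mu>" and sets: "sets \<mu> = sets borel" using \<mu> by (auto simp: finite_measures_def)
    have "h \<in> borel_measurable \<mu>" using h(1) by (simp add: measurable_cong_sets[OF sets refl])
    then show ?thesis using h(2) by (intro finite_measure.integrable_const_bound[OF fm, of h C]) auto
  qed
  have uniform: "uniform_limit {\<mu> \<in> finite_measures. measure \<mu> UNIV \<le> M}
      (\<lambda>t \<mu>. t * measure (PX \<mu>) (survives \<Omega>' X t)) (\<lambda>\<mu>. inverse \<nu> * (\<integral>x. \<phi>\<^sub>0 x \<partial>\<mu>)) at_top" for M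
  proof (rule survival_from_log[where \<tau>=\<tau> and D="\<Phi> * M" and U="\<lambda>s \<mu>. \<integral>x. u s (Some x) \<partial>\<mu>"])
    show "0 < \<nu>" by (rule \<nu>0)
    show "0 \<le> \<tau>" using \<tau>(1) by simp
  next
    fix s :: real and \<mu> :: "'a measure" assume \<mu>: "\<mu> \<in> {\<mu> \<in> finite_measures. measure \<mu> UNIV \<le> M}" and s: "0 \<le> s"
    show "0 \<le> (\<integral>x. u s (Some x) \<partial>\<mu>)"
      using u_pos[OF s] by (intro Bochner_Integration.integral_nonneg less_imp_le)
    show "measure (PX \<mu>) (survives \<Omega>' X (\<tau> + s)) = 1 - exp (- (\<integral>x. u s (Some x) \<partial>\<mu>))"
      using \<mu> s by (intro surv) auto
  next
    fix \<mu> :: "'a measure" assume \<mu>: "\<mu> \<in> {\<mu> \<in> finite_measures. measure \<mu> UNIV \<le> M}"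
    show "0 \<le> (\<integral>x. \<phi>\<^sub>0 x \<partial>\<mu>)" using \<phi>0 by (rule Bochner_Integration.integral_nonneg)
    have fm: "finite_measure \<mu>" and sp: "space \<mu> = UNIV" using \<mu> by (auto simp: finite_measures_def dest: sets_eq_imp_space_eq)
    have "(\<integral>x. \<phi>\<^sub>0 x \<partial>\<mu>) \<le> (\<integral>x. \<Phi> \<partial>\<mu>)"
      using \<mu> \<Phi> \<phi>0 by (intro integral_mono int[where C=\<Phi>]) auto
    also have "\<dots> = \<Phi> * measure \<mu> UNIV" by (simp add: sp)
    also have "\<dots> \<le> \<Phi> * M" using \<mu> \<Phi>(1) by (intro mult_left_mono) auto
    finally show "(\<integral>x. \<phi>\<^sub>0 x \<partial>\<mu>) \<le> \<Phi> * M" .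
  next
    fix e :: real assume e: "0 < e"
    show "\<forall>\<^sub>F s in at_top. \<forall>\<mu>\<in>{\<mu> \<in> finite_measures. measure \<mu> UNIV \<le> M}.
        \<bar>s * (\<integral>x. u s (Some x) \<partial>\<mu>) - (\<integral>x. \<phi>\<^sub>0 x \<partial>\<mu>) / \<nu>\<bar> \<le> e * (\<integral>x. \<phi>\<^sub>0 x \<partial>\<mu>)"
    proof (rule eventually_elim2[OF sol.v_asymptotics[OF e] eventually_ge_at_top[of 0]], rule ballI)
      fix s :: real and \<mu> :: "'a measure"
      assume b: "\<forall>x. \<bar>s * sol.v s x - \<phi>\<^sub>0 x / sol.\<nu>\<bar> \<le> e * \<phi>\<^sub>0 x" and s: "0 \<le> s"
        and "\<mu> \<in> {\<mu> \<in> finite_measures. measure \<mu> UNIV \<le> M}"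
      then have \<mu>: "\<mu> \<in> finite_measures" by simp
      obtain C where C: "\<And>r x. r \<le> s \<Longrightarrow> sol.v r x \<le> C" by (rule sol.v_bound) blast
      have iv: "integrable \<mu> (sol.v s)" using sol.v_nonneg C by (intro int[OF \<mu>, where C=C] sol.v_row) auto
      have i\<phi>: "integrable \<mu> \<phi>\<^sub>0" using \<phi>0 \<Phi>(2) by (intro int[OF \<mu>, where C=\<Phi>]) auto
      have "s * (\<integral>x. sol.v s x \<partial>\<mu>) - (\<integral>x. \<phi>\<^sub>0 x \<partial>\<mu>) / \<nu> = (\<integral>x. s * sol.v s x - \<phi>\<^sub>0 x / \<nu> \<partial>\<mu>)"
        using iv i\<phi> by simp
      also have "\<bar>\<dots>\<bar> \<le> (\<integral>x. \<bar>s * sol.v s x - \<phi>\<^sub>0 x / \<nu>\<bar> \<partial>\<mu>)" by (rule integral_abs_bound)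
      also have "\<dots> \<le> (\<integral>x. e * \<phi>\<^sub>0 x \<partial>\<mu>)"
        using iv i\<phi> b unfolding \<nu> by (intro integral_mono integrable_abs Bochner_Integration.integrable_diff) auto
      also have "\<dots> = e * (\<integral>x. \<phi>\<^sub>0 x \<partial>\<mu>)" by simp
      finally show "\<bar>s * (\<integral>x. u s (Some x) \<partial>\<mu>) - (\<integral>x. \<phi>\<^sub>0 x \<partial>\<mu>) / \<nu>\<bar> \<le> e * (\<integral>x. \<phi>\<^sub>0 x \<partial>\<mu>)"
        using v[OF s] by simp
    qed
  qed
  have "((\<lambda>t. t * measure (PX \<mu>) (survives \<Omega>' X t)) \<longlongrightarrow> inverse \<nu> * (\<integral>x. \<phi>\<^sub>0 x \<partial>\<mu>)) at_top"
    if "\<mu> \<in> finite_measures" for \<mu> :: "'a measure"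
    by (rule tendsto_uniform_limitI[OF uniform[of "measure \<mu> UNIV"]]) (use that in simp)
  then show ?thesis using uniform by blast
qed

end
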